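(* Let $d\ge 1$ and let $X\subset\mathbb{P}^d\subset\mathbb{P}^{2d}$ be the rational normal curve of degree $d$ in $\mathbb{P}^d$, with $\mathbb{P}^d$ embedded linearly in $\mathbb{P}^{2d}$. Then there exist double structures $Y\subset\mathbb{P}^{2d}$ on $X$ which are defined by quadratic equations and have only linear syzygies. These double curves have Hilbert polynomial $H(t)=2dt+1$.
   Context: All schemes are algebraic schemes over a fixed algebraically closed field $k$. The rational normal curve of degree $d$ in $\mathbb{P}^d$ is the image of $\mathbb{P}^1$ under the degree $d$ Veronese embedding $v_d$. Double structure (Ferrand doubling): let $X\subset\mathbb{P}^n$ be a smooth curve with ideal sheaf $\mathscr{I}$. A double structure $Y$ on $X$ in $\mathbb{P}^n$, with associated line bundle $\mathcal{L}$, is the closed subscheme $Y\subset\mathbb{P}^n$ whose ideal sheaf is $\mathscr{J}=\ker(\mathscr{I}\to\mathscr{I}/\mathscr{I}^2\xrightarrow{p}\mathcal{L})$, where $\mathcal{L}$ is a line bundle on $X$ and $p$ is a surjective homomorphism. Let $R=k[X_0,\dots,X_n]$. The homogeneous ideal of a closed subscheme $Y\subset\mathbb{P}^n$ with ideal sheaf $\mathscr{J}$ is $J=\bigoplus_{\ell\ge 0}H^0(\mathscr{J}(\ell))\subset R$. $Y$ is defined by quadratic equations and has only linear syzygies if the minimal generators of $J$ all have degree $2$ and the minimal graded free resolution of $J$ has the form $0\leftarrow J\leftarrow b_1R(-2)\leftarrow b_2R(-3)\leftarrow b_3R(-4)\leftarrow\cdots$, where $bR(-j)$ is a direct sum of $b$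 copies of $R(-j)$. *)

theory Defs
  imports
    "HOL-Algebra.Ideal"
    "HOL-Algebra.Module"
    "HOL-Library.Poly_Mapping"
    "HOL-Computational_Algebra.Polynomial"
begin

section \<open>The graded polynomial ring\<close>

text \<open>
  A polynomial maps exponent vectors to coefficients.  The ring
  \<open>k[X_0,...,X_n]\<close> consists of the polynomials involving only variables with index at
  most \<open>n\<close>; \<open>forms n l\<close> is its homogeneous part of degree \<open>l\<close> (with \<open>0\<close>).
\<close>

type_synonym 'k mpol = "(nat \<Rightarrow>\<^sub>0 nat) \<Rightarrow>\<^sub>0 'k"

definition mdeg :: "(nat \<Rightarrow>\<^sub>0 nat) \<Rightarrow> nat" where
  "mdeg m = (\<Sum>i\<in>Poly_Mapping.keys m. Poly_Mapping.lookup m i)"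

definition peval :: "'k::field mpol \<Rightarrow> (nat \<Rightarrow> 'k) \<Rightarrow> 'k" where
  "peval F x = (\<Sum>m\<in>Poly_Mapping.keys F. Poly_Mapping.lookup F m *
                  (\<Prod>i\<in>Poly_Mapping.keys m. x i ^ Poly_Mapping.lookup m i))"

definition polys :: "nat \<Rightarrow> 'k::field mpol set" where
  "polys n = {F. \<forall>m\<in>Poly_Mapping.keys F. Poly_Mapping.keys m \<subseteq> {..n}}"

definition forms :: "nat \<Rightarrow> nat \<Rightarrow> 'k::field mpol set" where
  "forms n l = {F \<in> polys n. \<forall>m\<in>Poly_Mapping.keys F. mdeg m = l}"

definition hom_comp :: "nat \<Rightarrow> 'k::field mpol \<Rightarrow> 'k mpol" where
  "hom_comp l F = (\<Sum>m\<in>{m \<in> Poly_Mapping.keys F. mdeg m = l}.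
                     Poly_Mapping.single m (Poly_Mapping.lookup F m))"

definition poly_ring :: "nat \<Rightarrow> 'k::field mpol ring" where
  "poly_ring n = \<lparr>carrier = polys n, monoid.mult = (*), one = 1, ring.zero = 0, add = (+)\<rparr>"

definition pscale :: "'k::field \<Rightarrow> 'k mpol \<Rightarrow> 'k mpol" where
  "pscale c F = Poly_Mapping.single 0 c * F"

lemma vector_space_pscale: "vector_space (pscale :: 'k::field \<Rightarrow> _)"
  by unfold_locales
    (simp_all add: pscale_def single_add mult_single distrib_left distrib_right
      flip: mult.assoc)


section \<open>Projective space as a variety\<close>

text \<open>
  A point of \<open>\<P>^n\<close> is given by its vectors of homogeneous coordinates, so subsets of
  \<open>\<P>^n\<close> are represented by the cones of these vectors (without the origin).  Functions on
  subsets of \<open>\<P>^n\<close> are functions of the homogeneous coordinates; regular functions, being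
  locally quotients of forms of equal degree, do not depend on the choice of coordinates.
  Functions on \<open>V\<close> are extended by \<open>0\<close> outside \<open>V\<close>.
\<close>

type_synonym 'k pts = "(nat \<Rightarrow> 'k) set"
type_synonym 'k fn = "(nat \<Rightarrow> 'k) \<Rightarrow> 'k"

definition vecs :: "nat \<Rightarrow> (nat \<Rightarrow> 'k::field) set" where
  "vecs n = {x. \<forall>i>n. x i = 0}"

definition proj_space :: "nat \<Rightarrow> 'k::field pts" where
  "proj_space n = vecs n - {\<lambda>_. 0}"

definition zariski_open :: "nat \<Rightarrow> 'k::field pts \<Rightarrow> bool" where
  "zariski_open n U \<longleftrightarrow>
     (\<exists>S \<subseteq> (\<Union>l. forms n l). U = {x \<in> proj_space n. \<exists>F\<in>S. peval F x \<noteq> 0})"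

definition open_in :: "nat \<Rightarrow> 'k::field pts \<Rightarrow> 'k pts \<Rightarrow> bool" where
  "open_in n X V \<longleftrightarrow> (\<exists>U. zariski_open n U \<and> V = U \<inter> X)"

definition res :: "'k::field pts \<Rightarrow> 'k fn \<Rightarrow> 'k fn" where
  "res W f = (\<lambda>x. if x \<in> W then f x else 0)"

text \<open>
  \<open>regular_ring n V\<close> is the ring of regular functions on a locally closed subset \<open>V\<close> of
  \<open>\<P>^n\<close>.  For \<open>V\<close> open in \<open>\<P>^n\<close> this is the ring of sections of the structure
  sheaf of \<open>\<P>^n\<close>; for \<open>V\<close> open in a closed subvariety \<open>X\<close> (with its reduced
  structure) that of the structure sheaf of \<open>X\<close>.
\<close>

definition regular_functions :: "nat \<Rightarrow> 'k::field pts \<Rightarrow> 'k fn set" where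
  "regular_functions n V = {f. (\<forall>x. x \<notin> V \<longrightarrow> f x = 0) \<and>
     (\<forall>x\<in>V. \<exists>W l. zariski_open n W \<and> x \<in> W \<and>
        (\<exists>G\<in>forms n l. \<exists>H\<in>forms n l.
           \<forall>y\<in>W \<inter> V. peval H y \<noteq> 0 \<and> f y = peval G y / peval H y))}"

definition regular_ring :: "nat \<Rightarrow> 'k::field pts \<Rightarrow> 'k fn ring" where
  "regular_ring n V =
     \<lparr>carrier = regular_functions n V, monoid.mult = (\<lambda>f g x. f x * g x),
      one = res V (\<lambda>_. 1), ring.zero = (\<lambda>_. 0), add = (\<lambda>f g x. f x + g x)\<rparr>"

text \<open>The sections over \<open>U\<close> of the ideal sheaf of a closed subvariety \<open>X\<close>.\<close>

definition ideal_sheaf :: "nat \<Rightarrow> 'k::field pts \<Rightarrow> 'k pts \<Rightarrow> 'k fn set" where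
  "ideal_sheaf n X U = {f \<in> regular_functions n U. \<forall>x\<in>U \<inter> X. f x = 0}"


section \<open>Line bundles\<close>

text \<open>
  A sheaf of modules on \<open>X\<close> consists of its modules of sections \<open>L V\<close> and its restriction
  maps \<open>r V W\<close>, for \<open>W \<subseteq> V\<close> open in \<open>X\<close>.
\<close>

definition sheaf_of_modules ::
  "nat \<Rightarrow> 'k::field pts \<Rightarrow> ('k pts \<Rightarrow> ('k fn, 'm) module) \<Rightarrow>
   ('k pts \<Rightarrow> 'k pts \<Rightarrow> 'm \<Rightarrow> 'm) \<Rightarrow> bool" where
  "sheaf_of_modules n X L r \<longleftrightarrow>
     (\<forall>V. open_in n X V \<longrightarrow> Module.module (regular_ring n V) (L V)) \<and>
     (\<forall>V W. open_in n X V \<and> open_in n X W \<and> W \<subseteq> V \<longrightarrow>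
        (\<forall>s\<in>carrier (L V). r V W s \<in> carrier (L W)) \<and>
        (\<forall>s\<in>carrier (L V). \<forall>t\<in>carrier (L V).
           r V W (s \<oplus>\<^bsub>L V\<^esub> t) = r V W s \<oplus>\<^bsub>L W\<^esub> r V W t) \<and>
        (\<forall>a\<in>regular_functions n V. \<forall>s\<in>carrier (L V).
           r V W (a \<odot>\<^bsub>L V\<^esub> s) = res W a \<odot>\<^bsub>L W\<^esub> r V W s)) \<and>
     (\<forall>V. open_in n X V \<longrightarrow> (\<forall>s\<in>carrier (L V). r V V s = s)) \<and>
     (\<forall>V W T. open_in n X V \<and> open_in n X W \<and> open_in n X T \<and> T \<subseteq> W \<and> W \<subseteq> V \<longrightarrow>
        (\<forall>s\<in>carrier (L V). r W T (r V W s) = r V T s)) \<and>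
     (\<forall>V \<W> s. open_in n X V \<and> (\<forall>W\<in>\<W>. open_in n X W) \<and> \<Union>\<W> = V \<and>
        (\<forall>W\<in>\<W>. s W \<in> carrier (L W)) \<and>
        (\<forall>W\<in>\<W>. \<forall>T\<in>\<W>. r W (W \<inter> T) (s W) = r T (W \<inter> T) (s T)) \<longrightarrow>
        (\<exists>!t. t \<in> carrier (L V) \<and> (\<forall>W\<in>\<W>. r V W t = s W)))"

text \<open>Locally, multiplication with a section \<open>e\<close> is an isomorphism from the structure sheaf.\<close>

definition line_bundle ::
  "nat \<Rightarrow> 'k::field pts \<Rightarrow> ('k pts \<Rightarrow> ('k fn, 'm) module) \<Rightarrow>
   ('k pts \<Rightarrow> 'k pts \<Rightarrow> 'm \<Rightarrow> 'm) \<Rightarrow> bool" where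
  "line_bundle n X L r \<longleftrightarrow> sheaf_of_modules n X L r \<and>
     (\<forall>x\<in>X. \<exists>V e. open_in n X V \<and> x \<in> V \<and> e \<in> carrier (L V) \<and>
        (\<forall>W. open_in n X W \<and> W \<subseteq> V \<longrightarrow>
           bij_betw (\<lambda>a. a \<odot>\<^bsub>L W\<^esub> r V W e) (regular_functions n W) (carrier (L W))))"


section \<open>Double structures\<close>

text \<open>
  Let \<open>I\<close> be the ideal sheaf of \<open>X\<close>.  By the universal property of the quotient sheaf, the
  homomorphisms \<open>p\<close> from \<open>I/I^2\<close> to \<open>L\<close> correspond to the linear maps of sheaves
  \<open>q\<close> from \<open>I\<close> to \<open>L\<close> that vanish on \<open>I^2\<close>, where \<open>q\<close> is the
  composite of \<open>p\<close> with the canonical map from \<open>I\<close> to \<open>I/I^2\<close>; moreover \<open>p\<close> is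
  surjective (as a map of sheaves) iff \<open>q\<close> is.
\<close>

definition conormal_hom ::
  "nat \<Rightarrow> 'k::field pts \<Rightarrow> ('k pts \<Rightarrow> ('k fn, 'm) module) \<Rightarrow>
   ('k pts \<Rightarrow> 'k pts \<Rightarrow> 'm \<Rightarrow> 'm) \<Rightarrow> ('k pts \<Rightarrow> 'k fn \<Rightarrow> 'm) \<Rightarrow> bool" where
  "conormal_hom n X L r q \<longleftrightarrow>
     (\<forall>U. zariski_open n U \<longrightarrow>
        (\<forall>f\<in>ideal_sheaf n X U. q U f \<in> carrier (L (U \<inter> X))) \<and>
        (\<forall>f\<in>ideal_sheaf n X U. \<forall>g\<in>ideal_sheaf n X U.
           q U (\<lambda>x. f x + g x) = q U f \<oplus>\<^bsub>L (U \<inter> X)\<^esub> q U g) \<and>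
        (\<forall>a\<in>regular_functions n U. \<forall>f\<in>ideal_sheaf n X U.
           q U (\<lambda>x. a x * f x) = res (U \<inter> X) a \<odot>\<^bsub>L (U \<inter> X)\<^esub> q U f) \<and>
        (\<forall>f\<in>ideal_sheaf n X U. \<forall>g\<in>ideal_sheaf n X U.
           q U (\<lambda>x. f x * g x) = \<zero>\<^bsub>L (U \<inter> X)\<^esub>)) \<and>
     (\<forall>U U'. zariski_open n U \<and> zariski_open n U' \<and> U' \<subseteq> U \<longrightarrow>
        (\<forall>f\<in>ideal_sheaf n X U. q U' (res U' f) = r (U \<inter> X) (U' \<inter> X) (q U f)))"

definition surjective_conormal_hom ::
  "nat \<Rightarrow> 'k::field pts \<Rightarrow> ('k pts \<Rightarrow> ('k fn, 'm) module) \<Rightarrow>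
   ('k pts \<Rightarrow> 'k pts \<Rightarrow> 'm \<Rightarrow> 'm) \<Rightarrow> ('k pts \<Rightarrow> 'k fn \<Rightarrow> 'm) \<Rightarrow> bool" where
  "surjective_conormal_hom n X L r q \<longleftrightarrow> conormal_hom n X L r q \<and>
     (\<forall>U. zariski_open n U \<longrightarrow> (\<forall>s\<in>carrier (L (U \<inter> X)). \<forall>x\<in>U \<inter> X.
        \<exists>U'. zariski_open n U' \<and> x \<in> U' \<and> U' \<subseteq> U \<and>
          (\<exists>f\<in>ideal_sheaf n X U'. q U' f = r (U \<inter> X) (U' \<inter> X) s)))"

text \<open>
  The closed subscheme \<open>Y\<close> is represented by its ideal sheaf \<open>J\<close>.
  The sections of \<open>L\<close> are drawn from the type of \<open>k\<close>-valued functions.  This is no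
  restriction up to isomorphism: as \<open>X\<close> is reduced, a section of a line bundle is determined
  by its values in the fibres, that is, after a choice of bases of the fibres, by a
  \<open>k\<close>-valued function.
\<close>

definition double_structure ::
  "nat \<Rightarrow> 'k::field pts \<Rightarrow> ('k pts \<Rightarrow> 'k fn set) \<Rightarrow> bool" where
  "double_structure n X J \<longleftrightarrow>
     (\<exists>(L :: 'k pts \<Rightarrow> ('k fn, 'k fn) module) r q.
        line_bundle n X L r \<and> surjective_conormal_hom n X L r q \<and>
        (\<forall>U. zariski_open n U \<longrightarrow>
           J U = {f \<in> ideal_sheaf n X U. q U f = \<zero>\<^bsub>L (U \<inter> X)\<^esub>}))"


section \<open>The homogeneous ideal and the Hilbert polynomial\<close>

text \<open>
  A form \<open>F\<close> of degree \<open>l\<close> is a global section of \<open>J(l)\<close> iff \<open>F/X_i^l\<close> is a section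
  of \<open>J\<close> over the set where \<open>X_i \<noteq> 0\<close>, for every \<open>i\<close>.
\<close>

definition twisted_sections ::
  "nat \<Rightarrow> ('k::field pts \<Rightarrow> 'k fn set) \<Rightarrow> nat \<Rightarrow> 'k mpol set" where
  "twisted_sections n J l = {F \<in> forms n l. \<forall>i\<le>n.
     (let U = {x \<in> proj_space n. x i \<noteq> 0} in res U (\<lambda>x. peval F x / x i ^ l) \<in> J U)}"

definition homogeneous_ideal :: "nat \<Rightarrow> ('k::field pts \<Rightarrow> 'k fn set) \<Rightarrow> 'k mpol set" where
  "homogeneous_ideal n J = {F \<in> polys n. \<forall>l. hom_comp l F \<in> twisted_sections n J l}"

text \<open>The Hilbert function of \<open>R/J\<close>, for a homogeneous ideal \<open>J\<close> of \<open>R\<close>.\<close>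

definition hilbert_function :: "nat \<Rightarrow> 'k::field mpol set \<Rightarrow> nat \<Rightarrow> int" where
  "hilbert_function n J l = int (vector_space.dim pscale (forms n l :: 'k mpol set))
                          - int (vector_space.dim pscale (J \<inter> forms n l))"

definition has_hilbert_polynomial :: "nat \<Rightarrow> 'k::field mpol set \<Rightarrow> rat poly \<Rightarrow> bool" where
  "has_hilbert_polynomial n J H \<longleftrightarrow>
     (\<exists>l0. \<forall>l\<ge>l0. of_int (hilbert_function n J l) = poly H (of_nat l))"


section \<open>Minimal generators and linear syzygies\<close>

definition minimal_generators :: "nat \<Rightarrow> 'k::field mpol set \<Rightarrow> 'k mpol set \<Rightarrow> bool" where
  "minimal_generators n J G \<longleftrightarrow> G \<subseteq> (\<Union>l. forms n l) \<and> Idl\<^bsub>poly_ring n\<^esub> G = J \<and>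
     (\<forall>G'. G' \<subset> G \<longrightarrow> Idl\<^bsub>poly_ring n\<^esub> G' \<noteq> J)"

definition quadratic_ideal :: "nat \<Rightarrow> 'k::field mpol set \<Rightarrow> bool" where
  "quadratic_ideal n J \<longleftrightarrow> (\<forall>G. minimal_generators n J G \<longrightarrow> G \<subseteq> forms n 2)"

definition free_module :: "nat \<Rightarrow> nat \<Rightarrow> (nat \<Rightarrow> 'k::field mpol) set" where
  "free_module n b = {v. (\<forall>c<b. v c \<in> polys n) \<and> (\<forall>c\<ge>b. v c = 0)}"

text \<open>
  A graded free resolution of \<open>J\<close>.  The \<open>i\<close>-th free module is the direct sum of the
  \<open>R(-e i c)\<close> for \<open>c < b i\<close>.  The augmentation onto \<open>J\<close> maps the \<open>c\<close>-th basis
  element to \<open>g c\<close>, and the differential from the module with index \<open>Suc i\<close> to the one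
  with index \<open>i\<close> has the matrix \<open>D i\<close>, acting on column vectors.
\<close>

definition graded_free_resolution ::
  "nat \<Rightarrow> 'k::field mpol set \<Rightarrow> (nat \<Rightarrow> nat) \<Rightarrow> (nat \<Rightarrow> nat \<Rightarrow> nat) \<Rightarrow>
   (nat \<Rightarrow> 'k mpol) \<Rightarrow> (nat \<Rightarrow> nat \<Rightarrow> nat \<Rightarrow> 'k mpol) \<Rightarrow> bool" where
  "graded_free_resolution n J b e g D \<longleftrightarrow>
     (\<forall>c<b 0. g c \<in> forms n (e 0 c)) \<and>
     (\<forall>i. \<forall>a<b i. \<forall>c<b (Suc i).
        if e i a \<le> e (Suc i) c then D i a c \<in> forms n (e (Suc i) c - e i a)
        else D i a c = 0) \<and>
     J = {\<Sum>c<b 0. g c * v c | v. v \<in> free_module n (b 0)} \<and>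
     (\<forall>v\<in>free_module n (b 0).
        (\<Sum>c<b 0. g c * v c) = 0 \<longleftrightarrow>
        (\<exists>w\<in>free_module n (b 1). \<forall>a<b 0. v a = (\<Sum>c<b 1. D 0 a c * w c))) \<and>
     (\<forall>i. \<forall>v\<in>free_module n (b (Suc i)).
        (\<forall>a<b i. (\<Sum>c<b (Suc i). D i a c * v c) = 0) \<longleftrightarrow>
        (\<exists>w\<in>free_module n (b (Suc (Suc i))).
           \<forall>a<b (Suc i). v a = (\<Sum>c<b (Suc (Suc i)). D (Suc i) a c * w c)))"

text \<open>Minimality: the matrices of the differentials have no entries with a constant term.\<close>

definition minimal_resolution ::
  "nat \<Rightarrow> 'k::field mpol set \<Rightarrow> (nat \<Rightarrow> nat) \<Rightarrow> (nat \<Rightarrow> nat \<Rightarrow> nat) \<Rightarrow>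
   (nat \<Rightarrow> 'k mpol) \<Rightarrow> (nat \<Rightarrow> nat \<Rightarrow> nat \<Rightarrow> 'k mpol) \<Rightarrow> bool" where
  "minimal_resolution n J b e g D \<longleftrightarrow> graded_free_resolution n J b e g D \<and>
     (\<forall>i. \<forall>a<b i. \<forall>c<b (Suc i). Poly_Mapping.lookup (D i a c) 0 = 0)"

definition linear_syzygies :: "nat \<Rightarrow> 'k::field mpol set \<Rightarrow> bool" where
  "linear_syzygies n J \<longleftrightarrow>
     (\<exists>b e g D. minimal_resolution n J b e g D \<and> (\<forall>i. \<forall>c<b i. e i c = i + 2))"


section \<open>Rational normal curves\<close>

text \<open>The factor \<open>c\<close> accounts for the choice of homogeneous coordinates of the image point.\<close>

definition rational_normal_curve :: "nat \<Rightarrow> 'k::field pts" where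
  "rational_normal_curve d =
     {(\<lambda>i. if i \<le> d then c * s ^ (d - i) * t ^ i else 0) | c s t. c \<noteq> 0 \<and> (s, t) \<noteq> (0, 0)}"

text \<open>Linear embeddings of \<open>\<P>^m\<close> in \<open>\<P>^n\<close>, given by injective linear maps of coordinate vectors.\<close>

definition linear_embedding ::
  "nat \<Rightarrow> nat \<Rightarrow> ((nat \<Rightarrow> 'k::field) \<Rightarrow> nat \<Rightarrow> 'k) \<Rightarrow> bool" where
  "linear_embedding m n \<phi> \<longleftrightarrow>
     (\<forall>x\<in>vecs m. \<phi> x \<in> vecs n) \<and> inj_on \<phi> (vecs m) \<and>
     (\<forall>x\<in>vecs m. \<forall>y\<in>vecs m. \<phi> (\<lambda>i. x i + y i) = (\<lambda>i. \<phi> x i + \<phi> y i)) \<and>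
     (\<forall>c. \<forall>x\<in>vecs m. \<phi> (\<lambda>i. c * x i) = (\<lambda>i. c * \<phi> x i))"

end

theory Submission
  imports Defs
begin

text \<open>
  Existence: let \<open>Y\<close> be the double structure with line bundle of degree \<open>-1\<close> in which
  \<open>d\<close> coordinates vanishing on \<open>X\<close> have normal derivatives \<open>s\<^sup>d\<^sup>-\<^sup>j t\<^sup>j\<^sup>-\<^sup>1\<close>.  Its coordinate ring
  is free over \<open>k[\<theta>\<^sub>0, \<theta>\<^sub>1]\<close>, for \<open>\<theta>\<^sub>0 = s\<^sup>d\<close> and \<open>\<theta>\<^sub>1 = t\<^sup>d\<close>, with basis \<open>1\<close> and the remaining coordinates
  \<open>z\<^sub>i\<close>.  Hence its ideal has a basis of quadrics with leading terms \<open>z\<^sub>i z\<^sub>j\<close>, of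
  Pommaret type.  The syzygies of such a basis have a basis of the same type with linear entries, and
  iteration gives a linear resolution.

  Hilbert polynomial: near a point of \<open>X\<close> any double structure is given by a normal vector field with
  polynomial coefficients, so \<open>I/J\<close> is given by sections of a line bundle of some degree \<open>a\<close>, and
  the Hilbert polynomial is \<open>2 d t + 2 + a\<close>.  As \<open>J\<close> contains no linear form, \<open>a \<ge> -1\<close>.
  If \<open>a \<ge> 0\<close>, then for some \<open>j \<ge> 1\<close> a section in degree \<open>j\<close> does not lift to \<open>I\<close>
  although its products with the variables do.  Modulo a variable that is not a zero divisor it yields a socle
  element of degree \<open>j + 1\<close>.  Killing the variables one by one moves this element through the
  resolution up to position \<open>n\<close>, whose generators have degree \<open>n + 1 < n + j + 1\<close>.
\<close>


text \<open>Origin of the construction: the \<open>d\<close> coordinates vanishing on the span of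
  the curve generate a summand O(-d)^d of the conormal bundle, and a map from it to O(-1) is given
  by \<open>d\<close> binary forms of degree d - 1. Taking all monomials makes these forms
  independent, so no linear form is left in the kernel. The same count fixes the degree in the
  converse: the ideal of the curve contains (2d + 1) - (d + 1) = d independent linear forms, which
  have to embed into the (d + a + 1)-dimensional space of sections of degree d + a. The converse
  ranges over all double structures. Only local data of a sheaf map are given, and the polynomial
  direction extracted from them has uncontrolled degree and common zeros, also at infinity. Hence
  I/J is studied through its graded pieces \<open>A l\<close>, from which the common zeros are
  divided out. Both directions meet in \<open>jet_ideal\<close>: conditions on sections over all
  open sets become two polynomial identities in one parameter \<open>z\<close>. This is possible
  because the curve is irreducible and the bundle torsion-free.\<close>

abbreviation "lookup \<equiv> Poly_Mapping.lookup"
abbreviation "keys \<equiv> Poly_Mapping.keys"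
abbreviation "single \<equiv> Poly_Mapping.single"

section \<open>Polynomials in several variables, evaluation and first-order expansion\<close>

section \<open>Polynomials\<close>

definition Xv :: "nat \<Rightarrow> 'k::field mpol" where
  "Xv i = single (single i 1) 1"

lemma keys_monom_add: "keys (a + b :: nat \<Rightarrow>\<^sub>0 nat) = keys a \<union> keys b"
  by (auto simp: in_keys_iff lookup_add)

lemma mdeg_eq_sum: "finite A \<Longrightarrow> keys m \<subseteq> A \<Longrightarrow> mdeg m = (\<Sum>i\<in>A. lookup m i)"
  unfolding mdeg_def by (rule sum.mono_neutral_left) (auto simp: in_keys_iff)

lemma mdeg_add [simp]: "mdeg (a + b) = mdeg a + mdeg b"
proof -
  have "mdeg (a + b) = (\<Sum>i\<in>keys a \<union> keys b. lookup (a + b) i)"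
    by (rule mdeg_eq_sum) (auto simp: keys_monom_add)
  then show ?thesis
    by (simp add: lookup_add sum.distrib mdeg_eq_sum[of "keys a \<union> keys b"])
qed

lemma mdeg_zero [simp]: "mdeg 0 = 0"
  by (simp add: mdeg_def)

lemma mdeg_single [simp]: "mdeg (single i e) = e"
  by (simp add: mdeg_def)

lemma mdeg_eq_0_iff [simp]: "mdeg m = 0 \<longleftrightarrow> m = 0"
proof
  assume "mdeg m = 0"
  then have "lookup m i = 0" for i
    by (cases "i \<in> keys m") (auto simp: mdeg_def in_keys_iff)
  then show "m = 0" by (intro poly_mapping_eqI) simp
qed simp

lemma mdeg_eq_1_iff: "mdeg m = Suc 0 \<longleftrightarrow> (\<exists>i. m = single i 1)"
proof
  assume m: "mdeg m = Suc 0"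
  then have "m \<noteq> 0" by auto
  then obtain i where i: "i \<in> keys m" by (metis all_not_in_conv keys_eq_empty)
  have "m = single i 1 + (m - single i 1)"
    by (rule poly_mapping_eqI) (use i in \<open>auto simp: lookup_add lookup_minus lookup_single in_keys_iff when_def\<close>)
  moreover from this have "mdeg m = 1 + mdeg (m - single i 1)"
    by (metis mdeg_add mdeg_single)
  ultimately show "\<exists>i. m = single i 1" using m by (metis add.right_neutral add_left_cancel One_nat_def mdeg_eq_0_iff)
qed auto

lemma keys_monom_split:
  fixes m :: "nat \<Rightarrow>\<^sub>0 nat"
  assumes "i \<in> keys m"
  obtains m' where "m = single i 1 + m'"
proof
  show "m = single i 1 + (m - single i 1)"
    by (rule poly_mapping_eqI) (use assms in \<open>auto simp: lookup_add lookup_minus lookup_single in_keys_iff when_def\<close>)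
qed

lemma mpol_sum_singles:
  fixes F :: "'a \<Rightarrow>\<^sub>0 'b::comm_monoid_add"
  shows "(\<Sum>m\<in>keys F. single m (lookup F m)) = F"
  by (rule poly_mapping_eqI) (auto simp: lookup_sum lookup_single when_def in_keys_iff)

lemma mpol_single_induct [case_names zero add]:
  fixes F0 :: "'a \<Rightarrow>\<^sub>0 'b::comm_monoid_add"
  assumes "P 0" "\<And>m F. m \<in> keys F0 \<Longrightarrow> P F \<Longrightarrow> P (single m (lookup F0 m) + F)"
  shows "P F0"
proof -
  have "finite A \<Longrightarrow> A \<subseteq> keys F0 \<Longrightarrow> P (\<Sum>m\<in>A. single m (lookup F0 m))" for A
    by (induction rule: finite_induct) (auto intro: assms)
  from this[of "keys F0"] show ?thesis by (simp add: mpol_sum_singles)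
qed

lemma polysI: "(\<And>m. m \<in> keys F \<Longrightarrow> keys m \<subseteq> {..n}) \<Longrightarrow> F \<in> polys n"
  by (auto simp: polys_def)

lemma polys_mono: "F \<in> polys c \<Longrightarrow> c \<le> n \<Longrightarrow> F \<in> polys n"
  by (auto simp: polys_def) (meson atMost_iff order_trans subsetD)

lemma polys_zero [simp]: "0 \<in> polys n" by (simp add: polys_def)
lemma polys_const [simp]: "single 0 c \<in> polys n" by (simp add: polys_def)
lemma polys_one [simp]: "1 \<in> polys n" by (simp add: polys_def)
lemma polys_add [simp]: "F \<in> polys n \<Longrightarrow> G \<in> polys n \<Longrightarrow> F + G \<in> polys n"
  using keys_add[of F G] by (auto simp: polys_def)
lemma keys_uminus_mpol [simp]: "keys (- F :: 'k::field mpol) = keys F"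
  by (auto simp: in_keys_iff)
lemma polys_uminus [simp]: "F \<in> polys n \<Longrightarrow> - F \<in> polys n"
  by (simp add: polys_def)
lemma polys_diff [simp]: "F \<in> polys n \<Longrightarrow> G \<in> polys n \<Longrightarrow> F - G \<in> polys n"
  using polys_add[of F n "- G"] by simp
lemma polys_mult [simp]: "F \<in> polys n \<Longrightarrow> G \<in> polys n \<Longrightarrow> F * G \<in> polys n"
proof (rule polysI)
  fix m assume *: "F \<in> polys n" "G \<in> polys n" "m \<in> keys (F * G)"
  then obtain a b where "a \<in> keys F" "b \<in> keys G" "m = a + b" using keys_mult[of F G] by auto
  with * show "keys m \<subseteq> {..n}" by (auto simp: keys_monom_add polys_def)
qed
lemma polys_sum [simp]: "(\<And>i. i \<in> A \<Longrightarrow> F i \<in> polys n) \<Longrightarrow> sum F A \<in> polys n"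
  by (induction A rule: infinite_finite_induct) auto
lemma polys_Xv [simp]: "Xv i \<in> polys n \<longleftrightarrow> i \<le> n"
  by (simp add: Xv_def polys_def)
lemma polys_single: "keys m \<subseteq> {..n} \<Longrightarrow> single m c \<in> polys n"
  by (simp add: polys_def)
lemma polys_power [simp]: "F \<in> polys n \<Longrightarrow> F ^ e \<in> polys n"
  by (induction e) auto

lemma forms_polys: "F \<in> forms n l \<Longrightarrow> F \<in> polys n" by (simp add: forms_def)
lemma forms_zero [simp]: "0 \<in> forms n l" by (simp add: forms_def)
lemma forms_const [simp]: "single 0 c \<in> forms n 0" by (simp add: forms_def)
lemma forms_one [simp]: "1 \<in> forms n 0" by (simp add: forms_def)
lemma forms_add [simp]: "F \<in> forms n l \<Longrightarrow> G \<in> forms n l \<Longrightarrow> F + G \<in> forms n l"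
  using keys_add[of F G] by (auto simp: forms_def)
lemma forms_uminus [simp]: "F \<in> forms n l \<Longrightarrow> - F \<in> forms n l"
  by (simp add: forms_def)
lemma forms_diff [simp]: "F \<in> forms n l \<Longrightarrow> G \<in> forms n l \<Longrightarrow> F - G \<in> forms n l"
  using forms_add[of F n l "- G"] by simp
lemma forms_mult: "F \<in> forms n k \<Longrightarrow> G \<in> forms n l \<Longrightarrow> F * G \<in> forms n (k + l)"
proof -
  assume *: "F \<in> forms n k" "G \<in> forms n l"
  have "mdeg m = k + l" if m: "m \<in> keys (F * G)" for m
  proof -
    obtain a b where "a \<in> keys F" "b \<in> keys G" "m = a + b" using keys_mult[of F G] m by auto
    with * show ?thesis by (auto simp: forms_def)
  qed
  with * show ?thesis by (simp add: forms_def)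
qed
lemma forms_mult': "F \<in> forms n k \<Longrightarrow> G \<in> forms n l \<Longrightarrow> e = k + l \<Longrightarrow> F * G \<in> forms n e"
  by (simp add: forms_mult)
lemma forms_sum [simp]: "(\<And>i. i \<in> A \<Longrightarrow> F i \<in> forms n l) \<Longrightarrow> sum F A \<in> forms n l"
  by (induction A rule: infinite_finite_induct) auto
lemma forms_Xv [simp]: "i \<le> n \<Longrightarrow> Xv i \<in> forms n 1"
  by (simp add: Xv_def forms_def polys_def)
lemma forms_Xv' [simp]: "i \<le> n \<Longrightarrow> Xv i \<in> forms n (Suc 0)"
  using forms_Xv by simp
lemma forms_single: "keys m \<subseteq> {..n} \<Longrightarrow> mdeg m = l \<Longrightarrow> single m c \<in> forms n l"
  by (simp add: forms_def polys_def)
lemma forms_power: "F \<in> forms n l \<Longrightarrow> F ^ e \<in> forms n (e * l)"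
  by (induction e) (auto intro: forms_mult)
lemma forms_prod: "(\<And>i. i \<in> A \<Longrightarrow> F i \<in> forms n (l i)) \<Longrightarrow> prod F A \<in> forms n (sum l A)"
  by (induction A rule: infinite_finite_induct) (auto intro: forms_mult)
lemma forms_const_mult [simp]: "F \<in> forms n l \<Longrightarrow> single 0 c * F \<in> forms n l"
  by (rule forms_mult'[where k = 0 and l = l]) auto

lemma single_Xv_mult: "single (single i 1 + m) c = Xv i * (single m c :: 'k::field mpol)"
  by (simp add: Xv_def mult_single)

lemma mpol_single_induct_var [consumes 1, case_names const var]:
  fixes m :: "nat \<Rightarrow>\<^sub>0 nat"
  assumes "keys m \<subseteq> {..n}"
    and "P (single 0 c)" "\<And>i m. i \<le> n \<Longrightarrow> keys m \<subseteq> {..n} \<Longrightarrow> P (single m c) \<Longrightarrow> P (Xv i * single m c)"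
  shows "P (single m (c::'k::field))"
  using assms(1)
proof (induction "mdeg m" arbitrary: m)
  case 0
  then show ?case using assms(2) by auto
next
  case (Suc k)
  then have "m \<noteq> 0" by auto
  then obtain i where i: "i \<in> keys m" by (metis all_not_in_conv keys_eq_empty)
  then obtain m' where m': "m = single i 1 + m'" by (rule keys_monom_split)
  then have "mdeg m' = k" "keys m' \<subseteq> {..n}" "i \<le> n" using Suc i by (auto simp: keys_monom_add)
  with Suc.hyps(1)[of m'] assms(3)[of i m'] show ?case
    using m' by (metis single_Xv_mult)
qed

lemma mpol_induct [consumes 1, case_names const var add mult]:
  assumes "F \<in> polys n"
    and "\<And>c. P (single 0 c)" "\<And>i. i \<le> n \<Longrightarrow> P (Xv i)"
    and "\<And>F G. F \<in> polys n \<Longrightarrow> G \<in> polys n \<Longrightarrow> P F \<Longrightarrow> P G \<Longrightarrow> P (F + G)"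
    and "\<And>F G. F \<in> polys n \<Longrightarrow> G \<in> polys n \<Longrightarrow> P F \<Longrightarrow> P G \<Longrightarrow> P (F * G)"
  shows "P (F :: 'k::field mpol)"
proof -
  have m: "P (single m c)" if "keys m \<subseteq> {..n}" for m c
    using that by (induction rule: mpol_single_induct_var) (auto intro: assms polys_single)
  have "P F \<and> F \<in> polys n"
  proof (induction F rule: mpol_single_induct)
    case zero
    then show ?case using assms(2)[of 0] by simp
  next
    case (add m F')
    then have "keys m \<subseteq> {..n}" using assms(1) by (auto simp: polys_def)
    with add show ?case by (auto intro!: assms(4) m polys_single polys_add)
  qed
  then show ?thesis ..
qed

section \<open>Evaluation homomorphisms\<close>

definition chom :: "('a::comm_ring_1 \<Rightarrow> 'b::comm_ring_1) \<Rightarrow> bool" where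
  "chom e \<longleftrightarrow> e 1 = 1 \<and> (\<forall>a b. e (a + b) = e a + e b) \<and> (\<forall>a b. e (a * b) = e a * e b)"

lemma chomD: assumes "chom e"
  shows "e 1 = 1" "e (a + b) = e a + e b" "e (a * b) = e a * e b" "e 0 = 0"
    "e (- a) = - e a" "e (a - b) = e a - e b" "e (a ^ k) = e a ^ k"
    "e (sum f A) = (\<Sum>i\<in>A. e (f i))" "e (prod f A) = (\<Prod>i\<in>A. e (f i))"
proof -
  show 1: "e 1 = 1" "e (a + b) = e a + e b" "e (a * b) = e a * e b" for a b
    using assms by (auto simp: chom_def)
  show 0: "e 0 = 0" using 1(2)[of 0 0] by simp
  show m: "e (- a) = - e a" for a using 1(2)[of a "- a"] 0 by (simp add: eq_neg_iff_add_eq_0 add.commute)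
  show "e (a - b) = e a - e b" using 1(2)[of a "- b"] m by simp
  show "e (a ^ k) = e a ^ k" by (induction k) (auto simp: 1)
  show "e (sum f A) = (\<Sum>i\<in>A. e (f i))" by (induction A rule: infinite_finite_induct) (auto simp: 1 0)
  show "e (prod f A) = (\<Prod>i\<in>A. e (f i))" by (induction A rule: infinite_finite_induct) (auto simp: 1 0)
qed

lemma chom_compose: "chom f \<Longrightarrow> chom g \<Longrightarrow> chom (\<lambda>x. f (g x))"
  by (auto simp: chom_def)

lemma chom_id [simp]: "chom (\<lambda>x. x)" by (auto simp: chom_def)
lemma chom_pCons [simp]: "chom (\<lambda>c. [:c:])"
  by (auto simp: chom_def one_pCons)
lemma chom_single [simp]: "chom (\<lambda>c. single 0 c :: 'k::field mpol)"
  by (auto simp: chom_def single_add mult_single)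
lemma chom_poly [simp]: "chom (\<lambda>p. poly p x)"
  by (auto simp: chom_def)

definition mval :: "(nat \<Rightarrow> 'b::comm_ring_1) \<Rightarrow> (nat \<Rightarrow>\<^sub>0 nat) \<Rightarrow> 'b" where
  "mval x m = (\<Prod>i\<in>keys m. x i ^ lookup m i)"

text \<open>The algebra homomorphism sending \<open>X_i\<close> to \<open>x i\<close> and acting on
  coefficients by \<open>e\<close>. Apart from \<open>dd\<close>, it is used with the identity
  (values at points), \<open>pC\<close> (restriction to a parametrized curve) and
  \<open>single 0\<close> (substitution of polynomials).\<close>

definition ins :: "('k::field \<Rightarrow> 'b::comm_ring_1) \<Rightarrow> (nat \<Rightarrow> 'b) \<Rightarrow> 'k mpol \<Rightarrow> 'b" where
  "ins e x F = (\<Sum>m\<in>keys F. e (lookup F m) * mval x m)"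

lemma mval_eq_prod: "finite A \<Longrightarrow> keys m \<subseteq> A \<Longrightarrow> mval x m = (\<Prod>i\<in>A. x i ^ lookup m i)"
  unfolding mval_def by (rule prod.mono_neutral_left) (auto simp: in_keys_iff)

lemma mval_add: "mval x (a + b) = mval x a * mval x b"
proof -
  have "mval x (a + b) = (\<Prod>i\<in>keys a \<union> keys b. x i ^ lookup (a + b) i)"
    by (rule mval_eq_prod) (auto simp: keys_monom_add)
  then show ?thesis
    by (simp add: lookup_add power_add prod.distrib mval_eq_prod[of "keys a \<union> keys b"])
qed

lemma mval_zero [simp]: "mval x 0 = 1" by (simp add: mval_def)
lemma mval_single [simp]: "mval x (single i e) = x i ^ e" by (simp add: mval_def)

lemma ins_eq_sum:
  assumes "chom e" "finite A" "keys F \<subseteq> A"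
  shows "ins e x F = (\<Sum>m\<in>A. e (lookup F m) * mval x m)"
  unfolding ins_def by (rule sum.mono_neutral_left) (use assms in \<open>auto simp: in_keys_iff chomD\<close>)

lemma ins_single: assumes "chom e" shows "ins e x (single m c) = e c * mval x m"
  using ins_eq_sum[OF assms, of "{m}" "single m c" x] by simp

lemma ins_add: assumes "chom e" shows "ins e x (F + G) = ins e x F + ins e x G"
proof -
  let ?A = "keys F \<union> keys G"
  have "ins e x (F + G) = (\<Sum>m\<in>?A. e (lookup (F + G) m) * mval x m)"
    by (rule ins_eq_sum[OF assms]) (use keys_add[of F G] in auto)
  then show ?thesis
    by (simp add: ins_eq_sum[OF assms, of ?A] lookup_add chomD[OF assms] distrib_right sum.distrib)
qed

lemma ins_zero [simp]: "ins e x 0 = 0" by (simp add: ins_def)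

lemma ins_mult: assumes "chom e" shows "ins e x (F * G) = ins e x F * ins e x G"
proof (induction F rule: mpol_single_induct)
  case zero
  then show ?case by simp
next
  case (add m F')
  have "ins e x (single m c * G) = e c * mval x m * ins e x G" for c
  proof (induction G rule: mpol_single_induct)
    case (add m' G')
    then show ?case
      by (simp add: distrib_left ins_add[OF assms] mult_single ins_single[OF assms] mval_add chomD[OF assms] algebra_simps)
  qed simp
  with add show ?case by (simp add: distrib_right ins_add[OF assms] ins_single[OF assms])
qed

lemma ins_one: "chom e \<Longrightarrow> ins e x 1 = 1"
  using ins_single[of e x 0 1] by (simp add: chomD)

lemma chom_ins: "chom e \<Longrightarrow> chom (ins e x)"
  by (simp add: chom_def[of "ins e x"] ins_one ins_add ins_mult)

lemma ins_const: "chom e \<Longrightarrow> ins e x (single 0 c) = e c"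
  by (simp add: ins_single)

lemma ins_Xv: "chom e \<Longrightarrow> ins e x (Xv i) = x i"
  by (simp add: Xv_def ins_single chomD)

lemma chom_ins_comp:
  assumes "chom h" shows "h (ins e x F) = ins (\<lambda>c. h (e c)) (\<lambda>i. h (x i)) F"
  by (simp add: ins_def mval_def chomD[OF assms])

text \<open>The uniqueness half of the universal property of the polynomial ring; it identifies
  compositions of substitutions.\<close>

lemma chom_eq_ins:
  assumes "chom h" "F \<in> polys n" "chom e" "\<And>c. h (single 0 c) = e c" "\<And>i. i \<le> n \<Longrightarrow> h (Xv i) = x i"
  shows "h F = ins e x F"
  using assms(2)
  by (induction rule: mpol_induct) (auto simp: assms chomD[OF assms(1)] ins_const ins_Xv ins_add ins_mult)

lemma ins_cong:
  assumes "F \<in> polys n" "\<And>i. i \<le> n \<Longrightarrow> x i = y i"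
  shows "ins e x F = ins e y F"
  unfolding ins_def mval_def
proof (intro sum.cong prod.cong arg_cong2[where f = "(*)"] refl)
  fix m i assume "m \<in> keys F" "i \<in> keys m"
  with assms(1) have "i \<le> n" by (auto simp: polys_def)
  with assms(2) show "x i ^ lookup m i = y i ^ lookup m i" by simp
qed

lemma ins_homogeneous:
  assumes "F \<in> forms n l"
  shows "ins e (\<lambda>i. a * x i) F = a ^ l * ins e x F"
proof -
  have "mval (\<lambda>i. a * x i) m = a ^ l * mval x m" if "m \<in> keys F" for m
    using that assms by (auto simp: mval_def power_mult_distrib prod.distrib forms_def mdeg_def power_sum)
  then show ?thesis by (simp add: ins_def sum_distrib_left algebra_simps)
qed

lemma peval_eq_ins: "peval F x = ins (\<lambda>c. c) x F"
  by (simp add: peval_def ins_def mval_def)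

lemma chom_peval: "chom (\<lambda>F. peval F x)"
  unfolding peval_eq_ins by (rule chom_ins) simp

lemmas peval_simps [simp] = chomD[OF chom_peval]

lemma peval_Xv [simp]: "peval (Xv i) x = x i"
  by (simp add: peval_eq_ins ins_Xv)
lemma peval_const [simp]: "peval (single 0 c) x = c"
  by (simp add: peval_eq_ins ins_const)

lemma peval_homogeneous: "F \<in> forms n l \<Longrightarrow> peval F (\<lambda>i. a * x i) = a ^ l * peval F x"
  unfolding peval_eq_ins by (rule ins_homogeneous)

section \<open>Homogeneous components\<close>

lemma lookup_hom_comp: "lookup (hom_comp l F) m = (if mdeg m = l then lookup F m else 0)"
proof -
  have *: "finite {m \<in> keys F. mdeg m = l}" by simp
  show ?thesis
    unfolding hom_comp_def lookup_sum
    by (auto simp: lookup_single when_def sum.delta[OF *] in_keys_iff if_distrib cong: if_cong)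
qed

lemma keys_hom_comp: "keys (hom_comp l F) = {m \<in> keys F. mdeg m = l}"
  by (auto simp: in_keys_iff lookup_hom_comp split: if_splits)

lemma hom_comp_zero [simp]: "hom_comp l 0 = 0"
  by (rule poly_mapping_eqI) (simp add: lookup_hom_comp)
lemma hom_comp_add: "hom_comp l (F + G) = hom_comp l F + hom_comp l G"
  by (rule poly_mapping_eqI) (simp add: lookup_hom_comp lookup_add)
lemma hom_comp_diff: "hom_comp l (F - G) = hom_comp l F - hom_comp l G"
  by (rule poly_mapping_eqI) (simp add: lookup_hom_comp lookup_minus)
lemma hom_comp_sum: "hom_comp l (sum f A) = (\<Sum>i\<in>A. hom_comp l (f i))"
  by (induction A rule: infinite_finite_induct) (auto simp: hom_comp_add)

lemma hom_comp_form: "F \<in> forms n k \<Longrightarrow> hom_comp l F = (if l = k then F else 0)"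
  by (rule poly_mapping_eqI) (auto simp: lookup_hom_comp forms_def in_keys_iff)

lemma hom_comp_in_polys [simp]: "F \<in> polys n \<Longrightarrow> hom_comp l F \<in> polys n"
  by (auto simp: polys_def keys_hom_comp)
lemma hom_comp_in_forms [simp]: "F \<in> polys n \<Longrightarrow> hom_comp l F \<in> forms n l"
  by (auto simp: forms_def keys_hom_comp)

lemma sum_hom_comp: "\<exists>N. \<forall>M\<ge>N. (\<Sum>l\<le>M. hom_comp l F) = F"
proof (intro exI allI impI)
  fix M assume M: "Max (insert 0 (mdeg ` keys F)) \<le> M"
  show "(\<Sum>l\<le>M. hom_comp l F) = F"
  proof (rule poly_mapping_eqI)
    fix m
    have "m \<in> keys F \<Longrightarrow> mdeg m \<le> M" using M by auto
    then show "lookup (\<Sum>l\<le>M. hom_comp l F) m = lookup F m"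
      by (auto simp: lookup_sum lookup_hom_comp in_keys_iff)
  qed
qed

lemma hom_comp_form_mult:
  assumes "A \<in> forms n k"
  shows "hom_comp l (A * F) = (if k \<le> l then A * hom_comp (l - k) F else 0)"
proof (induction F rule: mpol_single_induct)
  case (add m F')
  have "mdeg a = k + mdeg m" if "a \<in> keys (A * single m c)" for a c
    using that keys_mult[of A "single m c"] assms by (auto simp: forms_def split: if_splits)
  then have "keys (hom_comp l (A * single m c)) = {}" if "l \<noteq> k + mdeg m" for c
    using that by (auto simp: keys_hom_comp)
  moreover have "hom_comp (k + mdeg m) (A * single m c) = A * single m c" for c
    by (rule poly_mapping_eqI) (use \<open>\<And>a c. a \<in> keys (A * single m c) \<Longrightarrow> mdeg a = k + mdeg m\<close>[of _ c] in \<open>auto simp: lookup_hom_comp in_keys_iff\<close>)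
  moreover have "hom_comp j (single m c) = (if j = mdeg m then single m c else 0)" for j and c :: 'a
    by (rule poly_mapping_eqI) (auto simp: lookup_hom_comp lookup_single when_def)
  ultimately have "hom_comp l (A * single m c) = (if k \<le> l then A * hom_comp (l - k) (single m c) else 0)" for c
    by (cases "l = k + mdeg m") auto
  with add show ?case by (auto simp: distrib_left hom_comp_add)
qed simp

section \<open>First-order expansions\<close>

text \<open>The derivative of \<open>F\<close> at \<open>x\<close> in direction \<open>v\<close> is the coefficient of \<open>\<epsilon>\<close> in
  \<open>F(x + \<epsilon> v)\<close>, which makes sense in all characteristics.\<close>

definition dd :: "('k::field \<Rightarrow> 'b::comm_ring_1) \<Rightarrow> (nat \<Rightarrow> 'b) \<Rightarrow> (nat \<Rightarrow> 'b) \<Rightarrow> 'k mpol \<Rightarrow> 'b" where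
  "dd e x v F = coeff (ins (\<lambda>c. [:e c:]) (\<lambda>i. [:x i, v i:]) F) 1"

lemma coeff_mult_1: "coeff (p * q) (Suc 0) = coeff p 0 * coeff q (Suc 0) + coeff p (Suc 0) * coeff q (0::nat)"
  by (simp add: coeff_mult)

context
  fixes e :: "'k::field \<Rightarrow> 'b::comm_ring_1"
  assumes e: "chom e"
begin

lemma chom_e': "chom (\<lambda>c. [:e c:])" by (rule chom_compose[OF chom_pCons e])

lemma coeff_0_ins: "coeff (ins (\<lambda>c. [:e c:]) (\<lambda>i. [:x i, v i:]) F) 0 = ins e x F"
  using chom_ins_comp[OF chom_poly[of 0], of "\<lambda>c. [:e c:]" "\<lambda>i. [:x i, v i:]" F]
  by (simp add: poly_0_coeff_0)

lemma dd_add: "dd e x v (F + G) = dd e x v F + dd e x v G"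
  by (simp add: dd_def ins_add[OF chom_e'])
lemma dd_zero [simp]: "dd e x v 0 = 0" by (simp add: dd_def)
lemma dd_diff: "dd e x v (F - G) = dd e x v F - dd e x v G"
  using dd_add[of x v "F - G" G] by simp
lemma dd_sum: "dd e x v (sum f A) = (\<Sum>i\<in>A. dd e x v (f i))"
  by (induction A rule: infinite_finite_induct) (auto simp: dd_add)
lemma dd_mult: "dd e x v (F * G) = ins e x F * dd e x v G + dd e x v F * ins e x G"
  by (simp add: dd_def ins_mult[OF chom_e'] coeff_mult_1 coeff_0_ins)
lemma dd_const [simp]: "dd e x v (single 0 c) = 0"
  by (simp add: dd_def ins_const[OF chom_e'])
lemma dd_one [simp]: "dd e x v 1 = 0"
  using dd_const[of x v 1] by simp
lemma dd_Xv [simp]: "dd e x v (Xv i) = v i"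
  by (simp add: dd_def ins_Xv[OF chom_e'])
lemma dd_const_mult: "dd e x v (single 0 c * F) = e c * dd e x v F"
  by (simp add: dd_mult ins_const[OF e])

lemma dd_chom: assumes h: "chom h"
  shows "h (dd e x v F) = dd (\<lambda>c. h (e c)) (\<lambda>i. h (x i)) (\<lambda>i. h (v i)) F"
proof -
  have "chom (map_poly h)"
    unfolding chom_def
    by (auto simp: poly_eq_iff coeff_map_poly coeff_mult one_pCons map_poly_pCons chomD[OF h])
  from chom_ins_comp[OF this, of "\<lambda>c. [:e c:]" "\<lambda>i. [:x i, v i:]" F]
  show ?thesis using chomD(4)[OF h] by (simp add: dd_def coeff_map_poly map_poly_pCons flip: coeff_map_poly[of h])
qed

lemma dd_cong:
  assumes "F \<in> polys n" "\<And>i. i \<le> n \<Longrightarrow> x i = x' i" "\<And>i. i \<le> n \<Longrightarrow> v i = v' i"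
  shows "dd e x v F = dd e x' v' F"
  unfolding dd_def by (subst ins_cong[OF assms(1)]) (use assms in auto)

lemma dd_scale_dir:
  assumes "F \<in> polys n" shows "dd e x (\<lambda>i. a * v i) F = a * dd e x v F"
  using assms by (induction rule: mpol_induct) (auto simp: dd_add dd_mult algebra_simps)

end

section \<open>Algebraically closed fields are infinite\<close>

text \<open>Over a finite field, one plus the product of all \<open>x - a\<close> has positive
  degree but takes the value 1 everywhere.\<close>

lemma infinite_alg_closed: "infinite (UNIV :: 'k::alg_closed_field set)"
proof
  assume fin: "finite (UNIV :: 'k set)"
  define p :: "'k poly" where "p = 1 + (\<Prod>x\<in>UNIV. [:- x, 1:])"
  have "degree (\<Prod>x\<in>(UNIV::'k set). [:- x, 1:]) = card (UNIV :: 'k set)"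
    by (subst degree_prod_eq_sum_degree) auto
  moreover have "card (UNIV :: 'k set) > 0" using fin by (simp add: card_gt_0_iff)
  ultimately have "degree p > 0"
    unfolding p_def by (subst degree_add_eq_right) auto
  then obtain x where "poly p x = 0" using alg_closed_imp_poly_has_root by blast
  moreover have "(\<Prod>y\<in>UNIV. x - y) = 0" using fin by (auto simp: prod_zero_iff)
  ultimately show False by (simp add: p_def poly_prod)
qed

lemma poly_eq_0_if_infinite:
  assumes "infinite A" "\<And>x. x \<in> A \<Longrightarrow> poly p x = 0" shows "p = (0::'k::field poly)"
  using poly_roots_finite[of p] finite_subset[of A "{x. poly p x = 0}"] assms by auto

text \<open>Lets identities be checked off the zeros of any nonzero \<open>h\<close>; in the
  applications \<open>h\<close> collects denominators and the forms that cut out a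
  neighbourhood.\<close>

lemma poly_eq_0_cofinite:
  assumes "h \<noteq> 0" "\<And>x. poly h x \<noteq> 0 \<Longrightarrow> poly p x = 0" shows "p = (0::'k::alg_closed_field poly)"
proof -
  have "poly (h * p) x = 0" for x using assms(2)[of x] by auto
  then have "h * p = 0" using poly_eq_0_if_infinite[OF infinite_alg_closed, of "h * p"] by auto
  with assms show ?thesis by simp
qed


section \<open>Existence, algebraic half: a linear resolution from leading terms\<close>

section \<open>Linear resolutions from Pommaret-type bases\<close>

lemma lookup_mult_keys:
  "lookup (F * G) m = (\<Sum>p\<in>keys F. \<Sum>q\<in>keys G. if p + q = m then lookup F p * lookup G q else 0)"
  for F G :: "'k::field mpol"
proof -
  have "F * G = (\<Sum>p\<in>keys F. single p (lookup F p)) * (\<Sum>q\<in>keys G. single q (lookup G q))"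
    by (simp only: mpol_sum_singles)
  then show ?thesis
    by (simp add: sum_product mult_single lookup_sum lookup_single when_def)
qed

lemma sum_mult_if:
  "(\<Sum>s<b. f s * (if s = t then x else 0)) = (if t < b then f t * x else 0)"
  for f :: "nat \<Rightarrow> 'a::semiring_0" and b :: nat
  by (simp add: if_distrib[of "(*) _"] cong: if_cong)

definition wdeg :: "(nat \<Rightarrow> nat) \<Rightarrow> (nat \<Rightarrow>\<^sub>0 nat) \<Rightarrow> nat" where
  "wdeg w m = (\<Sum>i\<in>keys m. lookup m i * w i)"

lemma wdeg_add: "wdeg w (a + b) = wdeg w a + wdeg w b"
proof -
  have *: "wdeg w m = (\<Sum>i\<in>keys a \<union> keys b. lookup m i * w i)" if "keys m \<subseteq> keys a \<union> keys b" for m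
    unfolding wdeg_def by (rule sum.mono_neutral_left) (use that in \<open>auto simp: in_keys_iff\<close>)
  show ?thesis
    by (simp add: *[of a] *[of b] *[of "a + b"] keys_monom_add lookup_add sum.distrib distrib_right)
qed

lemma wdeg_single [simp]: "wdeg w (single i e) = e * w i"
  by (simp add: wdeg_def)

text \<open>A Schreyer-type comparison of terms \<open>m e_a\<close> of a free module:
  \<open>W a\<close> is the weight of the leading term behind generator \<open>a\<close>. Ties are
  decided by the row, the larger \<open>\<rho>\<close> being the lower one.\<close>

definition low :: "(nat \<Rightarrow> nat) \<Rightarrow> (nat \<Rightarrow> nat) \<Rightarrow> (nat \<Rightarrow> nat) \<Rightarrow> (nat \<Rightarrow>\<^sub>0 nat) \<Rightarrow> nat \<Rightarrow> (nat \<Rightarrow>\<^sub>0 nat) \<Rightarrow> nat \<Rightarrow> bool" where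
  "low w W \<rho> m a m' a' \<longleftrightarrow> wdeg w m + W a < wdeg w m' + W a' \<or>
     (wdeg w m + W a = wdeg w m' + W a' \<and> \<rho> a' < \<rho> a)"

lemma low_trans: "low w W \<rho> m a m' a' \<Longrightarrow> low w W \<rho> m' a' m'' a'' \<Longrightarrow> low w W \<rho> m a m'' a''"
  by (auto simp: low_def)

lemma low_add: "low w W \<rho> m a m' a' \<Longrightarrow> low w W \<rho> (\<mu> + m) a (\<mu> + m') a'"
  by (auto simp: low_def wdeg_add)

text \<open>The vectors \<open>D _ s\<close> have leading terms \<open>ld s\<close> in row \<open>la s\<close>; every term in the free module
  is either normal or in a unique way a product of a leading term with a monomial in the variables
  up to \<open>cl s\<close>.\<close>

locale triangular =
  fixes n b :: nat and w W \<rho> :: "nat \<Rightarrow> nat" and b' :: nat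
    and ld :: "nat \<Rightarrow> (nat \<Rightarrow>\<^sub>0 nat)" and la cl :: "nat \<Rightarrow> nat"
    and D :: "nat \<Rightarrow> nat \<Rightarrow> 'k::field mpol" and K :: "(nat \<Rightarrow> 'k mpol) set"
    and nrm :: "(nat \<Rightarrow>\<^sub>0 nat) \<Rightarrow> nat \<Rightarrow> bool"
  assumes la: "s < b' \<Longrightarrow> la s < b"
    and ld: "s < b' \<Longrightarrow> keys (ld s) \<subseteq> {..n}"
    and cl: "s < b' \<Longrightarrow> cl s \<le> n"
    and lead: "s < b' \<Longrightarrow> lookup (D (la s) s) (ld s) = 1"
    and lower: "s < b' \<Longrightarrow> a < b \<Longrightarrow> m \<in> keys (D a s) \<Longrightarrow>
          keys m \<subseteq> {..n} \<and> mdeg m = mdeg (ld s) \<and> (m = ld s \<and> a = la s \<or> low w W \<rho> m a (ld s) (la s))"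
    and cover: "a < b \<Longrightarrow> keys m \<subseteq> {..n} \<Longrightarrow> \<not> nrm m a \<Longrightarrow>
          \<exists>s<b'. \<exists>\<mu>. keys \<mu> \<subseteq> {..cl s} \<and> m = \<mu> + ld s \<and> a = la s"
    and uniq: "s < b' \<Longrightarrow> s' < b' \<Longrightarrow> keys \<mu> \<subseteq> {..cl s} \<Longrightarrow> keys \<mu>' \<subseteq> {..cl s'} \<Longrightarrow>
          \<mu> + ld s = \<mu>' + ld s' \<Longrightarrow> la s = la s' \<Longrightarrow> s = s'"
    and K_diff: "v \<in> K \<Longrightarrow> v' \<in> K \<Longrightarrow> (\<lambda>a. v a - v' a) \<in> K"
    and K_cong: "v \<in> K \<Longrightarrow> (\<And>a. a < b \<Longrightarrow> v a = v' a) \<Longrightarrow> v' \<in> K"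
    and K_D: "(\<And>s. s < b' \<Longrightarrow> u s \<in> polys n) \<Longrightarrow> (\<lambda>a. \<Sum>s<b'. D a s * u s) \<in> K"
    and K_nrm: "v \<in> K \<Longrightarrow> (\<And>a. a < b \<Longrightarrow> v a \<in> polys n \<and> (\<forall>m\<in>keys (v a). nrm m a)) \<Longrightarrow>
          a < b \<Longrightarrow> v a = 0"
begin

definition B :: nat where "B = (\<Sum>a<b. \<rho> a)"

text \<open>A numerical measure for \<open>low\<close>: \<open>B\<close> bounds
  \<open>\<rho>\<close> on the rows in range, so the factor \<open>B + 1\<close> lets the weight
  dominate.\<close>

definition rk :: "(nat \<Rightarrow>\<^sub>0 nat) \<Rightarrow> nat \<Rightarrow> nat" where
  "rk m a = (wdeg w m + W a) * (B + 1) + (B - \<rho> a)"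

lemma low_rk: assumes "low w W \<rho> m a m' a'" "a < b" "a' < b" shows "rk m a < rk m' a'"
proof -
  have B: "\<rho> a \<le> B" using assms unfolding B_def by (intro member_le_sum) auto
  show ?thesis
  proof (cases "wdeg w m + W a < wdeg w m' + W a'")
    case True
    then have "(wdeg w m + W a + 1) * (B + 1) \<le> (wdeg w m' + W a') * (B + 1)" by (intro mult_right_mono) auto
    then show ?thesis unfolding rk_def by (auto simp: algebra_simps)
  next
    case False
    then show ?thesis using assms B by (auto simp: low_def rk_def)
  qed
qed

text \<open>Consider the products of a leading term with a term of its coefficient, and choose one
  of maximal rank. By \<open>uniq\<close> no other leading product equals it, and every non-leading
  contribution lies strictly below some leading product, so it is too small to reach it. The
  coefficient of the chosen term survives.\<close>

lemma indep:
  assumes u: "\<And>s. s < b' \<Longrightarrow> u s \<in> polys (cl s)"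
    and 0: "\<And>a. a < b \<Longrightarrow> (\<Sum>s<b'. D a s * u s) = 0" and "s < b'"
  shows "u s = 0"
proof (rule ccontr)
  assume ne: "u s \<noteq> 0"
  define P where "P = Sigma {..<b'} (\<lambda>s. keys (u s))"
  have "finite P" by (auto simp: P_def)
  moreover obtain m0 where "m0 \<in> keys (u s)" using ne by (metis all_not_in_conv keys_eq_empty)
  then have "P \<noteq> {}" using assms(3) by (auto simp: P_def)
  ultimately obtain p where p: "p \<in> P" "\<And>q. q \<in> P \<Longrightarrow> rk (snd q + ld (fst q)) (la (fst q)) \<le> rk (snd p + ld (fst p)) (la (fst p))"
    using Max_in[of "(\<lambda>q. rk (snd q + ld (fst q)) (la (fst q))) ` P"]
      Max_ge[of "(\<lambda>q. rk (snd q + ld (fst q)) (la (fst q))) ` P"] by fastforce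
  obtain s \<mu> where sm: "p = (s, \<mu>)" by force
  then have s: "s < b'" "\<mu> \<in> keys (u s)" using p by (auto simp: P_def)
  define m where "m = \<mu> + ld s"
  have only: "p' = ld s \<and> q' = \<mu> \<and> s' = s"
    if s': "s' < b'" and q': "q' \<in> keys (u s')" and p': "p' \<in> keys (D (la s) s')" and e: "p' + q' = m" for s' p' q'
  proof -
    have kq: "keys q' \<subseteq> {..cl s'}" "keys \<mu> \<subseteq> {..cl s}" using u[OF s'] u[OF s(1)] q' s(2) by (auto simp: polys_def)
    from lower[OF s' la[OF s(1)] p'] consider "p' = ld s'" "la s = la s'" | "low w W \<rho> p' (la s) (ld s') (la s')" by blast
    then show ?thesis
    proof cases
      case 1
      then have "q' + ld s' = \<mu> + ld s" using e by (simp add: m_def add.commute)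
      then have "s' = s" using uniq[OF s' s(1) kq] 1 by auto
      then show ?thesis using 1 e by (auto simp: m_def add.commute)
    next
      case 2
      then have "low w W \<rho> (q' + p') (la s) (q' + ld s') (la s')" by (rule low_add)
      then have "rk m (la s) < rk (q' + ld s') (la s')"
        using low_rk la s(1) s' e by (metis add.commute)
      moreover have "(s', q') \<in> P" using s' q' by (auto simp: P_def)
      ultimately show ?thesis using p(2)[of "(s', q')"] sm by (auto simp: m_def)
    qed
  qed
  have "lookup (D (la s) s' * u s') m = (if s' = s then lookup (u s) \<mu> else 0)" if "s' < b'" for s'
  proof -
    have "lookup (D (la s) s' * u s') m = (\<Sum>p'\<in>keys (D (la s) s'). \<Sum>q'\<in>keys (u s').
        if p' + q' = m then lookup (D (la s) s') p' * lookup (u s') q' else 0)"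
      by (rule lookup_mult_keys)
    also have "\<dots> = (\<Sum>p'\<in>keys (D (la s) s'). \<Sum>q'\<in>keys (u s').
        if p' = ld s \<and> q' = \<mu> \<and> s' = s then lookup (u s) \<mu> else 0)"
    proof (intro sum.cong refl)
      fix p' q' assume *: "p' \<in> keys (D (la s) s')" "q' \<in> keys (u s')"
      show "(if p' + q' = m then lookup (D (la s) s') p' * lookup (u s') q' else 0) =
        (if p' = ld s \<and> q' = \<mu> \<and> s' = s then lookup (u s) \<mu> else 0)"
        using only[OF that *(2) *(1)] lead[OF s(1)] by (auto simp: m_def add.commute)
    qed
    also have "\<dots> = (if s' = s then lookup (u s) \<mu> else 0)"
    proof (cases "s' = s")
      case True
      have "ld s \<in> keys (D (la s) s)" using lead[OF s(1)] by (auto simp: in_keys_iff)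
      then have "(\<Sum>p'\<in>keys (D (la s) s). \<Sum>q'\<in>keys (u s). if p' = ld s \<and> q' = \<mu> then lookup (u s) \<mu> else 0)
        = (\<Sum>p'\<in>keys (D (la s) s). if p' = ld s then (\<Sum>q'\<in>keys (u s). if q' = \<mu> then lookup (u s) \<mu> else 0) else 0)"
        by (intro sum.cong) auto
      with \<open>ld s \<in> keys (D (la s) s)\<close> True s show ?thesis by simp
    qed simp
    finally show ?thesis .
  qed
  then have "lookup (\<Sum>s'<b'. D (la s) s' * u s') m = lookup (u s) \<mu>"
    using s(1) by (simp add: lookup_sum)
  moreover have "lookup (u s) \<mu> \<noteq> 0" using s(2) by (simp add: in_keys_iff)
  ultimately show False using 0[OF la[OF s(1)]] by simp
qed

text \<open>\<open>T\<close> is a downward closed set of terms. Carrying it through the reduction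
  bounds the terms of the quotients \<open>u\<close>; this bound is what makes the rewriting rules
  of the next syzygy module decrease the order again.\<close>

context
  fixes T :: "(nat \<Rightarrow>\<^sub>0 nat) \<Rightarrow> nat \<Rightarrow> bool"
  assumes T: "\<And>m a m' a'. T m a \<Longrightarrow> a < b \<Longrightarrow> a' < b \<Longrightarrow> mdeg m' = mdeg m \<Longrightarrow> low w W \<rho> m' a' m a \<Longrightarrow> T m' a'"
begin

definition good :: "(nat \<Rightarrow> 'k mpol) \<Rightarrow> bool" where
  "good v \<longleftrightarrow> (\<exists>p u. (\<forall>a<b. p a \<in> polys n \<and> (\<forall>m\<in>keys (p a). nrm m a)) \<and>
     (\<forall>s<b'. u s \<in> polys (cl s) \<and> (\<forall>m\<in>keys (u s). T (m + ld s) (la s))) \<and>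
     (\<forall>a<b. v a = p a + (\<Sum>s<b'. D a s * u s)))"

lemma good_add: assumes "good v" "good v'" shows "good (\<lambda>a. v a + v' a)"
proof -
  from assms(1) obtain p u where
    1: "\<forall>a<b. p a \<in> polys n \<and> (\<forall>m\<in>keys (p a). nrm m a)" "\<forall>s<b'. u s \<in> polys (cl s) \<and> (\<forall>m\<in>keys (u s). T (m + ld s) (la s))"
    "\<forall>a<b. v a = p a + (\<Sum>s<b'. D a s * u s)" unfolding good_def by blast
  from assms(2) obtain p' u' where
    2: "\<forall>a<b. p' a \<in> polys n \<and> (\<forall>m\<in>keys (p' a). nrm m a)" "\<forall>s<b'. u' s \<in> polys (cl s) \<and> (\<forall>m\<in>keys (u' s). T (m + ld s) (la s))"
    "\<forall>a<b. v' a = p' a + (\<Sum>s<b'. D a s * u' s)" unfolding good_def by blast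
  note * = 1 2
  show ?thesis unfolding good_def
  proof (rule exI[of _ "\<lambda>a. p a + p' a"], rule exI[of _ "\<lambda>s. u s + u' s"], intro conjI allI impI ballI)
    show "p a + p' a \<in> polys n" if "a < b" for a using * that by simp
    show "nrm m a" if "a < b" "m \<in> keys (p a + p' a)" for a m
      using * that keys_add[of "p a" "p' a"] by blast
    show "u s + u' s \<in> polys (cl s)" if "s < b'" for s using * that by simp
    show "T (m + ld s) (la s)" if "s < b'" "m \<in> keys (u s + u' s)" for s m
      using * that keys_add[of "u s" "u' s"] by blast
    show "v a + v' a = p a + p' a + (\<Sum>s<b'. D a s * (u s + u' s))" if "a < b" for a
      using * that by (simp add: distrib_left sum.distrib)
  qed
qed

lemma good_zero: "good (\<lambda>a. 0)"
  unfolding good_def by (intro exI[of _ "\<lambda>_. 0"]) auto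

lemma good_cong: "good v \<Longrightarrow> (\<And>a. a < b \<Longrightarrow> v a = v' a) \<Longrightarrow> good v'"
  unfolding good_def by (elim exE conjE, intro exI conjI) auto

lemma good_sum: "finite A \<Longrightarrow> (\<And>i. i \<in> A \<Longrightarrow> good (f i)) \<Longrightarrow> good (\<lambda>a. \<Sum>i\<in>A. f i a)"
proof (induction rule: finite_induct)
  case empty
  then show ?case by (simp add: good_zero)
next
  case (insert x F)
  then have "good (\<lambda>a. f x a + (\<Sum>i\<in>F. f i a))" by (intro good_add) auto
  then show ?case using insert by simp
qed

lemma good_terms:
  assumes "\<And>a m. a < b \<Longrightarrow> m \<in> keys (v a) \<Longrightarrow> good (\<lambda>r. if r = a then single m (lookup (v a) m) else 0)"
  shows "good v"
proof (rule good_cong)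
  show "good (\<lambda>r. \<Sum>a<b. \<Sum>m\<in>keys (v a). if r = a then single m (lookup (v a) m) else 0)"
    using assms by (intro good_sum) auto
next
  fix r assume "r < b"
  have "(\<Sum>a<b. \<Sum>m\<in>keys (v a). if r = a then single m (lookup (v a) m) else 0) =
      (\<Sum>a<b. if r = a then v a else 0)"
    by (intro sum.cong refl) (auto simp: mpol_sum_singles)
  then show "(\<Sum>a<b. \<Sum>m\<in>keys (v a). if r = a then single m (lookup (v a) m) else 0) = v r"
    using \<open>r < b\<close> by simp
qed

text \<open>Division with remainder: a non-normal term is a leading term times a monomial in the
  variables allowed for it, and subtracting that multiple of the column, whose leading coefficient
  is 1, leaves only strictly lower terms.\<close>

lemma good_term:
  "a < b \<Longrightarrow> keys m \<subseteq> {..n} \<Longrightarrow> T m a \<Longrightarrow> good (\<lambda>r. if r = a then single m c else 0)"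
proof (induction "rk m a" arbitrary: m a c rule: less_induct)
  case (less m a c)
  show ?case
  proof (cases "nrm m a")
    case True
    show ?thesis unfolding good_def
      by (rule exI[of _ "\<lambda>r. if r = a then single m c else 0"], rule exI[of _ "\<lambda>_. 0"])
        (use True less in \<open>auto intro: polys_single split: if_splits\<close>)
  next
    case False
    with cover less obtain s \<mu> where s: "s < b'" "keys \<mu> \<subseteq> {..cl s}" "m = \<mu> + ld s" "a = la s" by metis
    have g1: "good (\<lambda>r. D r s * single \<mu> c)"
      unfolding good_def
      by (rule exI[of _ "\<lambda>_. 0"], rule exI[of _ "\<lambda>s'. if s' = s then single \<mu> c else 0"])
        (use s less in \<open>auto simp: sum_mult_if intro: polys_single split: if_splits\<close>)
    define v where "v = (\<lambda>r. (if r = a then single m c else 0) - D r s * single \<mu> c)"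
    have "good v"
    proof (rule good_terms)
      fix a' m' assume a': "a' < b" and m': "m' \<in> keys (v a')"
      have low': "\<exists>q. m' = \<mu> + q \<and> q \<in> keys (D a' s) \<and> low w W \<rho> q a' (ld s) (la s)"
      proof (cases "m' = m \<and> a' = a")
        case True
        have "lookup (D a s * single \<mu> c) m = c"
        proof -
          have "lookup (D a s * single \<mu> c) m = (\<Sum>p\<in>keys (D a s). \<Sum>q\<in>keys (single \<mu> c).
             if p + q = m then lookup (D a s) p * lookup (single \<mu> c) q else 0)"
            by (rule lookup_mult_keys)
          also have "\<dots> = (\<Sum>p\<in>keys (D a s). if p = ld s then lookup (D a s) p * c else 0)"
            by (rule sum.cong[OF refl]) (use s in \<open>auto simp: add.commute[of _ \<mu>]\<close>)
          also have "\<dots> = c" using lead[OF s(1)] s(4) by (auto simp: in_keys_iff)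
          finally show ?thesis .
        qed
        then have "lookup (v a') m' = 0" using True by (simp add: v_def lookup_minus)
        with m' show ?thesis by (simp add: in_keys_iff)
      next
        case False
        then have "lookup (v a') m' = - lookup (D a' s * single \<mu> c) m'"
          by (auto simp: v_def lookup_minus lookup_single when_def)
        then have "m' \<in> keys (D a' s * single \<mu> c)" using m' by (auto simp: in_keys_iff)
        then obtain q where q: "q \<in> keys (D a' s)" "m' = q + \<mu>"
          using keys_mult[of "D a' s" "single \<mu> c"] by (auto split: if_splits)
        from lower[OF s(1) a' q(1)] q False s show ?thesis by (auto simp: add.commute)
      qed
      then obtain q where q: "m' = \<mu> + q" "q \<in> keys (D a' s)" "low w W \<rho> q a' (ld s) (la s)" by blast
      then have low: "low w W \<rho> m' a' m a" using low_add s by metis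
      have "mdeg m' = mdeg m" "keys m' \<subseteq> {..n}"
        using lower[OF s(1) a' q(2)] s cl[OF s(1)] q(1) by (auto simp: keys_monom_add)
      then show "good (\<lambda>r. if r = a' then single m' (lookup (v a') m') else 0)"
        using less low a' by (intro less.hyps) (auto intro: low_rk T)
    qed
    with g1 have "good (\<lambda>r. D r s * single \<mu> c + v r)" by (rule good_add)
    then show ?thesis by (rule good_cong) (auto simp: v_def)
  qed
qed

text \<open>The remainder of the division lies in \<open>K\<close> and consists of normal terms, so
  \<open>K_nrm\<close> kills it.\<close>

lemma reduce:
  assumes v: "v \<in> K" "\<And>a. a < b \<Longrightarrow> v a \<in> polys n" "\<And>a m. a < b \<Longrightarrow> m \<in> keys (v a) \<Longrightarrow> T m a"
  shows "\<exists>u. (\<forall>s<b'. u s \<in> polys (cl s) \<and> (\<forall>m\<in>keys (u s). T (m + ld s) (la s))) \<and>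
     (\<forall>a<b. v a = (\<Sum>s<b'. D a s * u s))"
proof -
  have "good v"
  proof (rule good_terms)
    fix a m assume a: "a < b" "m \<in> keys (v a)"
    then have "keys m \<subseteq> {..n}" using v(2) by (auto simp: polys_def)
    then show "good (\<lambda>r. if r = a then single m (lookup (v a) m) else 0)"
      using a v(3) by (intro good_term) auto
  qed
  then obtain p u where *: "\<And>a. a < b \<Longrightarrow> p a \<in> polys n \<and> (\<forall>m\<in>keys (p a). nrm m a)"
    "\<forall>s<b'. u s \<in> polys (cl s) \<and> (\<forall>m\<in>keys (u s). T (m + ld s) (la s))"
    "\<And>a. a < b \<Longrightarrow> v a = p a + (\<Sum>s<b'. D a s * u s)" unfolding good_def by auto
  have "u s \<in> polys n" if "s < b'" for s
    using *(2) that cl[OF that] polys_mono by blast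
  then have "(\<lambda>a. v a - (\<Sum>s<b'. D a s * u s)) \<in> K" by (intro K_diff v K_D)
  then have "p \<in> K" by (rule K_cong) (use * in auto)
  then have "p a = 0" if "a < b" for a using K_nrm *(1) that by blast
  with * show ?thesis by (intro exI[of _ u]) auto
qed

end

end

text \<open>The module spanned by the columns of \<open>M\<close> is the direct sum of the \<open>polys (c a)\<close>-multiples of
  column \<open>a\<close>, and the products with the other variables are rewritten into this form in a way that
  decreases the order on terms; so leading terms exist on each syzygy module again.\<close>

definition lin_sys :: "nat \<Rightarrow> (nat \<Rightarrow> nat) \<Rightarrow> nat \<Rightarrow> nat \<Rightarrow> (nat \<Rightarrow> nat) \<Rightarrow> (nat \<Rightarrow> nat) \<Rightarrow> (nat \<Rightarrow> nat) \<Rightarrow>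
    (nat \<Rightarrow> nat \<Rightarrow> 'k::field mpol) \<Rightarrow> bool" where
  "lin_sys n w r b c W \<rho> M \<longleftrightarrow>
     (\<forall>a<b. c a \<le> n) \<and> (\<forall>i<r. \<forall>a<b. M i a \<in> polys n) \<and>
     (\<forall>u. (\<forall>a<b. u a \<in> polys (c a)) \<and> (\<forall>i<r. (\<Sum>a<b. M i a * u a) = 0) \<longrightarrow> (\<forall>a<b. u a = 0)) \<and>
     (\<forall>a<b. \<forall>j. c a < j \<and> j \<le> n \<longrightarrow>
        (\<exists>P. (\<forall>a'<b. P a' \<in> polys (c a') \<and> (\<forall>m\<in>keys (P a'). mdeg m = 1 \<and> low w W \<rho> m a' (single j 1) a)) \<and>
             (\<forall>i<r. M i a * Xv j = (\<Sum>a'<b. M i a' * P a'))))"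

text \<open>Each rewriting rule for \<open>X_j\<close> times column \<open>a\<close>, with
  \<open>j > c a\<close>, is a linear syzygy with leading term \<open>X_j e_a\<close>. Modulo these,
  a syzygy has coefficients in \<open>polys (c a)\<close> only, hence is zero by independence. The
  new syzygy admits the variables up to \<open>j\<close>, and products with the later ones are
  rewritten by comparing two such syzygies of the same row.\<close>

lemma lin_sys_step:
  fixes M :: "nat \<Rightarrow> nat \<Rightarrow> 'k::field mpol"
  assumes sys: "lin_sys n w r b c W \<rho> M"
  shows "\<exists>b' c' W' \<rho>' D. lin_sys n w b b' c' W' \<rho>' D \<and> (\<forall>a<b. \<forall>s<b'. D a s \<in> forms n 1) \<and>
     (\<forall>v\<in>free_module n b. (\<forall>i<r. (\<Sum>a<b. M i a * v a) = 0) \<longleftrightarrow>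
        (\<exists>u\<in>free_module n b'. \<forall>a<b. v a = (\<Sum>s<b'. D a s * u s)))"
proof -
  have c: "a < b \<Longrightarrow> c a \<le> n" and Mp: "i < r \<Longrightarrow> a < b \<Longrightarrow> M i a \<in> polys n" for a i
    using sys by (auto simp: lin_sys_def)
  have un: "u a = 0" if "\<And>a. a < b \<Longrightarrow> u a \<in> polys (c a)" "\<And>i. i < r \<Longrightarrow> (\<Sum>a<b. M i a * u a) = 0" "a < b" for u a
    using sys that unfolding lin_sys_def by blast
  define ok where "ok a j P \<longleftrightarrow> (\<forall>a'<b. P a' \<in> polys (c a') \<and>
      (\<forall>m\<in>keys (P a'). mdeg m = 1 \<and> low w W \<rho> m a' (single j 1) a)) \<and>
      (\<forall>i<r. M i a * Xv j = (\<Sum>a'<b. M i a' * P a'))" for a j P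
  define P where "P a j = (SOME P. ok a j P)" for a j
  have ok: "ok a j (P a j)" if "a < b" "c a < j" "j \<le> n" for a j
  proof -
    have "\<exists>P. ok a j P" using sys that unfolding lin_sys_def ok_def by blast
    then show ?thesis unfolding P_def by (rule someI_ex)
  qed
  have P: "\<And>a j a'. a < b \<Longrightarrow> c a < j \<Longrightarrow> j \<le> n \<Longrightarrow> a' < b \<Longrightarrow> P a j a' \<in> polys (c a')"
    "\<And>a j a' m. a < b \<Longrightarrow> c a < j \<Longrightarrow> j \<le> n \<Longrightarrow> a' < b \<Longrightarrow> m \<in> keys (P a j a') \<Longrightarrow> mdeg m = 1 \<and> low w W \<rho> m a' (single j 1) a"
    "\<And>a j i. a < b \<Longrightarrow> c a < j \<Longrightarrow> j \<le> n \<Longrightarrow> i < r \<Longrightarrow> M i a * Xv j = (\<Sum>a'<b. M i a' * P a j a')"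
    using ok unfolding ok_def by blast+
  have Pn: "P a j a' \<in> polys n" if "a < b" "c a < j" "j \<le> n" "a' < b" for a j a'
    using P(1)[OF that] c[OF that(4)] by (rule polys_mono)
  \<comment> \<open>One syzygy for each row and each variable beyond its bound; \<open>f\<close>
    numbers them because columns are indexed by natural numbers.\<close>
  define I where "I = (SIGMA a:{..<b}. {c a<..n})"
  have "finite I" by (simp add: I_def)
  then obtain f where f: "bij_betw f {..<card I} I"
    using ex_bij_betw_nat_finite[of I] by (auto simp: atLeast0LessThan)
  define b' where "b' = card I"
  define \<alpha> \<tau> where "\<alpha> s = fst (f s)" and "\<tau> s = snd (f s)" for s
  have at: "\<alpha> s < b" "c (\<alpha> s) < \<tau> s" "\<tau> s \<le> n" if "s < b'" for s
    using bij_betwE[OF f] that by (force simp: b'_def I_def \<alpha>_def \<tau>_def)+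
  have inj: "s = s'" if "s < b'" "s' < b'" "\<alpha> s = \<alpha> s'" "\<tau> s = \<tau> s'" for s s'
    using f that unfolding bij_betw_def inj_on_def by (auto simp: b'_def \<alpha>_def \<tau>_def prod_eq_iff)
  have surj: "\<exists>s<b'. \<alpha> s = a \<and> \<tau> s = j" if "a < b" "c a < j" "j \<le> n" for a j
  proof -
    have "(a, j) \<in> f ` {..<b'}" using f that unfolding bij_betw_def by (auto simp: b'_def I_def)
    then obtain s where "s < b'" "f s = (a, j)" by auto
    then show ?thesis by (intro exI[of _ s]) (simp add: \<alpha>_def \<tau>_def)
  qed
  define D where "D a s = (if a = \<alpha> s then Xv (\<tau> s) else 0) - P (\<alpha> s) (\<tau> s) a" for a s
  define K where "K = {v. \<forall>i<r. (\<Sum>a<b. M i a * v a) = 0}"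
  have XK: "M i (\<alpha> s) * Xv (\<tau> s) = (\<Sum>a<b. M i a * P (\<alpha> s) (\<tau> s) a)" if "s < b'" "i < r" for s i
    using P(3) at that by blast
  have DK: "(\<Sum>a<b. M i a * D a s) = 0" if "s < b'" "i < r" for s i
  proof -
    have "(\<Sum>a<b. M i a * D a s) = (\<Sum>a<b. if a = \<alpha> s then M i a * Xv (\<tau> s) else 0) - (\<Sum>a<b. M i a * P (\<alpha> s) (\<tau> s) a)"
      unfolding sum_subtractf[symmetric] by (rule sum.cong) (auto simp: D_def algebra_simps)
    then show ?thesis using at[OF that(1)] XK[OF that] by simp
  qed
  have Dforms: "D a s \<in> forms n 1" if "a < b" "s < b'" for a s
  proof -
    have "P (\<alpha> s) (\<tau> s) a \<in> forms n 1"
      using at[OF that(2)] Pn[of "\<alpha> s" "\<tau> s" a] P(2)[of "\<alpha> s" "\<tau> s" a] that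
      by (simp add: forms_def)
    then show ?thesis using at[OF that(2)] by (simp add: D_def)
  qed
  interpret t: triangular n b w W \<rho> b' "\<lambda>s. single (\<tau> s) 1" \<alpha> \<tau> D K "\<lambda>m a. keys m \<subseteq> {..c a}"
  proof
    fix s assume s: "s < b'"
    show "\<alpha> s < b" "keys (single (\<tau> s) (1::nat)) \<subseteq> {..n}" "\<tau> s \<le> n" using at[OF s] by auto
    have "single (\<tau> s) 1 \<notin> keys (P (\<alpha> s) (\<tau> s) (\<alpha> s))"
      using P(1)[OF at[OF s] at(1)[OF s]] at[OF s] by (auto simp: polys_def)
    then show "lookup (D (\<alpha> s) s) (single (\<tau> s) 1) = 1"
      by (simp add: D_def lookup_minus Xv_def in_keys_iff)
    fix a m assume a: "a < b" and m: "m \<in> keys (D a s)"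
    have "keys m \<subseteq> {..n} \<and> mdeg m = 1" using Dforms[OF a s] m by (auto simp: forms_def polys_def)
    moreover have "m = single (\<tau> s) 1 \<and> a = \<alpha> s \<or> m \<in> keys (P (\<alpha> s) (\<tau> s) a)"
      using m by (auto simp: D_def in_keys_iff lookup_minus Xv_def lookup_single when_def split: if_splits)
    ultimately show "keys m \<subseteq> {..n} \<and> mdeg m = mdeg (single (\<tau> s) 1) \<and>
        (m = single (\<tau> s) 1 \<and> a = \<alpha> s \<or> low w W \<rho> m a (single (\<tau> s) 1) (\<alpha> s))"
      using P(2)[OF at[OF s] a] by auto
  next
    fix a and m :: "nat \<Rightarrow>\<^sub>0 nat" assume a: "a < b" "keys m \<subseteq> {..n}" "\<not> keys m \<subseteq> {..c a}"
    then have ne: "keys m \<noteq> {}" by auto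
    define j where "j = Max (keys m)"
    \<comment> \<open>Splitting off the largest variable leaves a monomial in the variables up to
      it; since the product determines its largest variable, this gives the covering here and
      uniqueness below.\<close>
    have j: "j \<in> keys m" "\<And>i. i \<in> keys m \<Longrightarrow> i \<le> j" using ne by (auto simp: j_def)
    then have "c a < j" "j \<le> n" using a by force+
    then obtain s where s: "s < b'" "\<alpha> s = a" "\<tau> s = j" using surj a by blast
    from j(1) obtain m' where m': "m = single j 1 + m'" by (rule keys_monom_split)
    then have "keys m' \<subseteq> {..\<tau> s}" using j s by (auto simp: keys_monom_add)
    then show "\<exists>s<b'. \<exists>\<mu>. keys \<mu> \<subseteq> {..\<tau> s} \<and> m = \<mu> + single (\<tau> s) 1 \<and> a = \<alpha> s"
      using s m' by (auto simp: add.commute)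
  next
    fix s s' and \<mu> \<mu>' :: "nat \<Rightarrow>\<^sub>0 nat" assume *: "s < b'" "s' < b'" "keys \<mu> \<subseteq> {..\<tau> s}" "keys \<mu>' \<subseteq> {..\<tau> s'}"
      "\<mu> + single (\<tau> s) 1 = \<mu>' + single (\<tau> s') 1" "\<alpha> s = \<alpha> s'"
    have mx: "Max (keys (\<mu> + single t 1)) = t" if "keys \<mu> \<subseteq> {..t}" for \<mu> :: "nat \<Rightarrow>\<^sub>0 nat" and t
      by (rule Max_eqI) (use that in \<open>auto simp: keys_monom_add\<close>)
    from mx[OF *(3)] mx[OF *(4)] show "s = s'" using * inj by metis
  next
    fix v v' assume "v \<in> K" "v' \<in> K"
    then show "(\<lambda>a. v a - v' a) \<in> K" by (simp add: K_def right_diff_distrib sum_subtractf)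
  next
    fix v v' assume "v \<in> K" "\<And>a. a < b \<Longrightarrow> v a = v' a"
    then show "v' \<in> K" by (simp add: K_def)
  next
    fix u
    have "(\<Sum>a<b. M i a * (\<Sum>s<b'. D a s * u s)) = 0" if "i < r" for i
    proof -
      have "(\<Sum>a<b. M i a * (\<Sum>s<b'. D a s * u s)) = (\<Sum>s<b'. (\<Sum>a<b. M i a * D a s) * u s)"
        by (simp add: sum_distrib_left sum_distrib_right mult.assoc) (rule sum.swap)
      then show ?thesis using DK that by simp
    qed
    then show "(\<lambda>a. \<Sum>s<b'. D a s * u s) \<in> K" by (simp add: K_def)
  next
    fix v a assume v: "v \<in> K" "\<And>a. a < b \<Longrightarrow> v a \<in> polys n \<and> (\<forall>m\<in>keys (v a). keys m \<subseteq> {..c a})" "a < b"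
    show "v a = 0" by (rule un) (use v in \<open>auto simp: polys_def K_def\<close>)
  qed
  define W' where "W' s = W (\<alpha> s) + w (\<tau> s)" for s
  \<comment> \<open>As \<open>\<tau> s \<le> n\<close>, this orders by the old row first and by the
    variable second.\<close>
  define \<rho>' where "\<rho>' s = \<rho> (\<alpha> s) * (n + 1) + \<tau> s" for s
  have low': "low w W' \<rho>' m s' (single l 1) s"
    if "low w W \<rho> (m + single (\<tau> s') 1) (\<alpha> s') (single l 1 + single (\<tau> s) 1) (\<alpha> s)" "s < b'" for m s' l s
  proof -
    have "\<rho>' s < \<rho>' s'" if "\<rho> (\<alpha> s) < \<rho> (\<alpha> s')"
    proof -
      have "(\<rho> (\<alpha> s) + 1) * (n + 1) \<le> \<rho> (\<alpha> s') * (n + 1)" using that by (intro mult_right_mono) auto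
      then show ?thesis using at(3)[OF \<open>s < b'\<close>] by (simp add: \<rho>'_def algebra_simps)
    qed
    then show ?thesis using that(1) by (auto simp: low_def wdeg_add W'_def)
  qed
  have "lin_sys n w b b' \<tau> W' \<rho>' D"
    unfolding lin_sys_def
  proof (intro conjI allI impI)
    show "\<tau> s \<le> n" if "s < b'" for s using at that by auto
    show "D a s \<in> polys n" if "a < b" "s < b'" for a s using Dforms[OF that] by (simp add: forms_def)
    show "u s = 0" if "(\<forall>a<b'. u a \<in> polys (\<tau> a)) \<and> (\<forall>i<b. (\<Sum>a<b'. D i a * u a) = 0)" "s < b'" for u s
      by (rule t.indep) (use that in auto)
  next
    fix s l assume s: "s < b'" and l: "\<tau> s < l \<and> l \<le> n"
    define a j where "a = \<alpha> s" and "j = \<tau> s"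
    have aj: "a < b" "c a < j" "j < l" "l \<le> n" "c a < l" "j \<le> n" using at[OF s] l by (auto simp: a_def j_def)
    then obtain s2 where s2: "s2 < b'" "\<alpha> s2 = a" "\<tau> s2 = l" using surj[of a l] by auto
    \<comment> \<open>The analogue of an S-polynomial: in
      \<open>D r s * Xv l - D r s2 * Xv j\<close> the common leading term \<open>X_j X_l e_a\<close>
      cancels and only the tails remain.\<close>
    define v where "v r = P a l r * Xv j - P a j r * Xv l" for r
    have vD: "v r = D r s * Xv l - D r s2 * Xv j" if "r < b" for r
      by (simp add: v_def D_def s2 a_def[symmetric] j_def[symmetric] algebra_simps)
    \<comment> \<open>All terms strictly below the cancelled one; after division by the linear
      leading terms this becomes the bound required for the new rule.\<close>
    define T where "T m a' \<longleftrightarrow> mdeg m = 2 \<and> low w W \<rho> m a' (single l 1 + single j 1) a" for m a'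
    have "\<exists>u. (\<forall>s<b'. u s \<in> polys (\<tau> s) \<and> (\<forall>m\<in>keys (u s). T (m + single (\<tau> s) 1) (\<alpha> s))) \<and>
      (\<forall>r<b. v r = (\<Sum>s<b'. D r s * u s))"
    proof (rule t.reduce)
      show "T m' a'" if "T m a" "mdeg m' = mdeg m" "low w W \<rho> m' a' m a" for m a m' a'
        using that low_trans unfolding T_def by metis
      have "(\<Sum>r<b. M i r * v r) = 0" if "i < r" for i
      proof -
        have "(\<Sum>r<b. M i r * v r) = (\<Sum>r<b. M i r * D r s) * Xv l - (\<Sum>r<b. M i r * D r s2) * Xv j"
          by (simp add: sum_distrib_right vD right_diff_distrib sum_subtractf mult.assoc)
        then show ?thesis using DK s s2 that by simp
      qed
      then show "v \<in> K" by (simp add: K_def)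
      show "v r \<in> polys n" if "r < b" for r
        using Pn aj that by (simp add: v_def)
      show "T m r" if r: "r < b" and m: "m \<in> keys (v r)" for r m
      proof -
        have "m \<in> keys (P a l r * Xv j) \<union> keys (P a j r * Xv l)"
          using m by (auto simp: v_def in_keys_iff lookup_minus)
        then consider q where "q \<in> keys (P a l r)" "m = single j 1 + q" | q where "q \<in> keys (P a j r)" "m = single l 1 + q"
          using keys_mult[of "P a l r" "Xv j"] keys_mult[of "P a j r" "Xv l"]
          by (fastforce simp: Xv_def add.commute)
        then show ?thesis
        proof cases
          case 1
          with P(2)[of a l r q] aj r low_add[of w W \<rho> q r "single l 1" a "single j 1"] show ?thesis
            by (auto simp: T_def add.commute)
        next
          case 2
          with P(2)[of a j r q] aj r low_add[of w W \<rho> q r "single j 1" a "single l 1"] show ?thesis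
            by (auto simp: T_def add.commute)
        qed
      qed
    qed
    then obtain u where u: "\<And>s. s < b' \<Longrightarrow> u s \<in> polys (\<tau> s)"
      "\<And>s m. s < b' \<Longrightarrow> m \<in> keys (u s) \<Longrightarrow> T (m + single (\<tau> s) 1) (\<alpha> s)"
      "\<And>r. r < b \<Longrightarrow> v r = (\<Sum>s<b'. D r s * u s)" by blast
    \<comment> \<open>The multiple \<open>X_j\<close> of column \<open>s2\<close> goes to the other
      side. It is admissible since \<open>j < l = \<tau> s2\<close>; the weights tie, and
      \<open>\<rho>'\<close> decides.\<close>
    define P' where "P' s' = u s' + (if s' = s2 then Xv j else 0)" for s'
    show "\<exists>P. (\<forall>a'<b'. P a' \<in> polys (\<tau> a') \<and> (\<forall>m\<in>keys (P a'). mdeg m = 1 \<and> low w W' \<rho>' m a' (single l 1) s)) \<and>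
         (\<forall>i<b. D i s * Xv l = (\<Sum>a'<b'. D i a' * P a'))"
    proof (intro exI[of _ P'] conjI allI impI ballI)
      fix s' assume s': "s' < b'"
      show "P' s' \<in> polys (\<tau> s')" using u(1)[OF s'] s2 aj by (auto simp: P'_def)
      fix m assume "m \<in> keys (P' s')"
      then consider "m \<in> keys (u s')" | "s' = s2" "m = single j 1"
        using keys_add[of "u s'" "if s' = s2 then Xv j else 0"] by (auto simp: P'_def Xv_def split: if_splits)
      then have "mdeg m = 1 \<and> low w W' \<rho>' m s' (single l 1) s"
      proof cases
        case 1
        from u(2)[OF s' this] show ?thesis
          using low'[of m s' l s] s by (auto simp: T_def a_def j_def)
      next
        case 2
        then show ?thesis using s2 aj by (auto simp: low_def W'_def \<rho>'_def simp flip: a_def j_def)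
      qed
      then show "mdeg m = 1" "low w W' \<rho>' m s' (single l 1) s" by auto
    next
      fix r assume r: "r < b"
      have "(\<Sum>s'<b'. D r s' * P' s') = (\<Sum>s'<b'. D r s' * u s') + (\<Sum>s'<b'. if s' = s2 then D r s' * Xv j else 0)"
        unfolding sum.distrib[symmetric] by (rule sum.cong) (auto simp: P'_def algebra_simps)
      then show "D r s * Xv l = (\<Sum>s'<b'. D r s' * P' s')"
        using u(3)[OF r, symmetric] vD[OF r] s2 by simp
    qed
  qed
  moreover have "(\<forall>i<r. (\<Sum>a<b. M i a * v a) = 0) \<longleftrightarrow>
        (\<exists>u\<in>free_module n b'. \<forall>a<b. v a = (\<Sum>s<b'. D a s * u s))" if v: "v \<in> free_module n b" for v
  proof
    assume "\<forall>i<r. (\<Sum>a<b. M i a * v a) = 0"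
    then have "v \<in> K" by (simp add: K_def)
    then obtain u where u: "\<And>s. s < b' \<Longrightarrow> u s \<in> polys (\<tau> s)" "\<And>a. a < b \<Longrightarrow> v a = (\<Sum>s<b'. D a s * u s)"
      using t.reduce[of "\<lambda>_ _. True" v] v by (auto simp: free_module_def)
    define u' where "u' s = (if s < b' then u s else 0)" for s
    have "u' \<in> free_module n b'"
      using polys_mono[OF u(1) at(3)] by (auto simp: u'_def free_module_def)
    then show "\<exists>u\<in>free_module n b'. \<forall>a<b. v a = (\<Sum>s<b'. D a s * u s)"
      using u(2) by (intro bexI[of _ u']) (auto simp: u'_def)
  next
    assume "\<exists>u\<in>free_module n b'. \<forall>a<b. v a = (\<Sum>s<b'. D a s * u s)"
    then obtain u where u: "u \<in> free_module n b'" "\<And>a. a < b \<Longrightarrow> v a = (\<Sum>s<b'. D a s * u s)" by auto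
    then have "v \<in> K" using t.K_cong[OF t.K_D[of u], of v] by (auto simp: free_module_def)
    then show "\<forall>i<r. (\<Sum>a<b. M i a * v a) = 0" by (simp add: K_def)
  qed
  ultimately show ?thesis using Dforms by blast
qed

text \<open>The one-row matrix \<open>M\<close> is the augmentation, and dependent choice iterates
  \<open>lin_sys_step\<close>; every state carries its number of rows so that consecutive matrices
  fit. Linear entries raise the shift by one and have no constant term, which gives
  minimality.\<close>

lemma linear_syzygies_if_lin_sys:
  fixes M :: "nat \<Rightarrow> nat \<Rightarrow> 'k::field mpol"
  assumes sys: "lin_sys n w 1 b c W \<rho> M" and M: "\<And>a. a < b \<Longrightarrow> M 0 a \<in> forms n 2"
    and J: "J = {\<Sum>a<b. M 0 a * v a | v. v \<in> free_module n b}"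
  shows "linear_syzygies n J"
proof -
  define ok where "ok = (\<lambda>(r, b, c, W, \<rho>, M :: nat \<Rightarrow> nat \<Rightarrow> 'k mpol). lin_sys n w r b c W \<rho> M)"
  define nxt where "nxt = (\<lambda>(r, b, c :: nat \<Rightarrow> nat, W :: nat \<Rightarrow> nat, \<rho> :: nat \<Rightarrow> nat, M :: nat \<Rightarrow> nat \<Rightarrow> 'k mpol) (r', b', c' :: nat \<Rightarrow> nat, W' :: nat \<Rightarrow> nat, \<rho>' :: nat \<Rightarrow> nat, D).
     r' = b \<and> (\<forall>a<b. \<forall>s<b'. D a s \<in> forms n 1) \<and>
     (\<forall>v\<in>free_module n b. (\<forall>i<r. (\<Sum>a<b. M i a * v a) = 0) \<longleftrightarrow>
        (\<exists>u\<in>free_module n b'. \<forall>a<b. v a = (\<Sum>s<b'. D a s * u s))))"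
  have "\<exists>S. \<forall>i. (ok (S i) \<and> (i = 0 \<longrightarrow> S i = (1, b, c, W, \<rho>, M))) \<and> nxt (S i) (S (Suc i))"
  proof (rule dependent_nat_choice)
    show "\<exists>x. ok x \<and> (0 = 0 \<longrightarrow> x = (1, b, c, W, \<rho>, M))" using sys by (simp add: ok_def)
  next
    fix x :: "nat \<times> nat \<times> (nat \<Rightarrow> nat) \<times> (nat \<Rightarrow> nat) \<times> (nat \<Rightarrow> nat) \<times> (nat \<Rightarrow> nat \<Rightarrow> 'k mpol)" and i :: nat
    assume x: "ok x \<and> (i = 0 \<longrightarrow> x = (1, b, c, W, \<rho>, M))"
    obtain r1 b1 c1 W1 \<rho>1 M1 where xe: "x = (r1, b1, c1, W1, \<rho>1, M1)" by (metis prod.exhaust)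
    from lin_sys_step[of n w r1 b1 c1 W1 \<rho>1 M1] x xe obtain b' c' W' \<rho>' D where
      "lin_sys n w b1 b' c' W' \<rho>' D" "\<forall>a<b1. \<forall>s<b'. D a s \<in> forms n 1"
      "\<forall>v\<in>free_module n b1. (\<forall>i<r1. (\<Sum>a<b1. M1 i a * v a) = 0) \<longleftrightarrow>
        (\<exists>u\<in>free_module n b'. \<forall>a<b1. v a = (\<Sum>s<b'. D a s * u s))"
      by (auto simp: ok_def)
    then show "\<exists>y. (ok y \<and> (Suc i = 0 \<longrightarrow> y = (1, b, c, W, \<rho>, M))) \<and> nxt x y"
      by (intro exI[of _ "(b1, b', c', W', \<rho>', D)"]) (auto simp: ok_def nxt_def xe)
  qed
  then obtain S where S: "S 0 = (1, b, c, W, \<rho>, M)" "\<And>i. nxt (S i) (S (Suc i))" by blast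
  define rr where "rr i = fst (S i)" for i
  define bb where "bb i = fst (snd (S i))" for i
  define MM where "MM i = snd (snd (snd (snd (snd (S i)))))" for i
  have S0: "rr 0 = 1" "bb 0 = b" "MM 0 = M" using S(1) by (auto simp: rr_def bb_def MM_def)
  have nx: "rr (Suc i) = bb i" "\<And>a s. a < bb i \<Longrightarrow> s < bb (Suc i) \<Longrightarrow> MM (Suc i) a s \<in> forms n 1"
    "\<And>v. v \<in> free_module n (bb i) \<Longrightarrow> (\<forall>j<rr i. (\<Sum>a<bb i. MM i j a * v a) = 0) \<longleftrightarrow>
        (\<exists>u\<in>free_module n (bb (Suc i)). \<forall>a<bb i. v a = (\<Sum>s<bb (Suc i). MM (Suc i) a s * u s))" for i
    using S(2)[of i] by (auto simp: nxt_def rr_def bb_def MM_def split: prod.splits)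
  have "minimal_resolution n J bb (\<lambda>i _. i + 2) (M 0) (\<lambda>i. MM (Suc i))"
    unfolding minimal_resolution_def graded_free_resolution_def
  proof (intro conjI allI impI ballI)
    show "M 0 c \<in> forms n (0 + 2)" if "c < bb 0" for c using M[of c] that S0 by (simp add: numeral_2_eq_2)
    show "if i + 2 \<le> Suc i + 2 then MM (Suc i) a c \<in> forms n (Suc i + 2 - (i + 2)) else MM (Suc i) a c = 0"
      if "a < bb i" "c < bb (Suc i)" for i a c using nx(2)[OF that] by simp
    show "J = {\<Sum>c<bb 0. M 0 c * v c |v. v \<in> free_module n (bb 0)}" using J S0 by simp
    show "((\<Sum>c<bb 0. M 0 c * v c) = 0) = (\<exists>w\<in>free_module n (bb 1). \<forall>a<bb 0. v a = (\<Sum>c<bb 1. MM (Suc 0) a c * w c))"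
      if "v \<in> free_module n (bb 0)" for v using nx(3)[OF that] S0 by simp
    show "(\<forall>a<bb i. (\<Sum>c<bb (Suc i). MM (Suc i) a c * v c) = 0) =
       (\<exists>w\<in>free_module n (bb (Suc (Suc i))). \<forall>a<bb (Suc i). v a = (\<Sum>c<bb (Suc (Suc i)). MM (Suc (Suc i)) a c * w c))"
      if "v \<in> free_module n (bb (Suc i))" for i v using nx(3)[OF that] nx(1) by simp
    show "lookup (MM (Suc i) a c) 0 = 0" if "a < bb i" "c < bb (Suc i)" for i a c
      using nx(2)[OF that] by (auto simp: forms_def simp flip: not_in_keys_iff_lookup_eq_zero)
  qed
  then show ?thesis unfolding linear_syzygies_def by blast
qed


section \<open>Ideals of first-order neighbourhoods of a curve in a direction\<close>

abbreviation (input) pC :: "'k::field \<Rightarrow> 'k poly" where "pC c \<equiv> [:c:]"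

text \<open>Forms vanishing at \<open>x + \<epsilon> v\<close> modulo the square of
  \<open>\<epsilon>\<close>. The conditions are imposed on each homogeneous component because
  \<open>x\<close> is only an affine parametrization: a combination of forms of different degrees
  may vanish at the chosen representatives without lying in a homogeneous ideal of the
  curve.\<close>

definition jet_ideal :: "nat \<Rightarrow> (nat \<Rightarrow> 'k::field poly) \<Rightarrow> (nat \<Rightarrow> 'k poly) \<Rightarrow> 'k mpol set" where
  "jet_ideal n x v = {F \<in> polys n. \<forall>l. ins pC x (hom_comp l F) = 0 \<and> dd pC x v (hom_comp l F) = 0}"

lemma jet_ideal_add: "F \<in> jet_ideal n x v \<Longrightarrow> G \<in> jet_ideal n x v \<Longrightarrow> F + G \<in> jet_ideal n x v"
  by (simp add: jet_ideal_def hom_comp_add ins_add dd_add)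

lemma jet_ideal_zero [simp]: "0 \<in> jet_ideal n x v"
  by (simp add: jet_ideal_def)

lemma jet_ideal_diff: "F \<in> jet_ideal n x v \<Longrightarrow> G \<in> jet_ideal n x v \<Longrightarrow> F - G \<in> jet_ideal n x v"
  by (simp add: jet_ideal_def hom_comp_diff chomD[OF chom_ins] dd_diff)

lemma jet_ideal_sum: "(\<And>i. i \<in> A \<Longrightarrow> f i \<in> jet_ideal n x v) \<Longrightarrow> sum f A \<in> jet_ideal n x v"
  by (induction A rule: infinite_finite_induct) (auto intro: jet_ideal_add)

lemma jet_ideal_mult:
  assumes F: "F \<in> jet_ideal n x v" and G: "G \<in> polys n"
  shows "F * G \<in> jet_ideal n x v"
proof -
  obtain N where N: "(\<Sum>a\<le>N. hom_comp a F) = F" using sum_hom_comp by blast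
  have Fp: "F \<in> polys n" using F by (simp add: jet_ideal_def)
  have "hom_comp l (F * G) = (\<Sum>a\<le>N. if a \<le> l then hom_comp a F * hom_comp (l - a) G else 0)" for l
    by (subst N[symmetric]) (simp add: sum_distrib_right hom_comp_sum hom_comp_form_mult[OF hom_comp_in_forms[OF Fp]])
  then show ?thesis
    using F G by (auto simp: jet_ideal_def chomD(8)[OF chom_ins] dd_sum if_distrib[of "ins _ _"]
        if_distrib[of "dd _ _ _"] ins_mult dd_mult intro!: sum.neutral)
qed

lemma jet_ideal_form_iff:
  "F \<in> forms n l \<Longrightarrow> F \<in> jet_ideal n x v \<longleftrightarrow> ins pC x F = 0 \<and> dd pC x v F = 0"
  by (auto simp: jet_ideal_def hom_comp_form forms_polys)

lemma mval_pCons_zero: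
  assumes "\<And>i. i \<in> keys m \<Longrightarrow> v i = 0"
  shows "mval (\<lambda>i. [:x i, v i:]) m = [:mval x m:]"
proof -
  have "mval (\<lambda>i. [:x i, v i:]) m = (\<Prod>i\<in>keys m. [:x i:] ^ lookup m i)"
    unfolding mval_def by (rule prod.cong) (use assms in auto)
  then show ?thesis by (simp add: mval_def chomD[OF chom_pCons])
qed

lemma dd_single_zero:
  assumes e: "chom e" and "\<And>i. i \<in> keys m \<Longrightarrow> v i = 0"
  shows "dd e x v (single m c) = 0"
  using assms(2) by (simp add: dd_def ins_single[OF chom_e'[OF e]] mval_pCons_zero)

section \<open>A double rational normal curve with a linear resolution\<close>

text \<open>Coordinates: \<open>X\<^sub>0\<close> and \<open>X\<^sub>1\<close> restrict to \<open>1\<close> and \<open>z\<^sup>d\<close>, which form a system of parameters, \<open>X\<^sub>k\<close>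
  for \<open>2 \<le> k \<le> d\<close> restricts to \<open>z\<^sup>k\<^sup>-\<^sup>1\<close>, and the remaining \<open>X\<^sub>k\<close> vanish on the curve and
  have derivatives \<open>z\<^sup>k\<^sup>-\<^sup>d\<^sup>-\<^sup>1\<close>.\<close>

locale std_double =
  fixes d :: nat and field_type :: "'k::field itself"
  assumes d: "d \<ge> 1"
begin

definition n :: nat where "n = 2 * d"
definition ex :: "nat \<Rightarrow> nat" where
  "ex k = (if k = 0 then 0 else if k = 1 then d else if k \<le> d then k - 1 else k - d - 1)"
definition z :: "'k poly" where "z = [:0, 1:]"
definition xc :: "nat \<Rightarrow> 'k poly" where "xc k = (if k \<le> d then z ^ ex k else 0)"
definition vc :: "nat \<Rightarrow> 'k poly" where "vc k = (if k \<le> d then 0 else z ^ ex k)"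
text \<open>The weight counts the variables other than the two parameters; the terms of weight at
  most 1 are those of the free module with basis 1 and \<open>X_2, ..., X_n\<close> over
  \<open>k[X_0, X_1]\<close>.\<close>

definition w :: "nat \<Rightarrow> nat" where "w k = (if k \<le> 1 then 0 else 1)"

abbreviation "J \<equiv> jet_ideal n xc vc"

lemma z_power: "z ^ e = monom 1 e"
  by (simp add: z_def monom_altdef)

text \<open>The multiplication table of the coordinate ring: exponents of \<open>z\<close> add, a
  sum below \<open>d\<close> is taken up by \<open>X_0\<close> (exponent 0) times another
  coordinate, and from a larger sum \<open>X_1\<close> removes \<open>d\<close>. The sum
  \<open>d\<close> among coordinates not vanishing on the curve gives \<open>X_0 X_1\<close>. Two
  coordinates vanishing on the curve have product zero to first order.\<close>

lemma Xv_Xv_normal: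
  assumes "2 \<le> i" "i \<le> j" "j \<le> n"
  shows "\<exists>N \<in> forms n 2. (\<forall>m\<in>keys N. wdeg w m \<le> 1) \<and> Xv i * Xv j - N \<in> J"
proof -
  have XX: "Xv a * Xv b \<in> forms n 2" if "a \<le> n" "b \<le> n" for a b
    using that by (intro forms_mult'[of _ n 1 _ 1]) auto
  have ok: ?thesis if ab: "a \<le> 1" "b \<le> n" and
      e: "xc i * xc j = xc a * xc b" "xc i * vc j + vc i * xc j = xc a * vc b + vc a * xc b" for a b
  proof (intro bexI[of _ "Xv a * Xv b"] conjI ballI)
    have "a \<le> n" using ab d by (auto simp: n_def)
    show N: "Xv a * Xv b \<in> forms n 2" using XX \<open>a \<le> n\<close> ab by blast
    show "wdeg w m \<le> 1" if "m \<in> keys (Xv a * Xv b :: 'k mpol)" for m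
      using that ab by (auto simp: Xv_def mult_single wdeg_add w_def)
    show "Xv i * Xv j - Xv a * Xv b \<in> J"
    proof (subst jet_ideal_form_iff)
      show "Xv i * Xv j - Xv a * Xv b \<in> forms n 2"
        using assms \<open>a \<le> n\<close> ab by (intro forms_diff XX) auto
    qed (use e in \<open>simp add: chomD[OF chom_ins] ins_Xv dd_diff dd_mult\<close>)
  qed
  have zz: "z ^ a * z ^ b = z ^ (a + b)" for a b by (simp add: power_add)
  consider "i > d" | "j \<le> d" "i - 1 + (j - 1) < d" | "j \<le> d" "i - 1 + (j - 1) = d" | "j \<le> d" "i - 1 + (j - 1) > d"
    | "i \<le> d" "j > d" "i - 1 + (j - d - 1) < d" | "i \<le> d" "j > d" "i - 1 + (j - d - 1) \<ge> d"
    by linarith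
  then show ?thesis
  proof cases
    case 1
    then have "Xv i * Xv j \<in> J" using assms
      by (subst jet_ideal_form_iff[OF XX]) (auto simp: ins_mult ins_Xv dd_mult xc_def)
    then show ?thesis by (intro bexI[of _ 0]) auto
  next
    case 2
    show ?thesis
      by (rule ok[of 0 "i - 1 + (j - 1) + 1"]) (use 2 assms in \<open>auto simp: n_def xc_def vc_def ex_def simp flip: power_add\<close>)
  next
    case 3
    show ?thesis
      by (rule ok[of 0 1]) (use 3 assms d in \<open>auto simp: n_def xc_def vc_def ex_def simp flip: power_add\<close>)
  next
    case 4
    show ?thesis
      by (rule ok[of 1 "i - 1 + (j - 1) - d + 1"]) (use 4 assms d in \<open>auto simp: numeral_2_eq_2 n_def xc_def vc_def ex_def simp flip: power_add\<close>)
  next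
    case 5
    show ?thesis
      by (rule ok[of 0 "d + 1 + (i - 1 + (j - d - 1))"]) (use 5 assms d in \<open>auto simp: n_def xc_def vc_def ex_def simp flip: power_add\<close>)
  next
    case 6
    show ?thesis
      by (rule ok[of 1 "d + 1 + (i - 1 + (j - d - 1) - d)"]) (use 6 assms d in \<open>auto simp: n_def xc_def vc_def ex_def simp flip: power_add\<close>)
  qed
qed

lemma wdeg_0D:
  assumes "wdeg w m = 0" shows "m = single 0 (lookup m 0) + single 1 (lookup m 1)"
proof (rule poly_mapping_eqI)
  fix k
  have "lookup m k = 0" if "k \<ge> 2"
  proof (cases "k \<in> keys m")
    case True
    with assms have "lookup m k * w k = 0" by (simp add: wdeg_def)
    with that show ?thesis by (simp add: w_def)
  qed (simp add: in_keys_iff)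
  then show "lookup m k = lookup (single 0 (lookup m 0) + single 1 (lookup m 1)) k"
    by (cases "k = 0 \<or> k = 1") (auto simp: lookup_add lookup_single when_def)
qed

lemma wdeg_posD: assumes "wdeg w m > 0" shows "\<exists>k\<in>keys m. k \<ge> 2"
proof (rule ccontr)
  assume "\<not> ?thesis"
  then have "wdeg w m = 0" unfolding wdeg_def by (intro sum.neutral) (auto simp: w_def)
  with assms show False by simp
qed

lemma normal_cases:
  assumes "wdeg w m \<le> 1" "keys m \<subseteq> {..n}"
  obtains a b where "m = single 0 a + single 1 b"
  | k a b where "2 \<le> k" "k \<le> n" "m = single k 1 + (single 0 a + single 1 b)"
proof (cases "wdeg w m = 0")
  case True
  with wdeg_0D that(1) show ?thesis by blast
next
  case False
  then obtain k where k: "k \<in> keys m" "k \<ge> 2" using wdeg_posD by auto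
  then obtain m' where m': "m = single k 1 + m'" by (metis keys_monom_split)
  then have "wdeg w m' = 0" using assms k by (auto simp: wdeg_add w_def)
  from wdeg_0D[OF this] m' have "m = single k 1 + (single 0 (lookup m' 0) + single 1 (lookup m' 1))" by metis
  moreover have "k \<le> n" using k assms(2) by auto
  ultimately show ?thesis using that(2) k(2) by metis
qed

definition ytype :: "(nat \<Rightarrow>\<^sub>0 nat) \<Rightarrow> bool" where "ytype m \<longleftrightarrow> (\<exists>k\<in>keys m. k > d)"

text \<open>A normal term has at most one factor outside \<open>X_0\<close> and \<open>X_1\<close>,
  so at most one factor vanishes on the curve. Without such a factor the expansion is a power of
  \<open>z\<close> without \<open>\<epsilon>\<close>-part; with one it is pure
  \<open>\<epsilon>\<close>-part.\<close>

lemma eval_normal: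
  assumes "wdeg w m \<le> 1" "keys m \<subseteq> {..n}"
  shows "ins pC xc (single m c) = (if ytype m then 0 else monom c (wdeg ex m))"
    and "dd pC xc vc (single m c) = (if ytype m then monom c (wdeg ex m) else 0)"
proof -
  have x: "mval xc m = monom 1 (wdeg ex m)" if "\<not> ytype m" for m
  proof -
    have "mval xc m = (\<Prod>i\<in>keys m. z ^ (lookup m i * ex i))"
      unfolding mval_def by (rule prod.cong) (use that in \<open>auto simp: xc_def ytype_def mult.commute simp flip: power_mult\<close>)
    then show ?thesis by (simp add: wdeg_def power_sum z_power[symmetric])
  qed
  show "ins pC xc (single m c) = (if ytype m then 0 else monom c (wdeg ex m))"
  proof (cases "ytype m")
    case True
    then obtain k where "k \<in> keys m" "k > d" by (auto simp: ytype_def)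
    then have "mval xc m = 0"
      unfolding mval_def by (intro prod_zero bexI[of _ k]) (auto simp: xc_def in_keys_iff)
    then show ?thesis using True by (simp add: ins_single)
  qed (simp add: ins_single x smult_monom)
  show "dd pC xc vc (single m c) = (if ytype m then monom c (wdeg ex m) else 0)"
  proof (cases "ytype m")
    case True
    from assms show ?thesis
    proof (cases rule: normal_cases)
      case (1 a b)
      with True d show ?thesis by (auto simp: ytype_def keys_monom_add split: if_splits)
    next
      case (2 k a b)
      let ?m = "single 0 a + single 1 b"
      have k: "k > d" using True 2 d by (auto simp: ytype_def keys_monom_add split: if_splits)
      have nm: "\<not> ytype ?m" using d by (auto simp: ytype_def keys_monom_add split: if_splits)
      have "dd pC xc vc (single ?m c) = 0"
        using d by (intro dd_single_zero) (auto simp: vc_def keys_monom_add split: if_splits)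
      then have "dd pC xc vc (single m c) = vc k * ins pC xc (single ?m c)"
        using 2 by (simp add: single_Xv_mult dd_mult del: One_nat_def)
      also have "\<dots> = monom c (ex k + wdeg ex ?m)"
        using k nm by (simp add: ins_single x vc_def z_power smult_monom mult_monom)
      finally show ?thesis using True 2 by (simp add: wdeg_add)
    qed
  next
    case False
    then show ?thesis by (auto simp: ytype_def vc_def intro!: dd_single_zero)
  qed
qed

text \<open>The exponent of \<open>z\<close> is \<open>b * d + ex k\<close> with
  \<open>ex k < d\<close>, so division by \<open>d\<close> recovers the power of \<open>X_1\<close>
  and the extra variable; the degree then gives the power of \<open>X_0\<close>. Terms without extra
  variable are told apart because \<open>ex k > 0\<close> for
  \<open>2 \<le> k \<le> d\<close>.\<close>

lemma normal_inj:
  assumes "wdeg w m \<le> 1" "keys m \<subseteq> {..n}" "wdeg w m' \<le> 1" "keys m' \<subseteq> {..n}"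
    and "mdeg m = mdeg m'" "ytype m = ytype m'" "wdeg ex m = wdeg ex m'"
  shows "m = m'"
proof -
  have ex0: "ex 0 = 0" "ex 1 = d" "ex (Suc 0) = d" by (auto simp: ex_def)
  have div: "b = b' \<and> e = e'" if "b * d + e = b' * d + e'" "e < d" "e' < d" for b b' e e' :: nat
  proof -
    show ?thesis
      using arg_cong[OF that(1), of "\<lambda>x. x div d"] arg_cong[OF that(1), of "\<lambda>x. x mod d"] that(2,3) by simp
  qed
  have exk: "ex k < d" "k \<le> d \<Longrightarrow> ex k > 0" if "2 \<le> k" "k \<le> n" for k
    using that d by (auto simp: ex_def n_def)
  have exinj: "k = k'" if "2 \<le> k" "k \<le> n" "2 \<le> k'" "k' \<le> n" "(k > d) = (k' > d)" "ex k = ex k'" for k k'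
    using that by (auto simp: ex_def split: if_splits)
  have yk: "ytype (single k 1 + (single 0 a + single 1 b)) \<longleftrightarrow> k > d" for k a b
    using d by (auto simp: ytype_def keys_monom_add split: if_splits)
  have y0: "\<not> ytype (single 0 a + single 1 b)" for a b
    using d by (auto simp: ytype_def keys_monom_add split: if_splits)
  from assms(1,2) show ?thesis
  proof (cases rule: normal_cases)
    case m: (1 a b)
    from assms(3,4) show ?thesis
    proof (cases rule: normal_cases)
      case (1 a' b')
      with m assms(5,7) d show ?thesis by (simp add: wdeg_add ex0)
    next
      case (2 k a' b')
      then have "b * d + 0 = b' * d + ex k" "k \<le> d" using m assms(6,7) yk y0 by (auto simp: wdeg_add ex0)
      then show ?thesis using div[of b 0 b' "ex k"] exk[of k] 2 d by auto
    qed
  next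
    case m: (2 k a b)
    from assms(3,4) show ?thesis
    proof (cases rule: normal_cases)
      case (1 a' b')
      then have "b' * d + 0 = b * d + ex k" "k \<le> d" using m assms(6,7) yk y0 by (auto simp: wdeg_add ex0)
      then show ?thesis using div[of b' 0 b "ex k"] exk[of k] m d by auto
    next
      case (2 k' a' b')
      then have e: "b * d + ex k = b' * d + ex k'" and kk: "(k > d) = (k' > d)"
        using m assms(6,7) yk by (auto simp: wdeg_add ex0)
      have "b = b' \<and> ex k = ex k'" using div[OF e] exk m 2 by blast
      moreover from this have "k = k'" using exinj kk m 2 by blast
      ultimately show ?thesis using assms(5) m 2 by simp
    qed
  qed
qed

text \<open>Normal terms of equal degree contribute distinct powers of \<open>z\<close>, either to
  the value or to the derivative, so nothing can cancel.\<close>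

lemma normal_J_zero:
  assumes F: "F \<in> J" "\<And>m. m \<in> keys F \<Longrightarrow> wdeg w m \<le> 1"
  shows "F = 0"
proof (rule ccontr)
  assume "F \<noteq> 0"
  then obtain m0 where m0: "m0 \<in> keys F" by (metis all_not_in_conv keys_eq_empty)
  define G where "G = hom_comp (mdeg m0) F"
  have kG: "keys G = {m \<in> keys F. mdeg m = mdeg m0}" by (simp add: G_def keys_hom_comp)
  have G: "ins pC xc G = 0" "dd pC xc vc G = 0" using F by (auto simp: jet_ideal_def G_def)
  have nm: "wdeg w m \<le> 1" "keys m \<subseteq> {..n}" if "m \<in> keys G" for m
    using F that kG by (auto simp: jet_ideal_def polys_def)
  have m0G: "m0 \<in> keys G" using m0 kG by auto
  have inj: "m = m0" if "m \<in> keys G" "ytype m = ytype m0" "wdeg ex m = wdeg ex m0" for m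
    using normal_inj[OF nm[OF that(1)] nm[OF m0G]] that kG by auto
  have s: "(\<Sum>m\<in>keys G. if ytype m = ytype m0 \<and> wdeg ex m = wdeg ex m0 then lookup G m else 0) = lookup G m0"
  proof -
    have "(\<Sum>m\<in>keys G. if ytype m = ytype m0 \<and> wdeg ex m = wdeg ex m0 then lookup G m else 0)
      = (\<Sum>m\<in>keys G. if m = m0 then lookup G m0 else 0)"
      by (rule sum.cong) (use inj in auto)
    then show ?thesis using m0G by simp
  qed
  have cf: "(\<Sum>m\<in>keys G. if Q m \<and> wdeg ex m = wdeg ex m0 then lookup G m else 0) =
      coeff (\<Sum>m\<in>keys G. if Q m then monom (lookup G m) (wdeg ex m) else 0) (wdeg ex m0)" for Q
    unfolding coeff_sum by (rule sum.cong) auto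
  have "ins pC xc G = (\<Sum>m\<in>keys G. if \<not> ytype m then monom (lookup G m) (wdeg ex m) else 0)"
    by (subst mpol_sum_singles[symmetric]) (use nm in \<open>auto simp: chomD(8)[OF chom_ins] eval_normal intro!: sum.cong\<close>)
  then have 1: "(\<Sum>m\<in>keys G. if \<not> ytype m \<and> wdeg ex m = wdeg ex m0 then lookup G m else 0) = 0"
    using G(1) by (simp add: cf)
  have "dd pC xc vc G = (\<Sum>m\<in>keys G. if ytype m then monom (lookup G m) (wdeg ex m) else 0)"
    by (subst mpol_sum_singles[symmetric]) (use nm in \<open>auto simp: dd_sum eval_normal intro!: sum.cong\<close>)
  then have 2: "(\<Sum>m\<in>keys G. if ytype m \<and> wdeg ex m = wdeg ex m0 then lookup G m else 0) = 0"
    using G(2) by (simp add: cf)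
  from 1 2 s have "lookup G m0 = 0" by (cases "ytype m0") auto
  with m0G show False by (simp add: in_keys_iff)
qed

definition I :: "(nat \<times> nat) set" where "I = {(i, j). 2 \<le> i \<and> i \<le> j \<and> j \<le> n}"
definition b :: nat where "b = card I"
definition f :: "nat \<Rightarrow> nat \<times> nat" where "f = (SOME f. bij_betw f {..<b} I)"
definition \<alpha> :: "nat \<Rightarrow> nat" where "\<alpha> s = fst (f s)"
definition \<tau> :: "nat \<Rightarrow> nat" where "\<tau> s = snd (f s)"
definition N :: "nat \<Rightarrow> 'k mpol" where
  "N s = (SOME N. N \<in> forms n 2 \<and> (\<forall>m\<in>keys N. wdeg w m \<le> 1) \<and> Xv (\<alpha> s) * Xv (\<tau> s) - N \<in> J)"
definition h :: "nat \<Rightarrow> 'k mpol" where "h s = Xv (\<alpha> s) * Xv (\<tau> s) - N s"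

lemma f_bij: "bij_betw f {..<b} I"
proof -
  have "I \<subseteq> {..n} \<times> {..n}" by (auto simp: I_def)
  then have "finite I" by (rule finite_subset) auto
  then have "\<exists>f. bij_betw f {..<b} I" unfolding b_def using ex_bij_betw_nat_finite[of I] by (auto simp: atLeast0LessThan)
  then show ?thesis unfolding f_def by (rule someI_ex)
qed

lemma at: "s < b \<Longrightarrow> 2 \<le> \<alpha> s" "s < b \<Longrightarrow> \<alpha> s \<le> \<tau> s" "s < b \<Longrightarrow> \<tau> s \<le> n"
  using bij_betwE[OF f_bij] by (force simp: I_def \<alpha>_def \<tau>_def)+

lemma at_inj: "s < b \<Longrightarrow> s' < b \<Longrightarrow> \<alpha> s = \<alpha> s' \<Longrightarrow> \<tau> s = \<tau> s' \<Longrightarrow> s = s'"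
  using f_bij unfolding bij_betw_def inj_on_def by (auto simp: \<alpha>_def \<tau>_def prod_eq_iff)

lemma at_surj: assumes "2 \<le> i" "i \<le> j" "j \<le> n" shows "\<exists>s<b. \<alpha> s = i \<and> \<tau> s = j"
proof -
  have "(i, j) \<in> f ` {..<b}" using f_bij assms unfolding bij_betw_def by (auto simp: I_def)
  then obtain s where "s < b" "f s = (i, j)" by auto
  then show ?thesis by (intro exI[of _ s]) (simp add: \<alpha>_def \<tau>_def)
qed

lemma N: assumes "s < b"
  shows "N s \<in> forms n 2" "m \<in> keys (N s) \<Longrightarrow> wdeg w m \<le> 1" "h s \<in> J"
proof -
  have "\<exists>N. N \<in> forms n 2 \<and> (\<forall>m\<in>keys N. wdeg w m \<le> 1) \<and> Xv (\<alpha> s) * Xv (\<tau> s) - N \<in> J"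
    using Xv_Xv_normal[OF at[OF assms]] by blast
  from someI_ex[OF this, folded N_def] show "N s \<in> forms n 2" "m \<in> keys (N s) \<Longrightarrow> wdeg w m \<le> 1" "h s \<in> J"
    by (auto simp: h_def)
qed

lemma h_forms: "s < b \<Longrightarrow> h s \<in> forms n 2"
  unfolding h_def using N(1)[of s] at[of s] by (intro forms_diff forms_mult'[of _ n 1 _ 1] forms_Xv) auto

text \<open>The basis of Pommaret type: \<open>X_i X_j\<close> with \<open>i \<le> j\<close> may be
  multiplied by the variables up to \<open>i\<close>, the smaller index.\<close>

sublocale t: triangular n 1 w "\<lambda>_. 0" "\<lambda>_. 0" b "\<lambda>s. single (\<alpha> s) 1 + single (\<tau> s) 1" "\<lambda>_. 0" \<alpha>
  "\<lambda>_. h" "{v. v 0 \<in> J}" "\<lambda>m _. wdeg w m \<le> 1"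
proof
  fix s assume s: "s < b"
  let ?ld = "single (\<alpha> s) (1::nat) + single (\<tau> s) 1"
  have hs: "h s = single ?ld 1 - N s" by (simp add: h_def Xv_def mult_single)
  have wld: "wdeg w ?ld = 2" using at[OF s] by (simp add: wdeg_add w_def)
  show "0 < (1::nat)" by simp
  show "keys ?ld \<subseteq> {..n}" "\<alpha> s \<le> n"
    using at[OF s] by (auto simp: keys_monom_add)
  have "?ld \<notin> keys (N s)" using N(2)[OF s, of ?ld] wld by auto
  then show "lookup (h s) ?ld = 1" by (simp add: hs lookup_minus in_keys_iff)
  fix a :: nat and m assume a: "a < 1" and m: "m \<in> keys (h s)"
  have "keys m \<subseteq> {..n} \<and> mdeg m = 2" using h_forms[OF s] m by (auto simp: forms_def polys_def)
  moreover have "m = ?ld \<or> m \<in> keys (N s)"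
    using m by (auto simp: hs in_keys_iff lookup_minus lookup_single when_def)
  ultimately show "keys m \<subseteq> {..n} \<and> mdeg m = mdeg ?ld \<and>
        (m = ?ld \<and> a = 0 \<or> low w (\<lambda>_. 0) (\<lambda>_. 0) m a ?ld 0)"
    using a N(2)[OF s] wld by (fastforce simp: low_def)
next
  fix a :: nat and m :: "nat \<Rightarrow>\<^sub>0 nat" assume a: "a < 1" "keys m \<subseteq> {..n}" "\<not> wdeg w m \<le> 1"
  \<comment> \<open>Used twice: the largest variable of \<open>m\<close> is \<open>j\<close>, that
    of the cofactor is \<open>i\<close>. Positive weight guarantees that both indices are at least
    2.\<close>
  have *: "\<exists>j m'. j \<ge> 2 \<and> j \<in> keys m \<and> m = m' + single j 1 \<and> keys m \<subseteq> {..j}" if "wdeg w m > 0" for m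
  proof -
    obtain k where k: "k \<in> keys m" "k \<ge> 2" using wdeg_posD[OF \<open>wdeg w m > 0\<close>] by auto
    define j where "j = Max (keys m)"
    have j: "j \<in> keys m" "\<And>i. i \<in> keys m \<Longrightarrow> i \<le> j" using k by (auto simp: j_def intro: Max_in)
    obtain m' where "m = single j 1 + m'" using keys_monom_split[OF j(1)] by metis
    moreover have "2 \<le> j" using k j(2)[OF k(1)] by simp
    ultimately show ?thesis using j by (intro exI[of _ j] exI[of _ m']) (auto simp: add.commute)
  qed
  obtain j m' where j: "j \<ge> 2" "j \<in> keys m" "m = m' + single j 1" "keys m \<subseteq> {..j}" using *[of m] a by auto
  then have "wdeg w m' > 0" using a by (auto simp: wdeg_add w_def)
  then obtain i \<mu> where i: "i \<ge> 2" "i \<in> keys m'" "m' = \<mu> + single i 1" "keys m' \<subseteq> {..i}" using *[of m'] by auto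
  have ij: "i \<le> j" "j \<le> n" using i j a by (auto simp: keys_monom_add)
  then obtain s where "s < b" "\<alpha> s = i" "\<tau> s = j" using at_surj i by blast
  then show "\<exists>s<b. \<exists>\<mu>. keys \<mu> \<subseteq> {..\<alpha> s} \<and> m = \<mu> + (single (\<alpha> s) 1 + single (\<tau> s) 1) \<and> a = 0"
    using i j a by (intro exI[of _ s] conjI exI[of _ \<mu>]) (auto simp: keys_monom_add add.assoc)
next
  fix s s' and \<mu> \<mu>' :: "nat \<Rightarrow>\<^sub>0 nat"
  assume *: "s < b" "s' < b" "keys \<mu> \<subseteq> {..\<alpha> s}" "keys \<mu>' \<subseteq> {..\<alpha> s'}"
    "\<mu> + (single (\<alpha> s) 1 + single (\<tau> s) 1) = \<mu>' + (single (\<alpha> s') 1 + single (\<tau> s') 1)"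
  have mx: "Max (keys (\<mu> + single t 1)) = t" if "keys \<mu> \<subseteq> {..t}" for \<mu> :: "nat \<Rightarrow>\<^sub>0 nat" and t
    by (rule Max_eqI) (use that in \<open>auto simp: keys_monom_add\<close>)
  have "keys (\<mu> + single (\<alpha> s) 1) \<subseteq> {..\<tau> s}" "keys (\<mu>' + single (\<alpha> s') 1) \<subseteq> {..\<tau> s'}"
    using * at by (auto simp: keys_monom_add intro: le_trans)
  from mx[OF this(1)] mx[OF this(2)] have t: "\<tau> s = \<tau> s'" using *(5) by (simp add: add.assoc)
  with *(5) have "\<mu> + single (\<alpha> s) 1 = \<mu>' + single (\<alpha> s') 1" by (simp flip: add.assoc)
  with mx[OF *(3)] mx[OF *(4)] have "\<alpha> s = \<alpha> s'" by simp
  with t * show "s = s'" using at_inj by blast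
next
  show "(\<lambda>a. v a - v' a) \<in> {v. v 0 \<in> J}" if "v \<in> {v. v 0 \<in> J}" "v' \<in> {v. v 0 \<in> J}" for v v' :: "nat \<Rightarrow> 'k mpol"
    using that by (auto intro: jet_ideal_diff)
  show "v' \<in> {v. v 0 \<in> J}" if "v \<in> {v. v 0 \<in> J}" "\<And>a. a < 1 \<Longrightarrow> v a = v' a" for v v' :: "nat \<Rightarrow> 'k mpol"
    using that(1) that(2)[of 0] by simp
  show "(\<lambda>a. \<Sum>s<b. h s * u s) \<in> {v. v 0 \<in> J}" if "\<And>s. s < b \<Longrightarrow> u s \<in> polys n" for u
    using that N(3) by (auto intro!: jet_ideal_sum jet_ideal_mult)
  show "v a = 0" if "v \<in> {v. v 0 \<in> J}" "\<And>a. a < 1 \<Longrightarrow> v a \<in> polys n \<and> (\<forall>m\<in>keys (v a). wdeg w m \<le> 1)" "a < 1"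
    for v and a :: nat
    using that normal_J_zero[of "v 0"] by auto
qed

lemma J_eq: "J = {\<Sum>s<b. h s * v s | v. v \<in> free_module n b}"
proof (intro equalityI subsetI)
  fix F assume F: "F \<in> J"
  have "\<exists>u. (\<forall>s<b. u s \<in> polys (\<alpha> s) \<and> (\<forall>m\<in>keys (u s). True)) \<and> (\<forall>a<1::nat. F = (\<Sum>s<b. h s * u s))"
    by (rule t.reduce[of "\<lambda>_ _. True" "\<lambda>_. F"]) (use F in \<open>auto simp: jet_ideal_def\<close>)
  then obtain u where u: "\<And>s. s < b \<Longrightarrow> u s \<in> polys (\<alpha> s)" "F = (\<Sum>s<b. h s * u s)" by auto
  have "(\<lambda>s. if s < b then u s else 0) \<in> free_module n b"
    using polys_mono[OF u(1) order_trans[OF at(2,3)]] by (auto simp: free_module_def)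
  then show "F \<in> {\<Sum>s<b. h s * v s | v. v \<in> free_module n b}"
    using u(2) by (intro CollectI exI[of _ "\<lambda>s. if s < b then u s else 0"]) auto
next
  fix F assume "F \<in> {\<Sum>s<b. h s * v s | v. v \<in> free_module n b}"
  then show "F \<in> J" using t.K_D by (auto simp: free_module_def)
qed

text \<open>It remains to rewrite \<open>h s\<close> times a variable beyond
  \<open>\<alpha> s\<close>, the first rule of the iteration. The constant 2 is the weight of every
  leading term \<open>X_i X_j\<close>.\<close>

theorem linear_syzygies_J: "linear_syzygies n J"
proof (rule linear_syzygies_if_lin_sys)
  define \<rho> where "\<rho> s = \<alpha> s * (n + 1) + \<tau> s" for s
  show "lin_sys n w 1 b \<alpha> (\<lambda>_. 2) \<rho> (\<lambda>_. h)"
    unfolding lin_sys_def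
  proof (intro conjI allI impI)
    show "\<alpha> s \<le> n" if "s < b" for s using at[OF that] by simp
    show "h s \<in> polys n" if "s < b" for s using h_forms[OF that] by (rule forms_polys)
    show "u s = 0" if "(\<forall>a<b. u a \<in> polys (\<alpha> a)) \<and> (\<forall>i<1::nat. (\<Sum>a<b. h a * u a) = 0)" "s < b" for u s
      by (rule t.indep) (use that in auto)
  next
    fix s k assume s: "s < b" and k: "\<alpha> s < k \<and> k \<le> n"
    define i j where "i = \<alpha> s" and "j = \<tau> s"
    have ij: "2 \<le> i" "i \<le> j" "j \<le> n" "i < k" "k \<le> n" using at[OF s] k by (auto simp: i_def j_def)
    \<comment> \<open>The leading term \<open>X_i X_j X_k\<close> of \<open>h s * Xv k\<close> is
      obtained a second time by multiplying with its smallest variable \<open>X_i\<close>, which is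
      allowed for the pair formed by \<open>j\<close> and \<open>k\<close>.\<close>
    then obtain s2 where s2: "s2 < b" "\<alpha> s2 = min j k" "\<tau> s2 = max j k"
      using at_surj[of "min j k" "max j k"] by fastforce
    define v where "v = h s * Xv k - h s2 * Xv i"
    have XX: "Xv (min j k) * Xv (max j k) = (Xv j * Xv k :: 'k mpol)" by (auto simp: min_def max_def mult.commute)
    have v: "v = N s2 * Xv i - N s * Xv k"
      by (simp add: v_def h_def s2 XX flip: i_def j_def) (simp add: algebra_simps)
    \<comment> \<open>Dividing a term of degree 3 and weight at most 2 by a leading term of weight 2
      leaves \<open>X_0\<close> or \<open>X_1\<close>, which is below \<open>X_k\<close> because
      \<open>w k = 1\<close>.\<close>
    define T :: "(nat \<Rightarrow>\<^sub>0 nat) \<Rightarrow> nat \<Rightarrow> bool" where "T m a \<longleftrightarrow> mdeg m = 3 \<and> wdeg w m \<le> 2" for m a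
    have "\<exists>u. (\<forall>s<b. u s \<in> polys (\<alpha> s) \<and> (\<forall>m\<in>keys (u s). T (m + (single (\<alpha> s) 1 + single (\<tau> s) 1)) 0)) \<and>
      (\<forall>r<1::nat. v = (\<Sum>s<b. h s * u s))"
    proof (rule t.reduce[of T "\<lambda>_. v"])
      show "T m' a'" if "T m a" "mdeg m' = mdeg m" "low w (\<lambda>_. 0) (\<lambda>_. 0) m' a' m a" for m a m' a'
        using that by (auto simp: low_def T_def)
      show "(\<lambda>_. v) \<in> {v. v 0 \<in> J}"
        using N(3)[OF s] N(3)[OF s2(1)] ij by (auto simp: v_def intro!: jet_ideal_diff jet_ideal_mult)
      show "v \<in> polys n" using N(1)[OF s] N(1)[OF s2(1)] ij by (auto simp: v forms_def)
      show "T m r" if m: "m \<in> keys v" for r m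
      proof -
        have "m \<in> keys (N s2 * Xv i) \<union> keys (N s * Xv k)"
          using m by (auto simp: v in_keys_iff lookup_minus)
        then obtain q t t' where q: "t' \<in> {s, s2}" "t \<in> {i, k}" "q \<in> keys (N t')" "m = q + single t 1"
          using keys_mult[of "N s2" "Xv i"] keys_mult[of "N s" "Xv k"] by (fastforce simp: Xv_def)
        have "wdeg w q \<le> 1" "mdeg q = 2" using q N[of t'] s s2(1) by (auto simp: forms_def)
        moreover have "w t \<le> 1" by (simp add: w_def)
        ultimately show ?thesis using q by (simp add: T_def wdeg_add)
      qed
    qed
    then obtain u where u: "\<And>s. s < b \<Longrightarrow> u s \<in> polys (\<alpha> s)"
      "\<And>s m. s < b \<Longrightarrow> m \<in> keys (u s) \<Longrightarrow> T (m + (single (\<alpha> s) 1 + single (\<tau> s) 1)) 0"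
      "v = (\<Sum>s<b. h s * u s)" by auto
    define P where "P s' = u s' + (if s' = s2 then Xv i else 0)" for s'
    show "\<exists>P. (\<forall>a'<b. P a' \<in> polys (\<alpha> a') \<and> (\<forall>m\<in>keys (P a'). mdeg m = 1 \<and> low w (\<lambda>_. 2) \<rho> m a' (single k 1) s)) \<and>
         (\<forall>i<1::nat. h s * Xv k = (\<Sum>a'<b. h a' * P a'))"
    proof (intro exI[of _ P] conjI allI impI ballI)
      fix s' assume s': "s' < b"
      show "P s' \<in> polys (\<alpha> s')" using u(1)[OF s'] s2 ij by (auto simp: P_def)
      fix m assume "m \<in> keys (P s')"
      then consider "m \<in> keys (u s')" | "s' = s2" "m = single i 1"
        using keys_add[of "u s'" "if s' = s2 then Xv i else 0"] by (auto simp: P_def Xv_def split: if_splits)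
      then have "mdeg m = 1 \<and> low w (\<lambda>_. 2) \<rho> m s' (single k 1) s"
      proof cases
        case 1
        from u(2)[OF s' this] at[OF s'] k at[OF s] show ?thesis
          by (auto simp: T_def wdeg_add low_def w_def)
      next
        case 2
        \<comment> \<open>Here the weights tie, as \<open>X_i\<close> and \<open>X_k\<close> both
          have weight 1. The new pair has larger smallest index than \<open>i\<close>, or the same
          one and a larger second index.\<close>
        have "\<rho> s < \<rho> s2"
        proof (cases "j = i")
          case True
          then show ?thesis using s2 ij by (simp add: \<rho>_def flip: i_def j_def)
        next
          case False
          then have "(i + 1) * (n + 1) \<le> min j k * (n + 1)" using ij by (intro mult_right_mono) auto
          then show ?thesis using s2 ij by (simp add: \<rho>_def flip: i_def j_def)
        qed
        then show ?thesis using 2 ij by (auto simp: low_def w_def)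
      qed
      then show "mdeg m = 1" "low w (\<lambda>_. 2) \<rho> m s' (single k 1) s" by auto
    next
      have "(\<Sum>s'<b. h s' * P s') = v + h s2 * Xv i"
        using s2(1) by (simp add: P_def distrib_left sum.distrib sum_mult_if u(3))
      then show "h s * Xv k = (\<Sum>a'<b. h a' * P a')" by (simp add: v_def)
    qed
  qed
  show "h s \<in> forms n 2" if "s < b" for s by (rule h_forms[OF that])
  show "J = {\<Sum>s<b. h s * v s | v. v \<in> free_module n b}" by (rule J_eq)
qed

end


section \<open>Consequences of a linear resolution\<close>

section \<open>Ideals with linear resolutions\<close>

lemma poly_ring_simps [simp]:
  "carrier (poly_ring n) = polys n" "monoid.mult (poly_ring n) = (*)" "monoid.one (poly_ring n) = 1"
  "ring.zero (poly_ring n) = 0" "ring.add (poly_ring n) = (+)"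
  by (simp_all add: poly_ring_def)

lemma ring_poly_ring: "ring (poly_ring n :: 'k::field mpol ring)"
proof (rule ringI)
  show "abelian_group (poly_ring n :: 'k mpol ring)"
  proof (rule abelian_groupI)
    fix x :: "'k mpol" assume "x \<in> carrier (poly_ring n)"
    then show "\<exists>y\<in>carrier (poly_ring n). y \<oplus>\<^bsub>poly_ring n\<^esub> x = \<zero>\<^bsub>poly_ring n\<^esub>"
      by (intro bexI[of _ "- x"]) auto
  qed (auto simp: algebra_simps)
  show "Group.monoid (poly_ring n :: 'k mpol ring)"
    by (rule monoidI) (auto simp: algebra_simps)
qed (auto simp: algebra_simps)

lemma ideal_poly_ringI:
  assumes sub: "I \<subseteq> polys n" and zero: "0 \<in> I" and add: "\<And>F G. F \<in> I \<Longrightarrow> G \<in> I \<Longrightarrow> F + G \<in> I"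
    and mult: "\<And>F G. F \<in> I \<Longrightarrow> G \<in> polys n \<Longrightarrow> F * G \<in> I"
  shows "ideal I (poly_ring n :: 'k::field mpol ring)"
proof (rule idealI[OF ring_poly_ring])
  interpret ring "poly_ring n :: 'k mpol ring" by (rule ring_poly_ring)
  show "subgroup I (add_monoid (poly_ring n))"
  proof (rule add.subgroupI)
    show "\<ominus>\<^bsub>poly_ring n\<^esub> F \<in> I" if "F \<in> I" for F
    proof -
      have "\<ominus>\<^bsub>poly_ring n\<^esub> F = - F" using sub that by (intro minus_equality) auto
      then show ?thesis using mult[OF that, of "- 1"] by simp
    qed
  qed (use sub zero add in auto)
qed (use mult in \<open>auto simp: mult.commute\<close>)

lemma ideal_poly_ringD:
  assumes "ideal I (poly_ring n :: 'k::field mpol ring)"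
  shows "I \<subseteq> polys n" "0 \<in> I" "F \<in> I \<Longrightarrow> G \<in> I \<Longrightarrow> F + G \<in> I" "F \<in> I \<Longrightarrow> G \<in> polys n \<Longrightarrow> F * G \<in> I"
  using ideal.axioms(1)[OF assms, THEN additive_subgroup.a_subset]
    ideal.axioms(1)[OF assms, THEN additive_subgroup.zero_closed]
    additive_subgroup.a_closed[OF ideal.axioms(1)[OF assms], of F G]
    ideal.I_r_closed[OF assms, of F G] by auto

lemma linear_syzygiesE:
  assumes "linear_syzygies n J"
  obtains b e g D where "graded_free_resolution n J b e g D" "\<And>i c. c < b i \<Longrightarrow> e i c = i + 2"
    "\<And>c. c < b 0 \<Longrightarrow> g c \<in> forms n 2" "\<And>i a c. a < b i \<Longrightarrow> c < b (Suc i) \<Longrightarrow> D i a c \<in> forms n 1"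
    "J = {\<Sum>c<b 0. g c * v c | v. v \<in> free_module n (b 0)}"
proof -
  from assms obtain b e g D where *: "graded_free_resolution n J b e g D" "\<And>i c. c < b i \<Longrightarrow> e i c = i + 2"
    unfolding linear_syzygies_def minimal_resolution_def by blast
  show ?thesis
  proof (rule that[OF *])
    show "g c \<in> forms n 2" if "c < b 0" for c
    proof -
      have "g c \<in> forms n (e 0 c)" using *(1) that unfolding graded_free_resolution_def by blast
      then show ?thesis using *(2)[OF that] by (simp add: numeral_2_eq_2)
    qed
    show "D i a c \<in> forms n 1" if "a < b i" "c < b (Suc i)" for i a c
    proof -
      have "if e i a \<le> e (Suc i) c then D i a c \<in> forms n (e (Suc i) c - e i a) else D i a c = 0"
        using *(1) that unfolding graded_free_resolution_def by blast
      then show ?thesis using *(2)[OF that(1)] *(2)[OF that(2)] by simp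
    qed
    show "J = {\<Sum>c<b 0. g c * v c | v. v \<in> free_module n (b 0)}"
      using *(1) unfolding graded_free_resolution_def by blast
  qed auto
qed

lemma linear_syzygies_low_degree:
  assumes "linear_syzygies n J" "F \<in> J" "l < 2" shows "hom_comp l F = 0"
proof -
  from assms(1) obtain b e g D where g: "\<And>c. c < b (0::nat) \<Longrightarrow> g c \<in> forms n 2"
    and J: "J = {\<Sum>c<b 0. g c * v c | v. v \<in> free_module n (b 0)}"
    by (elim linear_syzygiesE) blast
  then obtain v where "F = (\<Sum>c<b 0. g c * v c)" using assms(2) by auto
  then show ?thesis
    using assms(3) by (auto simp: hom_comp_sum hom_comp_form_mult[OF g] intro!: sum.neutral)
qed

text \<open>The quadrics of a generating set already generate the quadrics of \<open>J\<close>,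
  among them the generators of the resolution, hence all of \<open>J\<close>. A minimal set
  therefore contains nothing else.\<close>

lemma quadratic_ideal_if_linear_syzygies:
  fixes J :: "'k::field mpol set"
  assumes lin: "linear_syzygies n J" shows "quadratic_ideal n J"
  unfolding quadratic_ideal_def
proof (intro allI impI subsetI)
  fix G f assume min: "minimal_generators n J G" and f: "f \<in> G"
  interpret R: ring "poly_ring n :: 'k mpol ring" by (rule ring_poly_ring)
  from lin obtain b e g D where g: "\<And>c. c < b (0::nat) \<Longrightarrow> g c \<in> forms n 2"
    and J: "J = {\<Sum>c<b 0. g c * v c | v. v \<in> free_module n (b 0)}"
    by (elim linear_syzygiesE) blast
  have G: "G \<subseteq> (\<Union>l. forms n l)" "Idl\<^bsub>poly_ring n\<^esub> G = J" "\<And>G'. G' \<subset> G \<Longrightarrow> Idl\<^bsub>poly_ring n\<^esub> G' \<noteq> J"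
    using min by (auto simp: minimal_generators_def)
  have GR: "G \<subseteq> carrier (poly_ring n)" using G(1) by (auto simp: forms_def)
  have Jid: "ideal J (poly_ring n)" using R.genideal_ideal[OF GR] G(2) by simp
  define G2 where "G2 = G \<inter> forms n 2"
  define K where "K = Idl\<^bsub>poly_ring n\<^esub> G2"
  have G2R: "G2 \<subseteq> carrier (poly_ring n)" using GR by (auto simp: G2_def)
  have Kid: "ideal K (poly_ring n)" unfolding K_def by (rule R.genideal_ideal[OF G2R])
  have G2K: "G2 \<subseteq> K" unfolding K_def by (rule R.genideal_self[OF G2R])
  \<comment> \<open>As \<open>J\<close> has no elements in degrees below 2, the quadratic part of
    \<open>F * H\<close> is that of \<open>F\<close> times the constant part of \<open>H\<close>. So
    this is an ideal, and it contains \<open>G\<close>, hence \<open>J\<close>.\<close>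
  define M where "M = {F \<in> J. hom_comp 2 F \<in> K}"
  have "ideal M (poly_ring n)"
  proof (rule ideal_poly_ringI)
    show "M \<subseteq> polys n" using ideal_poly_ringD(1)[OF Jid] by (auto simp: M_def)
    show "0 \<in> M" using ideal_poly_ringD(2)[OF Jid] ideal_poly_ringD(2)[OF Kid] by (simp add: M_def)
    show "F + H \<in> M" if "F \<in> M" "H \<in> M" for F H
      using that ideal_poly_ringD(3)[OF Jid] ideal_poly_ringD(3)[OF Kid] by (simp add: M_def hom_comp_add)
    show "F * H \<in> M" if F: "F \<in> M" and H: "H \<in> polys n" for F H
    proof -
      have Fp: "F \<in> polys n" using F ideal_poly_ringD(1)[OF Jid] by (auto simp: M_def)
      obtain N where N: "\<forall>M\<ge>N. (\<Sum>a\<le>M. hom_comp a F) = F" using sum_hom_comp by blast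
      then have "F = (\<Sum>a\<le>max N 2. hom_comp a F)" by (metis max.cobounded1)
      then have "hom_comp 2 (F * H) = (\<Sum>a\<le>max N 2. hom_comp 2 (hom_comp a F * H))"
        by (metis sum_distrib_right hom_comp_sum)
      also have "\<dots> = (\<Sum>a\<le>max N 2. if a = 2 then hom_comp 2 F * hom_comp 0 H else 0)"
      proof (rule sum.cong[OF refl])
        fix a
        show "hom_comp 2 (hom_comp a F * H) = (if a = 2 then hom_comp 2 F * hom_comp 0 H else 0)"
          using linear_syzygies_low_degree[OF lin, of F a] F
          by (cases "a < 2") (auto simp: hom_comp_form_mult[OF hom_comp_in_forms[OF Fp]] M_def)
      qed
      also have "\<dots> = hom_comp 2 F * hom_comp 0 H" by simp
      finally show ?thesis
        using F H ideal_poly_ringD(4)[OF Jid] ideal_poly_ringD(4)[OF Kid] by (simp add: M_def)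
    qed
  qed
  moreover have "G \<subseteq> M"
  proof
    fix x assume x: "x \<in> G"
    then obtain l where l: "x \<in> forms n l" using G(1) by blast
    have "x \<in> J" using R.genideal_self[OF GR] x G(2) by auto
    moreover have "hom_comp 2 x \<in> K"
      using l x G2K ideal_poly_ringD(2)[OF Kid] by (auto simp: hom_comp_form[OF l] G2_def)
    ultimately show "x \<in> M" by (simp add: M_def)
  qed
  ultimately have JM: "J \<subseteq> M" using R.genideal_minimal G(2) by blast
  have gJ: "g c \<in> J" if c: "c < b 0" for c
  proof -
    have "(\<Sum>c'<b 0. g c' * (if c' = c then 1 else 0)) = g c" using c by (simp add: sum_mult_if)
    moreover have "(\<lambda>c'. if c' = c then 1 else 0) \<in> free_module n (b 0)" using c by (auto simp: free_module_def)
    ultimately show ?thesis unfolding J by force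
  qed
  have gK: "g c \<in> K" if "c < b 0" for c
    using gJ[OF that] JM hom_comp_form[OF g[OF that], of 2] by (auto simp: M_def)
  have sumK: "(\<Sum>c<k. g c * v c) \<in> K" if "k \<le> b 0" "v \<in> free_module n (b 0)" for k v
    using that(1)
  proof (induction k)
    case 0
    then show ?case using ideal_poly_ringD(2)[OF Kid] by simp
  next
    case (Suc k)
    then show ?case
      using ideal_poly_ringD(3)[OF Kid] ideal_poly_ringD(4)[OF Kid] gK that(2) by (simp add: free_module_def)
  qed
  then have JK: "J \<subseteq> K" unfolding J by blast
  show "f \<in> forms n 2"
  proof (rule ccontr)
    assume nf: "f \<notin> forms n 2"
    have "G2 \<subseteq> G - {f}" using nf by (auto simp: G2_def)
    moreover have GfR: "G - {f} \<subseteq> carrier (poly_ring n)" using GR by auto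
    ultimately have "K \<subseteq> Idl\<^bsub>poly_ring n\<^esub> (G - {f})"
      unfolding K_def using R.genideal_minimal R.genideal_ideal[OF GfR] R.genideal_self[OF GfR] by blast
    moreover have "Idl\<^bsub>poly_ring n\<^esub> (G - {f}) \<subseteq> J"
      using R.genideal_minimal[OF Jid, of "G - {f}"] R.genideal_self[OF GR] G(2) by blast
    ultimately have "Idl\<^bsub>poly_ring n\<^esub> (G - {f}) = J" using JK by blast
    with G(3)[of "G - {f}"] f show False by blast
  qed
qed

section \<open>Linear changes of coordinates\<close>

text \<open>Transfers the standard example to an arbitrary linear embedding. The maps are total on
  the type of polynomials, but inverse to each other only on \<open>polys n\<close>.\<close>

locale graded_aut =
  fixes n :: nat and \<Theta> \<Theta>' :: "'k::field mpol \<Rightarrow> 'k mpol"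
  assumes hom: "chom \<Theta>" "chom \<Theta>'"
    and forms: "F \<in> forms n l \<Longrightarrow> \<Theta> F \<in> forms n l" "F \<in> forms n l \<Longrightarrow> \<Theta>' F \<in> forms n l"
    and polys: "F \<in> polys n \<Longrightarrow> \<Theta> F \<in> polys n" "F \<in> polys n \<Longrightarrow> \<Theta>' F \<in> polys n"
    and inv: "F \<in> polys n \<Longrightarrow> \<Theta>' (\<Theta> F) = F" "F \<in> polys n \<Longrightarrow> \<Theta> (\<Theta>' F) = F"
begin

lemmas hom1 = chomD[OF hom(1)]
lemmas hom2 = chomD[OF hom(2)]

lemma eq_iff: "F \<in> polys n \<Longrightarrow> G \<in> polys n \<Longrightarrow> \<Theta> F = G \<longleftrightarrow> F = \<Theta>' G"
  using inv by metis

lemma free_module: "v \<in> free_module n b \<Longrightarrow> (\<lambda>c. \<Theta> (v c)) \<in> free_module n b"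
  "v \<in> free_module n b \<Longrightarrow> (\<lambda>c. \<Theta>' (v c)) \<in> free_module n b"
  using polys hom1(4) hom2(4) by (auto simp: free_module_def)

lemma transport_exact:
  assumes M: "\<And>i c. i < r \<Longrightarrow> c < b \<Longrightarrow> M i c \<in> polys n" and D: "\<And>a c. a < b \<Longrightarrow> c < b' \<Longrightarrow> D a c \<in> polys n"
    and ex: "\<And>v. v \<in> free_module n b \<Longrightarrow> (\<forall>i<r. (\<Sum>c<b. M i c * v c) = 0) \<longleftrightarrow>
       (\<exists>w\<in>free_module n b'. \<forall>a<b. v a = (\<Sum>c<b'. D a c * w c))"
    and v: "v \<in> free_module n b"
  shows "(\<forall>i<r. (\<Sum>c<b. \<Theta> (M i c) * v c) = 0) \<longleftrightarrow>
       (\<exists>w\<in>free_module n b'. \<forall>a<b. v a = (\<Sum>c<b'. \<Theta> (D a c) * w c))"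
proof -
  define u where "u = (\<lambda>c. \<Theta>' (v c))"
  have u: "u \<in> free_module n b" unfolding u_def by (rule free_module(2)[OF v])
  have vp: "v c \<in> polys n" for c using v by (cases "c < b") (auto simp: free_module_def)
  have vu: "v c = \<Theta> (u c)" for c using inv(2)[OF vp] by (simp add: u_def)
  have up: "u c \<in> polys n" for c using vp polys by (simp add: u_def)
  have Th0: "\<Theta> F = 0 \<longleftrightarrow> F = 0" if "F \<in> polys n" for F
    using eq_iff[OF that, of 0] hom2(4) by simp
  have "(\<Sum>c<b. \<Theta> (M i c) * v c) = \<Theta> (\<Sum>c<b. M i c * u c)" for i
    by (simp add: hom1 vu)
  then have "(\<forall>i<r. (\<Sum>c<b. \<Theta> (M i c) * v c) = 0) \<longleftrightarrow> (\<forall>i<r. (\<Sum>c<b. M i c * u c) = 0)"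
  proof -
    have "\<Theta> (\<Sum>c<b. M i c * u c) = 0 \<longleftrightarrow> (\<Sum>c<b. M i c * u c) = 0" if "i < r" for i
      by (rule Th0) (use M up that in \<open>auto intro!: polys_sum polys_mult\<close>)
    with \<open>\<And>i. (\<Sum>c<b. \<Theta> (M i c) * v c) = \<Theta> (\<Sum>c<b. M i c * u c)\<close> show ?thesis by auto
  qed
  also have "\<dots> \<longleftrightarrow> (\<exists>w\<in>free_module n b'. \<forall>a<b. u a = (\<Sum>c<b'. D a c * w c))" by (rule ex[OF u])
  also have "\<dots> \<longleftrightarrow> (\<exists>w\<in>free_module n b'. \<forall>a<b. v a = (\<Sum>c<b'. \<Theta> (D a c) * w c))"
  proof
    assume "\<exists>w\<in>free_module n b'. \<forall>a<b. u a = (\<Sum>c<b'. D a c * w c)"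
    then obtain w where "w \<in> free_module n b'" "\<forall>a<b. u a = (\<Sum>c<b'. D a c * w c)" by blast
    then show "\<exists>w\<in>free_module n b'. \<forall>a<b. v a = (\<Sum>c<b'. \<Theta> (D a c) * w c)"
      by (intro bexI[of _ "\<lambda>c. \<Theta> (w c)"] free_module) (auto simp: vu hom1)
  next
    assume "\<exists>w\<in>free_module n b'. \<forall>a<b. v a = (\<Sum>c<b'. \<Theta> (D a c) * w c)"
    then obtain w where w: "w \<in> free_module n b'" "\<forall>a<b. v a = (\<Sum>c<b'. \<Theta> (D a c) * w c)" by blast
    then show "\<exists>w\<in>free_module n b'. \<forall>a<b. u a = (\<Sum>c<b'. D a c * w c)"
      using D by (intro bexI[of _ "\<lambda>c. \<Theta>' (w c)"] free_module) (auto simp: u_def hom2 inv)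
  qed
  finally show ?thesis .
qed

lemma linear_syzygies_image:
  assumes "linear_syzygies n J" shows "linear_syzygies n (\<Theta> ` J)"
proof -
  obtain b e g D where res: "graded_free_resolution n J b e g D" and e: "\<And>i c. c < b i \<Longrightarrow> e i c = i + 2"
    and g: "\<And>c. c < b 0 \<Longrightarrow> g c \<in> forms n 2" and D: "\<And>i a c. a < b i \<Longrightarrow> c < b (Suc i) \<Longrightarrow> D i a c \<in> forms n 1"
    and J: "J = {\<Sum>c<b 0. g c * v c | v. v \<in> free_module n (b 0)}"
    by (rule linear_syzygiesE[OF assms]) (rule that)
  have ex0: "(\<Sum>c<b 0. g c * v c) = 0 \<longleftrightarrow> (\<exists>w\<in>free_module n (b 1). \<forall>a<b 0. v a = (\<Sum>c<b 1. D 0 a c * w c))"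
    if "v \<in> free_module n (b 0)" for v
    using res that unfolding graded_free_resolution_def by blast
  have ex: "(\<forall>a<b i. (\<Sum>c<b (Suc i). D i a c * v c) = 0) \<longleftrightarrow>
        (\<exists>w\<in>free_module n (b (Suc (Suc i))). \<forall>a<b (Suc i). v a = (\<Sum>c<b (Suc (Suc i)). D (Suc i) a c * w c))"
    if "v \<in> free_module n (b (Suc i))" for i v
    using res that unfolding graded_free_resolution_def by blast
  have "minimal_resolution n (\<Theta> ` J) b (\<lambda>i _. i + 2) (\<lambda>c. \<Theta> (g c)) (\<lambda>i a c. \<Theta> (D i a c))"
    unfolding minimal_resolution_def graded_free_resolution_def
  proof (intro conjI allI impI ballI)
    show "\<Theta> (g c) \<in> forms n (0 + 2)" if "c < b 0" for c
      using forms(1)[OF g[OF that]] by (simp add: numeral_2_eq_2)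
    show "if i + 2 \<le> Suc i + 2 then \<Theta> (D i a c) \<in> forms n (Suc i + 2 - (i + 2)) else \<Theta> (D i a c) = 0"
      if "a < b i" "c < b (Suc i)" for i a c using forms(1)[OF D[OF that]] by simp
    show "\<Theta> ` J = {\<Sum>c<b 0. \<Theta> (g c) * v c |v. v \<in> free_module n (b 0)}"
    proof (intro equalityI subsetI)
      fix F assume "F \<in> \<Theta> ` J"
      then obtain v where "v \<in> free_module n (b 0)" "F = \<Theta> (\<Sum>c<b 0. g c * v c)" unfolding J by blast
      then show "F \<in> {\<Sum>c<b 0. \<Theta> (g c) * v c |v. v \<in> free_module n (b 0)}"
        by (intro CollectI exI[of _ "\<lambda>c. \<Theta> (v c)"]) (auto simp: hom1 free_module)
    next
      fix F assume "F \<in> {\<Sum>c<b 0. \<Theta> (g c) * v c |v. v \<in> free_module n (b 0)}"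
      then obtain v where v: "v \<in> free_module n (b 0)" "F = (\<Sum>c<b 0. \<Theta> (g c) * v c)" by blast
      have "v c = \<Theta> (\<Theta>' (v c))" if "c < b 0" for c
        using inv(2) v(1) that by (simp add: free_module_def)
      then have "F = \<Theta> (\<Sum>c<b 0. g c * \<Theta>' (v c))" using v by (simp add: hom1)
      moreover have "(\<Sum>c<b 0. g c * \<Theta>' (v c)) \<in> J"
        unfolding J by (intro CollectI exI[of _ "\<lambda>c. \<Theta>' (v c)"] conjI refl free_module(2)[OF v(1)])
      ultimately show "F \<in> \<Theta> ` J" by blast
    qed
    show "((\<Sum>c<b 0. \<Theta> (g c) * v c) = 0) = (\<exists>w\<in>free_module n (b 1). \<forall>a<b 0. v a = (\<Sum>c<b 1. \<Theta> (D 0 a c) * w c))"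
      if "v \<in> free_module n (b 0)" for v
    proof -
      have gp: "c < b 0 \<Longrightarrow> g c \<in> polys n" and Dp: "a < b 0 \<Longrightarrow> c < b 1 \<Longrightarrow> D 0 a c \<in> polys n" for a c
        using g D[of a 0 c] by (auto intro: forms_polys)
      have ex0': "(\<forall>i<1::nat. (\<Sum>c<b 0. g c * v c) = 0) \<longleftrightarrow>
          (\<exists>w\<in>free_module n (b 1). \<forall>a<b 0. v a = (\<Sum>c<b 1. D 0 a c * w c))"
        if "v \<in> free_module n (b 0)" for v
        using ex0[OF that] by blast
      show ?thesis using transport_exact[of 1 "b 0" "\<lambda>_. g" "b 1" "D 0" v, OF gp Dp ex0' that] by blast
    qed
    show "(\<forall>a<b i. (\<Sum>c<b (Suc i). \<Theta> (D i a c) * v c) = 0) =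
       (\<exists>w\<in>free_module n (b (Suc (Suc i))). \<forall>a<b (Suc i). v a = (\<Sum>c<b (Suc (Suc i)). \<Theta> (D (Suc i) a c) * w c))"
      if "v \<in> free_module n (b (Suc i))" for i v
      by (rule transport_exact[of "b i" "b (Suc i)" "D i" "b (Suc (Suc i))" "D (Suc i)" v,
            OF D[THEN forms_polys] D[THEN forms_polys] ex that])
    show "lookup (\<Theta> (D i a c)) 0 = 0" if "a < b i" "c < b (Suc i)" for i a c
      using forms(1)[OF D[OF that]] by (auto simp: forms_def simp flip: not_in_keys_iff_lookup_eq_zero)
  qed
  then show ?thesis unfolding linear_syzygies_def by blast
qed

end

section \<open>Socle elements modulo a nonzerodivisor\<close>

text \<open>\<open>var_ideal P\<close> is the ideal generated by the variables with index in \<open>P\<close>.\<close>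

definition var_ideal :: "nat set \<Rightarrow> 'k::field mpol set" where
  "var_ideal P = {F. \<forall>m\<in>keys F. keys m \<inter> P \<noteq> {}}"

lemma var_ideal_zero [simp]: "0 \<in> var_ideal P" by (simp add: var_ideal_def)
lemma var_ideal_empty [simp]: "var_ideal {} = {0}" by (auto simp: var_ideal_def)
lemma var_ideal_add: "F \<in> var_ideal P \<Longrightarrow> G \<in> var_ideal P \<Longrightarrow> F + G \<in> var_ideal P"
  using keys_add[of F G] by (auto simp: var_ideal_def)
lemma var_ideal_uminus: "F \<in> var_ideal P \<Longrightarrow> - F \<in> var_ideal P"
  by (simp add: var_ideal_def)
lemma var_ideal_diff: "F \<in> var_ideal P \<Longrightarrow> G \<in> var_ideal P \<Longrightarrow> F - G \<in> var_ideal P"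
  using var_ideal_add[of F P "- G"] var_ideal_uminus[of G P] by simp
lemma var_ideal_mult: assumes "G \<in> var_ideal P" shows "F * G \<in> var_ideal P"
  unfolding var_ideal_def
proof (intro CollectI ballI)
  fix m assume "m \<in> keys (F * G)"
  then obtain a c where "c \<in> keys G" "m = a + c" using keys_mult[of F G] by blast
  then show "keys m \<inter> P \<noteq> {}" using assms by (auto simp: var_ideal_def keys_monom_add)
qed
lemma var_ideal_sum: "(\<And>i. i \<in> A \<Longrightarrow> f i \<in> var_ideal P) \<Longrightarrow> sum f A \<in> var_ideal P"
  by (induction A rule: infinite_finite_induct) (auto intro: var_ideal_add)
lemma var_ideal_mono: "F \<in> var_ideal P \<Longrightarrow> P \<subseteq> Q \<Longrightarrow> F \<in> var_ideal Q"
  by (auto simp: var_ideal_def)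
lemma var_ideal_hom_comp: "F \<in> var_ideal P \<Longrightarrow> hom_comp l F \<in> var_ideal P"
  by (auto simp: var_ideal_def keys_hom_comp)
lemma var_ideal_Xv: "q \<in> P \<Longrightarrow> Xv q * F \<in> var_ideal P"
  using var_ideal_mult[of "Xv q" P F] by (simp add: var_ideal_def Xv_def mult.commute)

lemma lookup_Xv_mult: "lookup (Xv q * F) (single q 1 + m) = lookup F m"
proof -
  have "lookup (Xv q * F) (single q 1 + m) = (\<Sum>m'\<in>keys F. if m' = m then lookup F m' else 0)"
    by (simp add: lookup_mult_keys Xv_def cong: if_cong)
  then show ?thesis by (simp add: in_keys_iff)
qed

text \<open>A variable outside \<open>P\<close> is a nonzerodivisor modulo those in
  \<open>P\<close>; all connecting maps below rest on this cancellation.\<close>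

lemma var_ideal_cancel:
  assumes "Xv q * F \<in> var_ideal P" "q \<notin> P" shows "F \<in> var_ideal P"
  unfolding var_ideal_def
proof (intro CollectI ballI)
  fix m assume "m \<in> keys F"
  then have "single q 1 + m \<in> keys (Xv q * F)" by (simp add: in_keys_iff lookup_Xv_mult del: One_nat_def)
  then have "keys (single q 1 + m) \<inter> P \<noteq> {}" using assms(1) by (auto simp: var_ideal_def)
  then show "keys m \<inter> P \<noteq> {}" using assms(2) by (auto simp: keys_monom_add)
qed

lemma var_ideal_split:
  assumes "F \<in> var_ideal (insert q P)" "F \<in> polys n" "q \<le> n"
  shows "\<exists>G H. G \<in> var_ideal P \<and> H \<in> polys n \<and> F = G + Xv q * H"
proof -
  have "\<exists>G H. G \<in> var_ideal P \<and> H \<in> polys n \<and> F = G + Xv q * H"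
  proof (induction F rule: mpol_single_induct)
    case zero
    then show ?case by (intro exI[of _ 0]) auto
  next
    case (add m F')
    then obtain G H where GH: "G \<in> var_ideal P" "H \<in> polys n" "F' = G + Xv q * H" by blast
    have m: "keys m \<inter> insert q P \<noteq> {}" "keys m \<subseteq> {..n}"
      using add.hyps assms by (auto simp: var_ideal_def polys_def)
    show ?case
    proof (cases "keys m \<inter> P = {}")
      case True
      then have "q \<in> keys m" using m by auto
      then obtain m' where m': "m = single q 1 + m'" by (rule keys_monom_split)
      then have "single m' (lookup F m) \<in> polys n" using m by (intro polys_single) (auto simp: keys_monom_add)
      moreover have "single m (lookup F m) = Xv q * single m' (lookup F m)" using m' by (metis single_Xv_mult)
      ultimately show ?thesis using GH
        by (intro exI[of _ G] exI[of _ "single m' (lookup F m) + H"]) (auto simp: algebra_simps)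
    next
      case False
      then have "single m (lookup F m) \<in> var_ideal P" by (auto simp: var_ideal_def)
      then show ?thesis using GH
        by (intro exI[of _ "single m (lookup F m) + G"] exI[of _ H]) (auto intro: var_ideal_add simp: algebra_simps)
    qed
  qed
  then show ?thesis .
qed

text \<open>A linear resolution of \<open>J\<close>, extended by \<open>R\<close> in position 0 to a resolution of \<open>R/J\<close>.  Modulo
  the variables in a set \<open>P\<close> containing a nonzerodivisor on \<open>R/J\<close> it is exact in positions
  \<open>\<ge> card P\<close>.  A socle element of its homology in position \<open>card P - 1\<close> yields one in the
  next position when a further variable is killed, and in the end a contradiction by degrees.\<close>

locale linear_resolution =
  fixes n :: nat and J :: "'k::field mpol set" and b :: "nat \<Rightarrow> nat" and D :: "nat \<Rightarrow> nat \<Rightarrow> nat \<Rightarrow> 'k mpol"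
  assumes b0: "b 0 = 1"
    and D0: "c < b 1 \<Longrightarrow> D 0 0 c \<in> forms n 2"
    and DS: "a < b (Suc i) \<Longrightarrow> c < b (Suc (Suc i)) \<Longrightarrow> D (Suc i) a c \<in> forms n 1"
    and J: "J = {\<Sum>c<b 1. D 0 0 c * v c | v. v \<in> free_module n (b 1)}"
    and exact: "v \<in> free_module n (b (Suc i)) \<Longrightarrow> (\<forall>a<b i. (\<Sum>c<b (Suc i). D i a c * v c) = 0) \<longleftrightarrow>
        (\<exists>w\<in>free_module n (b (Suc (Suc i))). \<forall>a<b (Suc i). v a = (\<Sum>c<b (Suc (Suc i)). D (Suc i) a c * w c))"
begin

definition vec :: "nat \<Rightarrow> (nat \<Rightarrow> 'k mpol) \<Rightarrow> bool" where
  "vec i v \<longleftrightarrow> (\<forall>a<b i. v a \<in> polys n)"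

definition app :: "nat \<Rightarrow> (nat \<Rightarrow> 'k mpol) \<Rightarrow> nat \<Rightarrow> 'k mpol" where
  "app i v a = (\<Sum>c<b (Suc i). D i a c * v c)"

lemma D_polys: "a < b i \<Longrightarrow> c < b (Suc i) \<Longrightarrow> D i a c \<in> polys n"
  using D0[THEN forms_polys] DS[THEN forms_polys] b0 by (cases i) auto

lemma vec_free: "vec i v \<Longrightarrow> (\<lambda>c. if c < b i then v c else 0) \<in> free_module n (b i)"
  by (auto simp: vec_def free_module_def)

lemma app_diff: "app i (\<lambda>c. v c - w c) a = app i v a - app i w a"
  by (simp add: app_def right_diff_distrib sum_subtractf)
lemma app_add: "app i (\<lambda>c. v c + w c) a = app i v a + app i w a"
  by (simp add: app_def distrib_left sum.distrib)
lemma app_scale: "app i (\<lambda>c. F * v c) a = F * app i v a"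
  by (simp add: app_def sum_distrib_left algebra_simps)
lemma app_cong: "(\<And>c. c < b (Suc i) \<Longrightarrow> v c = w c) \<Longrightarrow> app i v a = app i w a"
  by (simp add: app_def)
lemma app_vec: "vec (Suc i) v \<Longrightarrow> vec i (app i v)"
  unfolding vec_def app_def using D_polys by (auto intro!: polys_sum polys_mult)
lemma app_var_ideal: "(\<And>c. c < b (Suc i) \<Longrightarrow> v c \<in> var_ideal P) \<Longrightarrow> app i v a \<in> var_ideal P"
  by (auto simp: app_def intro!: var_ideal_sum var_ideal_mult)

lemma app_exact:
  assumes "vec (Suc i) v" "\<And>a. a < b i \<Longrightarrow> app i v a = 0"
  shows "\<exists>w. vec (Suc (Suc i)) w \<and> (\<forall>a<b (Suc i). v a = app (Suc i) w a)"
proof -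
  let ?v = "\<lambda>c. if c < b (Suc i) then v c else 0"
  have "\<forall>a<b i. (\<Sum>c<b (Suc i). D i a c * ?v c) = 0" using assms(2) by (simp add: app_def)
  with exact[OF vec_free[OF assms(1)]] obtain w where
    "w \<in> free_module n (b (Suc (Suc i)))" "\<forall>a<b (Suc i). ?v a = (\<Sum>c<b (Suc (Suc i)). D (Suc i) a c * w c)" by blast
  then show ?thesis by (intro exI[of _ w]) (auto simp: app_def vec_def free_module_def)
qed

lemma app_app:
  assumes "vec (Suc (Suc i)) w" "a < b i" shows "app i (app (Suc i) w) a = 0"
proof -
  let ?w = "\<lambda>c. if c < b (Suc (Suc i)) then w c else 0"
  let ?v = "\<lambda>c. if c < b (Suc i) then app (Suc i) w c else 0"
  have "\<exists>w\<in>free_module n (b (Suc (Suc i))). \<forall>a<b (Suc i). ?v a = (\<Sum>c<b (Suc (Suc i)). D (Suc i) a c * w c)"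
    by (rule bexI[OF _ vec_free[OF assms(1)]]) (simp add: app_def)
  with exact[OF vec_free[OF app_vec[OF assms(1)]]] assms(2)
  have "(\<Sum>c<b (Suc i). D i a c * ?v c) = 0" by blast
  then show ?thesis by (simp add: app_def)
qed

lemma J_iff: "F \<in> J \<longleftrightarrow> (\<exists>v. vec 1 v \<and> F = app 0 v 0)"
proof
  assume "F \<in> J"
  then show "\<exists>v. vec 1 v \<and> F = app 0 v 0" unfolding J by (auto simp: app_def vec_def free_module_def)
next
  assume "\<exists>v. vec 1 v \<and> F = app 0 v 0"
  then obtain v where v: "vec 1 v" "F = app 0 v 0" by blast
  then show "F \<in> J" unfolding J
    by (intro CollectI exI[of _ "\<lambda>c. if c < b 1 then v c else 0"] conjI vec_free) (auto simp: app_def)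
qed

text \<open>Exactness in position \<open>Suc i\<close> after killing the variables in
  \<open>P\<close>, phrased by congruences between representatives instead of a quotient
  complex.\<close>

definition ex_mod :: "nat set \<Rightarrow> nat \<Rightarrow> bool" where
  "ex_mod P i \<longleftrightarrow> (\<forall>v. vec (Suc i) v \<longrightarrow> (\<forall>a<b i. app i v a \<in> var_ideal P) \<longrightarrow>
     (\<exists>w. vec (Suc (Suc i)) w \<and> (\<forall>a<b (Suc i). v a - app (Suc i) w a \<in> var_ideal P)))"

lemma ex_mod_empty: "ex_mod {} i"
  unfolding ex_mod_def using app_exact by simp

lemma vec_split:
  assumes "vec i v" "\<And>a. a < b i \<Longrightarrow> v a \<in> var_ideal (insert q P)" "q \<le> n"
  shows "\<exists>x y. (\<forall>a<b i. x a \<in> var_ideal P) \<and> vec i y \<and> (\<forall>a<b i. v a = x a + Xv q * y a)"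
proof -
  have "\<forall>a. \<exists>x y. a < b i \<longrightarrow> x \<in> var_ideal P \<and> y \<in> polys n \<and> v a = x + Xv q * y"
    using var_ideal_split[of _ q P n] assms unfolding vec_def by blast
  then obtain x y where "\<And>a. a < b i \<Longrightarrow> x a \<in> var_ideal P \<and> y a \<in> polys n \<and> v a = x a + Xv q * y a" by metis
  then show ?thesis by (intro exI[of _ x] exI[of _ y]) (auto simp: vec_def)
qed

text \<open>\<open>v - Xv q * u\<close> is a cycle modulo \<open>P\<close>, hence a boundary, and it
  agrees with \<open>v\<close> modulo \<open>X_q\<close>.\<close>

lemma ex_mod_lift:
  assumes ex: "ex_mod P i" and q: "q \<le> n" and v: "vec (Suc i) v" and u: "vec (Suc i) u"
    and e: "\<And>a. a < b i \<Longrightarrow> app i v a - Xv q * app i u a \<in> var_ideal P"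
  shows "\<exists>w. vec (Suc (Suc i)) w \<and> (\<forall>a<b (Suc i). v a - app (Suc i) w a \<in> var_ideal (insert q P))"
proof -
  have "vec (Suc i) (\<lambda>c. v c - Xv q * u c)" using v u q by (auto simp: vec_def)
  moreover have "app i (\<lambda>c. v c - Xv q * u c) a \<in> var_ideal P" if "a < b i" for a
    using e[OF that] by (simp add: app_diff app_scale)
  ultimately obtain w where w: "vec (Suc (Suc i)) w" "\<And>a. a < b (Suc i) \<Longrightarrow> v a - Xv q * u a - app (Suc i) w a \<in> var_ideal P"
    using ex unfolding ex_mod_def by blast
  have "v a - app (Suc i) w a \<in> var_ideal (insert q P)" if "a < b (Suc i)" for a
  proof -
    have "(v a - Xv q * u a - app (Suc i) w a) + Xv q * u a \<in> var_ideal (insert q P)"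
      by (intro var_ideal_add var_ideal_Xv var_ideal_mono[OF w(2)[OF that]]) auto
    then show ?thesis by simp
  qed
  with w show ?thesis by blast
qed

text \<open>The long homology sequence of multiplication by \<open>X_q\<close>, on elements: if the
  differential of \<open>v\<close> is \<open>x + Xv q * y\<close>, applying the next differential
  and cancelling \<open>X_q\<close> shows that \<open>y\<close> is a cycle modulo \<open>P\<close>,
  hence a boundary.\<close>

lemma ex_mod_step:
  assumes ex: "ex_mod P i" "ex_mod P (Suc i)" and q: "q \<notin> P" "q \<le> n"
  shows "ex_mod (insert q P) (Suc i)"
  unfolding ex_mod_def
proof (intro allI impI)
  fix v assume v: "vec (Suc (Suc i)) v" and c: "\<forall>a<b (Suc i). app (Suc i) v a \<in> var_ideal (insert q P)"
  obtain x y where xy: "\<And>a. a < b (Suc i) \<Longrightarrow> x a \<in> var_ideal P" "vec (Suc i) y"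
    "\<And>a. a < b (Suc i) \<Longrightarrow> app (Suc i) v a = x a + Xv q * y a"
    using vec_split[OF app_vec[OF v], of q P] c q by metis
  have "app i y a \<in> var_ideal P" if "a < b i" for a
  proof -
    have "0 = app i (app (Suc i) v) a" using app_app[OF v that] by simp
    also have "\<dots> = app i (\<lambda>c. x c + Xv q * y c) a" using xy(3) by (intro app_cong) auto
    also have "\<dots> = app i x a + Xv q * app i y a" by (simp add: app_add app_scale)
    finally have "Xv q * app i y a = - app i x a" by (simp add: eq_neg_iff_add_eq_0 add.commute)
    moreover have "- app i x a \<in> var_ideal P" by (intro var_ideal_uminus app_var_ideal xy)
    ultimately show ?thesis using var_ideal_cancel q(1) by metis
  qed
  with ex(1) xy(2) obtain u where u: "vec (Suc (Suc i)) u" "\<And>a. a < b (Suc i) \<Longrightarrow> y a - app (Suc i) u a \<in> var_ideal P"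
    unfolding ex_mod_def by blast
  show "\<exists>w. vec (Suc (Suc (Suc i))) w \<and> (\<forall>a<b (Suc (Suc i)). v a - app (Suc (Suc i)) w a \<in> var_ideal (insert q P))"
  proof (rule ex_mod_lift[OF ex(2) q(2) v u(1)])
    fix a assume a: "a < b (Suc i)"
    have "x a + Xv q * (y a - app (Suc i) u a) \<in> var_ideal P"
      by (intro var_ideal_add var_ideal_mult xy u a)
    then show "app (Suc i) v a - Xv q * app (Suc i) u a \<in> var_ideal P"
      using xy(3)[OF a] by (simp add: algebra_simps)
  qed
qed

text \<open>In the lowest position the previous argument lacks its input, since the complex resolves
  \<open>R/J\<close> and has homology in position 0. There the nonzerodivisor \<open>X_p\<close>
  takes over.\<close>

lemma ex_mod_first:
  assumes p: "p \<le> n" and nzd: "\<And>F. F \<in> polys n \<Longrightarrow> Xv p * F \<in> J \<Longrightarrow> F \<in> J"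
  shows "ex_mod {p} i"
proof (cases i)
  case (Suc k)
  then show ?thesis using ex_mod_step[OF ex_mod_empty ex_mod_empty _ p] by auto
next
  case 0
  show ?thesis unfolding ex_mod_def 0
  proof (intro allI impI)
    fix v assume v: "vec (Suc 0) v" and c: "\<forall>a<b 0. app 0 v a \<in> var_ideal {p}"
    obtain x y where xy: "x \<in> var_ideal {}" "y \<in> polys n" "app 0 v 0 = x + Xv p * y"
      using var_ideal_split[of "app 0 v 0" p "{}" n] c p app_vec[OF v] b0 by (auto simp: vec_def)
    have "Xv p * y \<in> J" using J_iff[of "Xv p * y"] v xy by auto
    then have "y \<in> J" using nzd xy(2) by blast
    then obtain u where "vec 1 u" "y = app 0 u 0" using J_iff by blast
    then show "\<exists>w. vec (Suc (Suc 0)) w \<and> (\<forall>a<b (Suc 0). v a - app (Suc 0) w a \<in> var_ideal {p})"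
      using xy b0 by (intro ex_mod_lift[OF ex_mod_empty p v, of u]) auto
  qed
qed

text \<open>In other words \<open>R/(J, X_p)\<close> has no socle in degrees above 1. A
  counterexample is pushed through the connecting maps of the remaining variables, keeping three
  properties: fixed degree, not a boundary, and killed by every variable up to boundaries.\<close>

lemma socle_lift:
  assumes p: "p \<le> n" and nzd: "\<And>F. F \<in> polys n \<Longrightarrow> Xv p * F \<in> J \<Longrightarrow> F \<in> J"
    and j: "j \<ge> 1" and F: "F \<in> forms n (Suc j)"
    and soc: "\<And>r. r \<le> n \<Longrightarrow> \<exists>f\<in>polys n. Xv r * F - Xv p * f \<in> J"
  shows "\<exists>f\<in>polys n. F - Xv p * f \<in> J"
proof (rule ccontr)
  assume no: "\<not> ?thesis"
  \<comment> \<open>Each connecting map raises the total degree by one, so it is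
    \<open>Suc j + k\<close> in position \<open>k\<close>. The generators there have degree
    \<open>k + 1\<close> for \<open>k \<ge> 1\<close> and degree 0 for \<open>k = 0\<close>, which
    leaves these degrees for the entries.\<close>
  define dg where "dg k = (if k = 0 then Suc j else j)" for k :: nat
  define bd where "bd P k v \<longleftrightarrow> (\<exists>w. vec (Suc k) w \<and> (\<forall>a<b k. v a - app k w a \<in> var_ideal P))" for P k v
  have claim: "\<exists>P. p \<in> P \<and> P \<subseteq> {..n} \<and> card P = Suc k \<and> (\<forall>i\<ge>k. ex_mod P i) \<and>
      (\<exists>v. (\<forall>a<b k. v a \<in> forms n (dg k)) \<and> \<not> bd P k v \<and> (\<forall>r\<le>n. bd P k (\<lambda>a. Xv r * v a)))" if "k \<le> n" for k
    using that
  proof (induction k)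
    case 0
    have "\<not> bd {p} 0 (\<lambda>_. F)"
    proof
      assume "bd {p} 0 (\<lambda>_. F)"
      then obtain w where w: "vec (Suc 0) w" "F - app 0 w 0 \<in> var_ideal {p}" using b0 by (auto simp: bd_def)
      then have "F - app 0 w 0 \<in> polys n" using app_vec[OF w(1)] b0 F by (auto simp: vec_def forms_def)
      with var_ideal_split[OF w(2)] p obtain f where "f \<in> polys n" "F - app 0 w 0 = Xv p * f" by auto
      then have "f \<in> polys n \<and> F - Xv p * f = app 0 w 0" by (simp add: algebra_simps)
      then show False using no J_iff w(1) by auto
    qed
    moreover have "bd {p} 0 (\<lambda>a. Xv r * F)" if r: "r \<le> n" for r
    proof -
      obtain f where f: "f \<in> polys n" "Xv r * F - Xv p * f \<in> J" using soc[OF r] by blast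
      then obtain w where w: "vec 1 w" "Xv r * F - Xv p * f = app 0 w 0" using J_iff by blast
      then have "Xv r * F - app 0 w 0 = Xv p * f" by (simp add: algebra_simps)
      then show ?thesis using w b0 by (auto simp: bd_def var_ideal_Xv)
    qed
    ultimately show ?case using ex_mod_first[OF p nzd] F p
      by (intro exI[of _ "{p}"]) (auto simp: dg_def intro!: exI[of _ "\<lambda>_. F"])
  next
    case (Suc k)
    then obtain P v where P: "p \<in> P" "P \<subseteq> {..n}" "card P = Suc k" "\<And>i. i \<ge> k \<Longrightarrow> ex_mod P i"
      and v: "\<And>a. a < b k \<Longrightarrow> v a \<in> forms n (dg k)" "\<not> bd P k v" "\<And>r. r \<le> n \<Longrightarrow> bd P k (\<lambda>a. Xv r * v a)" by auto
    have "P \<noteq> {..n}" using P(3) Suc.prems by auto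
    then obtain q where q: "q \<le> n" "q \<notin> P" using P(2) by auto
    have finP: "finite P" using P(2) finite_subset by auto
    obtain u' where u': "vec (Suc k) u'" "\<And>a. a < b k \<Longrightarrow> Xv q * v a - app k u' a \<in> var_ideal P"
      using v(3)[OF q(1)] by (auto simp: bd_def)
    \<comment> \<open>The differential and \<open>v\<close> are homogeneous and
      \<open>var_ideal\<close> is a graded ideal, so a preimage may be replaced by its component of
      the right degree.\<close>
    define u where "u a = hom_comp j (u' a)" for a
    have uf: "u a \<in> forms n j" if "a < b (Suc k)" for a using u'(1) that by (simp add: u_def vec_def)
    then have u: "vec (Suc k) u" by (auto simp: vec_def forms_def)
    have ue: "Xv q * v a - app k u a \<in> var_ideal P" if a: "a < b k" for a
    proof -
      have "hom_comp (Suc (dg k)) (D k a c * u' c) = D k a c * u c" if c: "c < b (Suc k)" for c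
      proof (cases k)
        case 0
        then show ?thesis using D0[of c] c a b0 by (simp add: hom_comp_form_mult[of _ n 2] dg_def u_def)
      next
        case (Suc k')
        then show ?thesis using DS[of a k' c] c a j by (simp add: hom_comp_form_mult[of _ n 1] dg_def u_def)
      qed
      then have "hom_comp (Suc (dg k)) (app k u' a) = app k u a" by (simp add: app_def hom_comp_sum)
      moreover have "hom_comp (Suc (dg k)) (Xv q * v a) = Xv q * v a"
        using forms_mult[OF forms_Xv[OF q(1)] v(1)[OF a]] by (simp add: hom_comp_form)
      ultimately show ?thesis using var_ideal_hom_comp[OF u'(2)[OF a], of "Suc (dg k)"] by (simp add: hom_comp_diff)
    qed
    \<comment> \<open>Injectivity of the connecting map: a bounding chain of \<open>u\<close> modulo
      \<open>X_q\<close> differs from \<open>u\<close> by \<open>Xv q * y'\<close> up to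
      \<open>P\<close>, and after cancelling \<open>X_q\<close> the chain \<open>y'\<close> bounds
      \<open>v\<close>.\<close>
    have "\<not> bd (insert q P) (Suc k) u"
    proof
      assume "bd (insert q P) (Suc k) u"
      then obtain y where y: "vec (Suc (Suc k)) y" "\<And>a. a < b (Suc k) \<Longrightarrow> u a - app (Suc k) y a \<in> var_ideal (insert q P)"
        by (auto simp: bd_def)
      have "vec (Suc k) (\<lambda>a. u a - app (Suc k) y a)" using u app_vec[OF y(1)] by (simp add: vec_def)
      from vec_split[OF this y(2) q(1)] obtain x y' where
        x: "\<And>a. a < b (Suc k) \<Longrightarrow> x a \<in> var_ideal P" "vec (Suc k) y'"
        "\<And>a. a < b (Suc k) \<Longrightarrow> u a - app (Suc k) y a = x a + Xv q * y' a" by blast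
      have "v a - app k y' a \<in> var_ideal P" if a: "a < b k" for a
      proof -
        have "app k (\<lambda>c. u c - app (Suc k) y c) a = app k (\<lambda>c. x c + Xv q * y' c) a"
          using x(3) by (intro app_cong) auto
        then have "app k u a = app k x a + Xv q * app k y' a"
          using app_app[OF y(1) a] by (simp add: app_diff app_add app_scale)
        then have "Xv q * (v a - app k y' a) = (Xv q * v a - app k u a) + app k x a" by (simp add: algebra_simps)
        moreover have "\<dots> \<in> var_ideal P" by (intro var_ideal_add ue a app_var_ideal x)
        ultimately show ?thesis using var_ideal_cancel q(2) by metis
      qed
      then show False using v(2) x(2) by (auto simp: bd_def)
    qed
    \<comment> \<open>\<open>Xv r * u\<close> and \<open>Xv q * w\<close> have congruent
      differentials, where \<open>w\<close> bounds \<open>Xv r * v\<close>; exactness modulo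
      \<open>P\<close> makes their difference a boundary.\<close>
    moreover have "bd (insert q P) (Suc k) (\<lambda>a. Xv r * u a)" if r: "r \<le> n" for r
    proof -
      obtain w where w: "vec (Suc k) w" "\<And>a. a < b k \<Longrightarrow> Xv r * v a - app k w a \<in> var_ideal P"
        using v(3)[OF r] by (auto simp: bd_def)
      show ?thesis unfolding bd_def
      proof (rule ex_mod_lift[OF P(4) q(1) _ w(1)])
        show "vec (Suc k) (\<lambda>a. Xv r * u a)" using u r by (simp add: vec_def)
        fix a assume a: "a < b k"
        have "Xv q * (Xv r * v a - app k w a) - Xv r * (Xv q * v a - app k u a) \<in> var_ideal P"
          by (intro var_ideal_diff var_ideal_mult w ue a)
        then show "app k (\<lambda>a. Xv r * u a) a - Xv q * app k w a \<in> var_ideal P"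
          by (simp add: app_scale algebra_simps)
      qed auto
    qed
    moreover have "ex_mod (insert q P) i" if "i \<ge> Suc k" for i
      using ex_mod_step[OF P(4) P(4) q(2) q(1), of "i - 1"] that by simp
    moreover have "p \<in> insert q P" "insert q P \<subseteq> {..n}" "card (insert q P) = Suc (Suc k)"
      using P q finP by auto
    moreover have "u a \<in> forms n (dg (Suc k))" if "a < b (Suc k)" for a using uf[OF that] by (simp add: dg_def)
    ultimately show ?case by blast
  qed
  \<comment> \<open>With all variables killed, entries of positive degree vanish, so the last
    element is the zero boundary.\<close>
  from claim[of n] obtain P v where P: "P \<subseteq> {..n}" "card P = Suc n" and
    v: "\<And>a. a < b n \<Longrightarrow> v a \<in> forms n (dg n)" "\<not> bd P n v" by blast
  have "P = {..n}" using P card_subset_eq[of "{..n}" P] by simp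
  have "v a \<in> var_ideal P" if "a < b n" for a
    unfolding var_ideal_def
  proof (intro CollectI ballI)
    fix m assume "m \<in> keys (v a)"
    then have "mdeg m = dg n" "keys m \<subseteq> P"
      using v(1)[OF that] \<open>P = {..n}\<close> by (auto simp: forms_def polys_def)
    moreover from this(1) j have "keys m \<noteq> {}" by (auto simp: dg_def split: if_splits)
    ultimately show "keys m \<inter> P \<noteq> {}" by blast
  qed
  then have "bd P n v"
    unfolding bd_def by (intro exI[of _ "\<lambda>_. 0"]) (simp add: vec_def app_def)
  with v(2) show False by blast
qed

end


section \<open>Dimension counts and the Hilbert polynomial\<close>

section \<open>Dimensions\<close>

lemma rank_nullity:
  assumes lin: "Vector_Spaces.linear s1 s2 f" and V: "module.subspace s1 V"
    and fin: "finite W" "V \<subseteq> module.span s1 W"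
  shows "vector_space.dim s1 V = vector_space.dim s1 {x \<in> V. f x = 0} + vector_space.dim s2 (f ` V)"
proof -
  interpret lf: Vector_Spaces.linear s1 s2 f by (rule lin)
  define N where "N = {x \<in> V. f x = 0}"
  have sN: "lf.vs1.subspace N"
    using V by (auto simp: N_def lf.vs1.subspace_def lf.add lf.scale lf.zero)
  obtain B0 where B0: "B0 \<subseteq> N" "lf.vs1.independent B0" "N \<subseteq> lf.vs1.span B0"
    by (rule lf.vs1.maximal_independent_subset)
  have "B0 \<subseteq> V" using B0(1) by (auto simp: N_def)
  from lf.vs1.maximal_independent_subset_extend[OF this B0(2)]
  obtain B where B: "B0 \<subseteq> B" "B \<subseteq> V" "lf.vs1.independent B" "V \<subseteq> lf.vs1.span B" by metis
  have finB: "finite B" using lf.vs1.independent_span_bound[OF fin(1) B(3)] B(2) fin(2) by blast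
  define C where "C = B - B0"
  have indC: "lf.vs1.independent C" using B(3) by (rule lf.vs1.independent_mono) (auto simp: C_def)
  have int: "x = 0" if x: "x \<in> lf.vs1.span C" "x \<in> lf.vs1.span B0" for x
  proof -
    have "lf.vs1.representation B x = lf.vs1.representation C x"
      by (rule lf.vs1.representation_extend[OF B(3) x(1)]) (auto simp: C_def)
    moreover have "lf.vs1.representation B x = lf.vs1.representation B0 x"
      by (rule lf.vs1.representation_extend[OF B(3) x(2) B(1)])
    ultimately have "lf.vs1.representation C x v = 0" for v
      using lf.vs1.representation_ne_zero[of C x v] lf.vs1.representation_ne_zero[of B0 x v] by (auto simp: C_def)
    then show ?thesis using lf.vs1.sum_nonzero_representation_eq[OF indC x(1)] by simp
  qed
  have spanC: "lf.vs1.span C \<subseteq> V"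
    using B(2) V by (intro lf.vs1.span_minimal) (auto simp: C_def)
  have inj: "inj_on f (lf.vs1.span C)"
  proof (subst lf.inj_on_iff_eq_0[OF lf.vs1.subspace_span], intro ballI impI)
    fix x assume "x \<in> lf.vs1.span C" "f x = 0"
    then have "x \<in> N" using spanC by (auto simp: N_def)
    then show "x = 0" using int B0(3) \<open>x \<in> lf.vs1.span C\<close> by blast
  qed
  have ind: "lf.vs2.independent (f ` C)" by (rule lf.independent_injective_image[OF indC inj])
  have cC: "card (f ` C) = card C"
    by (rule card_image) (rule inj_on_subset[OF inj lf.vs1.span_superset])
  have "f ` V \<subseteq> lf.vs2.span (f ` C)"
  proof -
    have "f ` V \<subseteq> f ` lf.vs1.span B" using B(4) by blast
    also have "\<dots> = lf.vs2.span (f ` B)" by (rule lf.span_image[symmetric])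
    also have "f ` B \<subseteq> insert 0 (f ` C)" using B0(1) by (auto simp: C_def N_def)
    then have "lf.vs2.span (f ` B) \<subseteq> lf.vs2.span (f ` C)"
      by (metis lf.vs2.span_insert_0 lf.vs2.span_mono)
    finally show ?thesis .
  qed
  then have "lf.vs2.dim (f ` V) = card C"
    using B(2) ind cC by (intro lf.vs2.dim_unique[of "f ` C"]) (auto simp: C_def)
  moreover have "lf.vs1.dim N = card B0" by (rule lf.vs1.dim_unique[OF B0(1) B0(3) B0(2) refl])
  moreover have "lf.vs1.dim V = card B" by (rule lf.vs1.dim_unique[OF B(2) B(4) B(3) refl])
  moreover have "card B = card B0 + card C"
    unfolding C_def using B(1) finB by (metis card_Diff_subset card_mono finite_subset le_add_diff_inverse)
  ultimately show ?thesis by (simp add: N_def)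
qed

lemma vector_space_smult: "vector_space (smult :: 'k::field \<Rightarrow> _)"
  by unfold_locales (simp_all add: smult_add_left smult_add_right)

interpretation mp: vector_space "pscale :: 'k::field \<Rightarrow> 'k mpol \<Rightarrow> 'k mpol"
  by (rule vector_space_pscale)

interpretation up: vector_space "smult :: 'k::field \<Rightarrow> 'k poly \<Rightarrow> 'k poly"
  by (rule vector_space_smult)

lemma finite_monomials: "finite {m :: nat \<Rightarrow>\<^sub>0 nat. keys m \<subseteq> {..n} \<and> mdeg m = l}"
proof (induction l)
  case 0
  have "{m :: nat \<Rightarrow>\<^sub>0 nat. keys m \<subseteq> {..n} \<and> mdeg m = 0} \<subseteq> {0}" by auto
  then show ?case by (rule finite_subset) simp
next
  case (Suc l)
  have "{m :: nat \<Rightarrow>\<^sub>0 nat. keys m \<subseteq> {..n} \<and> mdeg m = Suc l}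
     \<subseteq> (\<lambda>(i, m). single i 1 + m) ` ({..n} \<times> {m. keys m \<subseteq> {..n} \<and> mdeg m = l})"
  proof
    fix m :: "nat \<Rightarrow>\<^sub>0 nat" assume "m \<in> {m. keys m \<subseteq> {..n} \<and> mdeg m = Suc l}"
    then have m: "keys m \<subseteq> {..n}" "mdeg m = Suc l" by auto
    then have "keys m \<noteq> {}" by auto
    then obtain i where i: "i \<in> keys m" by blast
    then obtain m' where m': "m = single i 1 + m'" by (rule keys_monom_split)
    with m have "(i, m') \<in> {..n} \<times> {m. keys m \<subseteq> {..n} \<and> mdeg m = l}" by (auto simp: keys_monom_add)
    then show "m \<in> (\<lambda>(i, m). single i 1 + m) ` ({..n} \<times> {m. keys m \<subseteq> {..n} \<and> mdeg m = l})"
      using m' by force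
  qed
  then show ?case by (rule finite_subset) (use Suc in auto)
qed

lemma pscale_single: "pscale c (single m x) = single m (c * x)"
  by (simp add: pscale_def mult_single)

lemma forms_span:
  "forms n l \<subseteq> mp.span ((\<lambda>m. single m 1) ` {m. keys m \<subseteq> {..n} \<and> mdeg m = l})"
proof
  fix F :: "'a mpol" assume F: "F \<in> forms n l"
  have "(\<Sum>m\<in>keys F. pscale (lookup F m) (single m 1)) \<in> mp.span ((\<lambda>m. single m 1) ` {m. keys m \<subseteq> {..n} \<and> mdeg m = l})"
    using F by (intro mp.span_sum mp.span_scale mp.span_base) (auto simp: forms_def polys_def)
  then show "F \<in> mp.span ((\<lambda>m. single m 1) ` {m. keys m \<subseteq> {..n} \<and> mdeg m = l})"
    by (simp add: pscale_single mpol_sum_singles)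
qed

lemma forms_pscale: "F \<in> forms n l \<Longrightarrow> pscale c F \<in> forms n l"
  by (simp add: pscale_def)

lemma forms_subspace: "mp.subspace (forms n l)"
  by (auto simp: mp.subspace_def pscale_def)

lemma lookup_pscale: "lookup (pscale c F) m = c * lookup F m"
  by (simp add: pscale_def lookup_mult_keys cong: if_cong) (simp add: in_keys_iff)

lemma single_eq_single_iff: "single i (Suc 0) = single j (Suc 0) \<longleftrightarrow> i = j"
  by (metis keys_single One_nat_def n_not_Suc_n singleton_inject)

lemma dim_forms_1: "mp.dim (forms n 1 :: 'k::field mpol set) = Suc n"
proof (rule mp.dim_unique)
  let ?B = "Xv ` {..n} :: 'k mpol set"
  show "?B \<subseteq> forms n 1" by auto
  have "(\<lambda>m. single m 1) ` {m :: nat \<Rightarrow>\<^sub>0 nat. keys m \<subseteq> {..n} \<and> mdeg m = 1} \<subseteq> ?B"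
    by (auto simp: mdeg_eq_1_iff Xv_def)
  then show "forms n 1 \<subseteq> mp.span ?B" using forms_span[of n 1] mp.span_mono by blast
  have inj: "inj_on (Xv :: nat \<Rightarrow> 'k mpol) {..n}"
  proof (rule inj_onI)
    fix i j assume "Xv i = (Xv j :: 'k mpol)"
    then have "keys (Xv i :: 'k mpol) = keys (Xv j :: 'k mpol)" by simp
    then show "i = j" by (simp add: Xv_def single_eq_single_iff)
  qed
  then show "card ?B = Suc n" by (simp add: card_image)
  show "mp.independent ?B"
  proof (rule mp.independent_if_scalars_zero)
    fix f :: "'k mpol \<Rightarrow> 'k" and x assume f: "(\<Sum>x\<in>?B. pscale (f x) x) = 0" and x: "x \<in> ?B"
    then obtain i where i: "i \<le> n" "x = Xv i" by auto
    have "0 = lookup (\<Sum>x\<in>?B. pscale (f x) x) (single i 1)" using f by simp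
    also have "\<dots> = (\<Sum>j\<le>n. f (Xv j) * (if j = i then 1 else 0))"
      unfolding sum.reindex[OF inj] lookup_sum
      by (rule sum.cong) (auto simp: lookup_pscale Xv_def lookup_single when_def single_eq_single_iff)
    also have "\<dots> = f x" using i by (simp add: if_distrib cong: if_cong)
    finally show "f x = 0" by simp
  qed simp
qed

text \<open>Phrased by coefficients so that \<open>deg_lt 0\<close> is the zero space, as required
  for bundles of negative degree.\<close>

definition deg_lt :: "nat \<Rightarrow> 'k::field poly set" where
  "deg_lt N = {p. \<forall>i\<ge>N. coeff p i = 0}"

lemma degree_less_if_deg_lt: assumes "q \<in> deg_lt N" "q \<noteq> 0" shows "degree q < N"
proof (rule ccontr)
  assume "\<not> degree q < N"
  then have "lead_coeff q = 0" using assms(1) by (simp add: deg_lt_def)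
  with assms(2) show False by simp
qed

lemma dim_mult_deg_lt:
  fixes G :: "'k::field poly"
  assumes G: "G \<noteq> 0" shows "up.dim ((*) G ` deg_lt N) = N"
proof -
  let ?B = "(\<lambda>i. G * monom 1 i) ` {..<N}"
  have inj: "inj_on (\<lambda>i. G * monom 1 i) {..<N}"
    using G by (auto intro!: inj_onI simp: monom_eq_iff')
  show ?thesis
  proof (rule up.dim_unique)
    show "?B \<subseteq> (*) G ` deg_lt N" by (auto simp: deg_lt_def)
    show "(*) G ` deg_lt N \<subseteq> up.span ?B"
    proof
      fix p assume "p \<in> (*) G ` deg_lt N"
      then obtain q where q: "q \<in> deg_lt N" "p = G * q" by auto
      have "q = (\<Sum>i<N. monom (coeff q i) i)"
        using q(1) by (auto simp: poly_eq_iff coeff_sum deg_lt_def)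
      then have "p = G * (\<Sum>i<N. monom (coeff q i) i)" using q(2) by argo
      then have "p = (\<Sum>i<N. smult (coeff q i) (G * monom 1 i))"
        by (simp add: sum_distrib_left smult_monom flip: mult_smult_right)
      also have "\<dots> \<in> up.span ?B" by (intro up.span_sum up.span_scale up.span_base) auto
      finally show "p \<in> up.span ?B" .
    qed
    show "card ?B = N" using inj by (simp add: card_image)
    show "up.independent ?B"
    proof (rule up.independent_if_scalars_zero)
      fix f x assume f: "(\<Sum>x\<in>?B. smult (f x) x) = 0" and x: "x \<in> ?B"
      then obtain i where i: "i < N" "x = G * monom 1 i" by auto
      have "0 = (\<Sum>j<N. smult (f (G * monom 1 j)) (G * monom 1 j))"
        using f by (simp add: sum.reindex[OF inj])
      also have "\<dots> = G * (\<Sum>j<N. monom (f (G * monom 1 j)) j)"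
        by (simp add: sum_distrib_left smult_monom flip: mult_smult_right)
      finally have "(\<Sum>j<N. monom (f (G * monom 1 j)) j) = 0" using G by simp
      then have "coeff (\<Sum>j<N. monom (f (G * monom 1 j)) j) i = 0" by simp
      then show "f x = 0" using i by (simp add: coeff_sum)
    qed simp
  qed
qed

text \<open>One element in each degree suffices, by elimination of leading coefficients.\<close>

lemma deg_lt_subset:
  assumes add: "\<And>p q. p \<in> A \<Longrightarrow> q \<in> A \<Longrightarrow> p + q \<in> A" and scale: "\<And>c p. p \<in> A \<Longrightarrow> smult c p \<in> A" and zero: "0 \<in> A"
    and deg: "\<And>i. i < N \<Longrightarrow> \<exists>p\<in>A. p \<noteq> 0 \<and> degree p = i"
  shows "deg_lt N \<subseteq> (A :: 'k::field poly set)"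
  using deg
proof (induction N)
  case 0
  have "p = 0" if "p \<in> deg_lt 0" for p :: "'k poly" using that by (auto simp: deg_lt_def poly_eq_iff)
  then show ?case using zero by auto
next
  case (Suc N)
  show ?case
  proof
    fix q :: "'k poly" assume q: "q \<in> deg_lt (Suc N)"
    obtain p where p: "p \<in> A" "p \<noteq> 0" "degree p = N" using Suc.prems by auto
    define c where "c = coeff q N / coeff p N"
    have "q - smult c p \<in> deg_lt N"
      unfolding deg_lt_def
    proof (intro CollectI allI impI)
      fix i assume "i \<ge> N"
      then show "coeff (q - smult c p) i = 0"
        using q p by (cases "i = N") (auto simp: deg_lt_def c_def coeff_eq_0 leading_coeff_neq_0)
    qed
    then have "q - smult c p \<in> A" using Suc by force
    from add[OF this scale[OF p(1), of c]] show "q \<in> A" by simp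
  qed
qed

section \<open>The Hilbert polynomial of a double rational normal curve\<close>

text \<open>A rational normal curve in its span, in an affine parameter: the linear forms
  \<open>\<Xi> i\<close> restrict to the powers of the parameter up to \<open>d\<close>. Hence forms
  of degree \<open>l\<close> restrict exactly to the polynomials of degree at most
  \<open>l * d\<close>.\<close>

locale param_curve =
  fixes n d :: nat and x :: "nat \<Rightarrow> 'k::field poly" and \<Xi> :: "nat \<Rightarrow> 'k mpol"
  assumes d: "d \<ge> 1" and deg_x: "i \<le> n \<Longrightarrow> degree (x i) \<le> d"
    and Xi: "i \<le> d \<Longrightarrow> \<Xi> i \<in> forms n 1" "i \<le> d \<Longrightarrow> ins pC x (\<Xi> i) = monom 1 i"
begin

abbreviation ev :: "'k mpol \<Rightarrow> 'k poly" where "ev \<equiv> ins pC x"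

lemmas ev_simps = chomD[OF chom_ins[OF chom_pCons], of x]

lemma ev_pscale: "ev (pscale c F) = smult c (ev F)"
  by (simp add: pscale_def ins_mult ins_const)

lemma linear_ev: "Vector_Spaces.linear pscale smult ev"
  by (unfold_locales) (simp_all add: ev_simps ev_pscale)

lemma degree_ev: assumes "F \<in> forms n l" shows "degree (ev F) \<le> l * d"
proof -
  have "degree (ev (single m c)) \<le> mdeg m * d" if "keys m \<subseteq> {..n}" for m c
  proof -
    have "degree (mval x m) \<le> (\<Sum>i\<in>keys m. lookup m i * d)"
      unfolding mval_def
    proof (rule order_trans[OF degree_prod_sum_le sum_mono])
      fix i assume "i \<in> keys m"
      then have "i \<le> n" using that by auto
      show "(degree \<circ> (\<lambda>i. x i ^ lookup m i)) i \<le> lookup m i * d"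
        using order_trans[OF degree_power_le mult_right_mono[OF deg_x[OF \<open>i \<le> n\<close>]], of "lookup m i"]
        by (simp add: mult.commute)
    qed simp
    then show ?thesis by (simp add: ins_single mdeg_def sum_distrib_right order_trans[OF degree_smult_le])
  qed
  note mon = this
  have "degree (\<Sum>m\<in>keys F. ev (single m (lookup F m))) \<le> l * d"
  proof (rule degree_sum_le)
    fix m assume "m \<in> keys F"
    then have "keys m \<subseteq> {..n}" "mdeg m = l" using assms by (auto simp: forms_def polys_def)
    then show "degree (ev (single m (lookup F m))) \<le> l * d" using mon[of m] by metis
  qed simp
  then show ?thesis by (simp add: mpol_sum_singles flip: ev_simps(8))
qed

lemma ev_monom: "e \<le> l * d \<Longrightarrow> \<exists>F\<in>forms n l. ev F = monom 1 e"
proof (induction l arbitrary: e)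
  case 0
  then show ?case by (intro bexI[of _ 1]) (auto simp: ins_one)
next
  case (Suc l)
  define k where "k = min e d"
  have "e - k \<le> l * d" using Suc.prems by (auto simp: k_def)
  then obtain F where F: "F \<in> forms n l" "ev F = monom 1 (e - k)" using Suc.IH by blast
  have "k \<le> d" "k + (e - k) = e" by (auto simp: k_def)
  then show ?case
    using F Xi[of k] by (intro bexI[of _ "\<Xi> k * F"]) (auto simp: ins_mult mult_monom intro!: forms_mult'[of _ n 1 _ l])
qed

lemma ev_surj: assumes "degree p \<le> l * d" shows "\<exists>F\<in>forms n l. ev F = p"
proof -
  have "\<forall>e. \<exists>F. e \<le> l * d \<longrightarrow> F \<in> forms n l \<and> ev F = monom 1 e" using ev_monom by blast
  then obtain F where F: "\<And>e. e \<le> l * d \<Longrightarrow> F e \<in> forms n l \<and> ev (F e) = monom 1 e" by metis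
  let ?F = "\<Sum>e\<le>degree p. single 0 (coeff p e) * F e"
  have "?F \<in> forms n l" using F assms by (intro forms_sum forms_const_mult) auto
  moreover have "ev ?F = (\<Sum>e\<le>degree p. smult (coeff p e) (monom 1 e))"
    using F assms by (auto simp: ev_simps ins_const intro!: sum.cong)
  then have "ev ?F = p" by (simp add: smult_monom poly_as_sum_of_monoms)
  ultimately show ?thesis by blast
qed

lemma ev_image: "ev ` forms n l = (*) 1 ` deg_lt (l * d + 1)"
proof -
  have "ev ` forms n l = {p. degree p \<le> l * d}" using degree_ev ev_surj by (auto simp: image_iff) metis
  also have "\<dots> = deg_lt (l * d + 1)"
  proof (intro equalityI subsetI)
    fix p :: "'k poly" assume "p \<in> deg_lt (l * d + 1)"
    then have "degree p \<le> l * d" by (intro degree_le) (auto simp: deg_lt_def)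
    then show "p \<in> {p. degree p \<le> l * d}" by simp
  qed (auto simp: deg_lt_def intro!: coeff_eq_0)
  finally show ?thesis by simp
qed

lemma ex_x_nonzero: "\<exists>p\<le>n. x p \<noteq> 0"
proof (rule ccontr)
  assume "\<not> ?thesis"
  then have "ev (\<Xi> 0) = ins pC (\<lambda>i. 0 * x i) (\<Xi> 0)"
    using Xi(1)[of 0] by (intro ins_cong[of _ n]) (auto simp: forms_def)
  also have "\<dots> = 0" using ins_homogeneous[OF Xi(1)[of 0], of pC 0 x] by simp
  finally show False using Xi(2)[of 0] by (simp add: monom_eq_0_iff)
qed

end

text \<open>The direction \<open>g\<close> is arbitrary: its degree is unrestricted and its normal
  part may have zeros. All that remains of the surjectivity of the conormal map is
  \<open>nz\<close>, that this part is not identically zero.\<close>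

locale double_curve = param_curve n d x \<Xi> for n d and x :: "nat \<Rightarrow> 'k::field poly" and \<Xi> +
  fixes g :: "nat \<Rightarrow> 'k poly"
  assumes n: "n = 2 * d"
    and lin: "linear_syzygies n (jet_ideal n x g)"
    and nz: "\<exists>l. \<exists>F\<in>forms n l. ins pC x F = 0 \<and> dd pC x g F \<noteq> 0"
begin

abbreviation Q :: "'k mpol \<Rightarrow> 'k poly" where "Q \<equiv> dd pC x g"
abbreviation "J \<equiv> jet_ideal n x g"

definition I :: "nat \<Rightarrow> 'k mpol set" where "I l = {F \<in> forms n l. ev F = 0}"
definition A :: "nat \<Rightarrow> 'k poly set" where "A l = Q ` I l"

lemma Q_pscale: "Q (pscale c F) = smult c (Q F)"
  by (simp add: pscale_def dd_const_mult)

lemma linear_Q: "Vector_Spaces.linear pscale smult Q"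
  by (unfold_locales) (simp_all add: dd_add Q_pscale)

lemma I_mult: "F \<in> I l \<Longrightarrow> H \<in> forms n k \<Longrightarrow> H * F \<in> I (k + l)" "F \<in> I l \<Longrightarrow> Q (H * F) = ev H * Q F"
  by (auto simp: I_def ins_mult dd_mult intro: forms_mult)

lemma A_mult: "p \<in> A l \<Longrightarrow> degree r \<le> k * d \<Longrightarrow> r * p \<in> A (k + l)"
  using I_mult ev_surj[of r k] unfolding A_def by (auto simp: image_iff) metis

lemma A_add: "p \<in> A l \<Longrightarrow> q \<in> A l \<Longrightarrow> p + q \<in> A l"
proof -
  assume "p \<in> A l" "q \<in> A l"
  then obtain F H where "F \<in> I l" "H \<in> I l" "p = Q F" "q = Q H" by (auto simp: A_def)
  then show ?thesis by (auto simp: A_def I_def dd_add ev_simps intro!: image_eqI[of _ Q "F + H"])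
qed

lemma A_smult: "p \<in> A l \<Longrightarrow> smult c p \<in> A l"
  using A_mult[of p l "[:c:]" 0] by simp

lemma A_zero: "0 \<in> A l"
  unfolding A_def by (rule image_eqI[of _ _ 0]) (auto simp: I_def)

lemma A_mono: "p \<in> A l \<Longrightarrow> l \<le> l' \<Longrightarrow> p \<in> A l'"
  using A_mult[of p l 1 "l' - l"] by simp

lemma I_subspace: "mp.subspace (I l)"
  by (auto simp: mp.subspace_def I_def ev_simps ev_pscale forms_pscale)

lemma J_form: "F \<in> forms n l \<Longrightarrow> F \<in> J \<longleftrightarrow> F \<in> I l \<and> Q F = 0"
  by (simp add: jet_ideal_form_iff I_def)

lemma dim_I: "mp.dim (forms n l :: 'k mpol set) = mp.dim (I l) + (l * d + 1)"
  unfolding I_def ev_image[symmetric, of l]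
  using rank_nullity[OF linear_ev forms_subspace[of n l] _ forms_span] finite_monomials[of n l]
    dim_mult_deg_lt[of 1 "l * d + 1"] ev_image[of l] by simp

lemma dim_A: "mp.dim (I l) = mp.dim (J \<inter> forms n l) + up.dim (A l)"
proof -
  have "I l \<subseteq> mp.span ((\<lambda>m. single m 1) ` {m. keys m \<subseteq> {..n} \<and> mdeg m = l})"
    using forms_span[of n l] by (auto simp: I_def)
  moreover have "{F \<in> I l. Q F = 0} = J \<inter> forms n l" using J_form by (auto simp: I_def)
  ultimately show ?thesis
    using rank_nullity[OF linear_Q I_subspace[of l] finite_imageI[OF finite_monomials]] by (simp add: A_def)
qed

lemma hilbert: "hilbert_function n J l = int (l * d + 1 + up.dim (A l))"
  using dim_I[of l] dim_A[of l] by (simp add: hilbert_function_def)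

lemma J_linear_forms: "J \<inter> forms n 1 = {0}"
  using linear_syzygies_low_degree[OF lin, of _ 1] hom_comp_form[of _ n 1 1] by force

text \<open>There are \<open>2 * d + 1\<close> linear forms, restricting onto polynomials of degree
  at most \<open>d\<close>; \<open>d\<close> of them vanish on the curve, and none is lost in
  \<open>J\<close>.\<close>

lemma dim_A_1: "up.dim (A 1) = d"
proof -
  have "mp.dim ({0} :: 'k mpol set) = 0"
    by (rule mp.dim_unique[of "{}"]) (auto simp: mp.independent_empty)
  then have "mp.dim (J \<inter> forms n 1) = 0" by (simp only: J_linear_forms)
  then show ?thesis
    using dim_I[of 1] dim_A[of 1] dim_forms_1[of n, where 'k = 'k] n by linarith
qed

definition M :: nat where "M = Max ((\<lambda>i. degree (g i)) ` {..n})"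

lemma degree_Q: assumes "F \<in> forms n l" shows "degree (Q F) \<le> l * d + M"
proof -
  have M: "degree (g i) \<le> M" if "i \<le> n" for i using that unfolding M_def by (intro Max_ge) auto
  have "degree (Q (single m c)) \<le> mdeg m * d + M \<and> keys m \<subseteq> {..n}" if "keys m \<subseteq> {..n}" for m c
    using that
  proof (induction "mdeg m" arbitrary: m)
    case 0
    then show ?case by simp
  next
    case (Suc k)
    then have "keys m \<noteq> {}" by auto
    then obtain i where i: "i \<in> keys m" by blast
    then obtain m' where m': "m = single i 1 + m'" by (rule keys_monom_split)
    have m'k: "k = mdeg m'" "keys m' \<subseteq> {..n}" "i \<le> n" using Suc.hyps(2) Suc.prems m' i by (auto simp: keys_monom_add)
    have "Q (single m c) = x i * Q (single m' c) + g i * ev (single m' c)"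
      using m' by (simp add: single_Xv_mult dd_mult ins_Xv del: One_nat_def)
    moreover have "degree (x i * Q (single m' c)) \<le> d + (mdeg m' * d + M)"
      using Suc.hyps(1)[OF m'k(1,2)] deg_x[OF m'k(3)] by (intro order_trans[OF degree_mult_le] add_mono) auto
    moreover have "degree (g i * ev (single m' c)) \<le> M + mdeg m' * d"
      using M[OF m'k(3)] degree_ev[OF forms_single[OF m'k(2) refl]] by (intro order_trans[OF degree_mult_le] add_mono) auto
    moreover have "mdeg m = Suc (mdeg m')" using m' by simp
    ultimately show ?case using Suc.prems by (auto intro!: degree_add_le)
  qed
  note mon = this
  have "degree (\<Sum>m\<in>keys F. Q (single m (lookup F m))) \<le> l * d + M"
  proof (rule degree_sum_le)
    fix m assume "m \<in> keys F"
    then have "keys m \<subseteq> {..n}" "mdeg m = l" using assms by (auto simp: forms_def polys_def)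
    then show "degree (Q (single m (lookup F m))) \<le> l * d + M" using mon[of m] by metis
  qed simp
  then show ?thesis by (simp add: mpol_sum_singles flip: dd_sum[OF chom_pCons])
qed

text \<open>The values of \<open>Q\<close> on the ideal of the curve are the multiples of a polynomial \<open>G\<close>, with
  bounds on the degrees; after division by \<open>G\<close> they become sections without common zeros of a line
  bundle of degree \<open>M - t\<close>, twisted by \<open>l\<close>.  The linear resolution forces the degree to be -1.\<close>

lemma ex_G: "\<exists>G. G \<noteq> 0 \<and> (\<exists>l. G \<in> A l) \<and> (\<forall>l. \<forall>p\<in>A l. G dvd p)"
proof -
  define S where "S = {p. p \<noteq> 0 \<and> (\<exists>l. p \<in> A l)}"
  obtain l F where "F \<in> forms n l" "ev F = 0" "Q F \<noteq> 0" using nz by blast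
  then have "F \<in> I l" "Q F \<noteq> 0" by (auto simp: I_def)
  then have "Q F \<in> S" unfolding S_def A_def by blast
  then obtain G where G: "G \<in> S" "\<And>p. p \<in> S \<Longrightarrow> degree G \<le> degree p"
    using arg_min_nat_lemma[of "\<lambda>p. p \<in> S" "Q F" degree] \<open>Q F \<in> S\<close> by blast
  then obtain l0 where l0: "G \<noteq> 0" "G \<in> A l0" by (auto simp: S_def)
  have "G dvd p" if p: "p \<in> A l" for l p
  proof (rule ccontr)
    assume nd: "\<not> G dvd p"
    \<comment> \<open>Division of \<open>p\<close> by \<open>G\<close> takes place inside the sets
      \<open>A\<close>: multiplication by the quotient is possible at the price of raising the
      degree by \<open>k\<close>, chosen so that \<open>p\<close> also fits into the common
      degree.\<close>
    define k where "k = l + degree (p div G)"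
    have "k \<le> k * d" using d by (cases d) auto
    moreover have "degree (- (p div G)) \<le> k" by (simp add: k_def)
    ultimately have "degree (- (p div G)) \<le> k * d" by linarith
    then have "- (p div G) * G \<in> A (k + l0)" by (intro A_mult l0)
    moreover have "p \<in> A (k + l0)" using p by (rule A_mono) (simp add: k_def)
    ultimately have "p + - (p div G) * G \<in> A (k + l0)" by (intro A_add)
    moreover have "p + - (p div G) * G = p mod G" by (simp add: minus_div_mult_eq_mod[symmetric])
    moreover have "p mod G \<noteq> 0" using nd by (simp add: dvd_eq_mod_eq_0)
    ultimately have "p mod G \<in> S" by (auto simp: S_def)
    then show False using G(2)[of "p mod G"] degree_mod_less'[OF l0(1) \<open>p mod G \<noteq> 0\<close>] by simp
  qed
  with l0 show ?thesis by blast
qed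

theorem hilbert_polynomial: "has_hilbert_polynomial n J [:1, 2 * of_nat d:]"
proof -
  obtain G l0 where G: "G \<noteq> 0" "G \<in> A l0" "\<And>l p. p \<in> A l \<Longrightarrow> G dvd p" using ex_G by blast
  \<comment> \<open>\<open>m\<close> is the order of vanishing at infinity of \<open>p\<close>,
    regarded as a section of degree \<open>l * d + M\<close>.\<close>
  define gap where "gap m \<longleftrightarrow> (\<exists>l. \<exists>p\<in>A l. p \<noteq> 0 \<and> degree p + m = l * d + M)" for m
  have degA: "degree p \<le> l * d + M" if "p \<in> A l" for p l
    using that degree_Q by (auto simp: A_def I_def)
  have "gap (l0 * d + M - degree G)" unfolding gap_def using G(1,2) degA[OF G(2)] by (intro exI bexI[OF _ G(2)]) auto
  then have g0: "gap (LEAST m. gap m)" and gmin: "\<And>m. gap m \<Longrightarrow> (LEAST m. gap m) \<le> m"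
    by (rule LeastI) (rule Least_le)
  define m0 where "m0 = (LEAST m. gap m)"
  \<comment> \<open>The degree of the common zeros: \<open>degree G\<close> in the affine part and
    \<open>m0\<close> at infinity. Dividing them out leaves sections of degree
    \<open>l * d + M - t\<close>, and \<open>N l\<close> is the dimension of that space, truncated
    at 0.\<close>
  define t where "t = degree G + m0"
  define N where "N l = l * d + M + 1 - t" for l
  define U where "U l = (*) G ` deg_lt (N l)" for l
  have AU: "A l \<subseteq> U l" for l
  proof
    fix p assume p: "p \<in> A l"
    then obtain q where q: "p = G * q" using G(3)[OF p] unfolding dvd_def by blast
    have "q \<in> deg_lt (N l)"
    proof (cases "q = 0")
      case False
      then have "p \<noteq> 0" using q G(1) by simp
      then have "gap (l * d + M - degree p)" unfolding gap_def using p degA[OF p] by (intro exI bexI[OF _ p]) auto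
      then have "m0 \<le> l * d + M - degree p" unfolding m0_def by (rule gmin)
      then have "degree q + t \<le> l * d + M" using degA[OF p] q G(1) False by (simp add: t_def degree_mult_eq)
      then show ?thesis by (auto simp: deg_lt_def N_def intro!: coeff_eq_0)
    qed (simp add: deg_lt_def)
    then show "p \<in> U l" using q by (auto simp: U_def)
  qed
  have U_mult: "r * p \<in> U (k + l)" if pU: "p \<in> U l" and r: "degree r \<le> k * d" for r p k l
  proof -
    obtain q where q: "p = G * q" "q \<in> deg_lt (N l)" using pU by (auto simp: U_def)
    have "r * q \<in> deg_lt (N (k + l))"
    proof (cases "q = 0")
      case False
      then have "degree q < N l" using degree_less_if_deg_lt q(2) by blast
      then have "degree (r * q) < N (k + l)"
        using degree_mult_le[of r q] r by (simp add: N_def algebra_simps)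
      then show ?thesis by (auto simp: deg_lt_def intro!: coeff_eq_0)
    qed (simp add: deg_lt_def)
    then show ?thesis using q(1) by (auto simp: U_def algebra_simps)
  qed
  \<comment> \<open>Two elements in one degree without further common zeros: \<open>G\<close> has
    only the common affine zeros, and \<open>G * q\<close> has minimal order at infinity.
    Multiplication by the power \<open>k * d\<close> of the parameter raises the degree without
    changing the order at infinity.\<close>
  obtain l1 q where l1: "G \<in> A l1" "G * q \<in> A l1" "q \<noteq> 0" "degree q + t = l1 * d + M"
  proof -
    obtain l' p where p: "p \<in> A l'" "p \<noteq> 0" "degree p + m0 = l' * d + M" using g0 unfolding m0_def gap_def by blast
    obtain q where q: "p = G * q" using G(3)[OF p(1)] unfolding dvd_def by blast
    have "q \<noteq> 0" using p q by auto
    define k where "k = max l0 l' - l'"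
    have "monom 1 (k * d) * p \<in> A (k + l')" by (intro A_mult p(1)) (simp add: degree_monom_le)
    moreover have "monom 1 (k * d) * p = G * (monom 1 (k * d) * q)" using q by simp
    moreover have kl: "k + l' = max l0 l'" by (simp add: k_def)
    ultimately have "G * (monom 1 (k * d) * q) \<in> A (max l0 l')" by simp
    moreover have "degree (monom 1 (k * d) * q) + t = max l0 l' * d + M"
      using p(3) q G(1) \<open>q \<noteq> 0\<close> by (simp add: degree_mult_eq t_def degree_monom_eq monom_eq_0_iff flip: kl) (simp add: algebra_simps)
    moreover have "G \<in> A (max l0 l')" using A_mono[OF G(2)] by simp
    ultimately show ?thesis using that[of "max l0 l'" "monom 1 (k * d) * q"] \<open>q \<noteq> 0\<close> by (simp add: monom_eq_0_iff)
  qed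
  \<comment> \<open>Low degrees are reached by multiples of \<open>G\<close>, the others by
    multiples of \<open>G * q\<close>; the two ranges overlap once \<open>l - l1\<close> is at least
    \<open>degree q\<close>.\<close>
  have big: "A l = U l" if l: "l \<ge> l1 + degree q" for l
  proof -
    define e where "e = l - l1"
    have e: "l = e + l1" "degree q \<le> e * d" using l d by (auto simp: e_def intro: order_trans[of _ "l - l1"])
    have "deg_lt (N l) \<subseteq> {r. G * r \<in> A l}"
    proof (rule deg_lt_subset)
      fix i assume i: "i < N l"
      show "\<exists>p\<in>{r. G * r \<in> A l}. p \<noteq> 0 \<and> degree p = i"
      proof (cases "i \<le> e * d")
        case True
        then have "monom 1 i * G \<in> A l" unfolding e(1) by (intro A_mult l1(1)) (simp add: degree_monom_eq)
        then show ?thesis by (intro bexI[of _ "monom 1 i"]) (auto simp: degree_monom_eq monom_eq_0_iff mult.commute)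
      next
        case False
        have "i - degree q \<le> e * d" using i l1(4) by (simp add: N_def e(1) algebra_simps)
        then have "monom 1 (i - degree q) * (G * q) \<in> A l"
          unfolding e(1) by (intro A_mult l1(2)) (simp add: degree_monom_eq)
        moreover have "degree (monom 1 (i - degree q) * q) = i"
          using False e(2) l1(3) by (simp add: degree_mult_eq degree_monom_eq monom_eq_0_iff)
        ultimately show ?thesis using l1(3)
          by (intro bexI[of _ "monom 1 (i - degree q) * q"]) (auto simp: monom_eq_0_iff algebra_simps)
      qed
    qed (auto simp: A_add A_zero A_smult distrib_left mult_smult_right)
    then show ?thesis using AU[of l] by (auto simp: U_def)
  qed
  have dimU: "up.dim (U l) = N l" for l unfolding U_def by (rule dim_mult_deg_lt[OF G(1)])
  have "M + 1 = t"
  proof (rule antisym)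
    \<comment> \<open>The \<open>d\<close>-dimensional space \<open>A 1\<close> lies in
      \<open>U 1\<close>.\<close>
    have "N 1 \<ge> d"
    proof -
      obtain B where B: "B \<subseteq> A 1" "up.independent B" "A 1 \<subseteq> up.span B" by (rule up.maximal_independent_subset)
      obtain C where C: "C \<subseteq> U 1" "up.independent C" "U 1 \<subseteq> up.span C" by (rule up.maximal_independent_subset)
      have "card C = N 1" using up.dim_unique[OF C(1,3,2) refl] dimU by simp
      have "card B = d" using up.dim_unique[OF B(1,3,2) refl] dim_A_1 by simp
      have "finite C"
      proof (cases "N 1 = 0")
        case True
        then have "q = 0" if "q \<in> deg_lt (N 1)" for q :: "'k poly"
          using that by (simp add: deg_lt_def poly_eq_iff)
        then have "U 1 \<subseteq> {0}" by (force simp: U_def)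
        with C(1) have "C \<subseteq> {0}" by blast
        then show ?thesis by (rule finite_subset) simp
      next
        case False
        then show ?thesis using \<open>card C = N 1\<close> card_ge_0_finite by force
      qed
      then have "card B \<le> card C" using up.independent_span_bound[OF _ B(2)] B(1) C(3) AU by blast
      then show ?thesis using \<open>card B = d\<close> \<open>card C = N 1\<close> by simp
    qed
    then show "t \<le> M + 1" using d by (simp add: N_def)
  next
    show "M + 1 \<le> t"
    proof (rule ccontr)
      assume "\<not> M + 1 \<le> t"
      then have "up.dim (A 1) \<noteq> up.dim (U 1)" using dimU dim_A_1 by (simp add: N_def)
      then have ne1: "A 1 \<noteq> U 1" by auto
      \<comment> \<open>The finitely many degrees in which some section does not lift to the ideal
        of the curve. In the last one, a section outside \<open>A j\<close> has all its products
        with the coordinates in \<open>A (Suc j)\<close>.\<close>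
      define T where "T = {l. A l \<noteq> U l}"
      have "T \<subseteq> {..l1 + degree q}" using big by (force simp: T_def)
      then have finT: "finite T" by (rule finite_subset) simp
      define j where "j = Max T"
      have "1 \<in> T" using ne1 by (simp add: T_def)
      then have "T \<noteq> {}" by blast
      then have j: "j \<in> T" "j \<ge> 1" "Suc j \<notin> T"
        using Max_in[OF finT] Max_ge[OF finT, of 1] Max_ge[OF finT, of "Suc j"] \<open>1 \<in> T\<close>
        by (auto simp: j_def)
      then obtain v where v: "v \<in> U j" "v \<notin> A j" using AU by (auto simp: T_def)
      have "\<exists>f\<in>I (Suc j). Q f = x i * v" if "i \<le> n" for i
      proof -
        have "x i * v \<in> U (1 + j)" using U_mult[OF v(1), of "x i" 1] deg_x[OF that] by simp
        then have "x i * v \<in> A (Suc j)" using j(3) by (simp add: T_def)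
        then show ?thesis by (auto simp: A_def)
      qed
      then obtain f where f: "\<And>i. i \<le> n \<Longrightarrow> f i \<in> I (Suc j)" "\<And>i. i \<le> n \<Longrightarrow> Q (f i) = x i * v" by metis
      \<comment> \<open>\<open>x p \<noteq> 0\<close> makes \<open>X_p\<close> a nonzerodivisor
        modulo \<open>J\<close>: it can be cancelled first from the value and then from the
        derivative.\<close>
      obtain p where p: "p \<le> n" "x p \<noteq> 0" using ex_x_nonzero by blast
      obtain b e gg D where res: "graded_free_resolution n J b e gg D"
        and gg: "\<And>c. c < b 0 \<Longrightarrow> gg c \<in> forms n 2" and D: "\<And>i a c. a < b i \<Longrightarrow> c < b (Suc i) \<Longrightarrow> D i a c \<in> forms n 1"
        and J: "J = {\<Sum>c<b 0. gg c * v c | v. v \<in> free_module n (b 0)}"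
        by (rule linear_syzygiesE[OF lin]) (rule that)
      interpret R: linear_resolution n J "\<lambda>i. case i of 0 \<Rightarrow> 1 | Suc i \<Rightarrow> b i"
        "\<lambda>i a c. case i of 0 \<Rightarrow> gg c | Suc i \<Rightarrow> D i a c"
      proof
        fix v :: "nat \<Rightarrow> 'k mpol" and i assume v: "v \<in> free_module n (case Suc i of 0 \<Rightarrow> 1 | Suc i \<Rightarrow> b i)"
        show "(\<forall>a<case i of 0 \<Rightarrow> 1 | Suc i \<Rightarrow> b i. (\<Sum>c<case Suc i of 0 \<Rightarrow> 1 | Suc i \<Rightarrow> b i. (case i of 0 \<Rightarrow> gg c | Suc i \<Rightarrow> D i a c) * v c) = 0) =
          (\<exists>w\<in>free_module n (case Suc (Suc i) of 0 \<Rightarrow> 1 | Suc i \<Rightarrow> b i). \<forall>a<case Suc i of 0 \<Rightarrow> 1 | Suc i \<Rightarrow> b i.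
              v a = (\<Sum>c<case Suc (Suc i) of 0 \<Rightarrow> 1 | Suc i \<Rightarrow> b i. (case Suc i of 0 \<Rightarrow> gg c | Suc i \<Rightarrow> D i a c) * w c))"
        proof (cases i)
          case 0
          have "(\<Sum>c<b 0. gg c * v c) = 0 \<longleftrightarrow> (\<exists>w\<in>free_module n (b 1). \<forall>a<b 0. v a = (\<Sum>c<b 1. D 0 a c * w c))"
            using res v 0 unfolding graded_free_resolution_def by simp
          then show ?thesis using 0 by simp
        next
          case (Suc k)
          have "(\<forall>a<b k. (\<Sum>c<b (Suc k). D k a c * v c) = 0) \<longleftrightarrow>
            (\<exists>w\<in>free_module n (b (Suc (Suc k))). \<forall>a<b (Suc k). v a = (\<Sum>c<b (Suc (Suc k)). D (Suc k) a c * w c))"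
            using res v Suc unfolding graded_free_resolution_def by simp
          then show ?thesis using Suc by simp
        qed
      qed (use gg D J in auto)
      \<comment> \<open>\<open>f p\<close> is a socle element modulo \<open>J\<close> and
        \<open>X_p\<close>, since \<open>Xv r * f p\<close> and \<open>Xv p * f r\<close> have the
        same derivative \<open>x r * x p * v\<close>. Were it trivial there, the cofactor of
        \<open>X_p\<close> would lift \<open>v\<close> itself.\<close>
      have "\<exists>h\<in>polys n. f p - Xv p * h \<in> J"
      proof (rule R.socle_lift[OF p(1) _ j(2)])
        fix F assume F: "F \<in> polys n" "Xv p * F \<in> J"
        have "ev (hom_comp l F) = 0 \<and> Q (hom_comp l F) = 0" for l
        proof -
          have "hom_comp (Suc l) (Xv p * F) = Xv p * hom_comp l F"
            by (subst hom_comp_form_mult[OF forms_Xv[OF p(1)]]) simp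
          then have "ev (Xv p * hom_comp l F) = 0" "Q (Xv p * hom_comp l F) = 0"
            using F(2) by (auto simp: jet_ideal_def) metis+
          then show ?thesis using p(2) by (simp add: ins_mult dd_mult ins_Xv)
        qed
        then show "F \<in> J" using F(1) by (simp add: jet_ideal_def)
      next
        show "f p \<in> forms n (Suc j)" using f(1)[OF p(1)] by (simp add: I_def)
      next
        fix r assume r: "r \<le> n"
        have fr: "f r \<in> forms n (Suc j)" "f p \<in> forms n (Suc j)" "ev (f r) = 0" "ev (f p) = 0"
          using f(1)[OF r] f(1)[OF p(1)] by (auto simp: I_def)
        have "Xv r * f p - Xv p * f r \<in> forms n (Suc (Suc j))"
          using fr r p by (intro forms_diff forms_mult'[of _ n 1 _ "Suc j"]) auto
        then have "Xv r * f p - Xv p * f r \<in> J"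
          using fr f(2)[OF r] f(2)[OF p(1)] by (simp add: jet_ideal_form_iff ev_simps ins_Xv dd_diff dd_mult)
        then show "\<exists>h\<in>polys n. Xv r * f p - Xv p * h \<in> J" using forms_polys[OF fr(1)] by blast
      qed
      then obtain h where h: "h \<in> polys n" "f p - Xv p * h \<in> J" by blast
      define h' where "h' = hom_comp j h"
      have h'f: "h' \<in> forms n j" using h by (simp add: h'_def)
      have fp: "f p \<in> forms n (Suc j)" "ev (f p) = 0" using f(1)[OF p(1)] by (auto simp: I_def)
      have "hom_comp (Suc j) (f p - Xv p * h) = f p - Xv p * h'"
        by (simp add: hom_comp_diff hom_comp_form[OF fp(1)] hom_comp_form_mult[OF forms_Xv[OF p(1)]] h'_def del: One_nat_def)
      then have "ev (f p - Xv p * h') = 0" "Q (f p - Xv p * h') = 0"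
        using h(2) by (auto simp: jet_ideal_def) metis+
      then have "ev h' = 0" "x p * v = x p * Q h'"
        using fp p(2) f(2)[OF p(1)] by (auto simp: ev_simps ins_Xv dd_diff dd_mult)
      then have "v = Q h'" "h' \<in> I j" using p(2) h'f by (auto simp: I_def)
      then show False using v(2) by (auto simp: A_def)
    qed
  qed
  then have "up.dim (A l) = l * d" if "l \<ge> l1 + degree q" for l
    using big[OF that] dimU[of l] by (simp add: N_def)
  then have "\<forall>l\<ge>l1 + degree q. of_int (hilbert_function n J l) = poly [:1, 2 * of_nat d:] (of_nat l :: rat)"
    by (auto simp: hilbert algebra_simps)
  then show ?thesis unfolding has_hilbert_polynomial_def by blast
qed

end


section \<open>Coordinates, regular functions and derivatives on projective space\<close>

section \<open>Coordinates adapted to a linear embedding\<close>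

definition unit_vec :: "nat \<Rightarrow> nat \<Rightarrow> 'k::field" where
  "unit_vec j = (\<lambda>i. if i = j then 1 else 0)"

lemma unit_vec_vecs: "j \<le> d \<Longrightarrow> unit_vec j \<in> vecs d"
  by (auto simp: unit_vec_def vecs_def)

lemma linear_embedding_zero: assumes "linear_embedding d n \<phi>" shows "\<phi> (\<lambda>_. 0) = (\<lambda>_. 0)"
proof -
  have "(\<lambda>_. 0) \<in> vecs d" by (simp add: vecs_def)
  moreover have "\<And>c x. x \<in> vecs d \<Longrightarrow> \<phi> (\<lambda>i. c * x i) = (\<lambda>i. c * \<phi> x i)"
    using assms by (simp add: linear_embedding_def)
  ultimately have "\<phi> (\<lambda>i. 0 * 0) = (\<lambda>i. 0 * \<phi> (\<lambda>_. 0) i)" by blast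
  then show ?thesis by simp
qed

lemma linear_embedding_sum:
  assumes emb: "linear_embedding d n \<phi>" and x: "x \<in> vecs d"
  shows "\<phi> x m = (\<Sum>j\<le>d. x j * \<phi> (unit_vec j) m)"
proof -
  have add: "\<And>x y. x \<in> vecs d \<Longrightarrow> y \<in> vecs d \<Longrightarrow> \<phi> (\<lambda>i. x i + y i) = (\<lambda>i. \<phi> x i + \<phi> y i)"
    and sc: "\<And>c x. x \<in> vecs d \<Longrightarrow> \<phi> (\<lambda>i. c * x i) = (\<lambda>i. c * \<phi> x i)"
    using emb by (auto simp: linear_embedding_def)
  note z = linear_embedding_zero[OF emb]
  have "\<phi> (\<lambda>i. \<Sum>j<k. x j * unit_vec j i) m = (\<Sum>j<k. x j * \<phi> (unit_vec j) m)" if "k \<le> Suc d" for k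
    using that
  proof (induction k)
    case 0
    then show ?case by (simp add: z)
  next
    case (Suc k)
    have 1: "(\<lambda>i. \<Sum>j<k. x j * unit_vec j i) \<in> vecs d"
      using Suc.prems by (auto simp: vecs_def unit_vec_def intro!: sum.neutral)
    have 2: "(\<lambda>i. x k * unit_vec k i) \<in> vecs d" using Suc.prems by (auto simp: vecs_def unit_vec_def)
    have "(unit_vec k :: nat \<Rightarrow> 'a) \<in> vecs d" using Suc.prems by (intro unit_vec_vecs) auto
    from fun_cong[OF sc[OF this, of "x k"], of m] fun_cong[OF add[OF 1 2], of m] show ?case
      using Suc by simp
  qed
  from this[of "Suc d"] have "\<phi> (\<lambda>i. \<Sum>j<Suc d. x j * unit_vec j i) m = (\<Sum>j\<le>d. x j * \<phi> (unit_vec j) m)"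
    by (simp only: order_refl lessThan_Suc_atMost)
  moreover have "(\<lambda>i. \<Sum>j<Suc d. x j * unit_vec j i) = x"
    using x by (auto simp: fun_eq_iff unit_vec_def vecs_def if_distrib cong: if_cong)
  ultimately show ?thesis by metis
qed

lemma form_1_sum: "F \<in> forms n 1 \<Longrightarrow> F = (\<Sum>m\<le>n. pscale (lookup F (single m 1)) (Xv m))"
proof (rule poly_mapping_eqI)
  fix k assume F: "F \<in> forms n 1"
  have "lookup (\<Sum>m\<le>n. pscale (lookup F (single m 1)) (Xv m)) k
      = (\<Sum>m\<le>n. if k = single m 1 then lookup F k else 0)"
    unfolding lookup_sum by (rule sum.cong) (auto simp: lookup_pscale Xv_def lookup_single when_def)
  also have "\<dots> = lookup F k"
  proof (cases "k \<in> keys F")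
    case True
    then have "mdeg k = Suc 0" "keys k \<subseteq> {..n}" using F by (auto simp: forms_def polys_def)
    then obtain i where "k = single i 1" "i \<le> n" by (auto simp: mdeg_eq_1_iff)
    then show ?thesis by (simp add: single_eq_single_iff cong: if_cong)
  qed (auto simp: in_keys_iff intro!: sum.neutral)
  finally show "lookup F k = lookup (\<Sum>m\<le>n. pscale (lookup F (single m 1)) (Xv m)) k" by simp
qed

text \<open>Vectors are encoded as linear forms, on which the vector space structure
  \<open>mp\<close> is available; the images of the unit vectors are independent by injectivity and
  extend to a basis. \<open>\<Lambda>\<close> holds the coordinates of the variables in this basis,
  hence is inverse to \<open>B\<close> on both sides.\<close>

lemma dual_basis:
  fixes \<phi> :: "(nat \<Rightarrow> 'k::field) \<Rightarrow> nat \<Rightarrow> 'k"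
  assumes emb: "linear_embedding d n \<phi>" and "d \<le> n"
  shows "\<exists>B \<Lambda> :: nat \<Rightarrow> nat \<Rightarrow> 'k. (\<forall>j\<le>d. B j = \<phi> (unit_vec j)) \<and> (\<forall>j\<le>n. B j \<in> vecs n) \<and>
     (\<forall>i\<le>n. \<forall>j\<le>n. (\<Sum>m\<le>n. \<Lambda> i m * B j m) = (if i = j then 1 else 0)) \<and>
     (\<forall>k\<le>n. \<forall>m\<le>n. (\<Sum>j\<le>n. B j k * \<Lambda> j m) = (if k = m then 1 else 0))"
proof -
  define a where "a j = \<phi> (unit_vec j)" for j
  have av: "a j \<in> vecs n" if "j \<le> d" for j
    using emb unit_vec_vecs[OF that] by (auto simp: linear_embedding_def a_def)
  have inj\<phi>: "inj_on \<phi> (vecs d)" using emb by (simp add: linear_embedding_def)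
  define A :: "nat \<Rightarrow> 'k mpol" where "A j = (\<Sum>m\<le>n. pscale (a j m) (Xv m))" for j
  have Af: "A j \<in> forms n 1" for j unfolding A_def by (intro forms_sum forms_pscale) auto
  have lA: "lookup (A j) (single m 1) = a j m" if "m \<le> n" for j m
  proof -
    have "lookup (A j) (single m 1) = (\<Sum>k\<le>n. if k = m then a j k else 0)"
      unfolding A_def lookup_sum
      by (rule sum.cong) (auto simp: lookup_pscale Xv_def lookup_single when_def single_eq_single_iff)
    then show ?thesis using that by simp
  qed
  have indep: "u j = 0" if u: "(\<Sum>j\<le>d. pscale (u j) (A j)) = 0" and j: "j \<le> d" for u j
  proof -
    define x where "x i = (if i \<le> d then u i else 0)" for i
    have x: "x \<in> vecs d" by (auto simp: x_def vecs_def)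
    have "\<phi> x m = 0" for m
    proof (cases "m \<le> n")
      case True
      have "\<phi> x m = (\<Sum>j\<le>d. u j * a j m)" unfolding linear_embedding_sum[OF emb x] by (simp add: x_def a_def)
      also have "\<dots> = lookup (\<Sum>j\<le>d. pscale (u j) (A j)) (single m 1)"
        by (simp add: lookup_sum lookup_pscale lA[OF True] del: One_nat_def)
      finally show ?thesis using u by simp
    next
      case False
      moreover have "\<phi> x \<in> vecs n" using emb x by (auto simp: linear_embedding_def)
      ultimately show ?thesis by (simp add: vecs_def)
    qed
    moreover note linear_embedding_zero[OF emb]
    ultimately have "\<phi> x = \<phi> (\<lambda>_. 0)" by auto
    then have "x = (\<lambda>_. 0)" using inj\<phi> x by (auto simp: inj_on_def vecs_def)
    then have "x j = 0" by simp
    then show ?thesis using j by (simp add: x_def)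
  qed
  have injA: "inj_on A {..d}"
  proof (rule inj_onI, rule ccontr)
    fix i j assume ij: "i \<in> {..d}" "j \<in> {..d}" "A i = A j" "i \<noteq> j"
    define u :: "nat \<Rightarrow> 'k" where "u k = (if k = i then 1 else 0) - (if k = j then 1 else 0)" for k
    have "(\<Sum>k\<le>d. pscale (u k) (A k)) = (\<Sum>k\<le>d. (if k = i then A k else 0) - (if k = j then A k else 0))"
      by (rule sum.cong) (auto simp: u_def pscale_def single_uminus)
    also have "\<dots> = 0" using ij by (simp add: sum_subtractf)
    finally show False using indep[of u i] ij by (simp add: u_def)
  qed
  have "mp.independent (A ` {..d})"
  proof (rule mp.independent_if_scalars_zero)
    fix f x assume f: "(\<Sum>x\<in>A ` {..d}. pscale (f x) x) = 0" and x: "x \<in> A ` {..d}"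
    then show "f x = 0" using indep[of "\<lambda>j. f (A j)"] by (auto simp: sum.reindex[OF injA])
  qed simp
  moreover have "A ` {..d} \<subseteq> forms n 1" using Af by auto
  ultimately obtain S where S: "A ` {..d} \<subseteq> S" "S \<subseteq> forms n 1" "mp.independent S" "forms n 1 \<subseteq> mp.span S"
    using mp.maximal_independent_subset_extend by metis
  have cS: "card S = Suc n" using mp.dim_unique[OF S(2,4,3) refl] dim_forms_1[of n, where 'k = 'k] by simp
  then have finS: "finite S" using card_ge_0_finite by force
  have "card (S - A ` {..d}) = n - d"
    using cS finS S(1) injA by (simp add: card_Diff_subset card_image)
  then obtain h where h: "bij_betw h {..<n - d} (S - A ` {..d})"
    using ex_bij_betw_nat_finite[of "S - A ` {..d}"] finS by (auto simp: atLeast0LessThan)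
  define b where "b j = (if j \<le> d then A j else h (j - d - 1))" for j
  have bS: "b j \<in> S" if "j \<le> n" for j
    using that S(1) bij_betwE[OF h] assms(2) by (force simp: b_def)
  have injb: "inj_on b {..n}"
  proof (rule inj_onI)
    fix i j assume ij: "i \<in> {..n}" "j \<in> {..n}" "b i = b j"
    have hA: "h (k - d - 1) \<notin> A ` {..d}" if "d < k" "k \<le> n" for k
      using bij_betwE[OF h] that by auto
    show "i = j"
    proof (cases "i \<le> d"; cases "j \<le> d")
      assume "i \<le> d" "j \<le> d"
      then show ?thesis using ij injA by (auto simp: b_def inj_on_def)
    next
      assume "\<not> i \<le> d" "\<not> j \<le> d"
      then have "i - d - 1 = j - d - 1"
        using ij h by (auto simp: b_def bij_betw_def inj_on_def)
      then show ?thesis using \<open>\<not> i \<le> d\<close> \<open>\<not> j \<le> d\<close> by simp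
    next
      assume "\<not> i \<le> d" "j \<le> d"
      then show ?thesis using hA[of i] ij by (auto simp: b_def)
    next
      assume "i \<le> d" "\<not> j \<le> d"
      then show ?thesis using hA[of j] ij by (auto simp: b_def) (metis atMost_iff imageI)
    qed
  qed
  have bimg: "b ` {..n} = S"
    using bS injb finS cS by (intro card_subset_eq) (auto simp: card_image)
  define B where "B j m = lookup (b j) (single m 1)" for j m
  define \<Lambda> where "\<Lambda> j m = mp.representation S (Xv m) (b j)" for j m
  have bf: "b j \<in> forms n 1" if "j \<le> n" for j using bS[OF that] S(2) by auto
  have Bv: "B j \<in> vecs n" if "j \<le> n" for j
  proof -
    have "single m 1 \<notin> keys (b j)" if "m > n" for m
      using bf[OF \<open>j \<le> n\<close>] that by (auto simp: forms_def polys_def)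
    then show ?thesis by (auto simp: vecs_def B_def in_keys_iff)
  qed
  have Ba: "B j = a j" if j: "j \<le> d" for j
  proof
    fix m
    show "B j m = a j m"
      using lA[of m j] av[OF j] Bv[of j] j assms(2)
      by (cases "m \<le> n") (auto simp: B_def b_def vecs_def)
  qed
  have Xs: "Xv m \<in> mp.span S" if "m \<le> n" for m using S(4) forms_Xv[OF that] by blast
  have 1: "(\<Sum>j\<le>n. B j k * \<Lambda> j m) = (if k = m then 1 else 0)" if km: "k \<le> n" "m \<le> n" for k m
  proof -
    have "(\<Sum>v\<in>S. pscale (mp.representation S (Xv m) v) v) = Xv m"
      by (rule mp.sum_representation_eq[OF S(3) Xs[OF km(2)] finS order_refl])
    then have "(\<Sum>j\<le>n. pscale (\<Lambda> j m) (b j)) = Xv m"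
      unfolding bimg[symmetric] sum.reindex[OF injb] by (simp add: \<Lambda>_def bimg)
    then have "lookup (\<Sum>j\<le>n. pscale (\<Lambda> j m) (b j)) (single k 1) = lookup (Xv m) (single k 1)" by simp
    then show ?thesis
      by (simp add: lookup_sum lookup_pscale B_def Xv_def lookup_single when_def single_eq_single_iff mult.commute eq_commute)
  qed
  have 2: "(\<Sum>m\<le>n. \<Lambda> i m * B j m) = (if i = j then 1 else 0)" if ij: "i \<le> n" "j \<le> n" for i j
  proof -
    have "mp.representation S (b j) = (\<lambda>v. \<Sum>m\<le>n. B j m * mp.representation S (Xv m) v)"
    proof -
      have "mp.representation S (b j) = mp.representation S (\<Sum>m\<le>n. pscale (B j m) (Xv m))"
        using form_1_sum[OF bf[OF ij(2)]] by (simp add: B_def)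
      also have "\<dots> = (\<lambda>v. \<Sum>m\<le>n. mp.representation S (pscale (B j m) (Xv m)) v)"
        using Xs by (intro mp.representation_sum[OF S(3)] mp.span_scale) auto
      also have "\<dots> = (\<lambda>v. \<Sum>m\<le>n. B j m * mp.representation S (Xv m) v)"
        using Xs by (intro ext sum.cong) (auto simp: mp.representation_scale[OF S(3)])
      finally show ?thesis .
    qed
    then have "(\<Sum>m\<le>n. \<Lambda> i m * B j m) = mp.representation S (b j) (b i)"
      by (simp add: \<Lambda>_def mult.commute)
    also have "\<dots> = (if i = j then 1 else 0)"
      using mp.representation_basis[OF S(3) bS[OF ij(2)]] injb ij by (auto simp: inj_on_def)
    finally show ?thesis .
  qed
  show ?thesis using Ba Bv 1 2 by (intro exI[of _ B] exI[of _ \<Lambda>]) (auto simp: a_def)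
qed

section \<open>Regular functions\<close>

definition basic_open :: "nat \<Rightarrow> 'k::field mpol \<Rightarrow> 'k pts" where
  "basic_open n K = {x \<in> proj_space n. peval K x \<noteq> 0}"

lemma zariski_open_basic: "K \<in> forms n k \<Longrightarrow> zariski_open n (basic_open n K)"
  unfolding zariski_open_def basic_open_def by (rule exI[of _ "{K}"]) auto

lemma zariski_open_sub: "zariski_open n U \<Longrightarrow> U \<subseteq> proj_space n"
  by (auto simp: zariski_open_def)

lemma zariski_open_basicE:
  assumes "zariski_open n U" "x \<in> U"
  obtains K k where "K \<in> forms n k" "peval K x \<noteq> 0" "basic_open n K \<subseteq> U"
proof -
  from assms obtain S K where "S \<subseteq> (\<Union>l. forms n l)" "U = {x \<in> proj_space n. \<exists>F\<in>S. peval F x \<noteq> 0}" "K \<in> S" "peval K x \<noteq> 0"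
    unfolding zariski_open_def by blast
  then show ?thesis using that[of K] by (auto simp: basic_open_def)
qed

lemma zariski_open_Int:
  assumes "zariski_open n U" "zariski_open n V" shows "zariski_open n (U \<inter> V)"
proof -
  define S where "S = {K \<in> (\<Union>l. forms n l). basic_open n K \<subseteq> U \<inter> V}"
  have "U \<inter> V = {x \<in> proj_space n. \<exists>F\<in>S. peval F x \<noteq> 0}"
  proof (intro equalityI subsetI)
    fix x assume x: "x \<in> U \<inter> V"
    obtain K k where K: "K \<in> forms n k" "peval K x \<noteq> 0" "basic_open n K \<subseteq> U" using zariski_open_basicE assms x by blast
    obtain K' k' where K': "K' \<in> forms n k'" "peval K' x \<noteq> 0" "basic_open n K' \<subseteq> V" using zariski_open_basicE assms x by blast
    have "K * K' \<in> S" using K K' forms_mult[OF K(1) K'(1)] by (auto simp: S_def basic_open_def)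
    then show "x \<in> {x \<in> proj_space n. \<exists>F\<in>S. peval F x \<noteq> 0}"
      using K K' x zariski_open_sub[OF assms(1)] by (auto intro!: bexI[of _ "K * K'"])
  qed (auto simp: S_def basic_open_def)
  moreover have "S \<subseteq> (\<Union>l. forms n l)" by (auto simp: S_def)
  ultimately show ?thesis unfolding zariski_open_def by blast
qed

lemma open_in_sub: "open_in n X V \<Longrightarrow> V \<subseteq> X"
  by (auto simp: open_in_def)

text \<open>\<open>f\<close> is represented by \<open>G/H\<close> near \<open>x\<close>, namely where \<open>K \<noteq> 0\<close>.\<close>

definition frac_at :: "nat \<Rightarrow> 'k::field pts \<Rightarrow> 'k fn \<Rightarrow> (nat \<Rightarrow> 'k) \<Rightarrow> 'k mpol \<Rightarrow> 'k mpol \<Rightarrow> 'k mpol \<Rightarrow> bool" where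
  "frac_at n V f x K G H \<longleftrightarrow> (\<exists>k. K \<in> forms n k) \<and> (\<exists>l. G \<in> forms n l \<and> H \<in> forms n l) \<and> peval K x \<noteq> 0 \<and>
     (\<forall>y\<in>V. peval K y \<noteq> 0 \<longrightarrow> peval H y \<noteq> 0 \<and> f y = peval G y / peval H y)"

lemma frac_atI:
  assumes "K \<in> forms n k" "G \<in> forms n l" "H \<in> forms n l" "peval K x \<noteq> 0"
    "\<And>y. y \<in> V \<Longrightarrow> peval K y \<noteq> 0 \<Longrightarrow> peval H y \<noteq> 0 \<and> f y = peval G y / peval H y"
  shows "frac_at n V f x K G H"
  using assms unfolding frac_at_def by metis

lemma frac_atE:
  assumes "frac_at n V f x K G H"
  obtains k l where "K \<in> forms n k" "G \<in> forms n l" "H \<in> forms n l" "peval K x \<noteq> 0"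
    "\<And>y. y \<in> V \<Longrightarrow> peval K y \<noteq> 0 \<Longrightarrow> peval H y \<noteq> 0" "\<And>y. y \<in> V \<Longrightarrow> peval K y \<noteq> 0 \<Longrightarrow> f y = peval G y / peval H y"
  using assms unfolding frac_at_def by metis

text \<open>Basic open sets form a base, so the neighbourhood in the definition may be given by the
  nonvanishing of a single form.\<close>

lemma regular_iff:
  assumes "V \<subseteq> proj_space n"
  shows "f \<in> regular_functions n V \<longleftrightarrow> (\<forall>x. x \<notin> V \<longrightarrow> f x = 0) \<and> (\<forall>x\<in>V. \<exists>K G H. frac_at n V f x K G H)"
proof
  assume f: "f \<in> regular_functions n V"
  have "\<exists>K G H. frac_at n V f x K G H" if "x \<in> V" for x
  proof -
    have "\<exists>W l. zariski_open n W \<and> x \<in> W \<and> (\<exists>G\<in>forms n l. \<exists>H\<in>forms n l.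
           \<forall>y\<in>W \<inter> V. peval H y \<noteq> 0 \<and> f y = peval G y / peval H y)"
      using f that by (simp add: regular_functions_def)
    then obtain W l where W1: "zariski_open n W" "x \<in> W" "\<exists>G\<in>forms n l. \<exists>H\<in>forms n l.
           \<forall>y\<in>W \<inter> V. peval H y \<noteq> 0 \<and> f y = peval G y / peval H y" by (elim exE conjE)
    from W1(3) obtain G H where "G \<in> forms n l" "H \<in> forms n l"
      "\<forall>y\<in>W \<inter> V. peval H y \<noteq> 0 \<and> f y = peval G y / peval H y" by (elim bexE)
    note W = W1(1,2) this
    obtain K k where K: "K \<in> forms n k" "peval K x \<noteq> 0" "basic_open n K \<subseteq> W"
      by (rule zariski_open_basicE[OF W(1,2)])
    have "y \<in> W \<inter> V" if "y \<in> V" "peval K y \<noteq> 0" for y using that K(3) assms by (auto simp: basic_open_def)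
    then have "frac_at n V f x K G H" using W(5) by (intro frac_atI[OF K(1) W(3,4) K(2)]) blast
    then show ?thesis by blast
  qed
  then show "(\<forall>x. x \<notin> V \<longrightarrow> f x = 0) \<and> (\<forall>x\<in>V. \<exists>K G H. frac_at n V f x K G H)"
    using f by (auto simp: regular_functions_def)
next
  assume f: "(\<forall>x. x \<notin> V \<longrightarrow> f x = 0) \<and> (\<forall>x\<in>V. \<exists>K G H. frac_at n V f x K G H)"
  have "\<exists>W l. zariski_open n W \<and> x \<in> W \<and> (\<exists>G\<in>forms n l. \<exists>H\<in>forms n l.
           \<forall>y\<in>W \<inter> V. peval H y \<noteq> 0 \<and> f y = peval G y / peval H y)" if "x \<in> V" for x
  proof -
    obtain K G H where fr: "frac_at n V f x K G H" using f \<open>x \<in> V\<close> by blast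
    from fr obtain k l where *: "K \<in> forms n k" "G \<in> forms n l" "H \<in> forms n l" "peval K x \<noteq> 0"
      "\<And>y. y \<in> V \<Longrightarrow> peval K y \<noteq> 0 \<Longrightarrow> peval H y \<noteq> 0" "\<And>y. y \<in> V \<Longrightarrow> peval K y \<noteq> 0 \<Longrightarrow> f y = peval G y / peval H y"
      by (rule frac_atE) (rule that)
    have "x \<in> basic_open n K" using \<open>x \<in> V\<close> assms *(4) by (auto simp: basic_open_def)
    moreover have "\<forall>y\<in>basic_open n K \<inter> V. peval H y \<noteq> 0 \<and> f y = peval G y / peval H y"
      using *(5,6) by (auto simp: basic_open_def)
    ultimately show ?thesis using zariski_open_basic[OF *(1)] *(2,3) by blast
  qed
  then show "f \<in> regular_functions n V" using f by (simp add: regular_functions_def)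
qed

lemma frac_at_sub: "frac_at n V f x K G H \<Longrightarrow> V' \<subseteq> V \<Longrightarrow> (\<And>y. y \<in> V' \<Longrightarrow> f' y = f y) \<Longrightarrow> frac_at n V' f' x K G H"
  by (auto simp: frac_at_def)

lemma frac_at_add:
  assumes "frac_at n V f x K G H" "frac_at n V f' x K' G' H'"
  shows "frac_at n V (\<lambda>y. f y + f' y) x (K * K') (G * H' + G' * H) (H * H')"
proof -
  obtain k l where 1: "K \<in> forms n k" "G \<in> forms n l" "H \<in> forms n l" using frac_atE[OF assms(1)] by metis
  obtain k' l' where 2: "K' \<in> forms n k'" "G' \<in> forms n l'" "H' \<in> forms n l'" using frac_atE[OF assms(2)] by metis
  show ?thesis
  proof (rule frac_atI)
    show "K * K' \<in> forms n (k + k')" "G * H' + G' * H \<in> forms n (l + l')" "H * H' \<in> forms n (l + l')"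
      using 1 2 by (auto intro!: forms_add forms_mult' simp: add.commute)
  qed (use assms in \<open>auto simp: frac_at_def add_frac_eq\<close>)
qed

lemma frac_at_mult:
  assumes "frac_at n V f x K G H" "frac_at n V f' x K' G' H'"
  shows "frac_at n V (\<lambda>y. f y * f' y) x (K * K') (G * G') (H * H')"
proof -
  obtain k l where 1: "K \<in> forms n k" "G \<in> forms n l" "H \<in> forms n l" using frac_atE[OF assms(1)] by metis
  obtain k' l' where 2: "K' \<in> forms n k'" "G' \<in> forms n l'" "H' \<in> forms n l'" using frac_atE[OF assms(2)] by metis
  show ?thesis
  proof (rule frac_atI)
    show "K * K' \<in> forms n (k + k')" "G * G' \<in> forms n (l + l')" "H * H' \<in> forms n (l + l')"
      using 1 2 by (auto intro!: forms_mult')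
  qed (use assms in \<open>auto simp: frac_at_def\<close>)
qed

lemma regular_add:
  assumes "V \<subseteq> proj_space n" "f \<in> regular_functions n V" "f' \<in> regular_functions n V"
  shows "(\<lambda>x. f x + f' x) \<in> regular_functions n V"
proof -
  have "\<exists>K G H. frac_at n V (\<lambda>x. f x + f' x) x K G H" if x: "x \<in> V" for x
  proof -
    obtain K G H K' G' H' where "frac_at n V f x K G H" "frac_at n V f' x K' G' H'"
      using assms x regular_iff[OF assms(1)] by meson
    from frac_at_add[OF this] show ?thesis by blast
  qed
  then show ?thesis using assms regular_iff[OF assms(1)] by auto
qed

lemma regular_mult:
  assumes "V \<subseteq> proj_space n" "f \<in> regular_functions n V" "f' \<in> regular_functions n V"
  shows "(\<lambda>x. f x * f' x) \<in> regular_functions n V"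
proof -
  have "\<exists>K G H. frac_at n V (\<lambda>x. f x * f' x) x K G H" if x: "x \<in> V" for x
  proof -
    obtain K G H K' G' H' where "frac_at n V f x K G H" "frac_at n V f' x K' G' H'"
      using assms x regular_iff[OF assms(1)] by meson
    from frac_at_mult[OF this] show ?thesis by blast
  qed
  then show ?thesis using assms regular_iff[OF assms(1)] by auto
qed

lemma regular_frac:
  assumes "V \<subseteq> proj_space n" "G \<in> forms n l" "H \<in> forms n l" "\<And>x. x \<in> V \<Longrightarrow> peval H x \<noteq> 0"
  shows "res V (\<lambda>x. peval G x / peval H x) \<in> regular_functions n V"
proof -
  have "frac_at n V (res V (\<lambda>x. peval G x / peval H x)) x 1 G H" if "x \<in> V" for x
    using assms that by (intro frac_atI[of 1 n 0 G l H]) (auto simp: res_def)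
  then show ?thesis unfolding regular_iff[OF assms(1)] by (auto simp: res_def)
qed

lemma regular_const: "V \<subseteq> proj_space n \<Longrightarrow> res V (\<lambda>_. c) \<in> regular_functions n V"
  using regular_frac[of V n "single 0 c" 0 1] by simp

lemma regular_zero: "V \<subseteq> proj_space n \<Longrightarrow> (\<lambda>_. 0) \<in> regular_functions n V"
  using regular_const[of V n 0] by (simp add: res_def)

lemma regular_uminus:
  assumes "V \<subseteq> proj_space n" "f \<in> regular_functions n V" shows "(\<lambda>x. - f x) \<in> regular_functions n V"
proof -
  have "(\<lambda>x. res V (\<lambda>_. -1) x * f x) = (\<lambda>x. - f x)"
    using assms(2) by (auto simp: res_def regular_functions_def)
  then show ?thesis using regular_mult[OF assms(1) regular_const[OF assms(1), of "-1"] assms(2)] by simp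
qed

lemma regular_res:
  assumes "V \<subseteq> proj_space n" "W \<subseteq> V" "f \<in> regular_functions n V" shows "res W f \<in> regular_functions n W"
proof -
  have "\<exists>K G H. frac_at n W (res W f) x K G H" if "x \<in> W" for x
  proof -
    have "x \<in> V" using assms that by auto
    then have "\<exists>K G H. frac_at n V f x K G H" using assms(3) regular_iff[OF assms(1), of f] by blast
    then obtain K G H where "frac_at n V f x K G H" by blast
    then have "frac_at n W (res W f) x K G H" by (rule frac_at_sub) (use assms in \<open>auto simp: res_def\<close>)
    then show ?thesis by blast
  qed
  then show ?thesis using regular_iff[of W n] assms by (auto simp: res_def)
qed

lemma regular_local:
  assumes V: "V \<subseteq> proj_space n" "\<And>x. x \<notin> V \<Longrightarrow> f x = 0"
    and loc: "\<And>x. x \<in> V \<Longrightarrow> \<exists>U. zariski_open n U \<and> x \<in> U \<and> res (U \<inter> V) f \<in> regular_functions n (U \<inter> V)"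
  shows "f \<in> regular_functions n V"
proof -
  have "\<exists>K G H. frac_at n V f x K G H" if x: "x \<in> V" for x
  proof -
    obtain U where U: "zariski_open n U" "x \<in> U" "res (U \<inter> V) f \<in> regular_functions n (U \<inter> V)" using loc x by blast
    have "U \<inter> V \<subseteq> proj_space n" using V by auto
    from regular_iff[OF this, of "res (U \<inter> V) f"] U x
    have "\<exists>K G H. frac_at n (U \<inter> V) (res (U \<inter> V) f) x K G H" by blast
    then obtain K G H where fr: "frac_at n (U \<inter> V) (res (U \<inter> V) f) x K G H" by blast
    obtain K' k' where K': "K' \<in> forms n k'" "peval K' x \<noteq> 0" "basic_open n K' \<subseteq> U"
      by (rule zariski_open_basicE[OF U(1,2)])
    obtain k where "K \<in> forms n k" using fr by (auto simp: frac_at_def)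
    then have "K * K' \<in> forms n (k + k')" using K' by (intro forms_mult)
    moreover have "y \<in> U" if "y \<in> V" "peval K' y \<noteq> 0" for y using that K' V by (auto simp: basic_open_def)
    ultimately have "frac_at n V f x (K * K') G H" using fr K'(2) by (auto simp: frac_at_def res_def)
    then show ?thesis by blast
  qed
  then show ?thesis using regular_iff[OF V(1)] V(2) by blast
qed

lemma cring_regular_ring:
  assumes V: "V \<subseteq> proj_space n" shows "cring (regular_ring n V)"
proof (rule cringI)
  show "abelian_group (regular_ring n V)"
  proof (rule abelian_groupI)
    fix f assume "f \<in> carrier (regular_ring n V)"
    then show "\<exists>g\<in>carrier (regular_ring n V). g \<oplus>\<^bsub>regular_ring n V\<^esub> f = \<zero>\<^bsub>regular_ring n V\<^esub>"
      using regular_uminus[OF V] by (intro bexI[of _ "\<lambda>x. - f x"]) (auto simp: regular_ring_def)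
  qed (auto simp: regular_ring_def regular_add[OF V] regular_zero[OF V] algebra_simps)
  have one: "res V (\<lambda>_. 1) x * f x = f x" if "f \<in> regular_functions n V" for f x
    using that by (auto simp: res_def regular_functions_def)
  show "Group.comm_monoid (regular_ring n V)"
    by (rule comm_monoidI)
      (auto simp: regular_ring_def regular_mult[OF V] regular_const[OF V] one one[unfolded mult.commute[of "res V _ _"]] algebra_simps)
qed (auto simp: regular_ring_def algebra_simps)


section \<open>The embedded rational normal curve\<close>

text \<open>\<open>B\<close> is a basis of the coordinate space whose first \<open>d + 1\<close> vectors span the image of
  the embedding, with dual basis \<open>\<Lambda>\<close>.\<close>

locale rnc =
  fixes d n :: nat and B \<Lambda> :: "nat \<Rightarrow> nat \<Rightarrow> 'k::alg_closed_field" and X :: "'k pts"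
  assumes d: "d \<ge> 1" and n: "n = 2 * d" and Bv: "j \<le> n \<Longrightarrow> B j \<in> vecs n"
    and LB: "i \<le> n \<Longrightarrow> j \<le> n \<Longrightarrow> (\<Sum>m\<le>n. \<Lambda> i m * B j m) = (if i = j then 1 else 0)"
    and BL: "k \<le> n \<Longrightarrow> m \<le> n \<Longrightarrow> (\<Sum>j\<le>n. B j k * \<Lambda> j m) = (if k = m then 1 else 0)"
    and X_def: "X = {(\<lambda>m. \<Sum>j\<le>d. c * s ^ (d - j) * t ^ j * B j m) | c s t. c \<noteq> 0 \<and> (s, t) \<noteq> (0, 0)}"
begin

definition L :: "nat \<Rightarrow> 'k mpol" where "L i = (\<Sum>m\<le>n. single 0 (\<Lambda> i m) * Xv m)"
definition pt :: "'k \<Rightarrow> 'k \<Rightarrow> 'k \<Rightarrow> nat \<Rightarrow> 'k" where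
  "pt c s t = (\<lambda>m. \<Sum>j\<le>d. c * s ^ (d - j) * t ^ j * B j m)"
definition cc :: "nat \<Rightarrow> 'k poly" where "cc m = (\<Sum>j\<le>d. smult (B j m) (monom 1 j))"
text \<open>The normal direction on the chart \<open>s = 1\<close>: the coefficients of the
  \<open>d\<close> complementary basis vectors run through all monomials of degree at most
  \<open>d - 1\<close>.\<close>

definition gg :: "nat \<Rightarrow> 'k poly" where "gg m = (\<Sum>j<d. smult (B (d + 1 + j) m) (monom 1 j))"

lemma dn: "d \<le> n" using n by simp

lemma L_forms [simp]: "L i \<in> forms n 1"
  unfolding L_def by (intro forms_sum forms_const_mult) auto

lemma L_forms' [simp]: "L i \<in> forms n (Suc 0)"
  using L_forms by simp

lemma peval_L: "peval (L i) x = (\<Sum>m\<le>n. \<Lambda> i m * x m)"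
  by (simp add: L_def)

lemma sum_dual:
  assumes "i \<le> n" "A \<subseteq> {..n}" "finite A"
  shows "(\<Sum>m\<le>n. \<Lambda> i m * (\<Sum>j\<in>A. a j * B j m)) = (if i \<in> A then a i else 0)"
proof -
  have "(\<Sum>m\<le>n. \<Lambda> i m * (\<Sum>j\<in>A. a j * B j m)) = (\<Sum>j\<in>A. a j * (\<Sum>m\<le>n. \<Lambda> i m * B j m))"
    by (simp add: sum_distrib_left mult.left_commute) (rule sum.swap)
  also have "\<dots> = (\<Sum>j\<in>A. if j = i then a j else 0)"
    using assms by (intro sum.cong) (auto simp: LB)
  also have "\<dots> = (if i \<in> A then a i else 0)" using assms(3) by simp
  finally show ?thesis .
qed

lemma L_pt: "i \<le> n \<Longrightarrow> peval (L i) (pt c s t) = (if i \<le> d then c * s ^ (d - i) * t ^ i else 0)"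
  using sum_dual[of i "{..d}" "\<lambda>j. c * s ^ (d - j) * t ^ j"] dn by (simp add: peval_L pt_def)

lemma X_pt: "x \<in> X \<longleftrightarrow> (\<exists>c s t. c \<noteq> 0 \<and> (s, t) \<noteq> (0, 0) \<and> x = pt c s t)"
  unfolding X_def pt_def by blast

lemma pt_vecs: "pt c s t \<in> vecs n"
  using Bv dn by (auto simp: pt_def vecs_def intro!: sum.neutral)

lemma X_L: "x \<in> X \<Longrightarrow> peval (L 0) x \<noteq> 0 \<or> peval (L d) x \<noteq> 0"
  using dn by (auto simp: X_pt L_pt)

lemma X_sub: "X \<subseteq> proj_space n"
proof
  fix x assume x: "x \<in> X"
  then have "x \<in> vecs n" using pt_vecs by (auto simp: X_pt)
  moreover have "x \<noteq> (\<lambda>_. 0)" using X_L[OF x] by (auto simp: peval_L)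
  ultimately show "x \<in> proj_space n" by (simp add: proj_space_def)
qed

lemma pt_scale: "s \<noteq> 0 \<Longrightarrow> pt c s t = (\<lambda>m. (c * s ^ d) * pt 1 1 (t / s) m)"
proof
  fix m assume s: "s \<noteq> 0"
  have "s ^ (d - j) = s ^ d / s ^ j" if "j \<le> d" for j using s that by (simp add: power_diff)
  then show "pt c s t m = (c * s ^ d) * pt 1 1 (t / s) m"
    by (simp add: pt_def sum_distrib_left power_divide mult.assoc)
qed

lemma pt_scale_0: "pt c 0 t = (\<lambda>m. (c * t ^ d) * pt 1 0 1 m)"
proof
  fix m
  show "pt c 0 t m = (c * t ^ d) * pt 1 0 1 m"
    unfolding pt_def sum_distrib_left by (rule sum.cong) (auto simp: power_0_left)
qed

lemma poly_cc: "poly (cc m) z = pt 1 1 z m"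
  by (simp add: cc_def pt_def poly_sum poly_monom mult.commute)

lemma poly_ins_cc: "poly (ins pC cc F) z = peval F (pt 1 1 z)"
  using chom_ins_comp[OF chom_poly[of z], of pC cc F] by (simp add: poly_cc peval_eq_ins)

text \<open>Homogeneity reduces everything to the points \<open>(1 : z)\<close> and the one
  remaining point \<open>(0 : 1)\<close>. The latter is reached in the parameter \<open>s\<close>
  near it, where the restricted form vanishes off 0 and so identically.\<close>

lemma vanish_iff:
  assumes F: "F \<in> forms n l" shows "(\<forall>x\<in>X. peval F x = 0) \<longleftrightarrow> ins pC cc F = 0"
proof
  assume v: "\<forall>x\<in>X. peval F x = 0"
  have "poly (ins pC cc F) z = 0" for z
    unfolding poly_ins_cc using v X_pt[of "pt 1 1 z"] by (metis one_neq_zero prod.inject)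
  then show "ins pC cc F = 0" using poly_eq_0_if_infinite[OF infinite_alg_closed] by blast
next
  assume 0: "ins pC cc F = 0"
  then have z: "peval F (pt 1 1 z) = 0" for z using poly_ins_cc[of F z] by simp
  then have s: "peval F (pt c s t) = 0" if "s \<noteq> 0" for c s t
    unfolding pt_scale[OF that] peval_homogeneous[OF F] by simp
  define r where "r m = (\<Sum>j\<le>d. smult (B j m) (monom 1 (d - j)))" for m
  have "poly (r m) s = pt 1 s 1 m" for m s
    by (simp add: r_def pt_def poly_sum poly_monom mult.commute)
  then have "poly (ins pC r F) s = peval F (pt 1 s 1)" for s
    using chom_ins_comp[OF chom_poly[of s], of pC r F] by (simp add: peval_eq_ins)
  moreover from this have "ins pC r F = 0"
    using poly_eq_0_cofinite[of "[:0, 1:]" "ins pC r F"] s by simp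
  ultimately have "peval F (pt 1 0 1) = 0" by (metis poly_0)
  then have "peval F (pt c 0 t) = 0" for c t
    unfolding pt_scale_0[of c t] peval_homogeneous[OF F] by simp
  with s show "\<forall>x\<in>X. peval F x = 0" by (metis X_pt)
qed

lemma ins_cc_L: assumes "i \<le> n" shows "ins pC cc (L i) = (if i \<le> d then monom 1 i else 0)"
proof -
  have "poly (ins pC cc (L i)) z = poly (if i \<le> d then monom 1 i else 0) z" for z
    unfolding poly_ins_cc using L_pt[OF assms, of 1 1 z] by (simp add: poly_monom)
  then have "ins pC cc (L i) - (if i \<le> d then monom 1 i else 0) = 0"
    by (intro poly_eq_0_if_infinite[OF infinite_alg_closed]) (simp del: if_split)
  then show ?thesis by simp
qed

sublocale param_curve n d cc L
proof
  show "d \<ge> 1" by (rule d)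
  show "degree (cc i) \<le> d" for i
    unfolding cc_def by (intro degree_sum_le) (auto intro: order_trans[OF degree_smult_le] order_trans[OF degree_monom_le])
  show "L i \<in> forms n 1" for i by simp
  show "ins pC cc (L i) = monom 1 i" if "i \<le> d" for i using ins_cc_L[of i] that dn by simp
qed

subsection \<open>Transport of the linear resolution\<close>

interpretation std: std_double d "TYPE('k)"
  by unfold_locales (rule d)

lemma std_n: "std.n = n" by (simp add: std.n_def n)

text \<open>Translates the standard numbering, with the two parameters in front, into the numbering
  of \<open>B\<close>, where the index up to \<open>d\<close> is the exponent of the
  parameter.\<close>

definition \<pi> :: "nat \<Rightarrow> nat" where
  "\<pi> k = (if k = 0 then 0 else if k = 1 then d else if k \<le> d then k - 1 else k)"
definition \<pi>' :: "nat \<Rightarrow> nat" where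
  "\<pi>' j = (if j = 0 then 0 else if j = d then 1 else if j < d then j + 1 else j)"

lemma bij_\<pi>: "bij_betw \<pi> {..n} {..n}"
  by (rule bij_betwI[of _ _ _ \<pi>']) (use d n in \<open>auto simp: \<pi>_def \<pi>'_def split: if_splits\<close>)

lemma \<pi>_le: "k \<le> n \<Longrightarrow> \<pi> k \<le> n" using d n by (auto simp: \<pi>_def)

lemma sum_\<pi>: "(\<Sum>k\<le>n. f (\<pi> k)) = (\<Sum>j\<le>n. f j)"
  by (rule sum.reindex_bij_betw[OF bij_\<pi>])

definition \<Theta> :: "'k mpol \<Rightarrow> 'k mpol" where "\<Theta> = ins (single 0) (\<lambda>k. L (\<pi> k))"
definition \<theta>' :: "nat \<Rightarrow> 'k mpol" where "\<theta>' m = (\<Sum>k\<le>n. single 0 (B (\<pi> k) m) * Xv k)"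
definition \<Theta>' :: "'k mpol \<Rightarrow> 'k mpol" where "\<Theta>' = ins (single 0) \<theta>'"

lemma ins_forms:
  assumes y: "\<And>i. i \<le> n \<Longrightarrow> y i \<in> forms n 1" and F: "F \<in> forms n l"
  shows "ins (single 0) y F \<in> forms n (l :: nat)"
proof -
  have "ins (single 0) y (single m c) \<in> forms n (mdeg m) \<and> keys m \<subseteq> {..n}" if "keys m \<subseteq> {..n}" for m c
  proof -
    have "mval y m \<in> forms n (\<Sum>i\<in>keys m. lookup m i * 1)"
      unfolding mval_def by (intro forms_prod forms_power y) (use that in auto)
    then show ?thesis using that by (simp add: ins_single mdeg_def)
  qed
  then have "ins (single 0) y (single m (lookup F m)) \<in> forms n l" if "m \<in> keys F" for m
    using F that by (auto simp: forms_def polys_def)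
  then have "(\<Sum>m\<in>keys F. ins (single 0) y (single m (lookup F m))) \<in> forms n l" by (rule forms_sum)
  then show ?thesis by (simp add: mpol_sum_singles flip: chomD(8)[OF chom_ins[OF chom_single]])
qed

lemma ins_polys:
  assumes y: "\<And>i. i \<le> n \<Longrightarrow> y i \<in> polys n" and F: "F \<in> polys n"
  shows "ins (single 0) y F \<in> polys n"
  using F by (induction rule: mpol_induct) (auto simp: ins_const ins_Xv ins_add ins_mult y)

lemma ins_Xv_id: assumes "F \<in> polys n" shows "ins (single 0) Xv F = F"
  using chom_eq_ins[OF chom_id assms chom_single, of Xv] by simp

lemma \<theta>'_forms: "\<theta>' m \<in> forms n 1"
  unfolding \<theta>'_def by (intro forms_sum forms_const_mult) auto

sublocale aut: graded_aut n \<Theta> \<Theta>'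
proof
  show hom: "chom \<Theta>" "chom \<Theta>'" unfolding \<Theta>_def \<Theta>'_def by (intro chom_ins chom_single)+
  show "\<Theta> F \<in> forms n l" if "F \<in> forms n l" for F l unfolding \<Theta>_def by (intro ins_forms that L_forms)
  show "\<Theta>' F \<in> forms n l" if "F \<in> forms n l" for F l unfolding \<Theta>'_def by (intro ins_forms that \<theta>'_forms)
  show "\<Theta> F \<in> polys n" if "F \<in> polys n" for F unfolding \<Theta>_def by (intro ins_polys that forms_polys[OF L_forms])
  show "\<Theta>' F \<in> polys n" if "F \<in> polys n" for F unfolding \<Theta>'_def by (intro ins_polys that forms_polys[OF \<theta>'_forms])
  have cst: "\<Theta> (single 0 c) = single 0 c" "\<Theta>' (single 0 c) = single 0 c" for c
    by (simp_all add: \<Theta>_def \<Theta>'_def ins_const)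
  have var: "\<Theta> (Xv i) = L (\<pi> i)" "\<Theta>' (Xv i) = \<theta>' i" for i
    by (simp_all add: \<Theta>_def \<Theta>'_def ins_Xv)
  have 1: "\<Theta>' (L (\<pi> i)) = Xv i" if i: "i \<le> n" for i
  proof -
    have "\<Theta>' (L (\<pi> i)) = (\<Sum>m\<le>n. single 0 (\<Lambda> (\<pi> i) m) * (\<Sum>k\<le>n. single 0 (B (\<pi> k) m) * Xv k))"
      by (simp add: L_def chomD[OF hom(2)] cst var \<theta>'_def)
    also have "\<dots> = (\<Sum>k\<le>n. \<Sum>m\<le>n. single 0 (\<Lambda> (\<pi> i) m * B (\<pi> k) m) * Xv k)"
      unfolding sum_distrib_left mult.assoc[symmetric] mult_single add_0 by (rule sum.swap)
    also have "\<dots> = (\<Sum>k\<le>n. single 0 (\<Sum>m\<le>n. \<Lambda> (\<pi> i) m * B (\<pi> k) m) * Xv k)"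
      by (simp add: sum_distrib_right chomD(8)[OF chom_single])
    also have "\<dots> = (\<Sum>k\<le>n. if k = i then Xv k else 0)"
    proof (rule sum.cong[OF refl])
      fix k assume "k \<in> {..n}"
      then have "\<pi> i = \<pi> k \<longleftrightarrow> k = i" using bij_\<pi> i by (auto simp: bij_betw_def inj_on_def)
      then show "single 0 (\<Sum>m\<le>n. \<Lambda> (\<pi> i) m * B (\<pi> k) m) * Xv k = (if k = i then Xv k else 0)"
        using LB[OF \<pi>_le[OF i] \<pi>_le[of k]] \<open>k \<in> {..n}\<close> by simp
    qed
    finally show ?thesis using i by simp
  qed
  have 2: "\<Theta> (\<theta>' i) = Xv i" if i: "i \<le> n" for i
  proof -
    have "\<Theta> (\<theta>' i) = (\<Sum>k\<le>n. single 0 (B (\<pi> k) i) * L (\<pi> k))"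
      by (simp add: \<theta>'_def chomD[OF hom(1)] cst var)
    also have "\<dots> = (\<Sum>j\<le>n. single 0 (B j i) * L j)" by (rule sum_\<pi>)
    also have "\<dots> = (\<Sum>m\<le>n. \<Sum>j\<le>n. single 0 (B j i * \<Lambda> j m) * Xv m)"
      unfolding L_def sum_distrib_left mult.assoc[symmetric] mult_single add_0 by (rule sum.swap)
    also have "\<dots> = (\<Sum>m\<le>n. single 0 (\<Sum>j\<le>n. B j i * \<Lambda> j m) * Xv m)"
      by (simp add: sum_distrib_right chomD(8)[OF chom_single])
    also have "\<dots> = (\<Sum>m\<le>n. if m = i then Xv m else 0)"
      using i by (intro sum.cong) (auto simp: BL)
    finally show ?thesis using i by simp
  qed
  show "\<Theta>' (\<Theta> F) = F" if F: "F \<in> polys n" for F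
    using chom_eq_ins[OF chom_compose[OF hom(2,1)] F chom_single, of Xv] ins_Xv_id[OF F] by (simp add: cst var 1)
  show "\<Theta> (\<Theta>' F) = F" if F: "F \<in> polys n" for F
    using chom_eq_ins[OF chom_compose[OF hom(1,2)] F chom_single, of Xv] ins_Xv_id[OF F] by (simp add: cst var 2)
qed

lemma hom_comp_\<Theta>': assumes F: "F \<in> polys n" shows "hom_comp l (\<Theta>' F) = \<Theta>' (hom_comp l F)"
proof -
  obtain N where N: "\<forall>M\<ge>N. (\<Sum>a\<le>M. hom_comp a F) = F" using sum_hom_comp by blast
  then have "hom_comp l (\<Theta>' F) = hom_comp l (\<Theta>' (\<Sum>a\<le>max N l. hom_comp a F))" by simp
  also have "\<dots> = (\<Sum>a\<le>max N l. hom_comp l (\<Theta>' (hom_comp a F)))"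
    by (simp add: aut.hom2 hom_comp_sum)
  also have "\<dots> = (\<Sum>a\<le>max N l. if l = a then \<Theta>' (hom_comp a F) else 0)"
    by (simp add: hom_comp_form[OF aut.forms(2)[OF hom_comp_in_forms[OF F]]])
  finally show ?thesis by simp
qed

lemma dd_ins_comp:
  assumes e: "chom e" and F: "F \<in> polys n"
  shows "dd e x v (ins (single 0) y F) = dd e (\<lambda>i. ins e x (y i)) (\<lambda>i. dd e x v (y i)) F"
proof -
  have "ins e x (ins (single 0) y F) = ins e (\<lambda>i. ins e x (y i)) F" for F
    by (subst chom_ins_comp[OF chom_ins[OF e]]) (simp add: ins_const[OF e])
  with F show ?thesis
    by (induction rule: mpol_induct)
      (auto simp: ins_const ins_Xv ins_add ins_mult dd_add[OF e] dd_mult[OF e] dd_const[OF e] dd_Xv[OF e])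
qed

lemma ins_xc_\<theta>': assumes "m \<le> n" shows "ins pC std.xc (\<theta>' m) = cc m"
proof -
  define f where "f j = smult (B j m) (if j \<le> d then monom 1 j else 0)" for j
  have xc: "smult (B (\<pi> k) m) (std.xc k) = f (\<pi> k)" if "k \<le> n" for k
    using that d by (auto simp: f_def \<pi>_def std.xc_def std.ex_def std.z_power)
  have "ins pC std.xc (\<theta>' m) = (\<Sum>k\<le>n. smult (B (\<pi> k) m) (std.xc k))"
    by (simp add: \<theta>'_def chomD[OF chom_ins[OF chom_pCons]] ins_const ins_Xv)
  also have "\<dots> = (\<Sum>k\<le>n. f (\<pi> k))" using xc by (intro sum.cong) auto
  also have "\<dots> = (\<Sum>j\<le>n. f j)" by (rule sum_\<pi>)
  also have "\<dots> = (\<Sum>j\<le>d. f j)" using dn by (intro sum.mono_neutral_right) (auto simp: f_def)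
  finally show ?thesis by (simp add: f_def cc_def)
qed

lemma dd_xc_\<theta>': assumes "m \<le> n" shows "dd pC std.xc std.vc (\<theta>' m) = gg m"
proof -
  define f where "f j = smult (B j m) (if j \<le> d then 0 else monom 1 (j - d - 1))" for j
  have vc: "smult (B (\<pi> k) m) (std.vc k) = f (\<pi> k)" if "k \<le> n" for k
    using that d by (auto simp: f_def \<pi>_def std.vc_def std.ex_def std.z_power)
  have "dd pC std.xc std.vc (\<theta>' m) = (\<Sum>k\<le>n. smult (B (\<pi> k) m) (std.vc k))"
    by (simp add: \<theta>'_def dd_sum dd_const_mult)
  also have "\<dots> = (\<Sum>k\<le>n. f (\<pi> k))" using vc by (intro sum.cong) auto
  also have "\<dots> = (\<Sum>j\<le>n. f j)" by (rule sum_\<pi>)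
  also have "\<dots> = (\<Sum>j\<in>{d<..n}. f j)" by (intro sum.mono_neutral_right) (auto simp: f_def)
  also have "\<dots> = (\<Sum>j<d. f (d + 1 + j))"
    by (rule sum.reindex_bij_witness[of _ "\<lambda>j. d + 1 + j" "\<lambda>j. j - d - 1"]) (auto simp: n)
  finally show ?thesis by (simp add: f_def gg_def)
qed

text \<open>Substituting \<open>\<theta>'\<close> turns the expansion along \<open>std.xc\<close> in
  direction \<open>std.vc\<close> into that along \<open>cc\<close> in direction \<open>gg\<close>,
  by the chain rule \<open>dd_ins_comp\<close>.\<close>

lemma jet_ideal_\<Theta>: "\<Theta> ` jet_ideal n std.xc std.vc = jet_ideal n cc gg"
proof -
  have 1: "ins pC std.xc (\<Theta>' F) = ins pC cc F" if F: "F \<in> polys n" for F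
  proof -
    have "ins pC std.xc (\<Theta>' F) = ins pC (\<lambda>i. ins pC std.xc (\<theta>' i)) F"
      unfolding \<Theta>'_def by (subst chom_ins_comp[OF chom_ins[OF chom_pCons]]) (simp add: ins_const)
    also have "\<dots> = ins pC cc F" by (rule ins_cong[OF F]) (rule ins_xc_\<theta>')
    finally show ?thesis .
  qed
  have 2: "dd pC std.xc std.vc (\<Theta>' F) = dd pC cc gg F" if F: "F \<in> polys n" for F
    unfolding \<Theta>'_def dd_ins_comp[OF chom_pCons F]
    by (rule dd_cong[OF chom_pCons F]) (auto simp: ins_xc_\<theta>' dd_xc_\<theta>')
  have iff: "\<Theta>' F \<in> jet_ideal n std.xc std.vc \<longleftrightarrow> F \<in> jet_ideal n cc gg" if F: "F \<in> polys n" for F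
    using F by (simp add: jet_ideal_def hom_comp_\<Theta>' 1 2 aut.polys)
  show ?thesis
  proof (intro equalityI subsetI)
    fix F assume "F \<in> \<Theta> ` jet_ideal n std.xc std.vc"
    then obtain F' where "F' \<in> jet_ideal n std.xc std.vc" "F = \<Theta> F'" by blast
    then show "F \<in> jet_ideal n cc gg" using iff[of F] aut.inv(1)[of F'] aut.polys(1)[of F'] by (auto simp: jet_ideal_def)
  next
    fix F assume F: "F \<in> jet_ideal n cc gg"
    then have Fp: "F \<in> polys n" by (simp add: jet_ideal_def)
    then show "F \<in> \<Theta> ` jet_ideal n std.xc std.vc"
      using F iff[OF Fp] aut.inv(2)[OF Fp] by (metis imageI)
  qed
qed

lemma linear_syzygies_gg: "linear_syzygies n (jet_ideal n cc gg)"
  using aut.linear_syzygies_image[OF std.linear_syzygies_J[unfolded std_n]] jet_ideal_\<Theta> by simp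

end


section \<open>Derivatives of regular functions\<close>

abbreviation pD :: "(nat \<Rightarrow> 'k::field) \<Rightarrow> (nat \<Rightarrow> 'k) \<Rightarrow> 'k mpol \<Rightarrow> 'k" where "pD \<equiv> dd (\<lambda>c. c)"

lemma pD_mult: "pD x v (F * G) = peval F x * pD x v G + pD x v F * peval G x"
  by (simp add: dd_mult peval_eq_ins)

lemma frac_atD: "frac_at n V f x K G H \<Longrightarrow> x \<in> V \<Longrightarrow> peval H x \<noteq> 0 \<and> f x = peval G x / peval H x"
  by (auto simp: frac_at_def)

text \<open>Two representations agree on an open set, hence at almost all points of each line
  through \<open>x\<close>.\<close>

lemma frac_at_pD_unique:
  fixes x :: "nat \<Rightarrow> 'k::alg_closed_field"
  assumes U: "zariski_open n U" "x \<in> U" and v: "v \<in> vecs n"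
    and fr: "frac_at n U f x K G H" "frac_at n U f x K' G' H'" and f0: "f x = 0"
  shows "pD x v G / peval H x = pD x v G' / peval H' x"
proof -
  obtain K0 k0 where K0: "K0 \<in> forms n k0" "peval K0 x \<noteq> 0" "basic_open n K0 \<subseteq> U"
    by (rule zariski_open_basicE[OF U])
  have x: "x \<in> vecs n" "x \<noteq> (\<lambda>_. 0)" using U zariski_open_sub by (auto simp: proj_space_def)
  then obtain i where i: "x i \<noteq> 0" by auto
  define ln where "ln F = ins pC (\<lambda>i. [:x i, v i:]) F" for F
  have ln_poly: "poly (ln F) a = peval F (\<lambda>i. x i + a * v i)" for F a
    using chom_ins_comp[OF chom_poly[of a], of pC "\<lambda>i. [:x i, v i:]" F] by (simp add: ln_def peval_eq_ins)
  have pD: "pD x v F = coeff (ln F) 1" for F by (simp add: dd_def ln_def)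
  define P where "P = G * H' - G' * H"
  define h where "h = ln (K0 * (K * K')) * [:x i, v i:]"
  have "poly h 0 \<noteq> 0"
    using fr K0(2) i by (auto simp: h_def ln_poly frac_at_def)
  then have "h \<noteq> 0" by auto
  have "ln P = 0"
  proof (rule poly_eq_0_cofinite[OF \<open>h \<noteq> 0\<close>])
    fix a assume "poly h a \<noteq> 0"
    define y where "y = (\<lambda>i. x i + a * v i)"
    have "poly h a = peval K0 y * (peval K y * peval K' y) * y i"
      unfolding h_def poly_mult ln_poly by (simp add: y_def)
    then have y: "peval K0 y \<noteq> 0" "peval K y \<noteq> 0" "peval K' y \<noteq> 0" "y i \<noteq> 0"
      using \<open>poly h a \<noteq> 0\<close> by auto
    have "y \<in> vecs n" using x(1) v by (auto simp: y_def vecs_def)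
    moreover have "y \<noteq> (\<lambda>_. 0)" using y(4) by auto
    ultimately have "y \<in> U" using K0(3) y(1) by (auto simp: basic_open_def proj_space_def)
    then have "peval H y \<noteq> 0" "peval H' y \<noteq> 0" "peval G y / peval H y = peval G' y / peval H' y"
      using fr y by (auto simp: frac_at_def)
    then show "poly (ln P) a = 0" by (simp add: ln_poly y_def[symmetric] P_def field_simps)
  qed
  then have "pD x v P = 0" by (simp add: pD)
  moreover have z: "peval H x \<noteq> 0" "peval H' x \<noteq> 0" "peval G x = 0" "peval G' x = 0"
    using frac_atD[OF fr(1) U(2)] frac_atD[OF fr(2) U(2)] f0 by auto
  ultimately show ?thesis by (simp add: P_def dd_diff pD_mult field_simps)
qed

text \<open>Differentiating at the generic point along a field of linear forms preserves the degree,
  so the derivative of a quotient of forms is again given by quotients of forms of equal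
  degrees.\<close>

lemma forms_derivative:
  assumes V: "\<And>m. m \<le> n \<Longrightarrow> V m \<in> forms n 1" and G: "G \<in> forms n l"
  shows "dd (single 0) Xv V G \<in> forms n l"
proof -
  have "dd (single 0) Xv V (single m c) \<in> forms n (mdeg m)" if "keys m \<subseteq> {..n}" for m c
    using that
  proof (induction "mdeg m" arbitrary: m)
    case 0
    then show ?case by (simp add: dd_const)
  next
    case (Suc k)
    then have "keys m \<noteq> {}" by auto
    then obtain i where i: "i \<in> keys m" by blast
    then obtain m' where m': "m = single i 1 + m'" by (rule keys_monom_split)
    have m'k: "k = mdeg m'" "keys m' \<subseteq> {..n}" "i \<le> n" using Suc.hyps(2) Suc.prems m' i by (auto simp: keys_monom_add)
    have id: "ins (single 0) Xv (single m' c) = single m' c"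
      by (rule chom_eq_ins[OF chom_id polys_single[OF m'k(2)] chom_single, symmetric]) auto
    have "dd (single 0) Xv V (single m c) = Xv i * dd (single 0) Xv V (single m' c) + V i * single m' c"
      unfolding m' single_Xv_mult by (simp add: dd_mult ins_Xv id)
    moreover have "Xv i * dd (single 0) Xv V (single m' c) \<in> forms n (Suc k)"
      using Suc.hyps(1)[OF m'k(1,2)] m'k by (intro forms_mult'[of _ n 1 _ k]) auto
    moreover have "V i * single m' c \<in> forms n (Suc k)"
      using V[OF m'k(3)] m'k by (intro forms_mult'[of _ n 1 _ k] forms_single) auto
    ultimately show ?case using Suc.hyps(2) by simp
  qed
  then have "dd (single 0) Xv V (single m (lookup G m)) \<in> forms n l" if "m \<in> keys G" for m
    using G that by (auto simp: forms_def polys_def)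
  then have "(\<Sum>m\<in>keys G. dd (single 0) Xv V (single m (lookup G m))) \<in> forms n l" by (rule forms_sum)
  then show ?thesis by (simp add: mpol_sum_singles flip: dd_sum[OF chom_single])
qed

lemma peval_derivative:
  "peval (dd (single 0) Xv V G) x = pD x (\<lambda>m. peval (V m) x) G"
  using dd_chom[OF chom_single chom_peval[of x], of Xv V G] by simp

section \<open>Existence, geometric half: a sheaf realizing the ideal\<close>

section \<open>The double structure with line bundle of degree -1\<close>

context rnc
begin

text \<open>The entries of the normal field have degree \<open>d - 1\<close> in the parameters
  \<open>(s, t)\<close>, so they are no restrictions of linear forms; \<open>s\<close> times and
  \<open>t\<close> times the field are, and these are \<open>VP0\<close> and
  \<open>VP1\<close>.\<close>

definition VP0 :: "nat \<Rightarrow> 'k mpol" where "VP0 m = (\<Sum>j<d. single 0 (B (d + 1 + j) m) * L j)"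
definition VP1 :: "nat \<Rightarrow> 'k mpol" where "VP1 m = (\<Sum>j<d. single 0 (B (d + 1 + j) m) * L (j + 1))"
definition V0 :: "(nat \<Rightarrow> 'k) \<Rightarrow> nat \<Rightarrow> 'k" where "V0 x m = peval (VP0 m) x"
definition V1 :: "(nat \<Rightarrow> 'k) \<Rightarrow> nat \<Rightarrow> 'k" where "V1 x m = peval (VP1 m) x"

text \<open>A point \<open>x\<close> of \<open>X\<close> with parameter \<open>(s : t)\<close> is given the normalized parameters
  \<open>(\<chi>0 x, \<chi>1 x)\<close>, equal to \<open>(1, t/s)\<close> or \<open>(0, 1)\<close>.\<close>

definition \<chi>0 :: "(nat \<Rightarrow> 'k) \<Rightarrow> 'k" where "\<chi>0 x = (if peval (L 0) x \<noteq> 0 then 1 else 0)"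
definition \<chi>1 :: "(nat \<Rightarrow> 'k) \<Rightarrow> 'k" where "\<chi>1 x = (if peval (L 0) x \<noteq> 0 then peval (L 1) x / peval (L 0) x else 1)"
definition Vq :: "(nat \<Rightarrow> 'k) \<Rightarrow> nat \<Rightarrow> 'k" where "Vq x = (if peval (L 0) x \<noteq> 0 then V0 x else V1 x)"

lemma VP_forms: "VP0 m \<in> forms n 1" "VP1 m \<in> forms n 1"
  unfolding VP0_def VP1_def by (intro forms_sum forms_const_mult L_forms)+

lemma Vq_vecs: "Vq x \<in> vecs n"
proof -
  have "B (d + 1 + j) m = 0" if "j < d" "m > n" for j m
    using Bv[of "d + 1 + j"] that by (simp add: vecs_def n)
  then show ?thesis by (auto simp: vecs_def Vq_def V0_def V1_def VP0_def VP1_def intro!: sum.neutral)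
qed

lemma V_sum:
  "V0 x m = (\<Sum>j\<in>{d + 1..<d + 1 + d}. peval (L (j - d - 1)) x * B j m)"
  "V1 x m = (\<Sum>j\<in>{d + 1..<d + 1 + d}. peval (L (j - d - 1 + 1)) x * B j m)"
  unfolding V0_def VP0_def V1_def VP1_def peval_simps peval_const
  by (rule sum.reindex_bij_witness[of _ "\<lambda>j. j - d - 1" "\<lambda>j. d + 1 + j"]; auto)+

lemma X_ratio:
  assumes x: "x \<in> X" and j: "j < d"
  shows "peval (L (j + 1)) x * \<chi>0 x = peval (L j) x * \<chi>1 x"
proof -
  obtain c s t where c: "c \<noteq> 0" "(s, t) \<noteq> (0, 0)" "x = pt c s t" using x X_pt by blast
  have L: "peval (L i) x = c * s ^ (d - i) * t ^ i" if "i \<le> d" for i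
    using L_pt[of i c s t] that dn c by simp
  show ?thesis
  proof (cases "s = 0")
    case True
    then show ?thesis using L[of 0] L[of j] j d by (simp add: \<chi>0_def \<chi>1_def)
  next
    case False
    have "s ^ (d - j) = s * s ^ (d - (j + 1))" "s ^ d = s * s ^ (d - 1)"
      using j d by (metis Suc_diff_Suc Suc_eq_plus1 power_Suc) (metis Suc_diff_1 d less_le_trans power_Suc zero_less_one)
    then show ?thesis using L[of 0] L[of 1] L[of j] L[of "j + 1"] j d False c(1)
      by (simp add: \<chi>0_def \<chi>1_def del: power_Suc) (simp add: field_simps)
  qed
qed

lemma V_ratio: assumes x: "x \<in> X" shows "V0 x = (\<lambda>m. \<chi>0 x * Vq x m)" "V1 x = (\<lambda>m. \<chi>1 x * Vq x m)"
proof -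
  have 1: "V1 x m * \<chi>0 x = V0 x m * \<chi>1 x" for m
    using X_ratio[OF x] by (simp add: V0_def V1_def VP0_def VP1_def sum_distrib_right mult.assoc)
  show "V0 x = (\<lambda>m. \<chi>0 x * Vq x m)"
    using 1 by (auto simp: fun_eq_iff Vq_def \<chi>0_def \<chi>1_def split: if_splits)
  show "V1 x = (\<lambda>m. \<chi>1 x * Vq x m)"
    using 1 by (auto simp: fun_eq_iff Vq_def \<chi>0_def \<chi>1_def split: if_splits)
qed

lemma chi_nz: "\<chi>0 x \<noteq> 0 \<or> \<chi>1 x \<noteq> 0"
  by (auto simp: \<chi>0_def \<chi>1_def)

text \<open>Sections of O(-1) on the projective line: they become regular functions after
  multiplication with \<open>s\<close> and with \<open>t\<close>, here in their normalized values
  \<open>\<chi>0\<close> and \<open>\<chi>1\<close>.\<close>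

definition LL :: "'k pts \<Rightarrow> 'k fn set" where
  "LL V = {\<sigma>. (\<forall>x. x \<notin> V \<longrightarrow> \<sigma> x = 0) \<and> (\<lambda>x. \<sigma> x * \<chi>0 x) \<in> regular_functions n V \<and>
     (\<lambda>x. \<sigma> x * \<chi>1 x) \<in> regular_functions n V}"

definition LB1 :: "'k pts \<Rightarrow> ('k fn, 'k fn) module" where
  "LB1 V = \<lparr>carrier = LL V, monoid.mult = (\<lambda>f g x. 0), one = (\<lambda>x. 0), ring.zero = (\<lambda>x. 0),
     add = (\<lambda>f g x. f x + g x), module.smult = (\<lambda>a f x. a x * f x)\<rparr>"

definition rs :: "'k pts \<Rightarrow> 'k pts \<Rightarrow> 'k fn \<Rightarrow> 'k fn" where "rs V W f = res W f"

lemma LB1_simps [simp]: "carrier (LB1 V) = LL V" "\<zero>\<^bsub>LB1 V\<^esub> = (\<lambda>x. 0)"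
  "f \<oplus>\<^bsub>LB1 V\<^esub> g = (\<lambda>x. f x + g x)" "a \<odot>\<^bsub>LB1 V\<^esub> f = (\<lambda>x. a x * f x)"
  by (simp_all add: LB1_def)

lemma regular_ring_simps [simp]: "carrier (regular_ring n V) = regular_functions n V"
  "a \<oplus>\<^bsub>regular_ring n V\<^esub> b = (\<lambda>x. a x + b x)" "a \<otimes>\<^bsub>regular_ring n V\<^esub> b = (\<lambda>x. a x * b x)"
  "\<one>\<^bsub>regular_ring n V\<^esub> = res V (\<lambda>_. 1)"
  by (simp_all add: regular_ring_def)

lemma LL_smult:
  assumes V: "V \<subseteq> proj_space n" and a: "a \<in> regular_functions n V" and f: "f \<in> LL V"
  shows "(\<lambda>x. a x * f x) \<in> LL V"
  using regular_mult[OF V a, of "\<lambda>x. f x * \<chi>0 x"] regular_mult[OF V a, of "\<lambda>x. f x * \<chi>1 x"] f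
  by (simp add: LL_def mult.assoc)

lemma LL_add: assumes V: "V \<subseteq> proj_space n" and "f \<in> LL V" "g \<in> LL V" shows "(\<lambda>x. f x + g x) \<in> LL V"
  using regular_add[OF V, of "\<lambda>x. f x * \<chi>0 x" "\<lambda>x. g x * \<chi>0 x"] regular_add[OF V, of "\<lambda>x. f x * \<chi>1 x" "\<lambda>x. g x * \<chi>1 x"] assms
  by (simp add: LL_def distrib_right)

lemma LL_zero: "V \<subseteq> proj_space n \<Longrightarrow> (\<lambda>x. 0) \<in> LL V"
  using regular_zero[of V n] by (simp add: LL_def)

lemma LL_uminus: assumes V: "V \<subseteq> proj_space n" and "f \<in> LL V" shows "(\<lambda>x. - f x) \<in> LL V"
  using regular_uminus[OF V, of "\<lambda>x. f x * \<chi>0 x"] regular_uminus[OF V, of "\<lambda>x. f x * \<chi>1 x"] assms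
  by (simp add: LL_def)

lemma LL_res: assumes V: "V \<subseteq> proj_space n" and W: "W \<subseteq> V" and f: "f \<in> LL V" shows "res W f \<in> LL W"
proof -
  have "(\<lambda>x. res W f x * h x) = res W (\<lambda>x. f x * h x)" for h by (auto simp: res_def)
  then show ?thesis using f regular_res[OF V W] by (auto simp: LL_def res_def)
qed

lemma module_LB1: assumes V: "V \<subseteq> proj_space n" shows "Module.module (regular_ring n V) (LB1 V)"
proof (rule moduleI[OF cring_regular_ring[OF V]])
  show "abelian_group (LB1 V)"
  proof (rule abelian_groupI)
    fix f assume "f \<in> carrier (LB1 V)"
    then show "\<exists>g\<in>carrier (LB1 V). g \<oplus>\<^bsub>LB1 V\<^esub> f = \<zero>\<^bsub>LB1 V\<^esub>"
      using LL_uminus[OF V] by (intro bexI[of _ "\<lambda>x. - f x"]) auto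
  qed (auto simp: LL_add[OF V] LL_zero[OF V] algebra_simps)
  show "\<one>\<^bsub>regular_ring n V\<^esub> \<odot>\<^bsub>LB1 V\<^esub> x = x" if "x \<in> carrier (LB1 V)" for x
    using that by (auto simp: res_def LL_def)
qed (auto simp: LL_smult[OF V] algebra_simps)

lemma sheaf_LB1: "sheaf_of_modules n X LB1 rs"
  unfolding sheaf_of_modules_def
proof (intro conjI allI impI ballI)
  have sub: "V \<subseteq> proj_space n" if "open_in n X V" for V using open_in_sub[OF that] X_sub by auto
  fix V assume V: "open_in n X V"
  show "Module.module (regular_ring n V) (LB1 V)" by (rule module_LB1[OF sub[OF V]])
  show "rs V V s = s" if "s \<in> carrier (LB1 V)" for s using that by (auto simp: rs_def res_def LL_def)
next
  have sub: "V \<subseteq> proj_space n" if "open_in n X V" for V using open_in_sub[OF that] X_sub by auto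
  fix V W assume VW: "open_in n X V \<and> open_in n X W \<and> W \<subseteq> V"
  show "rs V W s \<in> carrier (LB1 W)" if "s \<in> carrier (LB1 V)" for s
    using that LL_res[OF sub[of V]] VW by (simp add: rs_def)
  show "rs V W (s \<oplus>\<^bsub>LB1 V\<^esub> t) = rs V W s \<oplus>\<^bsub>LB1 W\<^esub> rs V W t" for s t by (auto simp: rs_def res_def)
  show "rs V W (a \<odot>\<^bsub>LB1 V\<^esub> s) = res W a \<odot>\<^bsub>LB1 W\<^esub> rs V W s" for a s by (auto simp: rs_def res_def)
next
  fix V W T s assume "open_in n X V \<and> open_in n X W \<and> open_in n X T \<and> T \<subseteq> W \<and> W \<subseteq> V"
  then show "rs W T (rs V W s) = rs V T s" by (auto simp: rs_def res_def fun_eq_iff)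
next
  have sub: "V \<subseteq> proj_space n" if "open_in n X V" for V using open_in_sub[OF that] X_sub by auto
  fix V \<W> and s :: "'k pts \<Rightarrow> 'k fn"
  assume *: "open_in n X V \<and> (\<forall>W\<in>\<W>. open_in n X W) \<and> \<Union>\<W> = V \<and>
        (\<forall>W\<in>\<W>. s W \<in> carrier (LB1 W)) \<and> (\<forall>W\<in>\<W>. \<forall>T\<in>\<W>. rs W (W \<inter> T) (s W) = rs T (W \<inter> T) (s T))"
  then have V: "open_in n X V" and W: "\<And>W. W \<in> \<W> \<Longrightarrow> open_in n X W" "\<Union>\<W> = V" "\<And>W. W \<in> \<W> \<Longrightarrow> s W \<in> LL W"
    and co: "\<And>W T. W \<in> \<W> \<Longrightarrow> T \<in> \<W> \<Longrightarrow> res (W \<inter> T) (s W) = res (W \<inter> T) (s T)" by (auto simp: rs_def)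
  have co': "s W x = s T x" if "W \<in> \<W>" "T \<in> \<W>" "x \<in> W" "x \<in> T" for W T x
    using fun_cong[OF co[OF that(1,2)], of x] that by (simp add: res_def)
  define t where "t x = (if x \<in> V then s (SOME W. W \<in> \<W> \<and> x \<in> W) x else 0)" for x
  have t: "t x = s W x" if "W \<in> \<W>" "x \<in> W" for W x
  proof -
    have "(SOME W. W \<in> \<W> \<and> x \<in> W) \<in> \<W> \<and> x \<in> (SOME W. W \<in> \<W> \<and> x \<in> W)"
      using that by (intro someI[of "\<lambda>W. W \<in> \<W> \<and> x \<in> W"]) auto
    then show ?thesis using co'[of "SOME W. W \<in> \<W> \<and> x \<in> W" W x] that W(2) by (auto simp: t_def)
  qed
  have reg: "(\<lambda>x. t x * h x) \<in> regular_functions n V"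
    if h: "\<And>W. W \<in> \<W> \<Longrightarrow> (\<lambda>x. s W x * h x) \<in> regular_functions n W" for h
  proof (rule regular_local[OF sub[OF V]])
    show "t x * h x = 0" if "x \<notin> V" for x using that by (simp add: t_def)
    fix x assume "x \<in> V"
    then obtain W where Wx: "W \<in> \<W>" "x \<in> W" using W(2) by auto
    obtain U where U: "zariski_open n U" "W = U \<inter> X" using W(1)[OF Wx(1)] by (auto simp: open_in_def)
    have "U \<inter> V = W" using U Wx W(2) open_in_sub[OF V] by auto
    moreover have "res W (\<lambda>x. t x * h x) = (\<lambda>x. s W x * h x)"
      using t[OF Wx(1)] W(3)[OF Wx(1)] by (auto simp: res_def LL_def)
    ultimately show "\<exists>U. zariski_open n U \<and> x \<in> U \<and> res (U \<inter> V) (\<lambda>x. t x * h x) \<in> regular_functions n (U \<inter> V)"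
      using U Wx h by auto
  qed
  show "\<exists>!t. t \<in> carrier (LB1 V) \<and> (\<forall>W\<in>\<W>. rs V W t = s W)"
  proof (rule ex1I[of _ t])
    have "t \<in> LL V" using reg[of \<chi>0] reg[of \<chi>1] W(3) by (auto simp: LL_def t_def)
    moreover have "res W t = s W" if "W \<in> \<W>" for W
      using t[OF that] W(3)[OF that] by (auto simp: res_def LL_def)
    ultimately show "t \<in> carrier (LB1 V) \<and> (\<forall>W\<in>\<W>. rs V W t = s W)" by (simp add: rs_def)
  next
    fix t' assume t': "t' \<in> carrier (LB1 V) \<and> (\<forall>W\<in>\<W>. rs V W t' = s W)"
    show "t' = t"
    proof
      fix x
      show "t' x = t x"
      proof (cases "x \<in> V")
        case True
        then obtain W where Wx: "W \<in> \<W>" "x \<in> W" using W(2) by auto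
        have "res W t' x = s W x" using t' Wx by (simp add: rs_def)
        then show ?thesis using t[OF Wx] Wx by (simp add: res_def)
      next
        case False
        then show ?thesis using t' by (simp add: t_def LL_def)
      qed
    qed
  qed
qed

lemma line_bundle_LB1: "line_bundle n X LB1 rs"
  unfolding line_bundle_def
proof (intro conjI ballI sheaf_LB1)
  fix x assume x: "x \<in> X"
  \<comment> \<open>A section \<open>e\<close> inverse to a function \<open>h\<close> that turns
    sections into regular functions trivializes the bundle, with inverse map given by multiplication
    with \<open>h\<close>.\<close>
  have triv: "\<exists>V e. open_in n X V \<and> x \<in> V \<and> e \<in> carrier (LB1 V) \<and>
        (\<forall>W. open_in n X W \<and> W \<subseteq> V \<longrightarrow>
           bij_betw (\<lambda>a. a \<odot>\<^bsub>LB1 W\<^esub> rs V W e) (regular_functions n W) (carrier (LB1 W)))"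
    if V: "open_in n X V" "x \<in> V" and e: "e \<in> LL V" and h: "\<And>y. y \<in> V \<Longrightarrow> e y * h y = 1"
      "\<And>\<sigma> W. W \<subseteq> V \<Longrightarrow> \<sigma> \<in> LL W \<Longrightarrow> (\<lambda>x. \<sigma> x * h x) \<in> regular_functions n W" for V e h
  proof (intro exI[of _ V] exI[of _ e] conjI allI impI)
    fix W assume W: "open_in n X W \<and> W \<subseteq> V"
    then have Wp: "W \<subseteq> proj_space n" using open_in_sub[of n X W] X_sub by auto
    have Vp: "V \<subseteq> proj_space n" using open_in_sub[OF V(1)] X_sub by auto
    have eW: "res W e \<in> LL W" using LL_res[OF Vp _ e] W by simp
    have e0: "e y \<noteq> 0" if "y \<in> W" for y using h(1)[of y] W that by auto
    show "bij_betw (\<lambda>a. a \<odot>\<^bsub>LB1 W\<^esub> rs V W e) (regular_functions n W) (carrier (LB1 W))"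
      unfolding bij_betw_def
    proof (intro conjI equalityI subsetI)
      show "inj_on (\<lambda>a. a \<odot>\<^bsub>LB1 W\<^esub> rs V W e) (regular_functions n W)"
      proof (rule inj_onI, rule ext)
        fix a a' y assume a: "a \<in> regular_functions n W" "a' \<in> regular_functions n W"
          and eq: "a \<odot>\<^bsub>LB1 W\<^esub> rs V W e = a' \<odot>\<^bsub>LB1 W\<^esub> rs V W e"
        show "a y = a' y"
        proof (cases "y \<in> W")
          case True
          then show ?thesis using fun_cong[OF eq, of y] e0 by (simp add: rs_def res_def)
        next
          case False
          then show ?thesis using a by (simp add: regular_functions_def)
        qed
      qed
      show "\<sigma> \<in> carrier (LB1 W)" if "\<sigma> \<in> (\<lambda>a. a \<odot>\<^bsub>LB1 W\<^esub> rs V W e) ` regular_functions n W" for \<sigma>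
        using that LL_smult[OF Wp _ eW] by (auto simp: rs_def)
      fix \<sigma> assume \<sigma>: "\<sigma> \<in> carrier (LB1 W)"
      have "\<sigma> y = \<sigma> y * h y * res W e y" for y
        using \<sigma> h(1)[of y] W by (cases "y \<in> W") (auto simp: res_def LL_def mult.assoc mult.commute[of "h y"])
      then have "\<sigma> = (\<lambda>x. \<sigma> x * h x) \<odot>\<^bsub>LB1 W\<^esub> rs V W e" by (auto simp: rs_def)
      then show "\<sigma> \<in> (\<lambda>a. a \<odot>\<^bsub>LB1 W\<^esub> rs V W e) ` regular_functions n W"
        using h(2)[of W \<sigma>] W \<sigma> by (intro image_eqI[of _ _ "\<lambda>x. \<sigma> x * h x"]) auto
    qed
  qed (use V e in auto)
  have op: "open_in n X (basic_open n (L i) \<inter> X)" for i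
    unfolding open_in_def using zariski_open_basic[OF L_forms] by blast
  show "\<exists>V e. open_in n X V \<and> x \<in> V \<and> e \<in> carrier (LB1 V) \<and>
        (\<forall>W. open_in n X W \<and> W \<subseteq> V \<longrightarrow>
           bij_betw (\<lambda>a. a \<odot>\<^bsub>LB1 W\<^esub> rs V W e) (regular_functions n W) (carrier (LB1 W)))"
  proof (cases "peval (L 0) x = 0")
    case False
    define V where "V = basic_open n (L 0) \<inter> X"
    have V: "V \<subseteq> proj_space n" "\<And>y. y \<in> V \<Longrightarrow> peval (L 0) y \<noteq> 0" by (auto simp: V_def basic_open_def)
    show ?thesis
    proof (rule triv[of V "res V (\<lambda>_. 1)" \<chi>0])
      have "(\<lambda>y. res V (\<lambda>_. 1) y * \<chi>0 y) = res V (\<lambda>_. 1)" "(\<lambda>y. res V (\<lambda>_. 1) y * \<chi>1 y) = res V (\<lambda>y. peval (L 1) y / peval (L 0) y)"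
        using V(2) by (auto simp: res_def \<chi>0_def \<chi>1_def)
      then show "res V (\<lambda>_. 1) \<in> LL V"
        using regular_const[OF V(1)] regular_frac[OF V(1) L_forms L_forms V(2)] by (auto simp: LL_def res_def)
      show "open_in n X V" unfolding V_def by (rule op)
      show "x \<in> V" using False x X_sub by (auto simp: V_def basic_open_def)
      show "res V (\<lambda>_. 1) y * \<chi>0 y = 1" if "y \<in> V" for y using V(2)[OF that] that by (simp add: res_def \<chi>0_def)
      show "(\<lambda>x. \<sigma> x * \<chi>0 x) \<in> regular_functions n W" if "\<sigma> \<in> LL W" for \<sigma> W using that by (simp add: LL_def)
    qed
  next
    case True
    define V where "V = basic_open n (L d) \<inter> X"
    have V: "V \<subseteq> proj_space n" "\<And>y. y \<in> V \<Longrightarrow> peval (L d) y \<noteq> 0" "V \<subseteq> X" by (auto simp: V_def basic_open_def)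
    \<comment> \<open>On this chart \<open>s/t\<close> is the regular function
      \<open>L (d - 1) / L d\<close>, so \<open>1 / \<chi>1\<close> is a section.\<close>
    have chi: "peval (L d) y * \<chi>0 y = peval (L (d - 1)) y * \<chi>1 y" if "y \<in> V" for y
      using X_ratio[of y "d - 1"] that V(3) d by auto
    have c1: "\<chi>1 y \<noteq> 0" if "y \<in> V" for y using chi[OF that] chi_nz[of y] V(2)[OF that] by auto
    show ?thesis
    proof (rule triv[of V "res V (\<lambda>y. 1 / \<chi>1 y)" \<chi>1])
      have "(\<lambda>y. res V (\<lambda>y. 1 / \<chi>1 y) y * \<chi>1 y) = res V (\<lambda>_. 1)"
        using c1 by (auto simp: res_def)
      moreover have "res V (\<lambda>y. 1 / \<chi>1 y) y * \<chi>0 y = res V (\<lambda>y. peval (L (d - 1)) y / peval (L d) y) y" for y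
        using chi[of y] c1[of y] V(2)[of y] by (auto simp: res_def field_simps)
      then have "(\<lambda>y. res V (\<lambda>y. 1 / \<chi>1 y) y * \<chi>0 y) = res V (\<lambda>y. peval (L (d - 1)) y / peval (L d) y)" by auto
      ultimately show "res V (\<lambda>y. 1 / \<chi>1 y) \<in> LL V"
        using regular_const[OF V(1)] regular_frac[OF V(1) L_forms L_forms V(2)] by (auto simp: LL_def res_def)
      show "x \<in> V" using X_L[OF x] True x X_sub by (auto simp: V_def basic_open_def)
      show "open_in n X V" unfolding V_def by (rule op)
      show "res V (\<lambda>y. 1 / \<chi>1 y) y * \<chi>1 y = 1" if "y \<in> V" for y using c1[OF that] that by (simp add: res_def)
      show "(\<lambda>x. \<sigma> x * \<chi>1 x) \<in> regular_functions n W" if "\<sigma> \<in> LL W" for \<sigma> W using that by (simp add: LL_def)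
    qed
  qed
qed

text \<open>The derivative of \<open>f\<close> in direction \<open>Vq x\<close>: as
  \<open>f x = 0\<close>, only the numerator contributes to the quotient rule. The choice is
  unambiguous by \<open>frac_at_pD_unique\<close>.\<close>

definition qq :: "'k pts \<Rightarrow> 'k fn \<Rightarrow> 'k fn" where
  "qq U f x = (if x \<in> U \<inter> X then (SOME c. \<exists>K G H. frac_at n U f x K G H \<and> c = pD x (Vq x) G / peval H x) else 0)"

lemma qq_eq:
  assumes U: "zariski_open n U" and f: "f \<in> ideal_sheaf n X U" and x: "x \<in> U" "x \<in> X" and fr: "frac_at n U f x K G H"
  shows "qq U f x = pD x (Vq x) G / peval H x" "peval G x = 0" "peval H x \<noteq> 0"
proof -
  have f0: "f x = 0" using f x by (simp add: ideal_sheaf_def)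
  let ?P = "\<lambda>c. \<exists>K G H. frac_at n U f x K G H \<and> c = pD x (Vq x) G / peval H x"
  have "?P (SOME c. ?P c)" using fr by (intro someI[of ?P "pD x (Vq x) G / peval H x"]) blast
  moreover have "c = pD x (Vq x) G / peval H x" if "?P c" for c
    using that frac_at_pD_unique[OF U x(1) Vq_vecs _ fr f0] by blast
  ultimately show "qq U f x = pD x (Vq x) G / peval H x" using x by (simp add: qq_def)
  show "peval G x = 0" "peval H x \<noteq> 0" using frac_atD[OF fr x(1)] f0 by auto
qed

lemma ideal_frac:
  assumes U: "zariski_open n U" and f: "f \<in> regular_functions n U" and x: "x \<in> U"
  obtains K G H where "frac_at n U f x K G H"
  using f x regular_iff[OF zariski_open_sub[OF U], of f] by blast

text \<open>\<open>Vq\<close> jumps at the point with \<open>L 0 = 0\<close>, but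
  \<open>\<chi>0\<close> and \<open>\<chi>1\<close> times it are given by linear forms on all of
  \<open>X\<close>; hence these multiples of the derivative are regular.\<close>

lemma qq_frac_at:
  assumes U: "zariski_open n U" and f: "f \<in> ideal_sheaf n X U" and x: "x \<in> U" "x \<in> X" and fr: "frac_at n U f x K G H"
  shows "frac_at n (U \<inter> X) (\<lambda>x. qq U f x * \<chi>0 x) x K (dd (single 0) Xv VP0 G) H"
    "frac_at n (U \<inter> X) (\<lambda>x. qq U f x * \<chi>1 x) x K (dd (single 0) Xv VP1 G) H"
proof -
  obtain k l where *: "K \<in> forms n k" "G \<in> forms n l" "H \<in> forms n l" "peval K x \<noteq> 0"
    using frac_atE[OF fr] by metis
  have y: "qq U f y = pD y (Vq y) G / peval H y \<and> peval H y \<noteq> 0" if "y \<in> U \<inter> X" "peval K y \<noteq> 0" for y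
  proof -
    have "frac_at n U f y K G H" using fr that(2) by (auto simp: frac_at_def)
    from qq_eq[OF U f _ _ this] that show ?thesis by auto
  qed
  have pV: "pD y (V0 y) G = \<chi>0 y * pD y (Vq y) G" "pD y (V1 y) G = \<chi>1 y * pD y (Vq y) G" if "y \<in> X" for y
    unfolding V_ratio[OF that] by (rule dd_scale_dir[OF chom_id forms_polys[OF *(2)]])+
  show "frac_at n (U \<inter> X) (\<lambda>x. qq U f x * \<chi>0 x) x K (dd (single 0) Xv VP0 G) H"
    by (rule frac_atI[OF *(1) forms_derivative[OF VP_forms(1) *(2)] *(3,4)])
      (use y pV in \<open>auto simp: peval_derivative V0_def[symmetric] mult.commute\<close>)
  show "frac_at n (U \<inter> X) (\<lambda>x. qq U f x * \<chi>1 x) x K (dd (single 0) Xv VP1 G) H"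
    by (rule frac_atI[OF *(1) forms_derivative[OF VP_forms(2) *(2)] *(3,4)])
      (use y pV in \<open>auto simp: peval_derivative V1_def[symmetric] mult.commute\<close>)
qed

lemma qq_LL: assumes U: "zariski_open n U" and f: "f \<in> ideal_sheaf n X U" shows "qq U f \<in> LL (U \<inter> X)"
proof -
  have sub: "U \<inter> X \<subseteq> proj_space n" using X_sub by auto
  have fr: "f \<in> regular_functions n U" using f by (simp add: ideal_sheaf_def)
  have "\<exists>K G H. frac_at n (U \<inter> X) (\<lambda>x. qq U f x * \<chi>0 x) x K G H"
    "\<exists>K G H. frac_at n (U \<inter> X) (\<lambda>x. qq U f x * \<chi>1 x) x K G H" if x: "x \<in> U \<inter> X" for x
  proof -
    obtain K G H where "frac_at n U f x K G H" using ideal_frac[OF U fr, of x] x by blast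
    from qq_frac_at[OF U f _ _ this] x show "\<exists>K G H. frac_at n (U \<inter> X) (\<lambda>x. qq U f x * \<chi>0 x) x K G H"
      "\<exists>K G H. frac_at n (U \<inter> X) (\<lambda>x. qq U f x * \<chi>1 x) x K G H" by blast+
  qed
  then show ?thesis by (auto simp: LL_def qq_def regular_iff[OF sub])
qed

lemma conormal_qq: "conormal_hom n X LB1 rs qq"
  unfolding conormal_hom_def
proof (intro conjI allI impI ballI)
  fix U f assume U: "zariski_open n U" and f: "f \<in> ideal_sheaf n X U"
  have Up: "U \<subseteq> proj_space n" by (rule zariski_open_sub[OF U])
  have fR: "f \<in> regular_functions n U" using f by (simp add: ideal_sheaf_def)
  show "qq U f \<in> carrier (LB1 (U \<inter> X))" using qq_LL[OF U f] by simp
  {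
    fix g assume g: "g \<in> ideal_sheaf n X U"
    have gR: "g \<in> regular_functions n U" using g by (simp add: ideal_sheaf_def)
    have fg: "(\<lambda>x. f x + g x) \<in> ideal_sheaf n X U" "(\<lambda>x. f x * g x) \<in> ideal_sheaf n X U"
      using f g regular_add[OF Up] regular_mult[OF Up] by (auto simp: ideal_sheaf_def)
    have "qq U (\<lambda>x. f x + g x) x = qq U f x + qq U g x \<and> qq U (\<lambda>x. f x * g x) x = 0" for x
    proof (cases "x \<in> U \<inter> X")
      case True
      obtain K G H where 1: "frac_at n U f x K G H" using ideal_frac[OF U fR, of x] True by blast
      obtain K' G' H' where 2: "frac_at n U g x K' G' H'" using ideal_frac[OF U gR, of x] True by blast
      have x: "x \<in> U" "x \<in> X" using True by auto
      note q1 = qq_eq[OF U f x 1] and q2 = qq_eq[OF U g x 2]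
      show ?thesis
        unfolding q1(1) q2(1) qq_eq(1)[OF U fg(1) x frac_at_add[OF 1 2]] qq_eq(1)[OF U fg(2) x frac_at_mult[OF 1 2]]
        using q1(2,3) q2(2,3) by (simp add: dd_add pD_mult add_frac_eq)
    qed (auto simp: qq_def)
    then show "qq U (\<lambda>x. f x + g x) = qq U f \<oplus>\<^bsub>LB1 (U \<inter> X)\<^esub> qq U g" "qq U (\<lambda>x. f x * g x) = \<zero>\<^bsub>LB1 (U \<inter> X)\<^esub>"
      by (auto simp: fun_eq_iff)
  }
  fix a assume a: "a \<in> regular_functions n U"
  have af: "(\<lambda>x. a x * f x) \<in> ideal_sheaf n X U" using f regular_mult[OF Up a] by (auto simp: ideal_sheaf_def)
  have "qq U (\<lambda>x. a x * f x) x = res (U \<inter> X) a x * qq U f x" for x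
  proof (cases "x \<in> U \<inter> X")
    case True
    obtain K G H where 1: "frac_at n U f x K G H" using ideal_frac[OF U fR, of x] True by blast
    obtain K' G' H' where 2: "frac_at n U a x K' G' H'" using ideal_frac[OF U a, of x] True by blast
    have x: "x \<in> U" "x \<in> X" using True by auto
    note q1 = qq_eq[OF U f x 1]
    show ?thesis
      unfolding q1(1) qq_eq(1)[OF U af x frac_at_mult[OF 2 1]]
      using q1(2,3) frac_atD[OF 2 x(1)] x by (simp add: pD_mult res_def)
  qed (auto simp: qq_def)
  then show "qq U (\<lambda>x. a x * f x) = res (U \<inter> X) a \<odot>\<^bsub>LB1 (U \<inter> X)\<^esub> qq U f" by auto
next
  fix U U' f assume UU: "zariski_open n U \<and> zariski_open n U' \<and> U' \<subseteq> U" and f: "f \<in> ideal_sheaf n X U"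
  then have U: "zariski_open n U" "zariski_open n U'" "U' \<subseteq> U" by auto
  have fR: "f \<in> regular_functions n U" using f by (simp add: ideal_sheaf_def)
  have f': "res U' f \<in> ideal_sheaf n X U'"
    using f regular_res[OF zariski_open_sub[OF U(1)] U(3)] U(3) by (auto simp: ideal_sheaf_def res_def)
  have "qq U' (res U' f) x = res (U' \<inter> X) (qq U f) x" for x
  proof (cases "x \<in> U' \<inter> X")
    case True
    then have x: "x \<in> U'" "x \<in> X" "x \<in> U" using U(3) by auto
    obtain K G H where 1: "frac_at n U f x K G H" using ideal_frac[OF U(1) fR x(3)] by blast
    have 2: "frac_at n U' (res U' f) x K G H" by (rule frac_at_sub[OF 1 U(3)]) (simp add: res_def)
    show ?thesis using qq_eq(1)[OF U(2) f' x(1,2) 2] qq_eq(1)[OF U(1) f x(3,2) 1] True by (simp add: res_def)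
  qed (auto simp: qq_def res_def)
  then show "qq U' (res U' f) = rs (U \<inter> X) (U' \<inter> X) (qq U f)" by (auto simp: rs_def)
qed

text \<open>The direction has no zeros: the first complementary coordinate has derivative
  \<open>L 0\<close> along \<open>s\<close> times the field, the last one has derivative
  \<open>L d\<close> along \<open>t\<close> times it, and \<open>L 0\<close> and \<open>L d\<close>
  have no common zero on \<open>X\<close>.\<close>

lemma surjective_qq: "surjective_conormal_hom n X LB1 rs qq"
  unfolding surjective_conormal_hom_def
proof (intro conjI allI impI ballI conormal_qq)
  fix U s x assume U: "zariski_open n U" and s: "s \<in> carrier (LB1 (U \<inter> X))" and x: "x \<in> U \<inter> X"
  have UX: "U \<inter> X \<subseteq> proj_space n" using X_sub by auto
  have sL: "s \<in> LL (U \<inter> X)" using s by simp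
  text \<open>The section is realized as the derivative of \<open>(s \<cdot> h) \<cdot> L j / L i\<close>, with \<open>h\<close> one of the
    functions \<open>\<chi>\<close> and \<open>L j\<close> vanishing on \<open>X\<close>.\<close>
  have main: "\<exists>U'. zariski_open n U' \<and> x \<in> U' \<and> U' \<subseteq> U \<and>
          (\<exists>f\<in>ideal_sheaf n X U'. qq U' f = rs (U \<inter> X) (U' \<inter> X) s)"
    if h: "(\<lambda>y. s y * h y) \<in> regular_functions n (U \<inter> X)" and i: "peval (L i) x \<noteq> 0"
      and j: "d < j" "j \<le> n" and e: "\<And>y. y \<in> X \<Longrightarrow> peval (L i) y \<noteq> 0 \<Longrightarrow> h y * (pD y (Vq y) (L j)) = peval (L i) y" for h i j
  proof -
    obtain K A C where fr: "frac_at n (U \<inter> X) (\<lambda>y. s y * h y) x K A C"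
      using h x regular_iff[OF UX, of "\<lambda>y. s y * h y"] by blast
    obtain k l where *: "K \<in> forms n k" "A \<in> forms n l" "C \<in> forms n l" "peval K x \<noteq> 0"
      using frac_atE[OF fr] by metis
    obtain K0 k0 where K0: "K0 \<in> forms n k0" "peval K0 x \<noteq> 0" "basic_open n K0 \<subseteq> U"
      using zariski_open_basicE[OF U, of x] x by blast
    have C: "peval C x \<noteq> 0" using frac_atD[OF fr x] by simp
    define T where "T = K0 * (K * (C * L i))"
    have T: "T \<in> forms n (k0 + (k + (l + 1)))" unfolding T_def using * K0(1) by (intro forms_mult L_forms)
    define U' where "U' = basic_open n T"
    have U': "zariski_open n U'" "x \<in> U'" "U' \<subseteq> U" "U' \<subseteq> proj_space n"
      "\<And>y. y \<in> U' \<Longrightarrow> peval K y \<noteq> 0 \<and> peval C y \<noteq> 0 \<and> peval (L i) y \<noteq> 0"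
      using zariski_open_basic[OF T] K0 x X_sub C *(4) i by (auto simp: U'_def basic_open_def T_def)
    define f where "f = res U' (\<lambda>y. peval (A * L j) y / peval (C * L i) y)"
    have AL: "A * L j \<in> forms n (l + 1)" "C * L i \<in> forms n (l + 1)" using * by (auto intro!: forms_mult')
    have fR: "f \<in> regular_functions n U'" unfolding f_def
      by (rule regular_frac[OF U'(4) AL]) (use U'(5) in auto)
    have Lj: "peval (L j) y = 0" if "y \<in> X" for y
      using that j L_pt[OF j(2)] by (auto simp: X_pt)
    then have fI: "f \<in> ideal_sheaf n X U'" using fR by (auto simp: ideal_sheaf_def f_def res_def)
    have "qq U' f y = res (U' \<inter> X) s y" for y
    proof (cases "y \<in> U' \<inter> X")
      case True
      then have y: "y \<in> U'" "y \<in> X" "y \<in> U \<inter> X" using U'(3) by auto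
      have "frac_at n U' f y 1 (A * L j) (C * L i)"
        using AL U'(5) by (intro frac_atI[of 1 n 0]) (auto simp: f_def res_def)
      from qq_eq(1)[OF U'(1) fI y(1,2) this]
      have q: "qq U' f y = peval A y * pD y (Vq y) (L j) / (peval C y * peval (L i) y)"
        using Lj[OF y(2)] by (simp add: pD_mult)
      have sh: "s y * h y = peval A y / peval C y" "peval K y \<noteq> 0"
        using fr U'(5)[OF y(1)] y(3) by (auto simp: frac_at_def)
      have nz: "peval C y \<noteq> 0" "peval (L i) y \<noteq> 0" using U'(5)[OF y(1)] by auto
      have "qq U' f y = (peval A y / peval C y) * (pD y (Vq y) (L j) / peval (L i) y)"
        unfolding q by simp
      also have "\<dots> = s y * (h y * pD y (Vq y) (L j)) / peval (L i) y" unfolding sh(1)[symmetric] by simp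
      also have "\<dots> = s y" using e[OF y(2) nz(2)] nz by simp
      finally show ?thesis using True by (simp add: res_def)
    qed (auto simp: qq_def res_def)
    then have "qq U' f = rs (U \<inter> X) (U' \<inter> X) s" by (auto simp: rs_def)
    with U' fI show ?thesis by blast
  qed
  have pL: "pD y v (L j) = (\<Sum>m\<le>n. \<Lambda> j m * v m)" for y v j
    by (simp add: L_def dd_sum dd_const_mult)
  have vV0: "(\<Sum>m\<le>n. \<Lambda> (d + 1 + i) m * V0 y m) = peval (L i) y" if "i < d" for i y
    unfolding V_sum by (subst sum_dual) (use that n in auto)
  have vV1: "(\<Sum>m\<le>n. \<Lambda> (d + 1 + i) m * V1 y m) = peval (L (i + 1)) y" if "i < d" for i y
    unfolding V_sum by (subst sum_dual) (use that n in auto)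
  show "\<exists>U'. zariski_open n U' \<and> x \<in> U' \<and> U' \<subseteq> U \<and>
          (\<exists>f\<in>ideal_sheaf n X U'. qq U' f = rs (U \<inter> X) (U' \<inter> X) s)"
  proof (cases "peval (L 0) x = 0")
    case False
    show ?thesis
    proof (rule main[of \<chi>0 0 "d + 1 + 0"])
      fix y assume y: "y \<in> X" "peval (L 0) y \<noteq> 0"
      have "\<chi>0 y * pD y (Vq y) (L (d + 1 + 0)) = (\<Sum>m\<le>n. \<Lambda> (d + 1 + 0) m * V0 y m)"
        unfolding pL V_ratio[OF y(1)] by (simp add: sum_distrib_left algebra_simps)
      also have "\<dots> = peval (L 0) y" by (rule vV0) (use d in simp)
      finally show "\<chi>0 y * pD y (Vq y) (L (d + 1 + 0)) = peval (L 0) y" .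
    next
      show "(\<lambda>y. s y * \<chi>0 y) \<in> regular_functions n (U \<inter> X)" using sL by (simp add: LL_def)
      show "d + 1 + 0 \<le> n" using d by (simp add: n)
    qed (use False in auto)
  next
    case True
    show ?thesis
    proof (rule main[of \<chi>1 d "d + 1 + (d - 1)"])
      fix y assume y: "y \<in> X" "peval (L d) y \<noteq> 0"
      have "\<chi>1 y * pD y (Vq y) (L (d + 1 + (d - 1))) = (\<Sum>m\<le>n. \<Lambda> (d + 1 + (d - 1)) m * V1 y m)"
        unfolding pL V_ratio[OF y(1)] by (simp add: sum_distrib_left algebra_simps)
      also have "\<dots> = peval (L (d - 1 + 1)) y" by (rule vV1) (use d in simp)
      finally show "\<chi>1 y * pD y (Vq y) (L (d + 1 + (d - 1))) = peval (L d) y" using d by simp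
    next
      show "(\<lambda>y. s y * \<chi>1 y) \<in> regular_functions n (U \<inter> X)" using sL by (simp add: LL_def)
      show "d + 1 + (d - 1) \<le> n" using d by (simp add: n)
    qed (use True X_L[of x] x in auto)
  qed
qed

definition JJ :: "'k pts \<Rightarrow> 'k fn set" where "JJ U = {f \<in> ideal_sheaf n X U. qq U f = (\<lambda>_. 0)}"

lemma double_structure_JJ: "double_structure n X JJ"
  unfolding double_structure_def
  by (intro exI[of _ LB1] exI[of _ rs] exI[of _ qq] conjI line_bundle_LB1 surjective_qq) (simp add: JJ_def)

lemma dd_cc_VP: "dd pC cc (\<lambda>m. ins pC cc (VP0 m)) F = dd pC cc gg F"
  "F \<in> polys n \<Longrightarrow> dd pC cc (\<lambda>m. ins pC cc (VP1 m)) F = monom 1 1 * dd pC cc gg F"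
proof -
  have L: "ins pC cc (L j) = monom 1 j" if "j \<le> d" for j using ins_cc_L[of j] that dn by simp
  have 0: "ins pC cc (VP0 m) = gg m" for m
    by (simp add: VP0_def gg_def chomD[OF chom_ins[OF chom_pCons]] ins_const L)
  have 1: "ins pC cc (VP1 m) = monom 1 1 * gg m" for m
  proof -
    have "ins pC cc (VP1 m) = (\<Sum>j<d. smult (B (d + 1 + j) m) (monom 1 (j + 1)))"
      using L by (simp add: VP1_def chomD[OF chom_ins[OF chom_pCons]] ins_const)
    also have "\<dots> = monom 1 1 * gg m"
      unfolding gg_def sum_distrib_left by (intro sum.cong) (auto simp: mult_monom smult_monom)
    finally show ?thesis .
  qed
  show "dd pC cc (\<lambda>m. ins pC cc (VP0 m)) F = dd pC cc gg F" by (simp add: 0)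
  show "dd pC cc (\<lambda>m. ins pC cc (VP1 m)) F = monom 1 1 * dd pC cc gg F" if "F \<in> polys n"
    unfolding 1 by (rule dd_scale_dir[OF chom_pCons that])
qed

lemma ins_cc_derivative: "ins pC cc (dd (single 0) Xv V G) = dd pC cc (\<lambda>m. ins pC cc (V m)) G"
  using dd_chom[OF chom_single chom_ins[OF chom_pCons, of cc], of Xv V G] by (simp add: ins_const ins_Xv)

text \<open>Membership in \<open>JJ\<close> is a pointwise condition on \<open>F\<close> and its
  derivative along \<open>Vq\<close>; by \<open>vanish_iff\<close>, applied to \<open>F\<close> and
  to its derivatives along the two fields of linear forms, it becomes two polynomial
  identities.\<close>

lemma twisted_sections_JJ:
  assumes F: "F \<in> forms n l"
  shows "F \<in> twisted_sections n JJ l \<longleftrightarrow> ins pC cc F = 0 \<and> dd pC cc gg F = 0"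
proof -
  define U :: "nat \<Rightarrow> 'k pts" where "U i = {x \<in> proj_space n. x i \<noteq> 0}" for i
  define f where "f i = res (U i) (\<lambda>x. peval F x / x i ^ l)" for i
  have Uo: "zariski_open n (U i)" if "i \<le> n" for i
    using zariski_open_basic[OF forms_Xv[OF that]] by (simp add: U_def basic_open_def)
  have Fp: "F \<in> polys n" using F by (rule forms_polys)
  have tw: "F \<in> twisted_sections n JJ l \<longleftrightarrow> (\<forall>i\<le>n. f i \<in> JJ (U i))"
    using F by (simp add: twisted_sections_def f_def U_def Let_def)
  have fr: "frac_at n (U i) (f i) x (Xv i) F (Xv i ^ l)" if "i \<le> n" "x \<in> U i" for i x
    using that F forms_power[OF forms_Xv[OF that(1)], of l]
    by (intro frac_atI[OF forms_Xv[OF that(1)], of F l]) (auto simp: U_def f_def res_def)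
  have fI: "f i \<in> ideal_sheaf n X (U i)" if "i \<le> n" "\<forall>x\<in>X. peval F x = 0" for i
  proof -
    have "res (U i) (\<lambda>x. peval F x / peval (Xv i ^ l) x) \<in> regular_functions n (U i)"
      using forms_power[OF forms_Xv[OF that(1)], of l] by (intro regular_frac[OF zariski_open_sub[OF Uo[OF that(1)]] F]) (auto simp: U_def)
    then show ?thesis using that(2) by (auto simp: ideal_sheaf_def f_def res_def)
  qed
  have pV: "pD x (V0 x) F = \<chi>0 x * pD x (Vq x) F" "pD x (V1 x) F = \<chi>1 x * pD x (Vq x) F" if "x \<in> X" for x
    unfolding V_ratio[OF that] by (rule dd_scale_dir[OF chom_id Fp])+
  show ?thesis
  proof
    assume "F \<in> twisted_sections n JJ l"
    then have fJ: "\<And>i. i \<le> n \<Longrightarrow> f i \<in> JJ (U i)" using tw by blast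
    have *: "peval F x = 0 \<and> pD x (Vq x) F = 0" if x: "x \<in> X" for x
    proof -
      have "x \<in> proj_space n" using x X_sub by auto
      then obtain i where i: "i \<le> n" "x i \<noteq> 0" "x \<in> U i"
        by (auto simp: proj_space_def vecs_def U_def) (metis linorder_not_le)
      have fi: "f i \<in> ideal_sheaf n X (U i)" "qq (U i) (f i) x = 0" using fJ[OF i(1)] by (auto simp: JJ_def)
      show ?thesis using qq_eq[OF Uo[OF i(1)] fi(1) i(3) x fr[OF i(1,3)]] fi(2) i(2) by simp
    qed
    have "\<forall>x\<in>X. peval (dd (single 0) Xv VP0 F) x = 0"
      using * pV by (auto simp: peval_derivative V0_def[symmetric])
    then have "ins pC cc (dd (single 0) Xv VP0 F) = 0"
      using vanish_iff[OF forms_derivative[of n VP0, OF VP_forms(1) F]] by blast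
    moreover have "ins pC cc F = 0" using * vanish_iff[OF F] by blast
    ultimately show "ins pC cc F = 0 \<and> dd pC cc gg F = 0" by (simp add: ins_cc_derivative dd_cc_VP)
  next
    assume 0: "ins pC cc F = 0 \<and> dd pC cc gg F = 0"
    then have F0: "\<forall>x\<in>X. peval F x = 0" using vanish_iff[OF F] by blast
    \<comment> \<open>Both fields enter: at the point \<open>(0 : 1)\<close> the factor
      \<open>\<chi>0\<close> is zero and only \<open>VP1\<close> controls the derivative.\<close>
    have "ins pC cc (dd (single 0) Xv VP0 F) = 0" "ins pC cc (dd (single 0) Xv VP1 F) = 0"
      using 0 by (auto simp: ins_cc_derivative dd_cc_VP(1) dd_cc_VP(2)[OF Fp])
    then have "\<forall>x\<in>X. peval (dd (single 0) Xv VP0 F) x = 0" "\<forall>x\<in>X. peval (dd (single 0) Xv VP1 F) x = 0"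
      using vanish_iff[OF forms_derivative[of n VP0, OF VP_forms(1) F]] vanish_iff[OF forms_derivative[of n VP1, OF VP_forms(2) F]] by blast+
    then have q0: "pD x (Vq x) F = 0" if "x \<in> X" for x
      using pV[OF that] chi_nz[of x] that by (auto simp: peval_derivative V0_def[symmetric] V1_def[symmetric])
    have "qq (U i) (f i) x = 0" if i: "i \<le> n" for i x
    proof (cases "x \<in> U i \<inter> X")
      case True
      then show ?thesis using qq_eq(1)[OF Uo[OF i] fI[OF i F0] _ _ fr[OF i]] q0 by auto
    qed (auto simp: qq_def)
    then show "F \<in> twisted_sections n JJ l" unfolding tw JJ_def using fI F0 by auto
  qed
qed

lemma homogeneous_ideal_JJ: "homogeneous_ideal n JJ = jet_ideal n cc gg"
  using twisted_sections_JJ[OF hom_comp_in_forms] by (auto simp: homogeneous_ideal_def jet_ideal_def)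

end


section \<open>From an arbitrary double structure to a polynomial direction\<close>

section \<open>Arbitrary double structures on the curve\<close>

locale rnc_bundle = rnc d n B \<Lambda> X for d n :: nat and B \<Lambda> :: "nat \<Rightarrow> nat \<Rightarrow> 'k::alg_closed_field" and X +
  fixes M :: "'k pts \<Rightarrow> ('k fn, 'm) module" and r :: "'k pts \<Rightarrow> 'k pts \<Rightarrow> 'm \<Rightarrow> 'm" and q :: "'k pts \<Rightarrow> 'k fn \<Rightarrow> 'm"
  assumes lb: "line_bundle n X M r" and sur: "surjective_conormal_hom n X M r q"
begin

lemma pt_X: "pt 1 1 z \<in> X"
  unfolding X_pt by (intro exI[of _ 1] exI[of _ z]) auto

lemma sheaf: "sheaf_of_modules n X M r" using lb by (simp add: line_bundle_def)

lemmas sheafD = sheaf[unfolded sheaf_of_modules_def]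

lemma op_sub: "open_in n X V \<Longrightarrow> V \<subseteq> proj_space n"
  using open_in_sub[of n X V] X_sub by auto

lemma op_Int: "open_in n X V \<Longrightarrow> open_in n X W \<Longrightarrow> open_in n X (V \<inter> W)"
proof -
  assume "open_in n X V" "open_in n X W"
  then obtain U U' where U: "zariski_open n U" "V = U \<inter> X" "zariski_open n U'" "W = U' \<inter> X" unfolding open_in_def by blast
  then have "V \<inter> W = (U \<inter> U') \<inter> X" by blast
  then show ?thesis unfolding open_in_def using zariski_open_Int[OF U(1,3)] by blast
qed

lemma op_zar: "zariski_open n U \<Longrightarrow> open_in n X (U \<inter> X)"
  by (auto simp: open_in_def)

lemma M_mod: "open_in n X V \<Longrightarrow> Module.module (regular_ring n V) (M V)"
  using sheafD[THEN conjunct1] by blast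

lemma r_closed: "open_in n X V \<Longrightarrow> open_in n X W \<Longrightarrow> W \<subseteq> V \<Longrightarrow> s \<in> carrier (M V) \<Longrightarrow> r V W s \<in> carrier (M W)"
  using sheafD[THEN conjunct2, THEN conjunct1] by blast

lemma r_smult: "open_in n X V \<Longrightarrow> open_in n X W \<Longrightarrow> W \<subseteq> V \<Longrightarrow> a \<in> regular_functions n V \<Longrightarrow> s \<in> carrier (M V) \<Longrightarrow>
    r V W (a \<odot>\<^bsub>M V\<^esub> s) = res W a \<odot>\<^bsub>M W\<^esub> r V W s"
  using sheafD[THEN conjunct2, THEN conjunct1] by blast

lemma r_id: "open_in n X V \<Longrightarrow> s \<in> carrier (M V) \<Longrightarrow> r V V s = s"
  using sheafD[THEN conjunct2, THEN conjunct2, THEN conjunct1] by blast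

lemma r_comp: "open_in n X V \<Longrightarrow> open_in n X W \<Longrightarrow> open_in n X T \<Longrightarrow> T \<subseteq> W \<Longrightarrow> W \<subseteq> V \<Longrightarrow> s \<in> carrier (M V) \<Longrightarrow>
    r W T (r V W s) = r V T s"
  using sheafD[THEN conjunct2, THEN conjunct2, THEN conjunct2, THEN conjunct1] by blast

lemma M_zero: "open_in n X V \<Longrightarrow> \<zero>\<^bsub>M V\<^esub> \<in> carrier (M V)"
proof -
  assume "open_in n X V"
  then interpret m: Module.module "regular_ring n V" "M V" by (rule M_mod)
  show ?thesis by simp
qed

lemma M_smult: "open_in n X V \<Longrightarrow> a \<in> regular_functions n V \<Longrightarrow> s \<in> carrier (M V) \<Longrightarrow> a \<odot>\<^bsub>M V\<^esub> s \<in> carrier (M V)"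
proof -
  assume *: "open_in n X V" "a \<in> regular_functions n V" "s \<in> carrier (M V)"
  then interpret m: Module.module "regular_ring n V" "M V" by (intro M_mod)
  show ?thesis using m.smult_closed * by simp
qed

lemma M_null: "open_in n X V \<Longrightarrow> s \<in> carrier (M V) \<Longrightarrow> (\<lambda>_. 0) \<odot>\<^bsub>M V\<^esub> s = \<zero>\<^bsub>M V\<^esub>"
proof -
  assume *: "open_in n X V" "s \<in> carrier (M V)"
  then interpret m: Module.module "regular_ring n V" "M V" by (intro M_mod)
  show ?thesis using m.smult_l_null[OF *(2)] by (simp add: regular_ring_def)
qed

lemma M_null_r: "open_in n X V \<Longrightarrow> a \<in> regular_functions n V \<Longrightarrow> a \<odot>\<^bsub>M V\<^esub> \<zero>\<^bsub>M V\<^esub> = \<zero>\<^bsub>M V\<^esub>"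
proof -
  assume *: "open_in n X V" "a \<in> regular_functions n V"
  then interpret m: Module.module "regular_ring n V" "M V" by (intro M_mod)
  show ?thesis using m.smult_r_null[of a] * by simp
qed

lemma r_zero:
  assumes "open_in n X V" "open_in n X W" "W \<subseteq> V" shows "r V W \<zero>\<^bsub>M V\<^esub> = \<zero>\<^bsub>M W\<^esub>"
proof -
  have "r V W ((\<lambda>_. 0) \<odot>\<^bsub>M V\<^esub> \<zero>\<^bsub>M V\<^esub>) = res W (\<lambda>_. 0) \<odot>\<^bsub>M W\<^esub> r V W \<zero>\<^bsub>M V\<^esub>"
    by (rule r_smult[OF assms regular_zero[OF op_sub[OF assms(1)]] M_zero[OF assms(1)]])
  moreover have "res W (\<lambda>_. 0) = (\<lambda>_. 0 :: 'k)" by (auto simp: res_def)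
  ultimately show ?thesis
    using M_null[OF assms(1) M_zero[OF assms(1)]] M_null[OF assms(2) r_closed[OF assms M_zero[OF assms(1)]]] by simp
qed

text \<open>The uniqueness part of gluing: \<open>s\<close> and the zero section have the same
  restrictions to a cover.\<close>

lemma zero_local:
  assumes V: "open_in n X V" and s: "s \<in> carrier (M V)"
    and loc: "\<And>y. y \<in> V \<Longrightarrow> \<exists>N. open_in n X N \<and> y \<in> N \<and> N \<subseteq> V \<and> r V N s = \<zero>\<^bsub>M N\<^esub>"
  shows "s = \<zero>\<^bsub>M V\<^esub>"
proof -
  define \<W> where "\<W> = {N. open_in n X N \<and> N \<subseteq> V \<and> r V N s = \<zero>\<^bsub>M N\<^esub>}"
  have W: "open_in n X W" "W \<subseteq> V" "r V W s = \<zero>\<^bsub>M W\<^esub>" if "W \<in> \<W>" for W using that by (auto simp: \<W>_def)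
  have "\<Union>\<W> = V" using loc by (auto simp: \<W>_def)
  moreover have "r W (W \<inter> T) \<zero>\<^bsub>M W\<^esub> = r T (W \<inter> T) \<zero>\<^bsub>M T\<^esub>" if "W \<in> \<W>" "T \<in> \<W>" for W T
    using r_zero[OF W(1)[OF that(1)] op_Int[OF W(1)[OF that(1)] W(1)[OF that(2)]]]
      r_zero[OF W(1)[OF that(2)] op_Int[OF W(1)[OF that(1)] W(1)[OF that(2)]]] by simp
  ultimately have "\<exists>!t. t \<in> carrier (M V) \<and> (\<forall>W\<in>\<W>. r V W t = \<zero>\<^bsub>M W\<^esub>)"
    using sheafD[THEN conjunct2, THEN conjunct2, THEN conjunct2, THEN conjunct2, rule_format, of V \<W> "\<lambda>W. \<zero>\<^bsub>M W\<^esub>"]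
      V W(1) M_zero by blast
  moreover have "r V W \<zero>\<^bsub>M V\<^esub> = \<zero>\<^bsub>M W\<^esub>" if "W \<in> \<W>" for W
    using r_zero[OF V W(1,2)[OF that]] W(1)[OF that] by simp
  ultimately show ?thesis using s M_zero[OF V] W(3) by blast
qed

text \<open>Irreducibility of \<open>X\<close>: near \<open>y\<close> the function is a quotient,
  whose numerator vanishes for all but finitely many parameters and hence on all of
  \<open>X\<close>.\<close>

lemma density:
  assumes U: "zariski_open n U" and a: "a \<in> regular_functions n (U \<inter> X)" and P: "P \<noteq> 0"
    and z: "\<And>z. poly P z \<noteq> 0 \<Longrightarrow> pt 1 1 z \<in> U \<Longrightarrow> a (pt 1 1 z) = 0"
  shows "a = (\<lambda>_. 0)"
proof
  fix y
  have sub: "U \<inter> X \<subseteq> proj_space n" using X_sub by auto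
  show "a y = 0"
  proof (cases "y \<in> U \<inter> X")
    case True
    obtain K G H where fr: "frac_at n (U \<inter> X) a y K G H"
      using a True regular_iff[OF sub, of a] by blast
    obtain k l where *: "K \<in> forms n k" "G \<in> forms n l" "peval K y \<noteq> 0" using frac_atE[OF fr] by metis
    obtain K0 k0 where K0: "K0 \<in> forms n k0" "peval K0 y \<noteq> 0" "basic_open n K0 \<subseteq> U"
      using zariski_open_basicE[OF U, of y] True by blast
    have "ins pC cc (K * K0) \<noteq> 0"
      using vanish_iff[OF forms_mult[OF *(1) K0(1)]] True *(3) K0(2) by (metis IntE mult_eq_0_iff peval_simps(3))
    have "poly (ins pC cc G) z = 0" if "poly (P * ins pC cc (K * K0)) z \<noteq> 0" for z
    proof -
      have nz: "poly P z \<noteq> 0" "peval K (pt 1 1 z) \<noteq> 0" "peval K0 (pt 1 1 z) \<noteq> 0"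
        using that by (auto simp: poly_ins_cc)
      have cX: "pt 1 1 z \<in> X" by (rule pt_X)
      then have "pt 1 1 z \<in> U" using K0(3) nz(3) X_sub by (auto simp: basic_open_def)
      then have "a (pt 1 1 z) = 0" "peval H (pt 1 1 z) \<noteq> 0" "a (pt 1 1 z) = peval G (pt 1 1 z) / peval H (pt 1 1 z)"
        using z nz fr cX by (auto simp: frac_at_def)
      then show ?thesis by (simp add: poly_ins_cc)
    qed
    then have "ins pC cc G = 0"
      using poly_eq_0_cofinite[of "P * ins pC cc (K * K0)" "ins pC cc G"] P \<open>ins pC cc (K * K0) \<noteq> 0\<close> by auto
    then have "peval G y = 0" using vanish_iff[OF *(2)] True by blast
    then show ?thesis using frac_atD[OF fr True] by simp
  next
    case False
    then show ?thesis using a by (simp add: regular_functions_def)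
  qed
qed

lemma con: "conormal_hom n X M r q" using sur by (simp add: surjective_conormal_hom_def)

lemma q_closed: "zariski_open n U \<Longrightarrow> f \<in> ideal_sheaf n X U \<Longrightarrow> q U f \<in> carrier (M (U \<inter> X))"
  using con[unfolded conormal_hom_def, THEN conjunct1] by blast
lemma q_add: "zariski_open n U \<Longrightarrow> f \<in> ideal_sheaf n X U \<Longrightarrow> g \<in> ideal_sheaf n X U \<Longrightarrow>
    q U (\<lambda>x. f x + g x) = q U f \<oplus>\<^bsub>M (U \<inter> X)\<^esub> q U g"
  using con[unfolded conormal_hom_def, THEN conjunct1] by blast
lemma q_smult: "zariski_open n U \<Longrightarrow> a \<in> regular_functions n U \<Longrightarrow> f \<in> ideal_sheaf n X U \<Longrightarrow>
    q U (\<lambda>x. a x * f x) = res (U \<inter> X) a \<odot>\<^bsub>M (U \<inter> X)\<^esub> q U f"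
  using con[unfolded conormal_hom_def, THEN conjunct1] by blast
lemma q_square: "zariski_open n U \<Longrightarrow> f \<in> ideal_sheaf n X U \<Longrightarrow> g \<in> ideal_sheaf n X U \<Longrightarrow>
    q U (\<lambda>x. f x * g x) = \<zero>\<^bsub>M (U \<inter> X)\<^esub>"
  using con[unfolded conormal_hom_def, THEN conjunct1] by blast
lemma q_res: "zariski_open n U \<Longrightarrow> zariski_open n U' \<Longrightarrow> U' \<subseteq> U \<Longrightarrow> f \<in> ideal_sheaf n X U \<Longrightarrow>
    q U' (res U' f) = r (U \<inter> X) (U' \<inter> X) (q U f)"
  using con[unfolded conormal_hom_def, THEN conjunct2] by blast

lemma q_zero: assumes U: "zariski_open n U" shows "q U (\<lambda>_. 0) = \<zero>\<^bsub>M (U \<inter> X)\<^esub>"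
proof -
  have "(\<lambda>_. 0) \<in> ideal_sheaf n X U" using regular_zero[OF zariski_open_sub[OF U]] by (simp add: ideal_sheaf_def)
  from q_square[OF U this this] show ?thesis by simp
qed

lemma ideal_sheaf_add: "zariski_open n U \<Longrightarrow> f \<in> ideal_sheaf n X U \<Longrightarrow> g \<in> ideal_sheaf n X U \<Longrightarrow> (\<lambda>x. f x + g x) \<in> ideal_sheaf n X U"
  using regular_add[OF zariski_open_sub] by (auto simp: ideal_sheaf_def)
lemma ideal_sheaf_mult: "zariski_open n U \<Longrightarrow> a \<in> regular_functions n U \<Longrightarrow> f \<in> ideal_sheaf n X U \<Longrightarrow> (\<lambda>x. a x * f x) \<in> ideal_sheaf n X U"
  using regular_mult[OF zariski_open_sub] by (auto simp: ideal_sheaf_def)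
text \<open>A trivialization over \<open>T \<noteq> 0\<close>, a neighbourhood of the point with parameter \<open>0\<close> on which
  \<open>L 0\<close> is invertible.\<close>

lemma ex_triv:
  "\<exists>T k e. T \<in> forms n k \<and> peval T (pt 1 1 0) \<noteq> 0 \<and> (\<forall>y. peval T y \<noteq> 0 \<longrightarrow> peval (L 0) y \<noteq> 0) \<and>
     e \<in> carrier (M (basic_open n T \<inter> X)) \<and>
     (\<forall>W. open_in n X W \<and> W \<subseteq> basic_open n T \<inter> X \<longrightarrow>
        bij_betw (\<lambda>a. a \<odot>\<^bsub>M W\<^esub> r (basic_open n T \<inter> X) W e) (regular_functions n W) (carrier (M W)))"
proof -
  have x0: "pt 1 1 0 \<in> X" by (rule pt_X)
  then obtain V e where V: "open_in n X V" "pt 1 1 0 \<in> V" "e \<in> carrier (M V)"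
    "\<And>W. open_in n X W \<Longrightarrow> W \<subseteq> V \<Longrightarrow> bij_betw (\<lambda>a. a \<odot>\<^bsub>M W\<^esub> r V W e) (regular_functions n W) (carrier (M W))"
    using lb unfolding line_bundle_def by blast
  obtain U where U: "zariski_open n U" "V = U \<inter> X" using V(1) by (auto simp: open_in_def)
  obtain K k where K: "K \<in> forms n k" "peval K (pt 1 1 0) \<noteq> 0" "basic_open n K \<subseteq> U"
    using zariski_open_basicE[OF U(1), of "pt 1 1 0"] V(2) U(2) by blast
  define T where "T = K * L 0"
  have T: "T \<in> forms n (k + 1)" unfolding T_def by (intro forms_mult K L_forms)
  let ?W = "basic_open n T \<inter> X"
  have sub: "?W \<subseteq> V" using K(3) U(2) by (auto simp: basic_open_def T_def)
  have op: "open_in n X ?W" by (rule op_zar[OF zariski_open_basic[OF T]])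
  show ?thesis
  proof (intro exI[of _ T] exI[of _ "k + 1"] exI[of _ "r V ?W e"] conjI allI impI T)
    show "peval T (pt 1 1 0) \<noteq> 0" using K(2) L_pt[of 0 1 1 0] by (simp add: T_def)
    show "peval (L 0) y \<noteq> 0" if "peval T y \<noteq> 0" for y using that by (simp add: T_def)
    show "r V ?W e \<in> carrier (M ?W)" by (rule r_closed[OF V(1) op sub V(3)])
    fix W assume W: "open_in n X W \<and> W \<subseteq> ?W"
    have "r ?W W (r V ?W e) = r V W e" using W sub by (intro r_comp V op) auto
    then show "bij_betw (\<lambda>a. a \<odot>\<^bsub>M W\<^esub> r ?W W (r V ?W e)) (regular_functions n W) (carrier (M W))"
      using V(4)[of W] W sub by auto
  qed
qed

definition "TT = (SOME T. \<exists>k e. T \<in> forms n k \<and> peval T (pt 1 1 0) \<noteq> 0 \<and> (\<forall>y. peval T y \<noteq> 0 \<longrightarrow> peval (L 0) y \<noteq> 0) \<and>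
     e \<in> carrier (M (basic_open n T \<inter> X)) \<and>
     (\<forall>W. open_in n X W \<and> W \<subseteq> basic_open n T \<inter> X \<longrightarrow>
        bij_betw (\<lambda>a. a \<odot>\<^bsub>M W\<^esub> r (basic_open n T \<inter> X) W e) (regular_functions n W) (carrier (M W))))"

definition U1 :: "'k pts" where "U1 = basic_open n TT"
definition W1 :: "'k pts" where "W1 = U1 \<inter> X"

definition e1 :: 'm where "e1 = (SOME e. e \<in> carrier (M W1) \<and> (\<forall>W. open_in n X W \<and> W \<subseteq> W1 \<longrightarrow>
        bij_betw (\<lambda>a. a \<odot>\<^bsub>M W\<^esub> r W1 W e) (regular_functions n W) (carrier (M W))))"

lemma TT: "\<exists>k. TT \<in> forms n k" "peval TT (pt 1 1 0) \<noteq> 0" "peval TT y \<noteq> 0 \<Longrightarrow> peval (L 0) y \<noteq> 0"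
  and e1: "e1 \<in> carrier (M W1)"
    "open_in n X W \<Longrightarrow> W \<subseteq> W1 \<Longrightarrow> bij_betw (\<lambda>a. a \<odot>\<^bsub>M W\<^esub> r W1 W e1) (regular_functions n W) (carrier (M W))"
proof -
  note T = someI_ex[OF ex_triv, folded TT_def U1_def, folded W1_def]
  show "\<exists>k. TT \<in> forms n k" "peval TT (pt 1 1 0) \<noteq> 0" "peval TT y \<noteq> 0 \<Longrightarrow> peval (L 0) y \<noteq> 0"
    using T by blast+
  from T have "\<exists>e. e \<in> carrier (M W1) \<and> (\<forall>W. open_in n X W \<and> W \<subseteq> W1 \<longrightarrow>
        bij_betw (\<lambda>a. a \<odot>\<^bsub>M W\<^esub> r W1 W e) (regular_functions n W) (carrier (M W)))" by blast
  from someI_ex[OF this, folded e1_def]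
  show "e1 \<in> carrier (M W1)"
    "open_in n X W \<Longrightarrow> W \<subseteq> W1 \<Longrightarrow> bij_betw (\<lambda>a. a \<odot>\<^bsub>M W\<^esub> r W1 W e1) (regular_functions n W) (carrier (M W))"
    by blast+
qed

lemma U1: "zariski_open n U1" "U1 \<subseteq> proj_space n" "y \<in> U1 \<Longrightarrow> peval (L 0) y \<noteq> 0"
  using TT zariski_open_basic by (auto simp: U1_def basic_open_def)

lemma W1: "open_in n X W1" "W1 \<subseteq> proj_space n" "W1 \<subseteq> X"
  using op_zar[OF U1(1)] X_sub by (auto simp: W1_def)

lemma smult_e_inj:
  assumes W: "open_in n X W" "W \<subseteq> W1" and a: "a \<in> regular_functions n W" and 0: "a \<odot>\<^bsub>M W\<^esub> r W1 W e1 = \<zero>\<^bsub>M W\<^esub>"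
  shows "a = (\<lambda>_. 0)"
proof -
  have "(\<lambda>_. 0) \<odot>\<^bsub>M W\<^esub> r W1 W e1 = \<zero>\<^bsub>M W\<^esub>"
    by (rule M_null[OF W(1) r_closed[OF W1(1) W e1(1)]])
  with 0 show ?thesis
    using inj_onD[OF bij_betw_imp_inj_on[OF e1(2)[OF W]], of a "\<lambda>_. 0"] a regular_zero[OF op_sub[OF W(1)]] by simp
qed

text \<open>The bundle is torsion-free.\<close>

lemma zero_generic:
  assumes V: "open_in n X V" and s: "s \<in> carrier (M V)" and 0: "r V (V \<inter> W1) s = \<zero>\<^bsub>M (V \<inter> W1)\<^esub>"
  shows "s = \<zero>\<^bsub>M V\<^esub>"
proof (rule zero_local[OF V s])
  fix y assume y: "y \<in> V"
  then have yX: "y \<in> X" using open_in_sub[OF V] by auto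
  obtain V' e where V': "open_in n X V'" "y \<in> V'" "e \<in> carrier (M V')"
    "\<And>W. open_in n X W \<Longrightarrow> W \<subseteq> V' \<Longrightarrow> bij_betw (\<lambda>a. a \<odot>\<^bsub>M W\<^esub> r V' W e) (regular_functions n W) (carrier (M W))"
    using lb yX unfolding line_bundle_def by blast
  define N where "N = V \<inter> V'"
  have N: "open_in n X N" "N \<subseteq> V" "N \<subseteq> V'" "y \<in> N" using op_Int[OF V V'(1)] y V'(2) by (auto simp: N_def)
  have rs: "r V N s \<in> carrier (M N)" by (rule r_closed[OF V N(1,2) s])
  then obtain a where a: "a \<in> regular_functions n N" "r V N s = a \<odot>\<^bsub>M N\<^esub> r V' N e"
    using V'(4)[OF N(1,3)] unfolding bij_betw_def by blast
  define N' where "N' = N \<inter> W1"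
  have N': "open_in n X N'" "N' \<subseteq> N" "N' \<subseteq> V \<inter> W1" "N' \<subseteq> V'" "N' \<subseteq> V"
    using op_Int[OF N(1) W1(1)] N by (auto simp: N'_def)
  have re: "r V' N e \<in> carrier (M N)" by (rule r_closed[OF V'(1) N(1,3) V'(3)])
  have "res N' a \<odot>\<^bsub>M N'\<^esub> r V' N' e = r N N' (r V N s)"
    using r_smult[OF N(1) N'(1,2) a(1) re] r_comp[OF V'(1) N(1) N'(1,2) N(3) V'(3)] a(2) by simp
  also have "\<dots> = r V N' s" by (rule r_comp[OF V N(1) N'(1,2) N(2) s])
  also have "\<dots> = r (V \<inter> W1) N' (r V (V \<inter> W1) s)"
    by (rule r_comp[OF V op_Int[OF V W1(1)] N'(1,3) _ s, symmetric]) auto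
  also have "\<dots> = \<zero>\<^bsub>M N'\<^esub>" unfolding 0 by (rule r_zero[OF op_Int[OF V W1(1)] N'(1,3)])
  finally have z: "res N' a \<odot>\<^bsub>M N'\<^esub> r V' N' e = \<zero>\<^bsub>M N'\<^esub>" .
  have "(\<lambda>_. 0) \<odot>\<^bsub>M N'\<^esub> r V' N' e = \<zero>\<^bsub>M N'\<^esub>"
    by (rule M_null[OF N'(1) r_closed[OF V'(1) N'(1,4) V'(3)]])
  moreover have "res N' a \<in> regular_functions n N'" by (rule regular_res[OF op_sub[OF N(1)] N'(2) a(1)])
  ultimately have ra: "res N' a = (\<lambda>_. 0)"
    using inj_onD[OF bij_betw_imp_inj_on[OF V'(4)[OF N'(1,4)]], of "res N' a" "\<lambda>_. 0"] z regular_zero[OF op_sub[OF N'(1)]] by simp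
  obtain U where U: "zariski_open n U" "N = U \<inter> X" using N(1) by (auto simp: open_in_def)
  have "a = (\<lambda>_. 0)"
  proof (rule density[OF U(1)])
    show "a \<in> regular_functions n (U \<inter> X)" using a(1) U(2) by simp
    have "poly (ins pC cc TT) 0 \<noteq> 0" using TT(2) by (simp add: poly_ins_cc)
    then show "ins pC cc TT \<noteq> 0" by auto
    fix z assume z: "poly (ins pC cc TT) z \<noteq> 0" "pt 1 1 z \<in> U"
    have "pt 1 1 z \<in> X" by (rule pt_X)
    then have "pt 1 1 z \<in> N'" using z X_sub U(2) by (auto simp: N'_def W1_def U1_def basic_open_def poly_ins_cc)
    then show "a (pt 1 1 z) = 0" using fun_cong[OF ra, of "pt 1 1 z"] by (simp add: res_def)
  qed
  then have "r V N s = \<zero>\<^bsub>M N\<^esub>" using a(2) M_null[OF N(1) re] by simp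
  then show "\<exists>N. open_in n X N \<and> y \<in> N \<and> N \<subseteq> V \<and> r V N s = \<zero>\<^bsub>M N\<^esub>" using N by blast
qed

text \<open>\<open>cz\<close> is a retraction of the chart \<open>L 0 \<noteq> 0\<close> onto the
  curve. It allows a polynomial \<open>F\<close> that does not vanish on \<open>X\<close> to enter
  \<open>q\<close>: subtracting its value at the retracted point gives \<open>df F\<close> in the
  ideal sheaf, and on forms that do vanish on \<open>X\<close> nothing is subtracted.\<close>

definition zz :: "(nat \<Rightarrow> 'k) \<Rightarrow> 'k" where "zz y = peval (L 1) y / peval (L 0) y"
definition cz :: "(nat \<Rightarrow> 'k) \<Rightarrow> nat \<Rightarrow> 'k" where "cz y i = poly (cc i) (zz y)"
definition af :: "'k mpol \<Rightarrow> 'k fn" where "af F = res U1 (\<lambda>y. peval F (\<lambda>i. y i / peval (L 0) y))"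
definition cf :: "'k mpol \<Rightarrow> 'k fn" where "cf F = res U1 (\<lambda>y. peval F (cz y))"
definition df :: "'k mpol \<Rightarrow> 'k fn" where "df F = (\<lambda>y. af F y - cf F y)"

lemma cz_X: assumes "y \<in> X" "peval (L 0) y \<noteq> 0" shows "cz y = (\<lambda>i. y i / peval (L 0) y)"
proof -
  obtain c s t where c: "c \<noteq> 0" "y = pt c s t" using assms(1) X_pt by blast
  have L: "peval (L 0) y = c * s ^ d" "peval (L 1) y = c * s ^ (d - 1) * t"
    using L_pt[of 0 c s t] L_pt[of 1 c s t] c d n by auto
  then have s: "s \<noteq> 0" using assms(2) d by (auto simp: power_0_left)
  have "s ^ d = s * s ^ (d - 1)" using d by (metis Suc_diff_1 less_le_trans power_Suc zero_less_one)
  then have z: "zz y = t / s" using L s c(1) by (simp add: zz_def)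
  show ?thesis
  proof
    fix i
    have "y i = (c * s ^ d) * pt 1 1 (t / s) i" using fun_cong[OF pt_scale[OF s, of c t], of i] c(2) by simp
    then show "cz y i = y i / peval (L 0) y" using s c(1) by (simp add: cz_def poly_cc z L(1))
  qed
qed

lemma af_cf_regular:
  assumes "F \<in> polys n" shows "af F \<in> regular_functions n U1 \<and> cf F \<in> regular_functions n U1"
  using assms
proof (induction rule: mpol_induct)
  case (const c)
  show ?case using regular_const[OF U1(2), of c] by (simp add: af_def cf_def)
next
  case (var i)
  have nz: "peval (L 0 ^ d) y \<noteq> 0" if "y \<in> U1" for y using U1(3)[OF that] by simp
  have "af (Xv i) = res U1 (\<lambda>y. peval (Xv i) y / peval (L 0) y)" by (simp add: af_def)
  then have 1: "af (Xv i) \<in> regular_functions n U1"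
    using regular_frac[OF U1(2) forms_Xv[OF var] L_forms U1(3)] by simp
  define G where "G = (\<Sum>j\<le>d. single 0 (B j i) * (L 1 ^ j * L 0 ^ (d - j)))"
  have G: "G \<in> forms n d" unfolding G_def
  proof (intro forms_sum forms_const_mult)
    fix j assume "j \<in> {..d}"
    then show "L 1 ^ j * L 0 ^ (d - j) \<in> forms n d"
      using forms_power[OF L_forms[of 1], of j] forms_power[OF L_forms[of 0], of "d - j"] by (intro forms_mult'[of _ n j _ "d - j"]) auto
  qed
  have "cz y i = peval G y / peval (L 0 ^ d) y" if "y \<in> U1" for y
  proof -
    have L0: "peval (L 0) y \<noteq> 0" by (rule U1(3)[OF that])
    have "(peval (L 1) y / peval (L 0) y) ^ j = peval (L 1) y ^ j * peval (L 0) y ^ (d - j) / peval (L 0) y ^ d" if "j \<le> d" for j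
    proof -
      have "peval (L 0) y ^ d = peval (L 0) y ^ j * peval (L 0) y ^ (d - j)" using that by (simp flip: power_add)
      then show ?thesis using L0 by (simp add: power_divide)
    qed
    then show ?thesis
      by (simp add: cz_def cc_def zz_def poly_sum poly_monom G_def sum_divide_distrib)
  qed
  then have "cf (Xv i) = res U1 (\<lambda>y. peval G y / peval (L 0 ^ d) y)" by (auto simp: cf_def res_def)
  moreover have "L 0 ^ d \<in> forms n d" using forms_power[OF L_forms[of 0], of d] by simp
  ultimately show ?case using 1 regular_frac[OF U1(2) G _ nz] by simp
next
  case (add F G)
  have "af (F + G) = (\<lambda>x. af F x + af G x)" "cf (F + G) = (\<lambda>x. cf F x + cf G x)"
    by (auto simp: af_def cf_def res_def)
  then show ?case using add regular_add[OF U1(2)] by simp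
next
  case (mult F G)
  have "af (F * G) = (\<lambda>x. af F x * af G x)" "cf (F * G) = (\<lambda>x. cf F x * cf G x)"
    by (auto simp: af_def cf_def res_def)
  then show ?case using mult regular_mult[OF U1(2)] by simp
qed

lemma df_ideal: assumes "F \<in> polys n" shows "df F \<in> ideal_sheaf n X U1"
proof -
  have "df F y = 0" if "y \<in> X" for y
    using cz_X[OF that] U1(3)[of y] by (auto simp: df_def af_def cf_def res_def)
  moreover have "df F \<in> regular_functions n U1"
    using regular_add[OF U1(2) _ regular_uminus[OF U1(2)]] af_cf_regular[OF assms] by (fastforce simp: df_def)
  ultimately show ?thesis by (simp add: ideal_sheaf_def)
qed

lemma triv_section: assumes "s \<in> carrier (M W1)" shows "\<exists>a\<in>regular_functions n W1. s = a \<odot>\<^bsub>M W1\<^esub> e1"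
proof -
  have "bij_betw (\<lambda>a. a \<odot>\<^bsub>M W1\<^esub> e1) (regular_functions n W1) (carrier (M W1))"
    using e1(2)[OF W1(1) order_refl] r_id[OF W1(1) e1(1)] by simp
  then show ?thesis using assms unfolding bij_betw_def by blast
qed

lemma ex_\<gamma>: "\<exists>\<gamma>. \<forall>i\<le>n. \<gamma> i \<in> regular_functions n W1 \<and> q U1 (df (Xv i)) = \<gamma> i \<odot>\<^bsub>M W1\<^esub> e1"
proof -
  have "\<forall>i. \<exists>a. i \<le> n \<longrightarrow> a \<in> regular_functions n W1 \<and> q U1 (df (Xv i)) = a \<odot>\<^bsub>M W1\<^esub> e1"
  proof
    fix i
    show "\<exists>a. i \<le> n \<longrightarrow> a \<in> regular_functions n W1 \<and> q U1 (df (Xv i)) = a \<odot>\<^bsub>M W1\<^esub> e1"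
    proof (cases "i \<le> n")
      case True
      then show ?thesis using triv_section[of "q U1 (df (Xv i))"] q_closed[OF U1(1) df_ideal[of "Xv i"]] by (auto simp: W1_def)
    qed auto
  qed
  then show ?thesis by metis
qed

text \<open>\<open>q\<close> kills products, so it acts on the expansion of a polynomial along the curve as a
  derivation.\<close>

lemma q_df:
  assumes \<gamma>: "\<And>i. i \<le> n \<Longrightarrow> \<gamma> i \<in> regular_functions n W1" "\<And>i. i \<le> n \<Longrightarrow> q U1 (df (Xv i)) = \<gamma> i \<odot>\<^bsub>M W1\<^esub> e1"
    and F: "F \<in> polys n"
  shows "\<exists>a\<in>regular_functions n W1. q U1 (df F) = a \<odot>\<^bsub>M W1\<^esub> e1 \<and> (\<forall>y\<in>W1. a y = pD (cz y) (\<lambda>i. \<gamma> i y) F)"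
  using F
proof (induction rule: mpol_induct)
  case (const c)
  have "df (single 0 c) = (\<lambda>_. 0)" by (auto simp: df_def af_def cf_def res_def)
  then show ?case using q_zero[OF U1(1)] M_null[OF W1(1) e1(1)] regular_zero[OF W1(2)]
    by (intro bexI[of _ "\<lambda>_. 0"]) (auto simp: W1_def)
next
  case (var i)
  then show ?case using \<gamma> by (intro bexI[of _ "\<gamma> i"]) auto
next
  case (add F G)
  then obtain a b where a: "a \<in> regular_functions n W1" "q U1 (df F) = a \<odot>\<^bsub>M W1\<^esub> e1" "\<forall>y\<in>W1. a y = pD (cz y) (\<lambda>i. \<gamma> i y) F"
    and b: "b \<in> regular_functions n W1" "q U1 (df G) = b \<odot>\<^bsub>M W1\<^esub> e1" "\<forall>y\<in>W1. b y = pD (cz y) (\<lambda>i. \<gamma> i y) G" by blast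
  interpret m: Module.module "regular_ring n W1" "M W1" by (rule M_mod[OF W1(1)])
  have "df (F + G) = (\<lambda>x. df F x + df G x)" by (auto simp: df_def af_def cf_def res_def)
  then have "q U1 (df (F + G)) = q U1 (df F) \<oplus>\<^bsub>M W1\<^esub> q U1 (df G)"
    using q_add[OF U1(1) df_ideal[OF add(1)] df_ideal[OF add(2)]] by (simp add: W1_def)
  also have "\<dots> = (\<lambda>x. a x + b x) \<odot>\<^bsub>M W1\<^esub> e1"
    using m.smult_l_distr[of a b e1] a b e1(1) by simp
  finally show ?case using a b regular_add[OF W1(2)] by (intro bexI[of _ "\<lambda>x. a x + b x"]) (auto simp: dd_add)
next
  case (mult F G)
  then obtain a b where a: "a \<in> regular_functions n W1" "q U1 (df F) = a \<odot>\<^bsub>M W1\<^esub> e1" "\<forall>y\<in>W1. a y = pD (cz y) (\<lambda>i. \<gamma> i y) F"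
    and b: "b \<in> regular_functions n W1" "q U1 (df G) = b \<odot>\<^bsub>M W1\<^esub> e1" "\<forall>y\<in>W1. b y = pD (cz y) (\<lambda>i. \<gamma> i y) G" by blast
  interpret m: Module.module "regular_ring n W1" "M W1" by (rule M_mod[OF W1(1)])
  have dI: "df F \<in> ideal_sheaf n X U1" "df G \<in> ideal_sheaf n X U1" using mult df_ideal by auto
  have cR: "cf F \<in> regular_functions n U1" "cf G \<in> regular_functions n U1" using mult af_cf_regular by auto
  have rcR: "res W1 (cf F) \<in> regular_functions n W1" "res W1 (cf G) \<in> regular_functions n W1"
    using cR regular_res[OF U1(2)] by (auto simp: W1_def)
  \<comment> \<open>The product rule up to a product of two sections of the ideal sheaf, which
    \<open>q\<close> kills.\<close>
  have eq: "df (F * G) = (\<lambda>x. (cf G x * df F x + cf F x * df G x) + df F x * df G x)"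
    by (auto simp: df_def af_def cf_def res_def algebra_simps)
  note I1 = ideal_sheaf_mult[OF U1(1) cR(2) dI(1)] and I2 = ideal_sheaf_mult[OF U1(1) cR(1) dI(2)]
  have dR: "df F \<in> regular_functions n U1" using dI by (simp add: ideal_sheaf_def)
  have "q U1 (df (F * G)) = (res W1 (cf G) \<odot>\<^bsub>M W1\<^esub> (a \<odot>\<^bsub>M W1\<^esub> e1) \<oplus>\<^bsub>M W1\<^esub> res W1 (cf F) \<odot>\<^bsub>M W1\<^esub> (b \<odot>\<^bsub>M W1\<^esub> e1)) \<oplus>\<^bsub>M W1\<^esub> \<zero>\<^bsub>M W1\<^esub>"
    unfolding eq q_add[OF U1(1) ideal_sheaf_add[OF U1(1) I1 I2] ideal_sheaf_mult[OF U1(1) dR dI(2)]]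
      q_add[OF U1(1) I1 I2] q_smult[OF U1(1) cR(2) dI(1)] q_smult[OF U1(1) cR(1) dI(2)] q_square[OF U1(1) dI]
      W1_def[symmetric] a(2) b(2) ..
  also have "\<dots> = ((\<lambda>x. res W1 (cf G) x * a x) \<odot>\<^bsub>M W1\<^esub> e1) \<oplus>\<^bsub>M W1\<^esub> ((\<lambda>x. res W1 (cf F) x * b x) \<odot>\<^bsub>M W1\<^esub> e1)"
    using m.smult_assoc1[of "res W1 (cf G)" a e1] m.smult_assoc1[of "res W1 (cf F)" b e1]
      rcR a(1) b(1) e1(1) M_smult[OF W1(1)] by simp
  also have "\<dots> = (\<lambda>x. res W1 (cf G) x * a x + res W1 (cf F) x * b x) \<odot>\<^bsub>M W1\<^esub> e1"
    using m.smult_l_distr[of "\<lambda>x. res W1 (cf G) x * a x" "\<lambda>x. res W1 (cf F) x * b x" e1]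
      regular_mult[OF W1(2) rcR(2) a(1)] regular_mult[OF W1(2) rcR(1) b(1)] e1(1) by simp
  finally have "q U1 (df (F * G)) = (\<lambda>x. res W1 (cf G) x * a x + res W1 (cf F) x * b x) \<odot>\<^bsub>M W1\<^esub> e1" .
  moreover have "(\<lambda>x. res W1 (cf G) x * a x + res W1 (cf F) x * b x) \<in> regular_functions n W1"
    by (intro regular_add[OF W1(2)] regular_mult[OF W1(2)] rcR a b)
  moreover have "\<forall>y\<in>W1. res W1 (cf G) y * a y + res W1 (cf F) y * b y = pD (cz y) (\<lambda>i. \<gamma> i y) (F * G)"
    using a(3) b(3) by (auto simp: pD_mult res_def cf_def W1_def)
  ultimately show ?case by blast
qed

lemma zz_pt: "zz (pt 1 1 z) = z"
proof -
  have "1 \<le> n" using d dn by linarith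
  then show ?thesis using L_pt[of 0 1 1 z] L_pt[of 1 1 1 z] d by (simp add: zz_def)
qed

lemma df_form:
  assumes F: "F \<in> forms n l" "ins pC cc F = 0"
  shows "df F = res U1 (\<lambda>y. peval F y / peval (L 0) y ^ l)"
proof
  fix y
  have "peval F (\<lambda>i. y i / peval (L 0) y) = peval F y / peval (L 0) y ^ l"
    using peval_homogeneous[OF F(1), of "1 / peval (L 0) y" y] by (simp add: power_divide)
  moreover have "peval F (cz y) = 0"
    using poly_ins_cc[of F "zz y"] F(2) by (simp add: cz_def[abs_def] poly_cc)
  ultimately show "df F y = res U1 (\<lambda>y. peval F y / peval (L 0) y ^ l) y"
    by (simp add: df_def af_def cf_def res_def)
qed

text \<open>By \<open>q_df\<close>, \<open>q\<close> is the derivative in the direction of the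
  regular functions \<open>\<gamma> i\<close>, in terms of the generator \<open>e1\<close>. Clearing
  their denominators along the curve gives a polynomial direction; it differs by a factor that is
  nonzero at almost all parameters, so the vanishing of the derivative is unaffected.\<close>

lemma ex_direction:
  "\<exists>g. \<forall>l. \<forall>F\<in>forms n l. ins pC cc F = 0 \<longrightarrow>
     (q U1 (res U1 (\<lambda>y. peval F y / peval (L 0) y ^ l)) = \<zero>\<^bsub>M W1\<^esub> \<longleftrightarrow> dd pC cc g F = 0)"
proof -
  obtain \<gamma> where \<gamma>: "\<And>i. i \<le> n \<Longrightarrow> \<gamma> i \<in> regular_functions n W1" "\<And>i. i \<le> n \<Longrightarrow> q U1 (df (Xv i)) = \<gamma> i \<odot>\<^bsub>M W1\<^esub> e1"
    using ex_\<gamma> by blast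
  have x0: "pt 1 1 0 \<in> W1" using TT(2) pt_X X_sub by (auto simp: W1_def U1_def basic_open_def)
  have "\<forall>i. \<exists>K G H. i \<le> n \<longrightarrow> frac_at n W1 (\<gamma> i) (pt 1 1 0) K G H"
    using \<gamma>(1) x0 regular_iff[OF W1(2)] by blast
  then obtain K G H where fr: "\<And>i. i \<le> n \<Longrightarrow> frac_at n W1 (\<gamma> i) (pt 1 1 0) (K i) (G i) (H i)" by metis
  \<comment> \<open>Where \<open>P\<close> is nonzero, the point lies in the trivializing
    neighbourhood and all chosen fractions are valid. It is nonzero at the parameter 0, around which
    they were chosen.\<close>
  define P where "P = ins pC cc TT * (\<Prod>i\<le>n. ins pC cc (K i))"
  have "poly P 0 \<noteq> 0"
    using TT(2) fr by (auto simp: P_def poly_prod poly_ins_cc frac_at_def)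
  then have P: "P \<noteq> 0" by auto
  have PW: "pt 1 1 z \<in> W1 \<and> (\<forall>i\<le>n. poly (ins pC cc (H i)) z \<noteq> 0 \<and> \<gamma> i (pt 1 1 z) = poly (ins pC cc (G i)) z / poly (ins pC cc (H i)) z)"
    if "poly P z \<noteq> 0" for z
  proof -
    have nz: "peval TT (pt 1 1 z) \<noteq> 0" "\<And>i. i \<le> n \<Longrightarrow> peval (K i) (pt 1 1 z) \<noteq> 0"
      using that by (auto simp: P_def poly_prod poly_ins_cc)
    then have "pt 1 1 z \<in> W1" using pt_X X_sub by (auto simp: W1_def U1_def basic_open_def)
    then show ?thesis using fr nz(2) by (auto simp: frac_at_def poly_ins_cc)
  qed
  define h where "h = (\<Prod>i\<le>n. ins pC cc (H i))"
  define g where "g i = ins pC cc (G i) * (\<Prod>k\<in>{..n} - {i}. ins pC cc (H k))" for i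
  have h: "poly h z \<noteq> 0" if "poly P z \<noteq> 0" for z using PW[OF that] by (auto simp: h_def poly_prod)
  have g: "poly (g i) z = poly h z * \<gamma> i (pt 1 1 z)" if "poly P z \<noteq> 0" "i \<le> n" for i z
  proof -
    have "h = ins pC cc (H i) * (\<Prod>k\<in>{..n} - {i}. ins pC cc (H k))"
      unfolding h_def using that(2) by (intro prod.remove) auto
    then show ?thesis using PW[OF that(1)] that(2) by (simp add: g_def)
  qed
  have "q U1 (res U1 (\<lambda>y. peval F y / peval (L 0) y ^ l)) = \<zero>\<^bsub>M W1\<^esub> \<longleftrightarrow> dd pC cc g F = 0"
    if F: "F \<in> forms n l" "ins pC cc F = 0" for F l
  proof -
    have Fp: "F \<in> polys n" using F(1) by (rule forms_polys)
    obtain a where a: "a \<in> regular_functions n W1" "q U1 (df F) = a \<odot>\<^bsub>M W1\<^esub> e1" "\<forall>y\<in>W1. a y = pD (cz y) (\<lambda>i. \<gamma> i y) F"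
      using q_df[OF \<gamma> Fp] by blast
    have dz: "poly (dd pC cc g F) z = poly h z * a (pt 1 1 z)" if z: "poly P z \<noteq> 0" for z
    proof -
      have "poly (dd pC cc g F) z = pD (\<lambda>i. poly (cc i) z) (\<lambda>i. poly (g i) z) F"
        using dd_chom[OF chom_pCons chom_poly[of z], of cc g F] by simp
      also have "\<dots> = pD (\<lambda>i. poly (cc i) z) (\<lambda>i. poly h z * \<gamma> i (pt 1 1 z)) F"
        by (rule dd_cong[OF chom_id Fp]) (use g[OF z] in auto)
      also have "\<dots> = poly h z * pD (\<lambda>i. poly (cc i) z) (\<lambda>i. \<gamma> i (pt 1 1 z)) F"
        by (rule dd_scale_dir[OF chom_id Fp])
      also have "(\<lambda>i. poly (cc i) z) = cz (pt 1 1 z)" by (simp add: cz_def zz_pt fun_eq_iff)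
      finally show ?thesis using a(3) PW[OF z] by simp
    qed
    have "q U1 (df F) = \<zero>\<^bsub>M W1\<^esub> \<longleftrightarrow> a = (\<lambda>_. 0)"
      using smult_e_inj[OF W1(1) order_refl a(1)] r_id[OF W1(1) e1(1)] M_null[OF W1(1) e1(1)] a(2) by auto
    also have "\<dots> \<longleftrightarrow> dd pC cc g F = 0"
    proof
      assume "a = (\<lambda>_. 0)"
      then show "dd pC cc g F = 0" using dz by (intro poly_eq_0_cofinite[OF P]) simp
    next
      assume "dd pC cc g F = 0"
      then have "a (pt 1 1 z) = 0" if "poly P z \<noteq> 0" for z using dz[OF that] h[OF that] by simp
      then show "a = (\<lambda>_. 0)" using a(1) by (intro density[OF U1(1) _ P]) (auto simp: W1_def)
    qed
    finally show ?thesis by (simp add: df_form[OF F])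
  qed
  then show ?thesis by blast
qed

lemma frac_form:
  assumes U: "zariski_open n U" and F: "F \<in> forms n l" "ins pC cc F = 0" and H: "H \<in> forms n l" "\<And>y. y \<in> U \<Longrightarrow> peval H y \<noteq> 0"
  shows "res U (\<lambda>y. peval F y / peval H y) \<in> ideal_sheaf n X U"
  using regular_frac[OF zariski_open_sub[OF U] F(1) H] vanish_iff[OF F(1)] F(2) by (auto simp: ideal_sheaf_def res_def)

text \<open>Whether \<open>q (F / H)\<close> vanishes does not depend on the denominator.\<close>

lemma q_frac_zero_iff:
  assumes U: "zariski_open n U" and F: "F \<in> forms n l" "ins pC cc F = 0"
    and H: "H \<in> forms n l" "\<And>y. y \<in> U \<Longrightarrow> peval H y \<noteq> 0" and H': "H' \<in> forms n l" "\<And>y. y \<in> U \<Longrightarrow> peval H' y \<noteq> 0"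
    and 0: "q U (res U (\<lambda>y. peval F y / peval H y)) = \<zero>\<^bsub>M (U \<inter> X)\<^esub>"
  shows "q U (res U (\<lambda>y. peval F y / peval H' y)) = \<zero>\<^bsub>M (U \<inter> X)\<^esub>"
proof -
  define a where "a = res U (\<lambda>y. peval H y / peval H' y)"
  have aR: "a \<in> regular_functions n U" unfolding a_def by (rule regular_frac[OF zariski_open_sub[OF U] H(1) H'])
  have "res U (\<lambda>y. peval F y / peval H' y) = (\<lambda>y. a y * res U (\<lambda>y. peval F y / peval H y) y)"
    using H(2) by (auto simp: a_def res_def)
  then have "q U (res U (\<lambda>y. peval F y / peval H' y)) = res (U \<inter> X) a \<odot>\<^bsub>M (U \<inter> X)\<^esub> \<zero>\<^bsub>M (U \<inter> X)\<^esub>"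
    using q_smult[OF U aR frac_form[OF U F H]] 0 by simp
  also have "\<dots> = \<zero>\<^bsub>M (U \<inter> X)\<^esub>"
    by (rule M_null_r[OF op_zar[OF U] regular_res[OF zariski_open_sub[OF U] _ aR]]) auto
  finally show ?thesis .
qed

definition JM :: "'k pts \<Rightarrow> 'k fn set" where
  "JM U = {f \<in> ideal_sheaf n X U. q U f = \<zero>\<^bsub>M (U \<inter> X)\<^esub>}"

text \<open>The coordinate charts cover \<open>W1\<close>, so vanishing on all of them gives
  vanishing there. Conversely a section over a chart that vanishes on its part in \<open>W1\<close>
  is zero because the bundle is torsion-free.\<close>

lemma twisted_sections_JM:
  assumes F: "F \<in> forms n l" and J: "\<And>U. zariski_open n U \<Longrightarrow> J U = JM U"
  shows "F \<in> twisted_sections n J l \<longleftrightarrow> ins pC cc F = 0 \<and>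
     q U1 (res U1 (\<lambda>y. peval F y / peval (L 0) y ^ l)) = \<zero>\<^bsub>M W1\<^esub>"
proof -
  define U :: "nat \<Rightarrow> 'k pts" where "U i = {x \<in> proj_space n. x i \<noteq> 0}" for i
  define f where "f i = res (U i) (\<lambda>x. peval F x / x i ^ l)" for i
  define f0 where "f0 = res U1 (\<lambda>y. peval F y / peval (L 0) y ^ l)"
  have Uo: "zariski_open n (U i)" if "i \<le> n" for i
    using zariski_open_basic[OF forms_Xv[OF that]] by (simp add: U_def basic_open_def)
  have tw: "F \<in> twisted_sections n J l \<longleftrightarrow> (\<forall>i\<le>n. f i \<in> JM (U i))"
    using F J[OF Uo] by (simp add: twisted_sections_def f_def U_def Let_def)
  have cover: "\<exists>i\<le>n. y \<in> U i" if "y \<in> proj_space n" for y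
    using that by (auto simp: proj_space_def vecs_def U_def) (metis linorder_not_le)
  have ev0: "ins pC cc F = 0" if "\<forall>i\<le>n. f i \<in> JM (U i)"
  proof -
    have "peval F x = 0" if x: "x \<in> X" for x
    proof -
      obtain i where i: "i \<le> n" "x \<in> U i" using cover X_sub x by blast
      then have "f i x = 0" using \<open>\<forall>i\<le>n. f i \<in> JM (U i)\<close> x by (auto simp: JM_def ideal_sheaf_def)
      then show ?thesis using i by (simp add: f_def res_def U_def)
    qed
    then show ?thesis using vanish_iff[OF F] by blast
  qed
  have main: "(\<forall>i\<le>n. f i \<in> JM (U i)) \<longleftrightarrow> q U1 f0 = \<zero>\<^bsub>M W1\<^esub>" if F0: "ins pC cc F = 0"
  proof -
    have HX: "Xv i ^ l \<in> forms n l" if "i \<le> n" for i using forms_power[OF forms_Xv[OF that], of l] by simp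
    have HL: "L 0 ^ l \<in> forms n l" using forms_power[OF L_forms[of 0], of l] by simp
    have fI: "f i \<in> ideal_sheaf n X (U i)" if "i \<le> n" for i
      using frac_form[OF Uo[OF that] F F0 HX[OF that]] by (simp add: f_def U_def)
    have f0I: "f0 \<in> ideal_sheaf n X U1" using frac_form[OF U1(1) F F0 HL] U1(3) by (simp add: f0_def)
    define D where "D i = U i \<inter> U1" for i
    have Do: "zariski_open n (D i)" if "i \<le> n" for i unfolding D_def by (rule zariski_open_Int[OF Uo[OF that] U1(1)])
    have DX: "D i \<inter> X = (U i \<inter> X) \<inter> W1" for i by (auto simp: D_def W1_def)
    have re: "res (D i) (f i) = res (D i) (\<lambda>y. peval F y / peval (Xv i ^ l) y)"
      "res (D i) f0 = res (D i) (\<lambda>y. peval F y / peval (L 0 ^ l) y)" for i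
      by (auto simp: f_def f0_def res_def D_def)
    have eq: "q (D i) (res (D i) (f i)) = \<zero>\<^bsub>M (D i \<inter> X)\<^esub> \<longleftrightarrow> q (D i) (res (D i) f0) = \<zero>\<^bsub>M (D i \<inter> X)\<^esub>" if i: "i \<le> n" for i
    proof -
      have nz: "peval (Xv i ^ l) y \<noteq> 0" "peval (L 0 ^ l) y \<noteq> 0" if "y \<in> D i" for y
        using that U1(3)[of y] by (auto simp: D_def U_def)
      show ?thesis unfolding re
        using q_frac_zero_iff[OF Do[OF i] F F0 HX[OF i] nz(1) HL nz(2)] q_frac_zero_iff[OF Do[OF i] F F0 HL nz(2) HX[OF i] nz(1)] by blast
    qed
    have ri: "q (D i) (res (D i) (f i)) = r (U i \<inter> X) (D i \<inter> X) (q (U i) (f i))" if "i \<le> n" for i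
      by (rule q_res[OF Uo[OF that] Do[OF that] _ fI[OF that]]) (auto simp: D_def)
    have r0: "q (D i) (res (D i) f0) = r W1 (D i \<inter> X) (q U1 f0)" if "i \<le> n" for i
      unfolding W1_def by (rule q_res[OF U1(1) Do[OF that] _ f0I]) (auto simp: D_def)
    have q0: "q U1 f0 \<in> carrier (M W1)" using q_closed[OF U1(1) f0I] by (simp add: W1_def)
    have Dop: "open_in n X (D i \<inter> X)" if "i \<le> n" for i by (rule op_zar[OF Do[OF that]])
    have Dsub: "D i \<inter> X \<subseteq> W1" "D i \<inter> X \<subseteq> U i \<inter> X" for i by (auto simp: D_def W1_def)
    show ?thesis
    proof
      assume all: "\<forall>i\<le>n. f i \<in> JM (U i)"
      show "q U1 f0 = \<zero>\<^bsub>M W1\<^esub>"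
      proof (rule zero_local[OF W1(1) q0])
        fix y assume y: "y \<in> W1"
        then obtain i where i: "i \<le> n" "y \<in> U i" using cover W1(2) by blast
        have "q (U i) (f i) = \<zero>\<^bsub>M (U i \<inter> X)\<^esub>" using all i by (simp add: JM_def)
        then have "q (D i) (res (D i) (f i)) = \<zero>\<^bsub>M (D i \<inter> X)\<^esub>"
          using ri[OF i(1)] r_zero[OF op_zar[OF Uo[OF i(1)]] Dop[OF i(1)] Dsub(2)] by simp
        then have "r W1 (D i \<inter> X) (q U1 f0) = \<zero>\<^bsub>M (D i \<inter> X)\<^esub>" using eq[OF i(1)] r0[OF i(1)] by simp
        moreover have "y \<in> D i \<inter> X" using y i by (auto simp: D_def W1_def)
        ultimately show "\<exists>N. open_in n X N \<and> y \<in> N \<and> N \<subseteq> W1 \<and> r W1 N (q U1 f0) = \<zero>\<^bsub>M N\<^esub>"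
          using Dop[OF i(1)] Dsub(1) by blast
      qed
    next
      assume 0: "q U1 f0 = \<zero>\<^bsub>M W1\<^esub>"
      show "\<forall>i\<le>n. f i \<in> JM (U i)"
      proof (intro allI impI)
        fix i assume i: "i \<le> n"
        have "q (D i) (res (D i) f0) = \<zero>\<^bsub>M (D i \<inter> X)\<^esub>"
          using r0[OF i] 0 r_zero[OF W1(1) Dop[OF i] Dsub(1)] by simp
        then have "r (U i \<inter> X) (D i \<inter> X) (q (U i) (f i)) = \<zero>\<^bsub>M (D i \<inter> X)\<^esub>" using eq[OF i] ri[OF i] by simp
        then have "q (U i) (f i) = \<zero>\<^bsub>M (U i \<inter> X)\<^esub>"
          by (intro zero_generic[OF op_zar[OF Uo[OF i]] q_closed[OF Uo[OF i] fI[OF i]]]) (simp add: DX)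
        then show "f i \<in> JM (U i)" using fI[OF i] by (simp add: JM_def)
      qed
    qed
  qed
  show ?thesis unfolding tw using main ev0 by (auto simp: f0_def)
qed

text \<open>Surjectivity lets some \<open>f\<close> near the parameter 0 map to the generator
  \<open>e1\<close>. Its numerator is a form vanishing on \<open>X\<close>; if \<open>q\<close>
  killed all these, \<open>e1\<close> would vanish on a nonempty open set.\<close>

lemma ex_nonzero:
  "\<exists>l. \<exists>F\<in>forms n l. ins pC cc F = 0 \<and> q U1 (res U1 (\<lambda>y. peval F y / peval (L 0) y ^ l)) \<noteq> \<zero>\<^bsub>M W1\<^esub>"
proof (rule ccontr)
  assume "\<not> ?thesis"
  then have no: "q U1 (res U1 (\<lambda>y. peval F y / peval (L 0) y ^ l)) = \<zero>\<^bsub>M W1\<^esub>" if "F \<in> forms n l" "ins pC cc F = 0" for F l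
    using that by blast
  have x0: "pt 1 1 0 \<in> U1 \<inter> X" using TT(2) pt_X X_sub by (auto simp: U1_def basic_open_def)
  have e1': "e1 \<in> carrier (M (U1 \<inter> X))" using e1(1) by (simp add: W1_def)
  obtain U' f where U': "zariski_open n U'" "pt 1 1 0 \<in> U'" "U' \<subseteq> U1" and f: "f \<in> ideal_sheaf n X U'"
    "q U' f = r (U1 \<inter> X) (U' \<inter> X) e1"
    using sur[unfolded surjective_conormal_hom_def, THEN conjunct2] U1(1) e1' x0 by blast
  have fR: "f \<in> regular_functions n U'" using f by (simp add: ideal_sheaf_def)
  obtain K G H where fr: "frac_at n U' f (pt 1 1 0) K G H"
    using fR U'(2) regular_iff[OF zariski_open_sub[OF U'(1)], of f] by blast
  obtain k l where *: "K \<in> forms n k" "G \<in> forms n l" "H \<in> forms n l" "peval K (pt 1 1 0) \<noteq> 0" using frac_atE[OF fr] by metis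
  define U2 where "U2 = U' \<inter> basic_open n K"
  have U2: "zariski_open n U2" "U2 \<subseteq> U'" "U2 \<subseteq> U1" "pt 1 1 0 \<in> U2"
    using zariski_open_Int[OF U'(1) zariski_open_basic[OF *(1)]] U' *(4) zariski_open_sub[OF U'(1)] by (auto simp: U2_def basic_open_def)
  have fe: "peval H y \<noteq> 0 \<and> f y = peval G y / peval H y" if "y \<in> U2" for y
    using that fr by (auto simp: U2_def basic_open_def frac_at_def)
  \<comment> \<open>The numerator vanishes only on a neighbourhood a priori; as a polynomial in the
    parameter it then vanishes identically.\<close>
  have G0: "ins pC cc G = 0"
  proof -
    obtain K2 k2 where K2: "K2 \<in> forms n k2" "peval K2 (pt 1 1 0) \<noteq> 0" "basic_open n K2 \<subseteq> U2"
      by (rule zariski_open_basicE[OF U2(1,4)])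
    have "poly (ins pC cc K2) 0 \<noteq> 0" using K2(2) by (simp add: poly_ins_cc)
    then have "ins pC cc K2 \<noteq> 0" by auto
    then show ?thesis
    proof (rule poly_eq_0_cofinite)
      fix z assume "poly (ins pC cc K2) z \<noteq> 0"
      then have "pt 1 1 z \<in> U2" using K2(3) pt_X X_sub by (auto simp: poly_ins_cc basic_open_def)
      moreover have "f (pt 1 1 z) = 0" using f(1) pt_X U2(2) calculation by (auto simp: ideal_sheaf_def)
      ultimately show "poly (ins pC cc G) z = 0" using fe by (auto simp: poly_ins_cc)
    qed
  qed
  have HL: "L 0 ^ l \<in> forms n l" using forms_power[OF L_forms[of 0], of l] by simp
  let ?f0 = "res U1 (\<lambda>y. peval G y / peval (L 0) y ^ l)"
  have f0I: "?f0 \<in> ideal_sheaf n X U1" using frac_form[OF U1(1) *(2) G0 HL] U1(3) by simp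
  have op2: "open_in n X (U2 \<inter> X)" by (rule op_zar[OF U2(1)])
  have sub2: "U2 \<inter> X \<subseteq> W1" using U2(3) by (auto simp: W1_def)
  have "q U2 (res U2 ?f0) = \<zero>\<^bsub>M (U2 \<inter> X)\<^esub>"
    using q_res[OF U1(1) U2(1,3) f0I] no[OF *(2) G0] r_zero[OF W1(1) op2 sub2] by (simp add: W1_def)
  moreover have "res U2 ?f0 = res U2 (\<lambda>y. peval G y / peval (L 0 ^ l) y)" using U2(3) by (auto simp: res_def fun_eq_iff)
  ultimately have "q U2 (res U2 (\<lambda>y. peval G y / peval H y)) = \<zero>\<^bsub>M (U2 \<inter> X)\<^esub>"
    using q_frac_zero_iff[OF U2(1) *(2) G0 HL _ *(3)] U1(3) U2(3) fe by (auto simp: subset_iff)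
  moreover have "res U2 f = res U2 (\<lambda>y. peval G y / peval H y)" using fe by (auto simp: res_def)
  moreover have "q U2 (res U2 f) = r W1 (U2 \<inter> X) e1"
  proof -
    have "q U2 (res U2 f) = r (U' \<inter> X) (U2 \<inter> X) (q U' f)" by (rule q_res[OF U'(1) U2(1,2) f(1)])
    also have "\<dots> = r W1 (U2 \<inter> X) e1" unfolding f(2) W1_def
      using U' U2 e1' by (intro r_comp op_zar U1(1)) auto
    finally show ?thesis .
  qed
  ultimately have z: "r W1 (U2 \<inter> X) e1 = \<zero>\<^bsub>M (U2 \<inter> X)\<^esub>" by simp
  have sp: "U2 \<inter> X \<subseteq> proj_space n" by (rule op_sub[OF op2])
  have one: "res (U2 \<inter> X) (\<lambda>_. 1) \<in> regular_functions n (U2 \<inter> X)" by (rule regular_const[OF sp])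
  have "res (U2 \<inter> X) (\<lambda>_. 1) = (\<lambda>_. 0 :: 'k)"
    by (rule smult_e_inj[OF op2 sub2 one]) (simp add: z M_null_r[OF op2 one])
  then have "res (U2 \<inter> X) (\<lambda>_. 1) (pt 1 1 0) = (0 :: 'k)" by metis
  then show False using U2(4) pt_X by (simp add: res_def)
qed

theorem homogeneous_ideal_JM:
  assumes J: "\<And>U. zariski_open n U \<Longrightarrow> J U = JM U"
  shows "\<exists>g. homogeneous_ideal n J = jet_ideal n cc g \<and> (\<exists>l. \<exists>F\<in>forms n l. ins pC cc F = 0 \<and> dd pC cc g F \<noteq> 0)"
proof -
  obtain g where g: "\<And>l F. F \<in> forms n l \<Longrightarrow> ins pC cc F = 0 \<Longrightarrow>
     q U1 (res U1 (\<lambda>y. peval F y / peval (L 0) y ^ l)) = \<zero>\<^bsub>M W1\<^esub> \<longleftrightarrow> dd pC cc g F = 0"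
    using ex_direction by blast
  have "F \<in> twisted_sections n J l \<longleftrightarrow> ins pC cc F = 0 \<and> dd pC cc g F = 0" if "F \<in> forms n l" for F l
    using twisted_sections_JM[OF that J] g[OF that] by blast
  then have "homogeneous_ideal n J = jet_ideal n cc g"
    using hom_comp_in_forms by (auto simp: homogeneous_ideal_def jet_ideal_def)
  moreover have "\<exists>l. \<exists>F\<in>forms n l. ins pC cc F = 0 \<and> dd pC cc g F \<noteq> 0" using ex_nonzero g by blast
  ultimately show ?thesis by blast
qed

end

theorem mainTheorem2:
  fixes d :: nat
    and \<phi> :: "(nat \<Rightarrow> 'k::alg_closed_field) \<Rightarrow> nat \<Rightarrow> 'k"
    and X :: "'k pts"
  assumes "d \<ge> 1"
    and "linear_embedding d (2 * d) \<phi>"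
    and "X = \<phi> ` rational_normal_curve d"
  shows "(\<exists>J. double_structure (2 * d) X J \<and>
              quadratic_ideal (2 * d) (homogeneous_ideal (2 * d) J) \<and>
              linear_syzygies (2 * d) (homogeneous_ideal (2 * d) J)) \<and>
         (\<forall>J. double_structure (2 * d) X J \<and>
              quadratic_ideal (2 * d) (homogeneous_ideal (2 * d) J) \<and>
              linear_syzygies (2 * d) (homogeneous_ideal (2 * d) J) \<longrightarrow>
              has_hilbert_polynomial (2 * d) (homogeneous_ideal (2 * d) J) [:1, 2 * of_nat d:])"
proof -
  obtain B \<Lambda> :: "nat \<Rightarrow> nat \<Rightarrow> 'k" where B: "\<forall>j\<le>d. B j = \<phi> (unit_vec j)" "\<forall>j\<le>2 * d. B j \<in> vecs (2 * d)"
     "\<forall>i\<le>2 * d. \<forall>j\<le>2 * d. (\<Sum>m\<le>2 * d. \<Lambda> i m * B j m) = (if i = j then 1 else 0)"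
     "\<forall>k\<le>2 * d. \<forall>m\<le>2 * d. (\<Sum>j\<le>2 * d. B j k * \<Lambda> j m) = (if k = m then 1 else 0)"
    using dual_basis[OF assms(2)] by auto
  interpret rnc d "2 * d" B \<Lambda> X
  proof
    have *: "\<phi> (\<lambda>i. if i \<le> d then c * s ^ (d - i) * t ^ i else 0) = (\<lambda>m. \<Sum>j\<le>d. c * s ^ (d - j) * t ^ j * B j m)" for c s t
    proof
      fix m
      have "(\<lambda>i. if i \<le> d then c * s ^ (d - i) * t ^ i else 0) \<in> vecs d" by (simp add: vecs_def)
      from linear_embedding_sum[OF assms(2) this, of m]
      show "\<phi> (\<lambda>i. if i \<le> d then c * s ^ (d - i) * t ^ i else 0) m = (\<Sum>j\<le>d. c * s ^ (d - j) * t ^ j * B j m)"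
        by (simp add: B(1))
    qed
    show "X = {(\<lambda>m. \<Sum>j\<le>d. c * s ^ (d - j) * t ^ j * B j m) | c s t. c \<noteq> 0 \<and> (s, t) \<noteq> (0, 0)}"
      unfolding assms(3) rational_normal_curve_def *[symmetric] by blast
  qed (use assms(1) B in auto)
  show ?thesis
  proof (intro conjI allI impI)
    have "linear_syzygies (2 * d) (homogeneous_ideal (2 * d) JJ)"
      unfolding homogeneous_ideal_JJ by (rule linear_syzygies_gg)
    then show "\<exists>J. double_structure (2 * d) X J \<and>
              quadratic_ideal (2 * d) (homogeneous_ideal (2 * d) J) \<and>
              linear_syzygies (2 * d) (homogeneous_ideal (2 * d) J)"
      using double_structure_JJ quadratic_ideal_if_linear_syzygies by blast
  next
    fix J assume J: "double_structure (2 * d) X J \<and>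
              quadratic_ideal (2 * d) (homogeneous_ideal (2 * d) J) \<and>
              linear_syzygies (2 * d) (homogeneous_ideal (2 * d) J)"
    then obtain M :: "'k pts \<Rightarrow> ('k fn, 'k fn) module" and r q where
      M: "line_bundle (2 * d) X M r" "surjective_conormal_hom (2 * d) X M r q"
      "\<And>U. zariski_open (2 * d) U \<Longrightarrow> J U = {f \<in> ideal_sheaf (2 * d) X U. q U f = \<zero>\<^bsub>M (U \<inter> X)\<^esub>}"
      unfolding double_structure_def by blast
    interpret rb: rnc_bundle d "2 * d" B \<Lambda> X M r q
      by unfold_locales (use M in auto)
    obtain g where g: "homogeneous_ideal (2 * d) J = jet_ideal (2 * d) cc g"
      "\<exists>l. \<exists>F\<in>forms (2 * d) l. ins pC cc F = 0 \<and> dd pC cc g F \<noteq> 0"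
      using rb.homogeneous_ideal_JM[of J] M(3) unfolding rb.JM_def by blast
    interpret double_curve "2 * d" d cc L g
      by unfold_locales (use g J in auto)
    show "has_hilbert_polynomial (2 * d) (homogeneous_ideal (2 * d) J) [:1, 2 * of_nat d:]"
      unfolding g(1) by (rule hilbert_polynomial)
  qed
qed

end
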